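(* Let $R$ be a field containing nonzero elements $q,u_1,\dots,u_r$ such that $q^2$ has multiplicative order greater than $2n$, the parameters $\mathbf u=(u_1,\dots,u_r)$ are generic for $\mathscr B_{r,n}$, $\Omega\cup\{\varrho\}$ is $\mathbf u$-admissible, and the root conditions hold. Let $0\le f\le\lfloor n/2\rfloor$ and $\lambda\in\Lambda_r^+(n-2f)$, and let $\Delta(\lambda)$ be the $R$-vector space with basis $\{v_{\mathfrak s}\mid \mathfrak s\in\mathscr T^{ud}_n(\lambda)\}$. Then $\Delta(\lambda)$ becomes a $\mathscr B_{r,n}$-module via $$T_kv_{\mathfrak s}=\begin{cases}\displaystyle\sum_{\mathfrak t\overset{k}{\sim}\mathfrak s}T_{\mathfrak s\mathfrak t}(k)v_{\mathfrak t},&\text{if }\mathfrak s_{k-1}=\mathfrak s_{k+1},\\ a_{\mathfrak s}(k)v_{\mathfrak s}+b_{\mathfrak s}(k)v_{s_k\mathfrak s},&\text{if }\mathfrak s_{k-1}\ne\mathfrak s_{k+1},\end{cases}$$ $$E_kv_{\mathfrak s}=\begin{cases}\displaystyle\sum_{\mathfrak t\overset{k}{\sim}\mathfrak s}E_{\mathfrak s\mathfrak t}(k)v_{\mathfrak t},&\text{if }\mathfrak s_{k-1}=\mathfrak s_{k+1},\\ 0,&\text{if }\mathfrak s_{k-1}\neq\mathfrak s_{k+1},\end{cases}\qquad X_iv_{\mathfrak s}=c_{\mathfrak s}(i)v_{\mathfrak s},$$ for $1\le k<n$ and $1\le i\le n$, where $v_{s_k\mathfrak s}$ is set equal to $0$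 when $s_k\mathfrak s$ is not defined.
   Context: **Algebra.** Let $r,n$ be positive integers and $R$ a commutative ring with $1$ containing invertible elements $q,u_1,\dots,u_r,\varrho,\delta$ with $\delta=q-q^{-1}$, and let $\Omega=\{\omega_a\mid a\in\mathbb Z\}\subseteq R$ with $\omega_0=1-\delta^{-1}(\varrho-\varrho^{-1})$. The cyclotomic BMW algebra $\mathscr B_{r,n}$ is the unital associative $R$-algebra generated by $T_i,E_i$ ($1\le i<n$), $X_j^{\pm1}$ ($1\le j\le n$) subject to: (a) $X_iX_i^{-1}=X_i^{-1}X_i=1$; (b) $1=T_i^2-\delta T_i+\delta\varrho E_i$; (c) $T_iT_j=T_jT_i$ if $|i-j|>1$, $T_iT_{i+1}T_i=T_{i+1}T_iT_{i+1}$ for $1\le i<n-1$, $T_iX_j=X_jT_i$ if $j\ne i,i+1$; (d) $E_i^2=\omega_0E_i$; (e) $X_iX_j=X_jX_i$; (f) $T_iX_i-X_{i+1}T_i=\delta X_{i+1}(E_i-1)$ and $X_iT_i-T_iX_{i+1}=\delta(E_i-1)X_{i+1}$; (g) $E_1X_1^aE_1=\omega_aE_1$ for $a\in\mathbb Z$; (h) $E_iT_i=\varrho E_i=T_iE_i$, and $E_{i+1}E_i=E_{i+1}T_iT_{i+1}=T_iT_{i+1}E_i$ for $1\le i\le n-2$; (i) $E_{i+1}E_iE_{i+1}=E_{i+1}$, $E_iE_{i+1}E_i=E_i$ for $1\le i\le n-2$; (j) $E_iX_iX_{i+1}=E_i=X_iX_{i+1}E_i$; (k) $(X_1-u_1)\cdots(X_1-u_r)=0$.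 **$\mathbf u$-admissibility.** Define $Q_a(\mathbf u),Q'_a(\mathbf u)$ for $a\ge0$ by $\prod_{i=1}^r\frac{y-u_i}{u_iy-1}=\sum_{a\ge0}Q_a(\mathbf u)y^a$ and $\prod_{i=1}^r\frac{u_iy-1}{y-u_i}=\sum_{a\ge0}Q'_a(\mathbf u)y^a$, and put $Q_a=Q'_a=0$ for $a<0$. Let $P=\prod_{i=1}^ru_i$ and, for $a\ge 0$, $A_a=\frac{1+(-1)^a}2+\delta^{-1}\varrho PQ_a(\mathbf u)$, $B_a=\frac{1+(-1)^a}2-\delta^{-1}\varrho PQ'_a(\mathbf u)$. $\Omega\cup\{\varrho\}$ is $\mathbf u$-admissible if $\varrho^{-1}\in\{P,-P\}$ when $r$ is odd, $\varrho^{-1}\in\{q^{-1}P,-qP\}$ when $r$ is even, and: for $a\ge0$, $\omega_a=A_a+\sum_{k=0}^{a-1}\frac{1+(-1)^k}2Q_{a-1-k}(\mathbf u)-\delta^{-1}\varrho\,\delta_{a,0}$ ($r$ odd), $\omega_a=A_a-\sum_{k=0}^{a}\frac{1+(-1)^k}2Q_{a-k}(\mathbf u)-\delta^{-1}\varrho\,\delta_{a,0}$ ($r$ even); for $a>0$, $\omega_{-a}=B_a+\sum_{k=0}^{a-1}\frac{1+(-1)^k}2Q'_{a-1-k}(\mathbf u)$ ($r$ odd), $\omega_{-a}=B_a-\sum_{k=0}^{a-2}\frac{1+(-1)^k}2Q'_{a-2-k}(\mathbf u)$ ($r$ even). Here $\delta_{a,0}$ is the Kronecker delta. **Genericity.**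 $\mathbf u$ is generic for $\mathscr B_{r,n}$ if whenever there is $d\in\mathbb Z$ such that either $u_iu_j^{\pm1}=q^{2d}$ with $i\ne j$, or $u_i=\pm q^d$, then $|d|\ge2n$. **Combinatorics.** $\Lambda_r^+(m)$ is the set of $r$-partitions $\lambda=(\lambda^{(1)},\dots,\lambda^{(r)})$ of $m$. A node $(i,j,s)$ is in row $i$, column $j$ of component $s$. Addable (removable) nodes of $\lambda$ are those whose addition (removal) gives again an $r$-partition. For $\lambda\in\Lambda_r^+(n-2f)$, $\mathscr T^{ud}_n(\lambda)$ is the set of sequences $\mathfrak t=(\mathfrak t_0,\mathfrak t_1,\dots,\mathfrak t_n)$ of $r$-partitions with $\mathfrak t_0=\emptyset$, $\mathfrak t_n=\lambda$, and each $\mathfrak t_i$ obtained from $\mathfrak t_{i-1}$ by adding or removing one node. Write $\mathfrak s\overset{k}{\sim}\mathfrak t$ if $\mathfrak s_j=\mathfrak t_j$ for all $j\ne k$. Let $c_{\mathfrak t}(k)=u_sq^{2(j-i)}$ if $\mathfrak t_k$ is obtained from $\mathfrak t_{k-1}$ by adding the node $(i,j,s)$, and $c_{\mathfrak t}(k)=u_s^{-1}q^{-2(j-i)}$ if by removing it. For a node $\alpha=(i,j,s)$ of an $r$-partition put $c(\alpha)=u_sq^{2(j-i)}$ if $\alpha$ is addable and $c(\alpha)=u_s^{-1}q^{-2(j-i)}$ if it is removable. **Rational functions.** Let $\gamma_r(y)=1$ if $r$ is odd, $\gamma_r(y)=-y$ if $r$ is even, and $$W_k(y,\mathfrak s)=\frac{y^2}{y^2-1}-\delta^{-1}\varrho+\Big(\delta^{-1}\varrho\prod_{i=1}^ru_i+\frac{y\gamma_r(y)}{y^2-1}\Big)\prod_{i=1}^ru_i\prod_\alpha\frac{y-c(\alpha)^{-1}}{y-c(\alpha)},$$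 $\alpha$ running over the addable and removable nodes of $\mathfrak s_{k-1}$. **Coefficients.** If $\mathfrak s_{k-1}=\mathfrak s_{k+1}$: $E_{\mathfrak s\mathfrak s}(k)=\mathrm{Res}_{y=c_{\mathfrak s}(k)}\frac{W_k(y,\mathfrak s)}y$; $E_{\mathfrak s\mathfrak t}(k)=\sqrt{E_{\mathfrak s\mathfrak s}(k)}\sqrt{E_{\mathfrak t\mathfrak t}(k)}$ if $\mathfrak t\ne\mathfrak s$, $\mathfrak t\overset{k}{\sim}\mathfrak s$; $E_{\mathfrak s\mathfrak t}(k)=0$ otherwise; and $T_{\mathfrak s\mathfrak t}(k)=\delta\,\frac{E_{\mathfrak s\mathfrak t}(k)-\delta_{\mathfrak s\mathfrak t}}{c_{\mathfrak s}(k)c_{\mathfrak t}(k)-1}$ for $\mathfrak t\overset{k}{\sim}\mathfrak s$ ($\delta_{\mathfrak s\mathfrak t}$ the Kronecker delta). If $\mathfrak s_{k-1}\ne\mathfrak s_{k+1}$: $a_{\mathfrak s}(k)=\frac{\delta c_{\mathfrak s}(k+1)}{c_{\mathfrak s}(k+1)-c_{\mathfrak s}(k)}$, $b_{\mathfrak s}(k)=\sqrt{1-a_{\mathfrak s}(k)^2+\delta a_{\mathfrak s}(k)}$. For $r$-partitions differing by one node $\alpha$ write $\mu\ominus\nu=\alpha$. If $\mathfrak s_{k-1}\neq\mathfrak s_{k+1}$ and $\mathfrak s_k\ominus\mathfrak s_{k-1}$, $\mathfrak s_{k+1}\ominus\mathfrak s_k$ lie in different rows and different columns (nodes in different components count as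 such), then $s_k\mathfrak s\in\mathscr T^{ud}_n(\lambda)$ is obtained from $\mathfrak s$ by replacing $\mathfrak s_k$ with the unique $r$-partition $\mathfrak t_k$ with $\mathfrak t_k\ominus\mathfrak s_{k+1}=\mathfrak s_{k-1}\ominus\mathfrak s_k$ and $\mathfrak s_{k-1}\ominus\mathfrak t_k=\mathfrak s_k\ominus\mathfrak s_{k+1}$; otherwise (same row or same column) $s_k\mathfrak s$ is not defined. **Root conditions.** All the square roots $\sqrt{E_{\mathfrak s\mathfrak s}(k)}$ and $b_{\mathfrak s}(k)$ (for $\mathfrak s\in\mathscr T^{ud}_n(\lambda)$, $1\le k<n$, whenever defined) lie in $R$ and are chosen so that: (a) if $\mathfrak s_{k-1}\ne\mathfrak s_{k+1}$ and $s_k\mathfrak s$ is defined, then $b_{s_k\mathfrak s}(k)=b_{\mathfrak s}(k)$; (b) if $\mathfrak s_{k-1}\ne\mathfrak s_{k+1}$ and $\mathfrak s\overset{l}{\sim}\mathfrak t$ with $|k-l|>1$, then $b_{\mathfrak s}(k)=b_{\mathfrak t}(k)$; (c) if $\mathfrak s_{k-1}\ne\mathfrak s_{k+1}$, $\mathfrak s_k\ne\mathfrak s_{k+2}$ and $s_k\mathfrak s$, $s_{k+1}\mathfrak s$ are both defined, then $b_{s_{k+1}\mathfrak s}(k)=b_{s_k\mathfrak s}(k+1)$; (d) if $\mathfrak s_{k-1}=\mathfrak s_{k+1}$ and $\mathfrak s_k=\mathfrak s_{k+2}$, then $\sqrt{E_{\mathfrak s\mathfrak s}(k)}\sqrt{E_{\mathfrak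 s\mathfrak s}(k+1)}=1$; (e) if $\mathfrak s_{k-1}=\mathfrak s_{k+1}$, $\mathfrak t_{k-1}=\mathfrak t_{k+1}$ and $E_{\mathfrak s\mathfrak s}(k)=E_{\mathfrak t\mathfrak t}(k)$, then $\sqrt{E_{\mathfrak s\mathfrak s}(k)}=\sqrt{E_{\mathfrak t\mathfrak t}(k)}$; (f) if $\mathfrak s_{k-1}=\mathfrak s_{k+1}$, $\mathfrak s_k=\mathfrak s_{k+2}$, $\mathfrak t\overset{k+1}{\sim}\mathfrak s$, $\mathfrak u\overset{k}{\sim}\mathfrak s$, with $s_k\mathfrak t$ and $s_{k+1}\mathfrak u$ both defined and $s_k\mathfrak t=s_{k+1}\mathfrak u$, then $b_{\mathfrak t}(k)\sqrt{E_{\mathfrak t\mathfrak t}(k+1)}=b_{\mathfrak u}(k+1)\sqrt{E_{\mathfrak u\mathfrak u}(k)}$. *)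

theory Defs
  imports
    "HOL-Library.Poly_Mapping"
    "HOL-Computational_Algebra.Fraction_Field"
    "HOL-Computational_Algebra.Polynomial_FPS"
    "HOL-Computational_Algebra.Formal_Laurent_Series"
    "HOL-Algebra.QuotRing"
begin

text \<open>Throughout, the parameters \<open>u\<^sub>1, \<dots>, u\<^sub>r\<close> are the values \<open>u 1, \<dots>, u r\<close> of a function
  \<open>u :: nat \<Rightarrow> 'a\<close>; its other values are irrelevant.\<close>

abbreviation (input) dlt :: "'a::field \<Rightarrow> 'a"
  where "dlt q \<equiv> q - inverse q"

section \<open>The cyclotomic BMW algebra\<close>

text \<open>The free associative algebra is the monoid algebra of the free monoid. In the type class
  \<open>monoid_add\<close>, which provides the convolution product on finitely supported functions, the
  (non-commutative) concatenation of words is written additively.\<close>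

datatype 'g free_word = Word (letters: "'g list")

instantiation free_word :: (type) monoid_add
begin

definition zero_free_word :: "'a free_word"
  where "0 = Word []"

definition plus_free_word :: "'a free_word \<Rightarrow> 'a free_word \<Rightarrow> 'a free_word"
  where "v + w = Word (letters v @ letters w)"

instance
  by standard (simp_all add: zero_free_word_def plus_free_word_def)

end

datatype bmw_gen = GenT nat | GenE nat | GenX nat | GenXinv nat

type_synonym 'a bmw_free = "bmw_gen free_word \<Rightarrow>\<^sub>0 'a"

definition bmw_gens :: "nat \<Rightarrow> bmw_gen set"
  where "bmw_gens n = GenT ` {1..<n} \<union> GenE ` {1..<n} \<union> GenX ` {1..n} \<union> GenXinv ` {1..n}"

definition free_alg :: "nat \<Rightarrow> 'a::field bmw_free ring"
  where "free_alg n =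
    \<lparr>carrier = {p. \<forall>w \<in> Poly_Mapping.keys p. set (letters w) \<subseteq> bmw_gens n},
     mult = (*), one = 1, zero = 0, add = (+)\<rparr>"

definition scal :: "'a::field \<Rightarrow> 'a bmw_free"
  where "scal c = Poly_Mapping.single 0 c"

definition gen :: "bmw_gen \<Rightarrow> 'a::field bmw_free"
  where "gen g = Poly_Mapping.single (Word [g]) 1"

abbreviation gT :: "nat \<Rightarrow> 'a::field bmw_free" where "gT i \<equiv> gen (GenT i)"
abbreviation gE :: "nat \<Rightarrow> 'a::field bmw_free" where "gE i \<equiv> gen (GenE i)"
abbreviation gX :: "nat \<Rightarrow> 'a::field bmw_free" where "gX i \<equiv> gen (GenX i)"
abbreviation gXinv :: "nat \<Rightarrow> 'a::field bmw_free" where "gXinv i \<equiv> gen (GenXinv i)"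

definition gXpow :: "nat \<Rightarrow> int \<Rightarrow> 'a::field bmw_free"
  where "gXpow i a = (if 0 \<le> a then gX i ^ nat a else gXinv i ^ nat (- a))"

text \<open>A pair \<open>(x, y)\<close> stands for the defining relation \<open>x = y\<close>.\<close>

inductive_set bmw_rels ::
    "nat \<Rightarrow> nat \<Rightarrow> 'a::field \<Rightarrow> (nat \<Rightarrow> 'a) \<Rightarrow> 'a \<Rightarrow> (int \<Rightarrow> 'a) \<Rightarrow> ('a bmw_free \<times> 'a bmw_free) set"
  for r n :: nat and q :: 'a and u :: "nat \<Rightarrow> 'a" and \<rho> :: 'a and \<omega> :: "int \<Rightarrow> 'a"
where
  a1: "i \<in> {1..n} \<Longrightarrow> (gX i * gXinv i, 1) \<in> bmw_rels r n q u \<rho> \<omega>"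
| a2: "i \<in> {1..n} \<Longrightarrow> (gXinv i * gX i, 1) \<in> bmw_rels r n q u \<rho> \<omega>"
| b: "i \<in> {1..<n} \<Longrightarrow>
    (1, gT i ^ 2 - scal (dlt q) * gT i + scal (dlt q * \<rho>) * gE i) \<in> bmw_rels r n q u \<rho> \<omega>"
| c1: "\<lbrakk>i \<in> {1..<n}; j \<in> {1..<n}; \<bar>int i - int j\<bar> > 1\<rbrakk> \<Longrightarrow>
    (gT i * gT j, gT j * gT i) \<in> bmw_rels r n q u \<rho> \<omega>"
| c2: "\<lbrakk>1 \<le> i; i + 1 < n\<rbrakk> \<Longrightarrow>
    (gT i * gT (i + 1) * gT i, gT (i + 1) * gT i * gT (i + 1)) \<in> bmw_rels r n q u \<rho> \<omega>"
| c3: "\<lbrakk>i \<in> {1..<n}; j \<in> {1..n}; j \<noteq> i; j \<noteq> i + 1\<rbrakk> \<Longrightarrow>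
    (gT i * gX j, gX j * gT i) \<in> bmw_rels r n q u \<rho> \<omega>"
| d: "i \<in> {1..<n} \<Longrightarrow> (gE i ^ 2, scal (\<omega> 0) * gE i) \<in> bmw_rels r n q u \<rho> \<omega>"
| e: "\<lbrakk>i \<in> {1..n}; j \<in> {1..n}\<rbrakk> \<Longrightarrow> (gX i * gX j, gX j * gX i) \<in> bmw_rels r n q u \<rho> \<omega>"
| f1: "i \<in> {1..<n} \<Longrightarrow>
    (gT i * gX i - gX (i + 1) * gT i, scal (dlt q) * gX (i + 1) * (gE i - 1))
      \<in> bmw_rels r n q u \<rho> \<omega>"
| f2: "i \<in> {1..<n} \<Longrightarrow>
    (gX i * gT i - gT i * gX (i + 1), scal (dlt q) * (gE i - 1) * gX (i + 1))
      \<in> bmw_rels r n q u \<rho> \<omega>"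
| g: "1 < n \<Longrightarrow> (gE 1 * gXpow 1 a * gE 1, scal (\<omega> a) * gE 1) \<in> bmw_rels r n q u \<rho> \<omega>"
| h1: "i \<in> {1..<n} \<Longrightarrow> (gE i * gT i, scal \<rho> * gE i) \<in> bmw_rels r n q u \<rho> \<omega>"
| h2: "i \<in> {1..<n} \<Longrightarrow> (gT i * gE i, scal \<rho> * gE i) \<in> bmw_rels r n q u \<rho> \<omega>"
| h3: "\<lbrakk>1 \<le> i; i + 2 \<le> n\<rbrakk> \<Longrightarrow>
    (gE (i + 1) * gE i, gE (i + 1) * gT i * gT (i + 1)) \<in> bmw_rels r n q u \<rho> \<omega>"
| h4: "\<lbrakk>1 \<le> i; i + 2 \<le> n\<rbrakk> \<Longrightarrow>
    (gE (i + 1) * gE i, gT i * gT (i + 1) * gE i) \<in> bmw_rels r n q u \<rho> \<omega>"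
| i1: "\<lbrakk>1 \<le> i; i + 2 \<le> n\<rbrakk> \<Longrightarrow>
    (gE (i + 1) * gE i * gE (i + 1), gE (i + 1)) \<in> bmw_rels r n q u \<rho> \<omega>"
| i2: "\<lbrakk>1 \<le> i; i + 2 \<le> n\<rbrakk> \<Longrightarrow>
    (gE i * gE (i + 1) * gE i, gE i) \<in> bmw_rels r n q u \<rho> \<omega>"
| j1: "i \<in> {1..<n} \<Longrightarrow> (gE i * gX i * gX (i + 1), gE i) \<in> bmw_rels r n q u \<rho> \<omega>"
| j2: "i \<in> {1..<n} \<Longrightarrow> (gX i * gX (i + 1) * gE i, gE i) \<in> bmw_rels r n q u \<rho> \<omega>"
| k: "(prod_list (map (\<lambda>l. gX 1 - scal (u l)) [1..<Suc r]), 0) \<in> bmw_rels r n q u \<rho> \<omega>"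

definition bmw_ideal ::
    "nat \<Rightarrow> nat \<Rightarrow> 'a::field \<Rightarrow> (nat \<Rightarrow> 'a) \<Rightarrow> 'a \<Rightarrow> (int \<Rightarrow> 'a) \<Rightarrow> 'a bmw_free set"
  where "bmw_ideal r n q u \<rho> \<omega> =
    genideal (free_alg n) {x - y | x y. (x, y) \<in> bmw_rels r n q u \<rho> \<omega>}"

definition cyc_bmw ::
    "nat \<Rightarrow> nat \<Rightarrow> 'a::field \<Rightarrow> (nat \<Rightarrow> 'a) \<Rightarrow> 'a \<Rightarrow> (int \<Rightarrow> 'a) \<Rightarrow> 'a bmw_free set ring"
  where "cyc_bmw r n q u \<rho> \<omega> = free_alg n Quot bmw_ideal r n q u \<rho> \<omega>"

definition bmw_class ::
    "nat \<Rightarrow> nat \<Rightarrow> 'a::field \<Rightarrow> (nat \<Rightarrow> 'a) \<Rightarrow> 'a \<Rightarrow> (int \<Rightarrow> 'a) \<Rightarrow> 'a bmw_free \<Rightarrow> 'a bmw_free set"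
  where "bmw_class r n q u \<rho> \<omega> x = bmw_ideal r n q u \<rho> \<omega> +>\<^bsub>free_alg n\<^esub> x"

section \<open>Modules\<close>

text \<open>\<open>act\<close> makes the vector space with carrier \<open>V\<close> and scalar multiplication \<open>scale\<close> a unital left
  module over the algebra \<open>A\<close> with structure map \<open>\<eta>\<close> from the ground field; the last clause says
  that the vector space structure of \<open>V\<close> is the one induced by \<open>\<eta>\<close>. The library locale \<open>module\<close>
  covers commutative rings only.\<close>

definition left_module_on ::
    "('b, 'm) ring_scheme \<Rightarrow> ('a \<Rightarrow> 'b) \<Rightarrow> ('v::ab_group_add) set \<Rightarrow> ('a \<Rightarrow> 'v \<Rightarrow> 'v) \<Rightarrow>
      ('b \<Rightarrow> 'v \<Rightarrow> 'v) \<Rightarrow> bool"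
  where "left_module_on A \<eta> V scale act \<longleftrightarrow>
    (\<forall>x \<in> carrier A. \<forall>v \<in> V. act x v \<in> V) \<and>
    (\<forall>x \<in> carrier A. \<forall>v \<in> V. \<forall>w \<in> V. act x (v + w) = act x v + act x w) \<and>
    (\<forall>x \<in> carrier A. \<forall>y \<in> carrier A. \<forall>v \<in> V. act (x \<oplus>\<^bsub>A\<^esub> y) v = act x v + act y v) \<and>
    (\<forall>x \<in> carrier A. \<forall>y \<in> carrier A. \<forall>v \<in> V. act (x \<otimes>\<^bsub>A\<^esub> y) v = act x (act y v)) \<and>
    (\<forall>v \<in> V. act \<one>\<^bsub>A\<^esub> v = v) \<and>
    (\<forall>c. \<forall>v \<in> V. act (\<eta> c) v = scale c v)"

text \<open>The vector space with basis \<open>S\<close>; the basis vector of \<open>s \<in> S\<close> is \<open>bvec s\<close>.\<close>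

definition free_space :: "'s set \<Rightarrow> ('s \<Rightarrow>\<^sub>0 'a::field) set"
  where "free_space S = {v. Poly_Mapping.keys v \<subseteq> S}"

definition bvec :: "'s \<Rightarrow> ('s \<Rightarrow>\<^sub>0 'a::field)"
  where "bvec s = Poly_Mapping.single s 1"

definition smul :: "'a::field \<Rightarrow> ('s \<Rightarrow>\<^sub>0 'a) \<Rightarrow> ('s \<Rightarrow>\<^sub>0 'a)"
  where "smul c v = Poly_Mapping.map ((*) c) v"

section \<open>Admissibility and genericity\<close>

definition Qser :: "nat \<Rightarrow> (nat \<Rightarrow> 'a::field) \<Rightarrow> int \<Rightarrow> 'a"
  where "Qser r u a = (if a < 0 then 0 else
    fps_nth (\<Prod>i = 1..r. (fps_X - fps_const (u i)) / (fps_const (u i) * fps_X - 1)) (nat a))"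

definition Qser' :: "nat \<Rightarrow> (nat \<Rightarrow> 'a::field) \<Rightarrow> int \<Rightarrow> 'a"
  where "Qser' r u a = (if a < 0 then 0 else
    fps_nth (\<Prod>i = 1..r. (fps_const (u i) * fps_X - 1) / (fps_X - fps_const (u i))) (nat a))"

text \<open>The number \<open>(1 + (-1)\<^sup>a) / 2\<close>, which is meant as an integer and hence makes sense in
  characteristic \<open>2\<close>.\<close>

definition ev :: "int \<Rightarrow> 'a::field"
  where "ev a = (if even a then 1 else 0)"

definition adm_A :: "nat \<Rightarrow> 'a::field \<Rightarrow> (nat \<Rightarrow> 'a) \<Rightarrow> 'a \<Rightarrow> int \<Rightarrow> 'a"
  where "adm_A r q u \<rho> a = ev a + inverse (dlt q) * \<rho> * (\<Prod>i = 1..r. u i) * Qser r u a"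

definition adm_B :: "nat \<Rightarrow> 'a::field \<Rightarrow> (nat \<Rightarrow> 'a) \<Rightarrow> 'a \<Rightarrow> int \<Rightarrow> 'a"
  where "adm_B r q u \<rho> a = ev a - inverse (dlt q) * \<rho> * (\<Prod>i = 1..r. u i) * Qser' r u a"

definition u_admissible ::
    "nat \<Rightarrow> 'a::field \<Rightarrow> (nat \<Rightarrow> 'a) \<Rightarrow> 'a \<Rightarrow> (int \<Rightarrow> 'a) \<Rightarrow> bool"
  where "u_admissible r q u \<rho> \<omega> \<longleftrightarrow>
    (let P = (\<Prod>i = 1..r. u i) in
      (odd r \<longrightarrow> inverse \<rho> \<in> {P, - P}) \<and>
      (even r \<longrightarrow> inverse \<rho> \<in> {inverse q * P, - (q * P)}) \<and>
      (\<forall>a \<ge> 0. \<omega> a =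
        (if odd r
         then adm_A r q u \<rho> a + (\<Sum>k = 0..a - 1. ev k * Qser r u (a - 1 - k))
                - inverse (dlt q) * \<rho> * (if a = 0 then 1 else 0)
         else adm_A r q u \<rho> a - (\<Sum>k = 0..a. ev k * Qser r u (a - k))
                - inverse (dlt q) * \<rho> * (if a = 0 then 1 else 0))) \<and>
      (\<forall>a > 0. \<omega> (- a) =
        (if odd r
         then adm_B r q u \<rho> a + (\<Sum>k = 0..a - 1. ev k * Qser' r u (a - 1 - k))
         else adm_B r q u \<rho> a - (\<Sum>k = 0..a - 2. ev k * Qser' r u (a - 2 - k)))))"

definition generic :: "nat \<Rightarrow> nat \<Rightarrow> 'a::field \<Rightarrow> (nat \<Rightarrow> 'a) \<Rightarrow> bool"
  where "generic r n q u \<longleftrightarrow>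
    (\<forall>d::int.
      (\<exists>i \<in> {1..r}. \<exists>j \<in> {1..r}. i \<noteq> j \<and>
          (u i * u j = q powi (2 * d) \<or> u i * inverse (u j) = q powi (2 * d))) \<or>
      (\<exists>i \<in> {1..r}. u i = q powi d \<or> u i = - (q powi d))
      \<longrightarrow> \<bar>d\<bar> \<ge> 2 * int n)"

section \<open>Multipartitions and updown tableaux\<close>

text \<open>An \<open>r\<close>-partition \<open>\<mu>\<close> is given by its parts: \<open>\<mu> s i\<close> is the \<open>i\<close>-th part of the component
  \<open>s\<close>, for \<open>1 \<le> s \<le> r\<close> and \<open>i \<ge> 1\<close>; all values outside this range are \<open>0\<close>.
  A node \<open>(i, j, s)\<close> is in row \<open>i\<close> and column \<open>j\<close> of the component \<open>s\<close>.\<close>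

type_synonym mpart = "nat \<Rightarrow> nat \<Rightarrow> nat"
type_synonym node = "nat \<times> nat \<times> nat"
type_synonym tab = "mpart list"

definition diagram :: "mpart \<Rightarrow> node set"
  where "diagram \<mu> = {(i, j, s). 1 \<le> j \<and> j \<le> \<mu> s i}"

definition is_rpart :: "nat \<Rightarrow> mpart \<Rightarrow> bool"
  where "is_rpart r \<mu> \<longleftrightarrow>
    (\<forall>s i. s \<notin> {1..r} \<or> i = 0 \<longrightarrow> \<mu> s i = 0) \<and>
    (\<forall>s \<in> {1..r}. \<forall>i \<ge> 1. \<mu> s (i + 1) \<le> \<mu> s i) \<and>
    finite (diagram \<mu>)"

definition rparts :: "nat \<Rightarrow> nat \<Rightarrow> mpart set"
  where "rparts r m = {\<mu>. is_rpart r \<mu> \<and> card (diagram \<mu>) = m}"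

definition empty_mpart :: mpart
  where "empty_mpart = (\<lambda>s i. 0)"

text \<open>\<open>\<nu>\<close> is obtained from \<open>\<mu>\<close> by adding the node \<open>\<alpha>\<close>, equivalently \<open>\<mu>\<close> from \<open>\<nu>\<close> by
  removing \<open>\<alpha>\<close>.\<close>

definition adds_node :: "node \<Rightarrow> mpart \<Rightarrow> mpart \<Rightarrow> bool"
  where "adds_node \<alpha> \<mu> \<nu> \<longleftrightarrow> \<alpha> \<notin> diagram \<mu> \<and> diagram \<nu> = insert \<alpha> (diagram \<mu>)"

definition differ_by :: "node \<Rightarrow> mpart \<Rightarrow> mpart \<Rightarrow> bool"
  where "differ_by \<alpha> \<mu> \<nu> \<longleftrightarrow> adds_node \<alpha> \<mu> \<nu> \<or> adds_node \<alpha> \<nu> \<mu>"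

definition addable :: "nat \<Rightarrow> mpart \<Rightarrow> node set"
  where "addable r \<mu> = {\<alpha>. \<exists>\<nu>. is_rpart r \<nu> \<and> adds_node \<alpha> \<mu> \<nu>}"

definition removable :: "nat \<Rightarrow> mpart \<Rightarrow> node set"
  where "removable r \<mu> = {\<alpha>. \<exists>\<nu>. is_rpart r \<nu> \<and> adds_node \<alpha> \<nu> \<mu>}"

text \<open>The node \<open>\<mu> \<ominus> \<nu>\<close>; it carries no sign, so \<open>\<mu> \<ominus> \<nu> = \<nu> \<ominus> \<mu>\<close>.\<close>

definition node_diff :: "mpart \<Rightarrow> mpart \<Rightarrow> node"
  where "node_diff \<mu> \<nu> = (THE \<alpha>. differ_by \<alpha> \<mu> \<nu>)"

definition updown :: "nat \<Rightarrow> nat \<Rightarrow> mpart \<Rightarrow> tab set"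
  where "updown r n \<mu> = {t. length t = n + 1 \<and> (\<forall>i \<le> n. is_rpart r (t ! i)) \<and>
    t ! 0 = empty_mpart \<and> t ! n = \<mu> \<and>
    (\<forall>i \<in> {1..n}. \<exists>\<alpha>. differ_by \<alpha> (t ! (i - 1)) (t ! i))}"

definition ksim :: "nat \<Rightarrow> tab \<Rightarrow> tab \<Rightarrow> bool"
  where "ksim k s t \<longleftrightarrow> length s = length t \<and> (\<forall>j < length s. j \<noteq> k \<longrightarrow> s ! j = t ! j)"

definition swap_defined :: "nat \<Rightarrow> tab \<Rightarrow> bool"
  where "swap_defined k s \<longleftrightarrow> s ! (k - 1) \<noteq> s ! (k + 1) \<and>
    (case node_diff (s ! k) (s ! (k - 1)) of (i, j, c) \<Rightarrow>
     case node_diff (s ! (k + 1)) (s ! k) of (i', j', c') \<Rightarrow>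
       (c, i) \<noteq> (c', i') \<and> (c, j) \<noteq> (c', j'))"

text \<open>The tableau \<open>s\<^sub>k s\<close>; meaningful only if \<open>swap_defined k s\<close>.\<close>

definition swap :: "nat \<Rightarrow> nat \<Rightarrow> tab \<Rightarrow> tab"
  where "swap r k s = s[k := (THE \<mu>. is_rpart r \<mu> \<and>
    (\<exists>\<alpha>. differ_by \<alpha> \<mu> (s ! (k + 1))) \<and> (\<exists>\<alpha>. differ_by \<alpha> (s ! (k - 1)) \<mu>) \<and>
    node_diff \<mu> (s ! (k + 1)) = node_diff (s ! (k - 1)) (s ! k) \<and>
    node_diff (s ! (k - 1)) \<mu> = node_diff (s ! k) (s ! (k + 1)))]"

section \<open>Contents, rational functions and coefficients\<close>

definition content :: "'a::field \<Rightarrow> (nat \<Rightarrow> 'a) \<Rightarrow> node \<Rightarrow> 'a"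
  where "content q u \<alpha> = (case \<alpha> of (i, j, s) \<Rightarrow> u s * q powi (2 * (int j - int i)))"

definition cont_tab :: "'a::field \<Rightarrow> (nat \<Rightarrow> 'a) \<Rightarrow> tab \<Rightarrow> nat \<Rightarrow> 'a"
  where "cont_tab q u t k =
    (let \<alpha> = node_diff (t ! k) (t ! (k - 1)) in
      if adds_node \<alpha> (t ! (k - 1)) (t ! k) then content q u \<alpha> else inverse (content q u \<alpha>))"

definition cont_node :: "nat \<Rightarrow> 'a::field \<Rightarrow> (nat \<Rightarrow> 'a) \<Rightarrow> mpart \<Rightarrow> node \<Rightarrow> 'a"
  where "cont_node r q u \<mu> \<alpha> =
    (if \<alpha> \<in> addable r \<mu> then content q u \<alpha> else inverse (content q u \<alpha>))"

text \<open>Rational functions over a field, and their Laurent expansions at a point \<open>c\<close> (in the local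
  parameter \<open>y - c\<close>, represented by \<open>fls_X\<close>).\<close>

type_synonym 'a ratfun = "'a poly fract"

definition rf_const :: "'a::field \<Rightarrow> 'a ratfun"
  where "rf_const c = Fraction_Field.Fract [:c:] 1"

definition rf_y :: "'a::field ratfun"
  where "rf_y = Fraction_Field.Fract [:0, 1:] 1"

definition poly_at :: "'a::field \<Rightarrow> 'a poly \<Rightarrow> 'a fls"
  where "poly_at c p = fps_to_fls (fps_of_poly (p \<circ>\<^sub>p [:c, 1:]))"

lemma poly_at_mult: "poly_at c (p * p') = poly_at c p * poly_at c p'"
  by (simp add: poly_at_def pcompose_mult fps_of_poly_mult fls_times_fps_to_fls)

lemma poly_at_eq_0_iff: "poly_at c p = 0 \<longleftrightarrow> p = 0"
  by (simp add: poly_at_def pcompose_eq_0_iff)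

lift_definition laurent_at :: "'a::field \<Rightarrow> 'a ratfun \<Rightarrow> 'a fls"
  is "\<lambda>c (p, d). poly_at c p / poly_at c d"
  by (auto simp: frac_eq_eq poly_at_eq_0_iff simp flip: poly_at_mult)

definition residue_at :: "'a::field \<Rightarrow> 'a ratfun \<Rightarrow> 'a"
  where "residue_at c f = fls_residue (laurent_at c f)"

definition Wfun :: "nat \<Rightarrow> 'a::field \<Rightarrow> (nat \<Rightarrow> 'a) \<Rightarrow> 'a \<Rightarrow> nat \<Rightarrow> tab \<Rightarrow> 'a ratfun"
  where "Wfun r q u \<rho> k s =
    (let y = rf_y; P = rf_const (\<Prod>i = 1..r. u i);
         \<delta>\<rho> = rf_const (inverse (dlt q) * \<rho>);
         \<gamma> = (if odd r then 1 else - y);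
         \<mu> = s ! (k - 1)
     in y^2 / (y^2 - 1) - \<delta>\<rho> +
        (\<delta>\<rho> * P + y * \<gamma> / (y^2 - 1)) * P *
        (\<Prod>\<alpha> \<in> addable r \<mu> \<union> removable r \<mu>.
           (y - rf_const (inverse (cont_node r q u \<mu> \<alpha>))) / (y - rf_const (cont_node r q u \<mu> \<alpha>))))"

definition E_diag :: "nat \<Rightarrow> 'a::field \<Rightarrow> (nat \<Rightarrow> 'a) \<Rightarrow> 'a \<Rightarrow> nat \<Rightarrow> tab \<Rightarrow> 'a"
  where "E_diag r q u \<rho> k s = residue_at (cont_tab q u s k) (Wfun r q u \<rho> k s / rf_y)"

text \<open>The square roots are data: \<open>sE k s\<close> is the chosen root of \<open>E_diag r q u \<rho> k s\<close>, and
  \<open>b k s\<close> below is the chosen root of \<open>1 - a\<^sup>2 + \<delta> a\<close> with \<open>a = a_coef q u k s\<close>.\<close>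

definition E_coef ::
    "nat \<Rightarrow> 'a::field \<Rightarrow> (nat \<Rightarrow> 'a) \<Rightarrow> 'a \<Rightarrow> (nat \<Rightarrow> tab \<Rightarrow> 'a) \<Rightarrow> nat \<Rightarrow> tab \<Rightarrow> tab \<Rightarrow> 'a"
  where "E_coef r q u \<rho> sE k s t =
    (if s = t then E_diag r q u \<rho> k s else if ksim k t s then sE k s * sE k t else 0)"

definition T_coef ::
    "nat \<Rightarrow> 'a::field \<Rightarrow> (nat \<Rightarrow> 'a) \<Rightarrow> 'a \<Rightarrow> (nat \<Rightarrow> tab \<Rightarrow> 'a) \<Rightarrow> nat \<Rightarrow> tab \<Rightarrow> tab \<Rightarrow> 'a"
  where "T_coef r q u \<rho> sE k s t =
    dlt q * ((E_coef r q u \<rho> sE k s t - (if s = t then 1 else 0)) /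
             (cont_tab q u s k * cont_tab q u t k - 1))"

definition a_coef :: "'a::field \<Rightarrow> (nat \<Rightarrow> 'a) \<Rightarrow> nat \<Rightarrow> tab \<Rightarrow> 'a"
  where "a_coef q u k s =
    dlt q * cont_tab q u s (k + 1) / (cont_tab q u s (k + 1) - cont_tab q u s k)"

text \<open>The root conditions for the tableaux of one shape. The root \<open>b k s\<close> is defined only if
  \<open>s ! (k - 1) \<noteq> s ! (k + 1)\<close>. In the condition on \<open>swap r k s\<close> and \<open>swap r (k + 1) s\<close> this is
  not automatic for the two roots that are compared (although one of them is defined iff the other
  is), and hence is a hypothesis there.\<close>

definition root_conditions ::
    "nat \<Rightarrow> nat \<Rightarrow> 'a::field \<Rightarrow> (nat \<Rightarrow> 'a) \<Rightarrow> 'a \<Rightarrow> mpart \<Rightarrow>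
      (nat \<Rightarrow> tab \<Rightarrow> 'a) \<Rightarrow> (nat \<Rightarrow> tab \<Rightarrow> 'a) \<Rightarrow> bool"
  where "root_conditions r n q u \<rho> \<mu> sE b \<longleftrightarrow>
    (let TT = updown r n \<mu>; stays = (\<lambda>k s. s ! (k - 1) = s ! (k + 1)) in
      (\<forall>s \<in> TT. \<forall>k \<in> {1..<n}. stays k s \<longrightarrow> sE k s ^ 2 = E_diag r q u \<rho> k s) \<and>
      (\<forall>s \<in> TT. \<forall>k \<in> {1..<n}. \<not> stays k s \<longrightarrow>
         b k s ^ 2 = 1 - a_coef q u k s ^ 2 + dlt q * a_coef q u k s) \<and>
      (\<forall>s \<in> TT. \<forall>k \<in> {1..<n}. \<not> stays k s \<and> swap_defined k s \<longrightarrow>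
         b k (swap r k s) = b k s) \<and>
      (\<forall>s \<in> TT. \<forall>t \<in> TT. \<forall>k \<in> {1..<n}. \<forall>l \<in> {1..<n}.
         \<not> stays k s \<and> ksim l s t \<and> \<bar>int k - int l\<bar> > 1 \<longrightarrow> b k s = b k t) \<and>
      (\<forall>s \<in> TT. \<forall>k. 1 \<le> k \<and> k + 1 < n \<and>
         \<not> stays k s \<and> \<not> stays (k + 1) s \<and> swap_defined k s \<and> swap_defined (k + 1) s \<and>
         \<not> stays k (swap r (k + 1) s) \<and> \<not> stays (k + 1) (swap r k s) \<longrightarrow>
         b k (swap r (k + 1) s) = b (k + 1) (swap r k s)) \<and>
      (\<forall>s \<in> TT. \<forall>k. 1 \<le> k \<and> k + 1 < n \<and> stays k s \<and> stays (k + 1) s \<longrightarrow>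
         sE k s * sE (k + 1) s = 1) \<and>
      (\<forall>s \<in> TT. \<forall>t \<in> TT. \<forall>k \<in> {1..<n}. stays k s \<and> stays k t \<and>
         E_diag r q u \<rho> k s = E_diag r q u \<rho> k t \<longrightarrow> sE k s = sE k t) \<and>
      (\<forall>s \<in> TT. \<forall>t \<in> TT. \<forall>v \<in> TT. \<forall>k. 1 \<le> k \<and> k + 1 < n \<and>
         stays k s \<and> stays (k + 1) s \<and> ksim (k + 1) t s \<and> ksim k v s \<and>
         swap_defined k t \<and> swap_defined (k + 1) v \<and> swap r k t = swap r (k + 1) v \<longrightarrow>
         b k t * sE (k + 1) t = b (k + 1) v * sE k v))"

end

theory Submission
  imports Defs
begin

text \<open>The generators act by symmetric matrices. On the tableaux which differ only in the vertex \<open>k\<close>, where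
  that vertex lies between two equal ones, \<open>E\<^sub>k = e e\<^sup>T\<close> has rank one and \<open>T\<^sub>k\<close> is determined by \<open>E\<^sub>k\<close> and the
  diagonal matrices \<open>X\<^sub>k\<close>, \<open>X\<^sub>k\<^sub>+\<^sub>1\<close>; the relations between them reduce to the partial fraction expansion
  of \<open>W\<^sub>k(y) / y\<close>, which has only simple poles, at the contents of the addable and removable nodes.
  Its expansions at \<open>0\<close> and \<open>\<infinity>\<close> for the empty multipartition give \<open>E\<^sub>1 X\<^sub>1\<^sup>a E\<^sub>1 = \<omega>\<^sub>a E\<^sub>1\<close>.

  The relations between \<open>E\<^sub>k\<close>, \<open>E\<^sub>k\<^sub>+\<^sub>1\<close>, \<open>T\<^sub>k\<close> and \<open>T\<^sub>k\<^sub>+\<^sub>1\<close> follow from one identity,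
  \<open>T\<^sub>k\<^sub>+\<^sub>1 \<xi>\<^sub>k = T\<^sub>k \<xi>\<^sub>k\<^sub>+\<^sub>1 + \<delta> \<xi>\<^sub>k - \<delta> \<xi>\<^sub>k\<^sub>+\<^sub>1\<close> for the vectors \<open>\<xi>\<^sub>k\<close>, \<open>\<xi>\<^sub>k\<^sub>+\<^sub>1\<close> spanning the images of \<open>E\<^sub>k\<close>, \<open>E\<^sub>k\<^sub>+\<^sub>1\<close> in
  the blocks of a common tableau, and from transposition. They imply that
  \<open>\<Phi> = T\<^sub>k T\<^sub>k\<^sub>+\<^sub>1 T\<^sub>k - T\<^sub>k\<^sub>+\<^sub>1 T\<^sub>k T\<^sub>k\<^sub>+\<^sub>1\<close> satisfies \<open>\<Phi> X\<^sub>k = X\<^sub>k\<^sub>+\<^sub>2 \<Phi>\<close> and \<open>E\<^sub>k \<Phi> = E\<^sub>k\<^sub>+\<^sub>1 \<Phi> = 0\<close>. So \<open>\<Phi>\<close> can connect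
  two tableaux only if it reverses three consecutive contents, and then both products in \<open>\<Phi>\<close> consist
  of a single path, with the same product of roots \<open>b\<close>.\<close>

section \<open>Partial fractions\<close>

text \<open>Genericity is applied at vertices with fewer than \<open>n\<close> nodes: there the
  labels of the addable and removable nodes are distinct, no two of them have product 1, and no
  ratio is \<open>q^2\<close> or \<open>q^(-2)\<close>. The first two facts make the poles simple
  and let the contents determine a tableau. The third guarantees exchanges of steps, since an
  exchange of two steps that do not cancel can fail only at such a ratio; there the root
  \<open>b\<close> is zero, in accordance with the convention in the theorem.

  Admissibility has two effects. The value of \<rho> makes the residues add up to
  \<open>\<omega> 0\<close> and keeps each of them from vanishing; the formulas for the other
  parameters are the coefficients of the two expansions of W_1.

  The obstacle in the braid relation is the paths through the blocks of staying tableaux, which give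
  sums of products of residues over overlapping blocks. They are never computed. A row of \<Phi> has
  at most one nonzero entry, say at \<open>t\<close>, and \<open>E_i\<close> has a nonzero diagonal
  entry at \<open>t\<close> whenever \<open>t\<close> stays at \<open>i\<close>; so
  \<open>E_i \<Phi> = 0\<close> excludes staying tableaux altogether.\<close>

lemma degree_prod_linear:
  fixes f :: "'b \<Rightarrow> 'a::field"
  assumes "finite C"
  shows "degree (\<Prod>d\<in>C. [:f d, 1:]) = card C" "lead_coeff (\<Prod>d\<in>C. [:f d, 1:]) = 1"
proof -
  show "lead_coeff (\<Prod>d\<in>C. [:f d, 1:]) = 1"
    by (simp add: lead_coeff_prod)
  show "degree (\<Prod>d\<in>C. [:f d, 1:]) = card C"
    by (subst degree_prod_eq_sum_degree) auto
qed

lemma Lagrange_interpolation: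
  fixes G :: "'a::field poly"
  assumes "finite C" "degree G < card C"
  shows "G = (\<Sum>c\<in>C. smult (poly G c / (\<Prod>d\<in>C - {c}. c - d)) (\<Prod>d\<in>C - {c}. [:- d, 1:]))"
    (is "G = ?S")
proof (rule ccontr)
  assume "G \<noteq> ?S"
  then have nz: "G - ?S \<noteq> 0" by simp
  have "degree ?S \<le> card C - 1"
  proof (rule degree_sum_le[OF assms(1)])
    fix c assume "c \<in> C"
    then show "degree (smult (poly G c / (\<Prod>d\<in>C - {c}. c - d)) (\<Prod>d\<in>C - {c}. [:- d, 1:])) \<le> card C - 1"
      using degree_prod_linear(1)[of "C - {c}" uminus] assms(1)
      by (intro order.trans[OF degree_smult_le]) simp
  qed
  then have deg: "degree (G - ?S) < card C"
    using assms(2) by (intro degree_diff_less) linarith+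
  have "poly ?S c = poly G c" if "c \<in> C" for c
  proof -
    have "poly ?S c = (\<Sum>b\<in>C. poly G b / (\<Prod>d\<in>C - {b}. b - d) * (\<Prod>d\<in>C - {b}. c - d))"
      by (simp add: poly_sum poly_prod)
    also have "\<dots> = (\<Sum>b\<in>C. if b = c then poly G c else 0)"
    proof (rule sum.cong[OF refl])
      fix b assume "b \<in> C"
      show "poly G b / (\<Prod>d\<in>C - {b}. b - d) * (\<Prod>d\<in>C - {b}. c - d) = (if b = c then poly G c else 0)"
      proof (cases "b = c")
        case True
        then show ?thesis using assms(1) by (simp add: prod_zero_iff)
      next
        case False
        then have "(\<Prod>d\<in>C - {b}. c - d) = 0"
          using that assms(1) by (intro prod_zero) auto
        then show ?thesis using False by simp
      qed
    qed
    also have "\<dots> = poly G c" using that assms(1) by simp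
    finally show ?thesis .
  qed
  then have "C \<subseteq> {x. poly (G - ?S) x = 0}" by auto
  then have "card C \<le> card {x. poly (G - ?S) x = 0}"
    by (intro card_mono poly_roots_finite[OF nz])
  then show False
    using card_poly_roots_bound[OF nz] deg by linarith
qed

definition gam :: "nat \<Rightarrow> 'a::field \<Rightarrow> 'a"
  where "gam r y = (if odd r then 1 else - y)"

text \<open>W_k at a point, with \<open>\<kappa>\<close> for
  \<open>inverse \<delta> * \<rho>\<close> and \<open>C\<close> for the contents of the nodes of
  \<open>s ! (k - 1)\<close>. The field is left open because the formula is later evaluated in the
  Laurent series over the ground field.\<close>

definition Wval :: "nat \<Rightarrow> 'a::field \<Rightarrow> 'a \<Rightarrow> 'a set \<Rightarrow> 'a \<Rightarrow> 'a"
  where "Wval r \<kappa> P C y = y\<^sup>2 / (y\<^sup>2 - 1) - \<kappa> +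
    (\<kappa> * P + y * gam r y / (y\<^sup>2 - 1)) * P * (\<Prod>c\<in>C. (y - inverse c) / (y - c))"

text \<open>The residue at \<open>y = c\<close> of \<open>Wval r \<kappa> P C y / y\<close>.\<close>

definition Eval :: "nat \<Rightarrow> 'a::field \<Rightarrow> 'a \<Rightarrow> 'a set \<Rightarrow> 'a \<Rightarrow> 'a"
  where "Eval r \<kappa> P C c = (\<kappa> * P + c * gam r c / (c\<^sup>2 - 1)) * P * (c - inverse c) *
    (\<Prod>d\<in>C - {c}. (c - inverse d) / (c - d)) / c"

text \<open>Modulo \<open>y\<^sup>2 - 1\<close>, the variable \<open>y\<close> is its own inverse, whence \<open>d y - 1 = - y (y - d)\<close>; this
  cancels both poles \<open>y = \<plusminus>1\<close> at once, also in characteristic \<open>2\<close>, where they coincide.\<close>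

lemma dvd_reflected_prod:
  fixes C :: "'a::field set"
  assumes "finite C"
  shows "[:-1, 0, 1:] dvd
    (\<Prod>d\<in>C. [:-1, d:]) - (-1) ^ card C * [:0, 1:] ^ card C * (\<Prod>d\<in>C. [:- d, 1:])"
  using assms
proof (induction C rule: finite_induct)
  case empty
  then show ?case by simp
next
  case (insert c C)
  let ?M = "\<Prod>d\<in>C. [:-1, d:]" and ?D = "\<Prod>d\<in>C. [:- d, 1:]" and ?y = "[:0, 1:] :: 'a poly"
  have "(\<Prod>d\<in>insert c C. [:-1, d:])
      - (-1) ^ card (insert c C) * ?y ^ card (insert c C) * (\<Prod>d\<in>insert c C. [:- d, 1:])
    = [:-1, c:] * (?M - (-1) ^ card C * ?y ^ card C * ?D)
      + (-1) ^ card C * ?y ^ card C * ?D * ([:-1, c:] + ?y * [:- c, 1:])"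
    using insert by (simp add: algebra_simps)
  also have "[:-1, c:] + ?y * [:- c, 1:] = [:-1, 0, 1:]" by simp
  finally show ?case
    using insert.IH by (simp only: dvd_add dvd_mult dvd_triv_right)
qed

lemma dvd_power_even_minus_1: "[:-1, 0, 1:] dvd ([:0, 1:] :: 'a::field poly) ^ (2 * k) - 1"
proof -
  have "[:-1, 0, 1:] = ([:0, 1:] :: 'a poly)\<^sup>2 - 1"
    by (simp add: power2_eq_square one_pCons)
  moreover have "x - 1 dvd x ^ k - 1" for x :: "'a poly"
    by (simp add: power_diff_1_eq)
  ultimately show ?thesis by (simp add: power_mult)
qed

text \<open>What the residue calculus needs from the contents of the addable and removable nodes of
  one multipartition. Taking \<open>c = d\<close> in \<open>mult_ne_1\<close> keeps \<open>C\<close>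
  away from the zeros of \<open>y^2 - 1\<close>; product and parity cancel the apparent poles at 0
  and at these zeros.\<close>

locale contents_set =
  fixes r :: nat and \<kappa> P :: "'a::field" and C :: "'a set"
  assumes finC: "finite C" and nz: "0 \<notin> C" and mult_ne_1: "\<And>c d. c \<in> C \<Longrightarrow> d \<in> C \<Longrightarrow> c * d \<noteq> 1"
    and prodC: "(\<Prod>c\<in>C. c) = P" and parity: "even (card C) = even r"
begin

definition DD :: "'a poly" where "DD = (\<Prod>d\<in>C. [:- d, 1:])"
text \<open>As the elements of \<open>C\<close> have product \<open>P\<close>, this is
  \<open>P\<close> times the product of the \<open>y - inverse d\<close>; hence \<open>P\<close>
  times the product in \<open>Wval\<close> is the quotient of \<open>MM\<close> by
  \<open>DD\<close>.\<close>

definition MM :: "'a poly" where "MM = (\<Prod>d\<in>C. [:-1, d:])"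
definition gamp :: "'a poly" where "gamp = (if odd r then 1 else - [:0, 1:])"

lemma poly_gamp [simp]: "poly gamp y = gam r y"
  by (simp add: gamp_def gam_def)

lemma deg_DD: "degree DD = card C" "coeff DD (card C) = 1"
  using degree_prod_linear[OF finC, of uminus] by (simp_all add: DD_def)

lemma deg_MM: "degree MM = card C" "coeff MM (card C) = P"
proof -
  show "degree MM = card C"
    proof -
    have "degree MM = (\<Sum>d\<in>C. degree [:-1, d:])"
      unfolding MM_def by (subst degree_prod_eq_sum_degree) auto
    also have "\<dots> = (\<Sum>d\<in>C. 1)"
      by (rule sum.cong) (use nz in auto)
    finally have "degree MM = (\<Sum>d\<in>C. 1)" .
    then show ?thesis by simp
  qed
  moreover have "lead_coeff MM = P"
    unfolding MM_def lead_coeff_prod prodC[symmetric] using nz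
    by (intro prod.cong) auto
  ultimately show "coeff MM (card C) = P" by simp
qed

lemma poly_MM: "poly MM y = P * (\<Prod>d\<in>C. y - inverse d)"
  unfolding MM_def poly_prod prodC[symmetric] prod.distrib[symmetric]
  by (rule prod.cong) (use nz in \<open>auto simp: field_simps\<close>)

lemma poly_DD: "poly DD y = (\<Prod>d\<in>C. y - d)"
  unfolding DD_def poly_prod by simp

text \<open>At 0 both \<open>P * MM\<close> and \<open>DD\<close> equal
  \<open>(-1) ^ card C * P\<close>. This cancels the pole of \<open>Wval / y\<close> at 0 in the
  part proportional to \<open>\<kappa>\<close>.\<close>

lemma first_numerator:
  obtains H where "smult P MM - DD = [:0, 1:] * H" "degree H \<le> card C - 1"
    "card C > 0 \<Longrightarrow> coeff H (card C - 1) = P * P - 1"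
proof -
  have "poly (smult P MM - DD) 0 = 0"
  proof -
    have "poly DD 0 = (-1) ^ card C * P"
      by (simp add: poly_DD prodC prod_uminus)
    moreover have "poly MM 0 = (-1) ^ card C"
      by (simp add: MM_def poly_prod)
    ultimately show ?thesis by simp
  qed
  then have "[:0, 1:] dvd smult P MM - DD"
    by (simp only: poly_eq_0_iff_dvd minus_zero)
  then obtain H where H: "smult P MM - DD = [:0, 1:] * H" by (rule dvdE)
  have *: "degree (smult P MM - DD) \<le> card C"
    using deg_DD deg_MM by (intro degree_diff_le) (auto intro: order.trans[OF degree_smult_le])
  have "degree H \<le> card C - 1"
    using * unfolding H by (cases "H = 0") (auto simp: degree_mult_eq)
  moreover have "coeff H (card C - 1) = P * P - 1" if "card C > 0"
  proof -
    have "coeff ([:0, 1:] * H) (Suc (card C - 1)) = coeff H (card C - 1)" by simp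
    then show ?thesis unfolding H[symmetric] using that deg_DD deg_MM by simp
  qed
  ultimately show thesis by (rule that[OF H])
qed

text \<open>The part without \<open>\<kappa>\<close> has this polynomial, times \<open>y\<close>,
  over \<open>(y^2 - 1) * DD\<close>. Modulo \<open>y^2 - 1\<close> the polynomial \<open>MM\<close>
  is \<open>(-y) ^ card C * DD\<close>, and as \<open>card C\<close> and \<open>r\<close> have the
  same parity, multiplication by \<open>gamp\<close> turns this into
  \<open>- y * DD\<close>.\<close>

lemma second_numerator:
  assumes "card C > 0"
  obtains H where "[:0, 1:] * DD + gamp * MM = [:-1, 0, 1:] * H" "degree H \<le> card C - 1"
    "coeff H (card C - 1) = 1 - (if even r then P else 0)"
proof -
  let ?y = "[:0, 1:] :: 'a poly" and ?m = "card C"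
  have dv: "[:-1, 0, 1:] dvd MM - (-1) ^ ?m * ?y ^ ?m * DD"
    unfolding MM_def DD_def by (rule dvd_reflected_prod[OF finC])
  have "[:-1, 0, 1:] dvd ?y * DD + gamp * MM"
  proof (cases "odd r")
    case True
    then have "odd ?m" using parity by simp
    then obtain k where k: "?m = 2 * k + 1" by (rule oddE)
    have "?y * DD + gamp * MM = (MM - (-1) ^ ?m * ?y ^ ?m * DD) - ?y * DD * (?y ^ (2 * k) - 1)"
      using True by (simp add: gamp_def k algebra_simps)
    then show ?thesis using dv dvd_power_even_minus_1[of k]
      by (metis dvd_diff dvd_mult)
  next
    case False
    then have "even ?m" using parity by simp
    then obtain k where k: "?m = 2 * k" by (rule evenE)
    have "?y * DD + gamp * MM = (- ?y) * (MM - (-1) ^ ?m * ?y ^ ?m * DD) - ?y * DD * (?y ^ (2 * k) - 1)"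
      using False unfolding gamp_def k by (simp add: algebra_simps)
    then show ?thesis using dv dvd_power_even_minus_1[of k]
      by (metis dvd_diff dvd_mult)
  qed
  then obtain H where H: "?y * DD + gamp * MM = [:-1, 0, 1:] * H" by (rule dvdE)
  have nz: "DD \<noteq> 0" "MM \<noteq> 0" using deg_DD deg_MM assms by auto
  have "degree (gamp * MM) \<le> Suc ?m"
    using deg_MM by (intro order.trans[OF degree_mult_le]) (simp add: gamp_def)
  then have *: "degree (?y * DD + gamp * MM) \<le> Suc ?m"
    using deg_DD nz by (intro degree_add_le) (simp_all add: degree_mult_eq)
  have "degree H \<le> ?m - 1"
  proof (cases "H = 0")
    case False
    then have "degree ([:-1, 0, 1:] * H) = 2 + degree H"
      by (subst degree_mult_eq) auto
    then show ?thesis using * unfolding H by simp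
  qed simp
  \<comment> \<open>Only for even \<open>r\<close> does \<open>gamp\<close> raise the degree, so
    that the top coefficient \<open>P\<close> of \<open>MM\<close> enters.\<close>
  moreover have "coeff H (?m - 1) = 1 - (if even r then P else 0)"
  proof -
    have "coeff ([:-1, 0, 1:] * H) (Suc (Suc (?m - 1))) = coeff H (?m - 1)"
    proof -
      obtain k where k: "?m = Suc k" using assms by (cases ?m) auto
      then show ?thesis
        using \<open>degree H \<le> ?m - 1\<close> by (simp add: coeff_eq_0 coeff_pCons)
    qed
    then show ?thesis unfolding H[symmetric] using assms deg_DD deg_MM
      by (auto simp: gamp_def coeff_eq_0)
  qed
  ultimately show thesis by (rule that[OF H])
qed

lemma sq_ne_1: "c \<in> C \<Longrightarrow> c\<^sup>2 - 1 \<noteq> 0"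
  using mult_ne_1[of c c] by (auto simp: power2_eq_square)

text \<open>\<open>Wval / y\<close> is \<open>G\<close> over \<open>DD\<close>, and \<open>G\<close>
  has smaller degree than \<open>DD\<close>. So interpolation of \<open>G\<close> at
  \<open>C\<close> is the partial fraction expansion, and the top coefficient of \<open>G\<close> is
  the sum of the residues.\<close>

lemma Wval_numerator:
  assumes "card C > 0"
  obtains G where "degree G < card C"
    "\<And>y. y \<noteq> 0 \<Longrightarrow> y\<^sup>2 \<noteq> 1 \<Longrightarrow> y \<notin> C \<Longrightarrow> Wval r \<kappa> P C y / y = poly G y / poly DD y"
    "\<And>c. c \<in> C \<Longrightarrow> Eval r \<kappa> P C c = poly G c / (\<Prod>d\<in>C - {c}. c - d)"
    "coeff G (card C - 1) = 1 - \<kappa> + \<kappa> * P\<^sup>2 - (if even r then P else 0)"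
proof -
  obtain H1 where H1: "smult P MM - DD = [:0, 1:] * H1" "degree H1 \<le> card C - 1"
    "coeff H1 (card C - 1) = P * P - 1"
    using first_numerator assms by metis
  obtain H2 where H2: "[:0, 1:] * DD + gamp * MM = [:-1, 0, 1:] * H2" "degree H2 \<le> card C - 1"
    "coeff H2 (card C - 1) = 1 - (if even r then P else 0)"
    using second_numerator assms by metis
  define G where "G = smult \<kappa> H1 + H2"
  have p1: "P * poly MM y - poly DD y = y * poly H1 y" for y
    using arg_cong[OF H1(1), of "\<lambda>p. poly p y"] by simp
  have p2: "y * poly DD y + gam r y * poly MM y = (y\<^sup>2 - 1) * poly H2 y" for y
    using arg_cong[OF H2(1), of "\<lambda>p. poly p y"] by (simp add: algebra_simps power2_eq_square)
  have "degree (smult \<kappa> H1) \<le> card C - 1"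
    using H1(2) degree_smult_le order.trans by blast
  then have "degree G \<le> card C - 1"
    unfolding G_def using H2(2) by (intro degree_add_le)
  then have "degree G < card C" using assms by simp
  moreover have "Wval r \<kappa> P C y / y = poly G y / poly DD y"
    if "y \<noteq> 0" "y\<^sup>2 \<noteq> 1" "y \<notin> C" for y
  proof -
    define D where "D = poly DD y"
    define M where "M = poly MM y"
    define h1 where "h1 = poly H1 y"
    define h2 where "h2 = poly H2 y"
    have D: "D \<noteq> 0" using that finC by (simp add: D_def poly_DD)
    have e1: "P * M - D = y * h1" and e2: "y * D + gam r y * M = (y\<^sup>2 - 1) * h2"
      using p1[of y] p2[of y] by (simp_all add: D_def M_def h1_def h2_def)
    have Mn: "P * (\<Prod>c\<in>C. (y - inverse c) / (y - c)) = M / D"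
      by (simp add: M_def D_def poly_MM poly_DD prod_dividef)
    have "Wval r \<kappa> P C y = y\<^sup>2 / (y\<^sup>2 - 1) - \<kappa> + (\<kappa> * P + y * gam r y / (y\<^sup>2 - 1)) * (M / D)"
      unfolding Wval_def Mn[symmetric] by (simp only: mult.assoc)
    also have "\<dots> = (\<kappa> * (P * M - D) + y * (y * D + gam r y * M) / (y\<^sup>2 - 1)) / D"
    proof -
      have "y\<^sup>2 / A - \<kappa> + (\<kappa> * P + y * gam r y / A) * (M / D) =
          (\<kappa> * (P * M - D) + y * (y * D + gam r y * M) / A) / D" if "A \<noteq> 0" for A
        using D that by (simp add: field_simps power2_eq_square)
      then show ?thesis using \<open>y\<^sup>2 \<noteq> 1\<close> by simp
    qed
    also have "\<dots> = y * (\<kappa> * h1 + h2) / D"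
    proof -
      have "y * ((y\<^sup>2 - 1) * h2) / (y\<^sup>2 - 1) = y * h2" using that by simp
      then show ?thesis unfolding e1 e2 by (simp add: algebra_simps)
    qed
    finally show ?thesis using that by (simp add: G_def D_def h1_def h2_def)
  qed
  moreover have "Eval r \<kappa> P C c = poly G c / (\<Prod>d\<in>C - {c}. c - d)" if "c \<in> C" for c
  proof -
    define M where "M = poly MM c"
    have c0: "c \<noteq> 0" and c1: "c\<^sup>2 - 1 \<noteq> 0" using that nz sq_ne_1 by auto
    have D: "poly DD c = 0" using that finC by (auto simp: poly_DD)
    have e1: "P * M = c * poly H1 c" and e2: "gam r c * M = (c\<^sup>2 - 1) * poly H2 c"
      using p1[of c] p2[of c] D by (simp_all add: M_def)
    have Mn: "P * (c - inverse c) * (\<Prod>d\<in>C - {c}. (c - inverse d) / (c - d)) = M / (\<Prod>d\<in>C - {c}. c - d)"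
      unfolding M_def poly_MM using that finC
      by (simp add: prod_dividef prod.remove[of C c "\<lambda>d. c - inverse d"])
    have "Eval r \<kappa> P C c = (\<kappa> * P + c * gam r c / (c\<^sup>2 - 1)) / c * (M / (\<Prod>d\<in>C - {c}. c - d))"
      unfolding Eval_def Mn[symmetric] by simp
    also have "(\<kappa> * P + c * gam r c / (c\<^sup>2 - 1)) / c * (M / (\<Prod>d\<in>C - {c}. c - d)) =
        (\<kappa> * (P * M) / c + gam r c * M / (c\<^sup>2 - 1)) / (\<Prod>d\<in>C - {c}. c - d)"
      using c0 by (simp add: field_simps)
    also have "\<kappa> * (P * M) / c + gam r c * M / (c\<^sup>2 - 1) = poly G c"
      unfolding e1 e2 using c0 c1 by (simp add: G_def)
    finally show ?thesis .
  qed
  moreover have "coeff G (card C - 1) = 1 - \<kappa> + \<kappa> * P\<^sup>2 - (if even r then P else 0)"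
    unfolding G_def coeff_add coeff_smult H1(3) H2(3) by (simp add: algebra_simps power2_eq_square)
  ultimately show thesis by (rule that)
qed

theorem Wval_partial_fractions:
  assumes "y \<noteq> 0" "y\<^sup>2 \<noteq> 1" "y \<notin> C" "card C > 0"
  shows "Wval r \<kappa> P C y / y = (\<Sum>c\<in>C. Eval r \<kappa> P C c / (y - c))"
proof -
  obtain G where G: "degree G < card C"
    "\<And>y. y \<noteq> 0 \<Longrightarrow> y\<^sup>2 \<noteq> 1 \<Longrightarrow> y \<notin> C \<Longrightarrow> Wval r \<kappa> P C y / y = poly G y / poly DD y"
    "\<And>c. c \<in> C \<Longrightarrow> Eval r \<kappa> P C c = poly G c / (\<Prod>d\<in>C - {c}. c - d)"
    "coeff G (card C - 1) = 1 - \<kappa> + \<kappa> * P\<^sup>2 - (if even r then P else 0)"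
    by (rule Wval_numerator[OF assms(4)]) (rule that)
  have "poly G y = (\<Sum>c\<in>C. Eval r \<kappa> P C c * (\<Prod>d\<in>C - {c}. y - d))"
    by (subst Lagrange_interpolation[OF finC G(1)]) (simp add: poly_sum poly_prod G(3))
  also have "\<dots> / poly DD y = (\<Sum>c\<in>C. Eval r \<kappa> P C c / (y - c))"
    unfolding sum_divide_distrib
  proof (rule sum.cong[OF refl])
    fix c assume c: "c \<in> C"
    have "poly DD y = (y - c) * (\<Prod>d\<in>C - {c}. y - d)"
      unfolding poly_DD using c finC by (rule prod.remove[rotated])
    moreover have "(\<Prod>d\<in>C - {c}. y - d) \<noteq> 0" using assms finC by auto
    ultimately show "Eval r \<kappa> P C c * (\<Prod>d\<in>C - {c}. y - d) / poly DD y = Eval r \<kappa> P C c / (y - c)"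
      by simp
  qed
  finally show ?thesis unfolding G(2)[OF assms(1-3)] .
qed

text \<open>Comparison of top coefficients, that is, the value of \<open>Wval\<close> at infinity.
  It becomes the relation for the square of \<open>E_k\<close>.\<close>

theorem sum_Eval:
  assumes "card C > 0"
  shows "(\<Sum>c\<in>C. Eval r \<kappa> P C c) = 1 - \<kappa> + \<kappa> * P\<^sup>2 - (if even r then P else 0)"
proof -
  obtain G where G: "degree G < card C"
    "\<And>y. y \<noteq> 0 \<Longrightarrow> y\<^sup>2 \<noteq> 1 \<Longrightarrow> y \<notin> C \<Longrightarrow> Wval r \<kappa> P C y / y = poly G y / poly DD y"
    "\<And>c. c \<in> C \<Longrightarrow> Eval r \<kappa> P C c = poly G c / (\<Prod>d\<in>C - {c}. c - d)"
    "coeff G (card C - 1) = 1 - \<kappa> + \<kappa> * P\<^sup>2 - (if even r then P else 0)"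
    by (rule Wval_numerator[OF assms]) (rule that)
  have "coeff (\<Prod>d\<in>C - {c}. [:- d, 1:]) (card C - 1) = 1" if "c \<in> C" for c
    using degree_prod_linear[of "C - {c}" uminus] finC that by simp
  then have "coeff G (card C - 1) = (\<Sum>c\<in>C. Eval r \<kappa> P C c)"
    by (subst Lagrange_interpolation[OF finC G(1)]) (simp add: coeff_sum G(3))
  then show ?thesis unfolding G(4) by (rule sym)
qed

text \<open>The expansion at \<open>y = inverse c\<close>, where the product in \<open>Wval\<close>
  vanishes. This is what \<open>T_k E_k = \<rho> E_k\<close> amounts to in one row of a
  block.\<close>

theorem sum_Eval_over_mult_minus_1:
  assumes "c \<in> C"
  shows "(\<Sum>d\<in>C. Eval r \<kappa> P C d / (c * d - 1)) = 1 / (c\<^sup>2 - 1) + \<kappa>"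
proof -
  have c: "c \<noteq> 0" "c\<^sup>2 - 1 \<noteq> 0" using assms nz sq_ne_1 by auto
  have "inverse c \<notin> C" using mult_ne_1[OF assms, of "inverse c"] c by auto
  moreover have "(inverse c)\<^sup>2 \<noteq> 1"
    using c by (metis inverse_1 inverse_inverse_eq power_inverse right_minus_eq)
  moreover have "card C > 0" using assms finC card_gt_0_iff by blast
  ultimately have "Wval r \<kappa> P C (inverse c) / inverse c = (\<Sum>d\<in>C. Eval r \<kappa> P C d / (inverse c - d))"
    using c by (intro Wval_partial_fractions) auto
  moreover have "(\<Prod>d\<in>C. (inverse c - inverse d) / (inverse c - d)) = 0"
    using assms finC by (intro prod_zero) auto
  ultimately have *: "(\<Sum>d\<in>C. Eval r \<kappa> P C d / (inverse c - d)) =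
      ((inverse c)\<^sup>2 / ((inverse c)\<^sup>2 - 1) - \<kappa>) * c"
    by (simp add: Wval_def divide_inverse)
  have "(\<Sum>d\<in>C. Eval r \<kappa> P C d / (c * d - 1)) = - inverse c * (\<Sum>d\<in>C. Eval r \<kappa> P C d / (inverse c - d))"
    unfolding sum_distrib_left
  proof (rule sum.cong[OF refl])
    fix d assume "d \<in> C"
    have "inverse c - d = - ((c * d - 1) * inverse c)"
      using c by (simp add: left_diff_distrib)
    then show "Eval r \<kappa> P C d / (c * d - 1) = - inverse c * (Eval r \<kappa> P C d / (inverse c - d))"
      using c by simp
  qed
  also have "\<dots> = \<kappa> - (inverse c)\<^sup>2 / ((inverse c)\<^sup>2 - 1)"
  proof -
    have "- inverse c * ((x - \<kappa>) * c) = \<kappa> - x" for x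
      using c by (simp add: field_simps)
    then show ?thesis unfolding * .
  qed
  also have "(inverse c)\<^sup>2 / ((inverse c)\<^sup>2 - 1) = 1 / (1 - c\<^sup>2)"
  proof -
    have "(inverse c)\<^sup>2 - 1 = (1 - c\<^sup>2) * (inverse c)\<^sup>2"
      using c by (simp add: left_diff_distrib power_inverse)
    then show ?thesis using c by simp
  qed
  also have "1 / (1 - c\<^sup>2) = - (1 / (c\<^sup>2 - 1))"
    by (metis minus_diff_eq minus_divide_right)
  also have "\<kappa> - - (1 / (c\<^sup>2 - 1)) = 1 / (c\<^sup>2 - 1) + \<kappa>" by simp
  finally show ?thesis .
qed

end

section \<open>Power sums weighted by the residues\<close>

lemma fps_to_fls_divide_unit:
  fixes f g :: "'a::field fps"
  assumes "fps_nth g 0 \<noteq> 0"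
  shows "fps_to_fls (f / g) = fps_to_fls f / fps_to_fls g"
proof -
  have "f / g * g = f"
    using assms by (simp add: fps_divide_unit mult.assoc inverse_mult_eq_1)
  then have "fps_to_fls f = fps_to_fls (f / g) * fps_to_fls g"
    by (metis fls_times_fps_to_fls)
  moreover have "fps_to_fls g \<noteq> 0" using assms by auto
  ultimately show ?thesis by simp
qed

lemma fps_to_fls_sum: "fps_to_fls (\<Sum>c\<in>C. f c) = (\<Sum>c\<in>C. fps_to_fls (f c))"
  by (induction C rule: infinite_finite_induct) auto

lemma fps_to_fls_prod:
  "fps_to_fls (\<Prod>c\<in>C. f c) = (\<Prod>c\<in>C. fps_to_fls (f c :: 'a::field fps))"
  by (induction C rule: infinite_finite_induct) (auto simp: fls_times_fps_to_fls)

lemma fls_const_prod: "fls_const (\<Prod>c\<in>C. f c) = (\<Prod>c\<in>C. fls_const (f c :: 'a::field))"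
  by (induction C rule: infinite_finite_induct) (auto simp: fls_const_mult_const[symmetric])

lemma fls_const_minus_1: "fls_const x - 1 = fls_const (x - 1 :: 'a::field)"
  using fls_minus_const[of x 1] by simp

lemmas fls_const_collect = fls_const_minus_1 fls_plus_const fls_minus_const fls_const_mult_const
  fls_inverse_const fls_const_divide_const fls_const_prod[symmetric] fls_const_power[symmetric]

lemma fls_const_eq_iff [simp]: "fls_const a = fls_const b \<longleftrightarrow> a = b"
  by (metis fls_const_nth)

text \<open>Transcendence of the variable: partial fractions can be evaluated at it without meeting
  a pole.\<close>

lemma fls_X_ne_const [simp]: "(fls_X :: 'a::field fls) \<noteq> fls_const c"
proof
  assume "(fls_X :: 'a fls) = fls_const c"
  then have "fls_nth (fls_X :: 'a fls) 1 = fls_nth (fls_const c) 1" by simp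
  then show False by simp
qed

text \<open>The series of \<open>1 / (1 - X^2)\<close>, the generating function of
  \<open>ev\<close>.\<close>

definition even_ones :: "'a::field fps"
  where "even_ones = Abs_fps (\<lambda>k. if even k then 1 else 0)"

lemma even_ones_mult: "even_ones * (1 - fps_X\<^sup>2) = 1"
  by (rule fps_ext)
    (auto simp: even_ones_def right_diff_distrib fps_X_power_mult_right_nth)

lemma geometric_mult: "Abs_fps (\<lambda>a. c ^ a) * (1 - fps_const c * fps_X) = (1 :: 'a::field fps)"
proof (rule fps_ext)
  fix n
  have "Abs_fps (\<lambda>a. c ^ a) * (1 - fps_const c * fps_X) =
    Abs_fps (\<lambda>a. c ^ a) - fps_const c * (Abs_fps (\<lambda>a. c ^ a) * fps_X)"
    by (simp add: algebra_simps)
  then show "fps_nth (Abs_fps (\<lambda>a. c ^ a) * (1 - fps_const c * fps_X)) n = fps_nth (1 :: 'a fps) n"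
    by (cases n) simp_all
qed

context contents_set
begin

text \<open>Extension of scalars: the expansions of \<open>Wval\<close> at infinity and at 0 are
  then its partial fractions evaluated at the field elements \<open>1 / X\<close> and
  \<open>X\<close>.\<close>

lemma contents_set_fls: "contents_set r (fls_const P) (fls_const ` C)"
proof
  show "finite (fls_const ` C)" using finC by simp
  show "0 \<notin> fls_const ` C" using nz by auto
  show "c * d \<noteq> 1" if "c \<in> fls_const ` C" "d \<in> fls_const ` C" for c d :: "'a fls"
    using that mult_ne_1 by auto
  show "(\<Prod>c\<in>fls_const ` C. c) = fls_const P"
    by (subst prod.reindex) (auto intro: inj_onI simp: prodC[symmetric] fls_const_prod)
  show "even (card (fls_const ` C)) = even r"
    using parity by (subst card_image) (auto intro: inj_onI)
qed

lemma Eval_fls: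
  assumes "c \<in> C"
  shows "Eval r (fls_const \<kappa>) (fls_const P) (fls_const ` C) (fls_const c) = fls_const (Eval r \<kappa> P C c)"
proof -
  have *: "fls_const ` C - {fls_const c} = fls_const ` (C - {c})" by auto
  have "(\<Prod>d\<in>fls_const ` C - {fls_const c}. (fls_const c - inverse d) / (fls_const c - d)) =
    fls_const (\<Prod>d\<in>C - {c}. (c - inverse d) / (c - d))"
    unfolding * by (subst prod.reindex) (auto intro: inj_onI simp: fls_const_collect)
  then show ?thesis
    by (simp add: Eval_def fls_const_collect gam_def)
qed

lemma fls_partial_fractions:
  assumes "Y \<noteq> 0" "Y\<^sup>2 \<noteq> 1" "\<And>c. Y \<noteq> fls_const c" "card C > 0"
  shows "Wval r (fls_const \<kappa>) (fls_const P) (fls_const ` C) Y =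
    (\<Sum>c\<in>C. fls_const (Eval r \<kappa> P C c) * (Y / (Y - fls_const c)))"
proof -
  interpret fl: contents_set r "fls_const \<kappa>" "fls_const P" "fls_const ` C"
    by (rule contents_set_fls)
  have "card (fls_const ` C) > 0"
    using assms(4) by (subst card_image) (auto intro: inj_onI)
  then have "Wval r (fls_const \<kappa>) (fls_const P) (fls_const ` C) Y / Y =
      (\<Sum>c\<in>fls_const ` C. Eval r (fls_const \<kappa>) (fls_const P) (fls_const ` C) c / (Y - c))"
    using assms by (intro fl.Wval_partial_fractions) auto
  also have "\<dots> = (\<Sum>c\<in>C. fls_const (Eval r \<kappa> P C c) / (Y - fls_const c))"
    by (subst sum.reindex) (auto intro: inj_onI simp: Eval_fls)
  finally have "Wval r (fls_const \<kappa>) (fls_const P) (fls_const ` C) Y =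
      (\<Sum>c\<in>C. fls_const (Eval r \<kappa> P C c) / (Y - fls_const c)) * Y"
    using assms(1) by (simp add: divide_eq_eq)
  then show ?thesis by (simp add: sum_distrib_right)
qed

lemma Wval_prod_fls:
  "fls_const P * (\<Prod>c\<in>fls_const ` C. (Y - inverse c) / (Y - c)) =
    (\<Prod>c\<in>C. (fls_const c * Y - 1) / (Y - fls_const c))"
proof -
  have "(\<Prod>c\<in>fls_const ` C. (Y - inverse c) / (Y - c)) =
      (\<Prod>c\<in>C. (Y - inverse (fls_const c)) / (Y - fls_const c))"
    by (subst prod.reindex) (auto intro: inj_onI)
  moreover have "fls_const P = (\<Prod>c\<in>C. fls_const c)"
    by (simp add: prodC[symmetric] fls_const_prod)
  ultimately have "fls_const P * (\<Prod>c\<in>fls_const ` C. (Y - inverse c) / (Y - c)) =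
      (\<Prod>c\<in>C. fls_const c * ((Y - inverse (fls_const c)) / (Y - fls_const c)))"
    by (simp only: prod.distrib)
  also have "\<dots> = (\<Prod>c\<in>C. (fls_const c * Y - 1) / (Y - fls_const c))"
  proof (rule prod.cong[OF refl])
    fix c assume "c \<in> C"
    then have "c \<noteq> 0" using nz by auto
    then have "fls_const c * (Y - inverse (fls_const c)) = fls_const c * Y - 1"
      by (simp add: right_diff_distrib)
    then show "fls_const c * ((Y - inverse (fls_const c)) / (Y - fls_const c)) =
        (fls_const c * Y - 1) / (Y - fls_const c)" by simp
  qed
  finally show ?thesis .
qed

lemma fls_even_ones:
  "fps_to_fls even_ones = (1 / (1 - fls_X\<^sup>2) :: 'a fls)" "(1 - fls_X\<^sup>2 :: 'a fls) \<noteq> 0"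
proof -
  have "fps_to_fls even_ones * fps_to_fls (1 - fps_X\<^sup>2) = (1 :: 'a fls)"
    by (metis even_ones_mult fls_times_fps_to_fls fps_one_to_fls)
  then have *: "fps_to_fls even_ones * (1 - fls_X\<^sup>2) = (1 :: 'a fls)"
    by (simp add: power2_eq_square fls_times_fps_to_fls)
  then show "(1 - fls_X\<^sup>2 :: 'a fls) \<noteq> 0" by auto
  then show "fps_to_fls even_ones = 1 / (1 - fls_X\<^sup>2 :: 'a fls)"
    using * by (simp add: eq_divide_eq)
qed

text \<open>Expansion at infinity: for \<open>Y = 1 / X\<close> the fraction
  \<open>Y / (Y - c)\<close> is the geometric series in \<open>c * X\<close>, so the generating
  function of the power sums is \<open>Wval\<close> at \<open>Y\<close>.\<close>

theorem moments_nonneg: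
  assumes "card C > 0"
  shows "Abs_fps (\<lambda>a. \<Sum>c\<in>C. Eval r \<kappa> P C c * c ^ a) =
    even_ones - fps_const \<kappa> + (fps_const (\<kappa> * P) + (if odd r then fps_X else - 1) * even_ones) *
      (\<Prod>c\<in>C. (fps_X - fps_const c) / (fps_const c * fps_X - 1))" (is "?L = ?R")
proof -
  define X where "X = (fls_X :: 'a fls)"
  define Y where "Y = inverse X"
  have X: "X \<noteq> 0" by (simp add: X_def)
  have X2: "1 - X\<^sup>2 \<noteq> 0" using fls_even_ones(2) by (simp add: X_def)
  have Y: "Y \<noteq> 0" using X by (simp add: Y_def)
  have Y2: "Y\<^sup>2 - 1 = (1 - X\<^sup>2) * Y\<^sup>2"
    using X by (simp add: Y_def left_diff_distrib power_inverse)
  then have "Y\<^sup>2 \<noteq> 1" using X2 Y by auto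
  have Yc: "Y \<noteq> fls_const c" for c
  proof
    assume "Y = fls_const c"
    then have "X = fls_const (inverse c)"
      by (metis Y_def fls_inverse_const inverse_inverse_eq)
    then show False by (simp add: X_def)
  qed
  have cX: "1 - fls_const c * X \<noteq> 0" for c
  proof -
    have "Y - fls_const c = (1 - fls_const c * X) * Y"
      using X by (simp add: Y_def left_diff_distrib)
    then show ?thesis using Yc by auto
  qed
  have geo: "fps_to_fls (Abs_fps (\<lambda>a. c ^ a)) = Y / (Y - fls_const c)" for c :: 'a
  proof -
    have "fps_to_fls (Abs_fps (\<lambda>a. c ^ a)) * (1 - fls_const c * X) = 1"
      using arg_cong[OF geometric_mult[of c], of fps_to_fls]
      by (simp add: X_def fls_times_fps_to_fls)
    then have "fps_to_fls (Abs_fps (\<lambda>a. c ^ a)) = 1 / (1 - fls_const c * X)"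
      using cX by (simp add: eq_divide_eq)
    also have "Y - fls_const c = (1 - fls_const c * X) * Y"
      using X by (simp add: Y_def left_diff_distrib)
    then have "1 / (1 - fls_const c * X) = Y / (Y - fls_const c)"
      using Y by simp
    finally show ?thesis .
  qed
  have "?L = (\<Sum>c\<in>C. fps_const (Eval r \<kappa> P C c) * Abs_fps (\<lambda>a. c ^ a))"
    by (rule fps_ext) (simp add: fps_sum_nth)
  then have "fps_to_fls ?L = (\<Sum>c\<in>C. fls_const (Eval r \<kappa> P C c) * (Y / (Y - fls_const c)))"
    by (simp only: fps_to_fls_sum fls_times_fps_to_fls fps_const_to_fls geo)
  also have "\<dots> = Wval r (fls_const \<kappa>) (fls_const P) (fls_const ` C) Y"
    by (rule fls_partial_fractions[symmetric]) (use Y \<open>Y\<^sup>2 \<noteq> 1\<close> Yc assms in auto)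
  also have "\<dots> = Y\<^sup>2 / (Y\<^sup>2 - 1) - fls_const \<kappa> + (fls_const \<kappa> * fls_const P + Y * gam r Y / (Y\<^sup>2 - 1)) *
      (\<Prod>c\<in>C. (fls_const c * Y - 1) / (Y - fls_const c))"
    unfolding Wval_def Wval_prod_fls[symmetric] by (simp only: mult.assoc)
  also have "Y\<^sup>2 / (Y\<^sup>2 - 1) = fps_to_fls even_ones"
    unfolding Y2 fls_even_ones X_def[symmetric] using Y by simp
  also have "Y * gam r Y / (Y\<^sup>2 - 1) = fps_to_fls ((if odd r then fps_X else - 1) * even_ones)"
  proof -
    have "Y / ((1 - X\<^sup>2) * Y\<^sup>2) = X / (1 - X\<^sup>2)"
      using X X2 by (simp add: Y_def field_simps power2_eq_square)
    moreover have "Y * Y / ((1 - X\<^sup>2) * Y\<^sup>2) = 1 / (1 - X\<^sup>2)"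
      using Y X2 by (simp add: power2_eq_square)
    ultimately show ?thesis
      unfolding Y2 by (simp add: gam_def fls_times_fps_to_fls fls_even_ones X_def[symmetric])
  qed
  also have "(\<Prod>c\<in>C. (fls_const c * Y - 1) / (Y - fls_const c)) =
      fps_to_fls (\<Prod>c\<in>C. (fps_X - fps_const c) / (fps_const c * fps_X - 1))"
    unfolding fps_to_fls_prod
  proof (rule prod.cong[OF refl])
    fix c assume "c \<in> C"
    have "fps_to_fls ((fps_X - fps_const c) / (fps_const c * fps_X - 1)) =
        (X - fls_const c) / (fls_const c * X - 1)"
      by (subst fps_to_fls_divide_unit) (simp_all add: fls_times_fps_to_fls X_def)
    also have "X - fls_const c = - ((fls_const c * Y - 1) * X)"
      using X by (simp add: Y_def algebra_simps)
    also have "fls_const c * X - 1 = - ((Y - fls_const c) * X)"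
      using X by (simp add: Y_def algebra_simps)
    finally show "(fls_const c * Y - 1) / (Y - fls_const c) =
        fps_to_fls ((fps_X - fps_const c) / (fps_const c * fps_X - 1))"
      using X by simp
  qed
  finally have "fps_to_fls ?L = fps_to_fls ?R"
    by (simp add: fls_times_fps_to_fls fls_const_collect)
  then show ?thesis by (simp only: fps_to_fls_eq_iff)
qed

text \<open>Expansion at 0: \<open>- X / (X - c)\<close> generates the positive powers of
  \<open>inverse c\<close>, so this series without constant term is \<open>- Wval\<close> at
  \<open>X\<close>.\<close>

theorem moments_neg:
  assumes "card C > 0"
  shows "Abs_fps (\<lambda>a. if a = 0 then 0 else \<Sum>c\<in>C. Eval r \<kappa> P C c * inverse c ^ a) =
    fps_X\<^sup>2 * even_ones + fps_const \<kappa> -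
      (fps_const (\<kappa> * P) - (if odd r then fps_X else - fps_X\<^sup>2) * even_ones) *
      (\<Prod>c\<in>C. (fps_const c * fps_X - 1) / (fps_X - fps_const c))" (is "?L = ?R")
proof -
  define X where "X = (fls_X :: 'a fls)"
  have X: "X \<noteq> 0" by (simp add: X_def)
  have X2: "1 - X\<^sup>2 \<noteq> 0" using fls_even_ones(2) by (simp add: X_def)
  have X2': "a / (X\<^sup>2 - 1) = - (a / (1 - X\<^sup>2))" for a
    by (metis minus_diff_eq minus_divide_right)
  have "X\<^sup>2 \<noteq> 1" using X2 by auto
  have Xc: "X \<noteq> fls_const c" for c by (simp add: X_def)
  have geo: "fps_to_fls (Abs_fps (\<lambda>a. if a = 0 then 0 else inverse c ^ a)) = - (X / (X - fls_const c))"
    if "c \<noteq> 0" for c :: 'a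
  proof -
    let ?c = "inverse c"
    have "Abs_fps (\<lambda>a. if a = 0 then 0 else ?c ^ a) = fps_const ?c * fps_X * Abs_fps (\<lambda>a. ?c ^ a)"
      unfolding mult.assoc
      by (rule fps_ext) (auto simp: fps_X_mult_nth power_eq_if)
    then have "Abs_fps (\<lambda>a. if a = 0 then 0 else ?c ^ a) * (1 - fps_const ?c * fps_X) = fps_const ?c * fps_X"
      by (simp only: mult.assoc geometric_mult mult_1_right)
    from arg_cong[OF this, of fps_to_fls]
    have e1: "fps_to_fls (Abs_fps (\<lambda>a. if a = 0 then 0 else ?c ^ a)) * (1 - fls_const ?c * X) = fls_const ?c * X"
      by (simp add: X_def fls_times_fps_to_fls)
    have e2: "1 - fls_const ?c * X = - ((X - fls_const c) * fls_const ?c)"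
      using that by (simp add: algebra_simps)
    have alg: "L = - (x / A)" if "L * - (A * k) = k * x" "k \<noteq> 0" "A \<noteq> 0" for L A k x :: "'a fls"
    proof -
      have "k * (L * A) = - (L * - (A * k))" by (simp add: algebra_simps)
      then have "k * (L * A) = k * - x" unfolding that(1) by simp
      then have "L * A = - x" using that(2) mult_left_cancel by blast
      then show ?thesis using that(3) by (metis divide_minus_left nonzero_mult_div_cancel_right)
    qed
    have "fls_const ?c \<noteq> 0" "X - fls_const c \<noteq> 0" using that Xc[of c] by auto
    then show ?thesis by (rule alg[OF e1[unfolded e2]])
  qed
  have "?L = (\<Sum>c\<in>C. fps_const (Eval r \<kappa> P C c) * Abs_fps (\<lambda>a. if a = 0 then 0 else inverse c ^ a))"
    by (rule fps_ext) (simp add: fps_sum_nth)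
  then have "fps_to_fls ?L = (\<Sum>c\<in>C. fls_const (Eval r \<kappa> P C c) *
      fps_to_fls (Abs_fps (\<lambda>a. if a = 0 then 0 else inverse c ^ a)))"
    by (simp only: fps_to_fls_sum fls_times_fps_to_fls fps_const_to_fls)
  also have "\<dots> = (\<Sum>c\<in>C. - (fls_const (Eval r \<kappa> P C c) * (X / (X - fls_const c))))"
  proof (rule sum.cong[OF refl])
    fix c assume "c \<in> C"
    then have "c \<noteq> 0" using nz by auto
    from geo[OF this] show "fls_const (Eval r \<kappa> P C c) *
        fps_to_fls (Abs_fps (\<lambda>a. if a = 0 then 0 else inverse c ^ a)) =
      - (fls_const (Eval r \<kappa> P C c) * (X / (X - fls_const c)))" by simp
  qed
  also have "\<dots> = - Wval r (fls_const \<kappa>) (fls_const P) (fls_const ` C) X"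
    unfolding sum_negf
    by (subst fls_partial_fractions) (use X \<open>X\<^sup>2 \<noteq> 1\<close> Xc assms in auto)
  also have "\<dots> = - (X\<^sup>2 / (X\<^sup>2 - 1) - fls_const \<kappa> + (fls_const \<kappa> * fls_const P + X * gam r X / (X\<^sup>2 - 1)) *
      (\<Prod>c\<in>C. (fls_const c * X - 1) / (X - fls_const c)))"
    unfolding Wval_def Wval_prod_fls[symmetric] by (simp only: mult.assoc)
  also have "X\<^sup>2 / (X\<^sup>2 - 1) = - fps_to_fls (fps_X\<^sup>2 * even_ones)"
    unfolding X2' by (simp add: fls_times_fps_to_fls fls_even_ones X_def power2_eq_square)
  also have "X * gam r X / (X\<^sup>2 - 1) = - fps_to_fls ((if odd r then fps_X else - fps_X\<^sup>2) * even_ones)"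
    unfolding X2' by (simp add: fls_times_fps_to_fls fls_even_ones X_def gam_def power2_eq_square)
  also have "(\<Prod>c\<in>C. (fls_const c * X - 1) / (X - fls_const c)) =
      fps_to_fls (\<Prod>c\<in>C. (fps_const c * fps_X - 1) / (fps_X - fps_const c))"
    unfolding fps_to_fls_prod
  proof (rule prod.cong[OF refl])
    fix c assume "c \<in> C"
    then have "c \<noteq> 0" using nz by auto
    then show "(fls_const c * X - 1) / (X - fls_const c) =
        fps_to_fls ((fps_const c * fps_X - 1) / (fps_X - fps_const c))"
      by (subst fps_to_fls_divide_unit) (simp_all add: fls_times_fps_to_fls X_def)
  qed
  finally have "fps_to_fls ?L = fps_to_fls ?R"
    by (simp add: fls_times_fps_to_fls fls_const_collect algebra_simps)
  then show ?thesis by (simp only: fps_to_fls_eq_iff)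
qed

end

section \<open>Residues of rational functions\<close>

lemma poly_at_add: "poly_at c (p + p') = poly_at c p + poly_at c p'"
  by (simp add: poly_at_def pcompose_add fps_of_poly_add)

lemma poly_at_1: "poly_at c 1 = 1"
  by (simp add: poly_at_def pcompose_1)

lemma laurent_at_Fract: "d \<noteq> 0 \<Longrightarrow> laurent_at c (Fraction_Field.Fract p d) = poly_at c p / poly_at c d"
  by transfer auto

lemma laurent_at_mult: "laurent_at c (f * g) = laurent_at c f * laurent_at c g"
  by (cases f; cases g) (simp add: laurent_at_Fract poly_at_mult)

lemma laurent_at_add: "laurent_at c (f + g) = laurent_at c f + laurent_at c g"
proof (cases f; cases g)
  fix a b a' b'
  assume *: "f = Fraction_Field.Fract a b" "b \<noteq> 0" "g = Fraction_Field.Fract a' b'" "b' \<noteq> 0"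
  then have "poly_at c b \<noteq> 0" "poly_at c b' \<noteq> 0" by (simp_all add: poly_at_eq_0_iff)
  then show ?thesis
    using * by (simp add: laurent_at_Fract poly_at_mult poly_at_add add_frac_eq)
qed

lemma laurent_at_rf_const: "laurent_at c (rf_const a) = fls_const a"
  by (simp add: rf_const_def laurent_at_Fract poly_at_1) (simp add: poly_at_def pcompose_const fps_of_poly_const)

lemma laurent_at_1: "laurent_at c 1 = 1"
  using laurent_at_rf_const[of c 1] by (simp add: rf_const_def One_fract_def one_pCons)

lemma laurent_at_0: "laurent_at c 0 = 0"
  by (metis add.right_neutral add_left_cancel laurent_at_add)

lemma laurent_at_uminus: "laurent_at c (- f) = - laurent_at c f"
  using laurent_at_add[of c f "- f"] by (simp add: laurent_at_0 eq_neg_iff_add_eq_0 add.commute)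

lemma laurent_at_diff: "laurent_at c (f - g) = laurent_at c f - laurent_at c g"
  using laurent_at_add[of c f "- g"] by (simp add: laurent_at_uminus)

lemma laurent_at_inverse: "laurent_at c (inverse f) = inverse (laurent_at c f)"
proof (cases "f = 0")
  case False
  then have "laurent_at c f * laurent_at c (inverse f) = 1"
    by (simp add: laurent_at_1 flip: laurent_at_mult)
  then show ?thesis by (simp add: inverse_unique)
qed (simp add: laurent_at_0)

lemma laurent_at_divide: "laurent_at c (f / g) = laurent_at c f / laurent_at c g"
  by (simp add: divide_inverse laurent_at_mult laurent_at_inverse)

lemma laurent_at_prod: "laurent_at c (\<Prod>x\<in>A. f x) = (\<Prod>x\<in>A. laurent_at c (f x))"
  by (induction A rule: infinite_finite_induct) (auto simp: laurent_at_1 laurent_at_mult)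

lemma laurent_at_rf_y: "laurent_at c rf_y = fls_const c + fls_X"
  by (simp add: rf_y_def laurent_at_Fract poly_at_1)
    (simp add: poly_at_def fps_of_poly_pCons pcompose_pCons)

text \<open>Regularity at the centre together with the value there. Tracking both at once reduces a
  residue to arithmetic with values.\<close>

definition regular_val :: "'a::field fls \<Rightarrow> 'a \<Rightarrow> bool"
  where "regular_val f a \<longleftrightarrow> (\<exists>g. f = fps_to_fls g \<and> fps_nth g 0 = a)"

lemma regular_val_const: "regular_val (fls_const a) a"
  unfolding regular_val_def by (intro exI[of _ "fps_const a"]) simp

lemma regular_val_1: "regular_val 1 1"
  using regular_val_const[of 1] by simp

lemma regular_val_y: "regular_val (fls_const a + fls_X) a"
  unfolding regular_val_def by (intro exI[of _ "fps_const a + fps_X"]) simp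

lemma regular_val_add: "regular_val f a \<Longrightarrow> regular_val g b \<Longrightarrow> regular_val (f + g) (a + b)"
  unfolding regular_val_def by (metis fps_add_nth fps_to_fls_plus)

lemma regular_val_diff: "regular_val f a \<Longrightarrow> regular_val g b \<Longrightarrow> regular_val (f - g) (a - b)"
  unfolding regular_val_def by (metis fps_sub_nth fps_to_fls_minus)

lemma regular_val_mult: "regular_val f a \<Longrightarrow> regular_val g b \<Longrightarrow> regular_val (f * g) (a * b)"
  unfolding regular_val_def by (metis fps_mult_nth_0 fls_times_fps_to_fls)

lemma regular_val_inverse:
  assumes "regular_val f a" "a \<noteq> 0"
  shows "regular_val (inverse f) (inverse a)"
proof -
  obtain g where g: "f = fps_to_fls g" "fps_nth g 0 = a"
    using assms by (auto simp: regular_val_def)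
  have "g * inverse g = 1" using g assms by (simp add: inverse_mult_eq_1')
  then have "f * fps_to_fls (inverse g) = 1"
    unfolding g by (metis fls_times_fps_to_fls fps_one_to_fls)
  then have "inverse f = fps_to_fls (inverse g)" by (rule inverse_unique)
  then show ?thesis using g(2) unfolding regular_val_def
    by (intro exI[of _ "inverse g"]) simp
qed

lemma regular_val_divide:
  "regular_val f a \<Longrightarrow> regular_val g b \<Longrightarrow> b \<noteq> 0 \<Longrightarrow> regular_val (f / g) (a / b)"
  by (simp add: divide_inverse regular_val_inverse regular_val_mult)

lemma regular_val_prod:
  "(\<And>x. x \<in> A \<Longrightarrow> regular_val (f x) (a x)) \<Longrightarrow> regular_val (\<Prod>x\<in>A. f x) (\<Prod>x\<in>A. a x)"
  by (induction A rule: infinite_finite_induct) (auto intro: regular_val_1 regular_val_mult)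

lemma residue_simple_pole:
  assumes "regular_val f a" "regular_val g b"
  shows "fls_residue (f + g / fls_X) = b"
proof -
  obtain f' g' where "f = fps_to_fls f'" "g = fps_to_fls g'" "fps_nth g' 0 = b"
    using assms by (auto simp: regular_val_def)
  moreover have "g / fls_X = fls_shift 1 g"
    by (simp add: divide_inverse fls_inverse_X fls_X_inv_times_conv_shift)
  ultimately show ?thesis by simp
qed

text \<open>Only the factor of \<open>\<alpha>\<close> has a pole at \<open>g \<alpha>\<close>:
  injectivity of \<open>g\<close> excludes the other nodes, and the conditions on
  \<open>g \<alpha>\<close> exclude the zeros of \<open>y\<close> and
  \<open>y^2 - 1\<close>.\<close>

lemma residue_at_Wfun:
  fixes g :: "'n \<Rightarrow> 'a::field"
  assumes fin: "finite N" and inj: "inj_on g N" and \<alpha>: "\<alpha> \<in> N" "g \<alpha> \<noteq> 0" "(g \<alpha>)\<^sup>2 \<noteq> 1"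
  shows "residue_at (g \<alpha>) ((rf_y\<^sup>2 / (rf_y\<^sup>2 - 1) - rf_const \<kappa> +
      (rf_const \<kappa> * rf_const P + rf_y * (if odd r then 1 else - rf_y) / (rf_y\<^sup>2 - 1)) * rf_const P *
      (\<Prod>\<beta>\<in>N. (rf_y - rf_const (inverse (g \<beta>))) / (rf_y - rf_const (g \<beta>)))) / rf_y)
    = Eval r \<kappa> P (g ` N) (g \<alpha>)"
proof -
  define c where "c = g \<alpha>"
  define Y where "Y = fls_const c + fls_X"
  have c: "c \<noteq> 0" "c\<^sup>2 - 1 \<noteq> 0" using \<alpha> by (auto simp: c_def)
  note ri = regular_val_const regular_val_1 regular_val_add regular_val_diff regular_val_mult
    regular_val_divide regular_val_prod
  have rY: "regular_val Y c" unfolding Y_def by (rule regular_val_y)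
  \<comment> \<open>\<open>A\<close> is the regular summand; \<open>B\<close> is the other one
    without its factor \<open>1 / (y - c)\<close>, which is \<open>1 / fls_X\<close> in the local
    parameter.\<close>
  define A where "A = (Y\<^sup>2 / (Y\<^sup>2 - 1) - fls_const \<kappa>) / Y"
  define B where "B = (fls_const \<kappa> * fls_const P + Y * (if odd r then 1 else - Y) / (Y\<^sup>2 - 1)) * fls_const P *
      (Y - fls_const (inverse c)) * (\<Prod>\<beta>\<in>N - {\<alpha>}. (Y - fls_const (inverse (g \<beta>))) / (Y - fls_const (g \<beta>))) / Y"
  have rA: "regular_val A ((c\<^sup>2 / (c\<^sup>2 - 1) - \<kappa>) / c)"
    unfolding A_def power2_eq_square using c
    by (intro ri rY) (auto simp: power2_eq_square)
  have rg: "regular_val (if odd r then 1 else - Y) (gam r c)"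
    using regular_val_diff[OF regular_val_const[of 0] rY] by (auto simp: gam_def regular_val_1)
  have "regular_val B ((\<kappa> * P + c * gam r c / (c * c - 1)) * P * (c - inverse c) *
      (\<Prod>\<beta>\<in>N - {\<alpha>}. (c - inverse (g \<beta>)) / (c - g \<beta>)) / c)"
    unfolding B_def power2_eq_square
  proof (intro ri rY rg)
    show "c * c - 1 \<noteq> 0" "c \<noteq> 0" using c by (auto simp: power2_eq_square)
    show "c - g \<beta> \<noteq> 0" if "\<beta> \<in> N - {\<alpha>}" for \<beta>
      using that inj \<alpha>(1) by (auto simp: c_def inj_on_def)
  qed
  moreover have "(\<Prod>\<beta>\<in>N - {\<alpha>}. (c - inverse (g \<beta>)) / (c - g \<beta>)) =
      (\<Prod>d\<in>g ` N - {c}. (c - inverse d) / (c - d))"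
  proof -
    have "g ` N - {c} = g ` (N - {\<alpha>})"
      using inj \<alpha>(1) by (auto simp: c_def inj_on_def)
    then show ?thesis
      by (simp only:) (subst prod.reindex, auto intro: inj_on_subset[OF inj])
  qed
  ultimately have rB: "regular_val B (Eval r \<kappa> P (g ` N) c)"
    unfolding Eval_def power2_eq_square by simp
  have "Y - fls_const c = fls_X" by (simp add: Y_def)
  then have prod: "(\<Prod>\<beta>\<in>N. (Y - fls_const (inverse (g \<beta>))) / (Y - fls_const (g \<beta>))) =
      (Y - fls_const (inverse c)) / fls_X *
      (\<Prod>\<beta>\<in>N - {\<alpha>}. (Y - fls_const (inverse (g \<beta>))) / (Y - fls_const (g \<beta>)))"
    by (subst prod.remove[OF fin \<alpha>(1)]) (simp only: c_def[symmetric])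
  have "laurent_at c ((rf_y\<^sup>2 / (rf_y\<^sup>2 - 1) - rf_const \<kappa> +
      (rf_const \<kappa> * rf_const P + rf_y * (if odd r then 1 else - rf_y) / (rf_y\<^sup>2 - 1)) * rf_const P *
      (\<Prod>\<beta>\<in>N. (rf_y - rf_const (inverse (g \<beta>))) / (rf_y - rf_const (g \<beta>)))) / rf_y) =
    (Y\<^sup>2 / (Y\<^sup>2 - 1) - fls_const \<kappa> +
      (fls_const \<kappa> * fls_const P + Y * (if odd r then 1 else - Y) / (Y\<^sup>2 - 1)) * fls_const P *
      (\<Prod>\<beta>\<in>N. (Y - fls_const (inverse (g \<beta>))) / (Y - fls_const (g \<beta>)))) / Y"
    by (simp add: laurent_at_divide laurent_at_add laurent_at_diff laurent_at_mult laurent_at_prod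
        laurent_at_1 laurent_at_rf_const laurent_at_rf_y laurent_at_uminus power2_eq_square
        flip: Y_def split del: if_split cong: if_cong)
       (simp add: laurent_at_1 laurent_at_uminus laurent_at_rf_y Y_def)
  also have "\<dots> = A + B / fls_X"
  proof -
    have "(a + K * p * (y / x * R)) / z = a / z + K * p * y * R / z / x" for a K p x y z R :: "'a fls"
      by (simp add: add_divide_distrib mult_ac)
    then show ?thesis unfolding prod A_def B_def .
  qed
  finally show ?thesis
    unfolding residue_at_def c_def[symmetric] using residue_simple_pole[OF rA rB] by simp
qed

section \<open>Multipartitions as sets of nodes\<close>

text \<open>Adding and removing become one operation: toggling is an involution, toggles commute,
  and a step of a tableau and its reverse toggle the same node.\<close>

definition toggle :: "node set \<Rightarrow> node \<Rightarrow> node set"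
  where "toggle D \<alpha> = (if \<alpha> \<in> D then D - {\<alpha>} else insert \<alpha> D)"

text \<open>Young diagrams as finite order ideals in \<open>r\<close> copies of the quarter plane.
  Closure is stated for neighbours only, which keeps it easy to verify for a toggled diagram;
  \<open>node_ideal_down\<close> is the general form.\<close>

definition node_ideal :: "nat \<Rightarrow> node set \<Rightarrow> bool"
  where "node_ideal r D \<longleftrightarrow> finite D \<and>
    (\<forall>i j s. (i, j, s) \<in> D \<longrightarrow> i \<ge> 1 \<and> j \<ge> 1 \<and> s \<in> {1..r}) \<and>
    (\<forall>i j s. (Suc i, j, s) \<in> D \<and> i \<ge> 1 \<longrightarrow> (i, j, s) \<in> D) \<and>
    (\<forall>i j s. (i, Suc j, s) \<in> D \<and> j \<ge> 1 \<longrightarrow> (i, j, s) \<in> D)"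

lemma in_toggle: "\<beta> \<in> toggle D \<alpha> \<longleftrightarrow> (if \<beta> = \<alpha> then \<alpha> \<notin> D else \<beta> \<in> D)"
  by (auto simp: toggle_def)

lemma toggle_toggle [simp]: "toggle (toggle D \<alpha>) \<alpha> = D"
  by (auto simp: in_toggle set_eq_iff)

lemma toggle_commute: "toggle (toggle D \<alpha>) \<beta> = toggle (toggle D \<beta>) \<alpha>"
  by (auto simp: in_toggle set_eq_iff)

lemma toggle_inj: "toggle D \<alpha> = toggle D \<beta> \<Longrightarrow> \<alpha> = \<beta>"
  by (metis in_toggle)

lemma finite_toggle [simp]: "finite (toggle D \<alpha>) \<longleftrightarrow> finite D"
  by (simp add: toggle_def)

lemma node_ideal_pos: "node_ideal r D \<Longrightarrow> (i, j, s) \<in> D \<Longrightarrow> i \<ge> 1 \<and> j \<ge> 1 \<and> s \<in> {1..r}"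
  unfolding node_ideal_def by blast

lemma node_ideal_finite: "node_ideal r D \<Longrightarrow> finite D"
  unfolding node_ideal_def by blast

lemma node_ideal_pred:
  assumes "node_ideal r D"
  shows "(Suc i, j, s) \<in> D \<Longrightarrow> 1 \<le> i \<Longrightarrow> (i, j, s) \<in> D"
    "(i, Suc j, s) \<in> D \<Longrightarrow> 1 \<le> j \<Longrightarrow> (i, j, s) \<in> D"
  using assms unfolding node_ideal_def by blast+

lemma node_ideal_down:
  assumes D: "node_ideal r D" "(i', j', s) \<in> D" and le: "1 \<le> i" "i \<le> i'" "1 \<le> j" "j \<le> j'"
  shows "(i, j, s) \<in> D"
proof -
  have "(i, j', s) \<in> D"
    using le(2) D(2) le(1)
  proof (induction i' rule: dec_induct)
    case (step k)
    then show ?case using node_ideal_pred[OF D(1)] by (metis le_trans)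
  qed simp
  with le(4) show ?thesis using le(3)
  proof (induction j' rule: dec_induct)
    case (step k)
    then show ?case using node_ideal_pred[OF D(1)] by (metis le_trans)
  qed simp
qed

text \<open>The key fact on nodes that can be added to or removed from the same multipartition: two
  comparable ones are neighbours, the smaller one is removable and the larger one addable.\<close>

lemma toggleable_comparable:
  assumes D: "node_ideal r D" "node_ideal r (toggle D (i, j, s))" "node_ideal r (toggle D (i', j', s))"
    and le: "i \<le> i'" "j \<le> j'" and ne: "(i, j) \<noteq> (i', j')"
  shows "(i, j, s) \<in> D" "(i', j', s) \<notin> D" "(i' = Suc i \<and> j' = j) \<or> (i' = i \<and> j' = Suc j)"
proof -
  have pos: "i \<ge> 1 \<and> j \<ge> 1"
    using node_ideal_pos[OF D(1), of i j s] node_ideal_pos[OF D(2), of i j s] by (auto simp: in_toggle)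
  \<comment> \<open>One of \<open>D\<close> and its toggle contains \<open>(i', j', s)\<close>, and
    they agree at all other nodes.\<close>
  have below: "(a, b, s) \<in> D" if "1 \<le> a" "a \<le> i'" "1 \<le> b" "b \<le> j'" "(a, b) \<noteq> (i', j')" for a b
    using node_ideal_down[OF D(1), of i' j' s a b] node_ideal_down[OF D(3), of i' j' s a b] that
    by (cases "(i', j', s) \<in> D") (auto simp: in_toggle)
  show in_D: "(i, j, s) \<in> D" using below pos le ne by auto
  have above: "(a, b, s) \<notin> D" if "i \<le> a" "j \<le> b" "(a, b) \<noteq> (i, j)" for a b
    using node_ideal_down[OF D(2), of a b s i j] that pos in_D by (auto simp: in_toggle)
  show "(i', j', s) \<notin> D" using above le ne by auto
  show "(i' = Suc i \<and> j' = j) \<or> (i' = i \<and> j' = Suc j)"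
  proof (rule ccontr)
    \<comment> \<open>Otherwise a neighbour of \<open>(i, j)\<close> lies strictly between the two
      nodes and is both inside and outside \<open>D\<close>.\<close>
    assume *: "\<not> ?thesis"
    show False
    proof (cases "i < i'")
      case True
      then show False using * below[of "Suc i" j] above[of "Suc i" j] pos le by auto
    next
      case False
      then show False using * below[of i "Suc j"] above[of i "Suc j"] pos le ne by auto
    qed
  qed
qed

text \<open>Nodes on one diagonal are comparable, whereas neighbours lie on adjacent
  diagonals.\<close>

lemma toggleable_same_diagonal:
  assumes "node_ideal r D" "node_ideal r (toggle D (i, j, s))" "node_ideal r (toggle D (i', j', s))"
    and "int j - int i = int j' - int i'"
  shows "(i, j) = (i', j')"
proof (rule ccontr)
  assume ne: "(i, j) \<noteq> (i', j')"
  have "(i \<le> i' \<and> j \<le> j') \<or> (i' \<le> i \<and> j' \<le> j)" using assms(4) by presburger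
  then consider "i \<le> i'" "j \<le> j'" | "i' \<le> i" "j' \<le> j" by blast
  then show False
  proof cases
    case 1
    then show False using toggleable_comparable(3)[OF assms(1-3)] ne assms(4) by auto
  next
    case 2
    then show False using toggleable_comparable(3)[OF assms(1,3,2)] ne assms(4) by auto
  qed
qed

text \<open>Nodes on adjacent diagonals are comparable as well, so one is removable and the other
  addable.\<close>

lemma toggleable_adjacent_diagonals:
  assumes "node_ideal r D" "node_ideal r (toggle D (i, j, s))" "node_ideal r (toggle D (i', j', s))"
    and "\<bar>(int j - int i) - (int j' - int i')\<bar> = 1"
  shows "(i, j, s) \<in> D \<longleftrightarrow> (i', j', s) \<notin> D"
proof -
  have ne: "(i, j) \<noteq> (i', j')" "(i', j') \<noteq> (i, j)" using assms(4) by auto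
  have "(i \<le> i' \<and> j \<le> j') \<or> (i' \<le> i \<and> j' \<le> j)" using assms(4) by presburger
  then consider "i \<le> i'" "j \<le> j'" | "i' \<le> i" "j' \<le> j" by blast
  then show ?thesis
  proof cases
    case 1
    then show ?thesis using toggleable_comparable(1,2)[OF assms(1-3)] ne by blast
  next
    case 2
    then show ?thesis using toggleable_comparable(1,2)[OF assms(1,3,2)] ne by blast
  qed
qed

text \<open>Steps in different rows and columns can be interchanged: no closure condition for
  neighbours relates the two nodes, and every other one can be read off from \<open>D\<close> or
  from the diagram after both steps.\<close>

lemma toggle_square:
  assumes D: "node_ideal r D" "node_ideal r (toggle D \<alpha>)" "node_ideal r (toggle (toggle D \<alpha>) \<beta>)"
    and \<alpha>: "\<alpha> = (i, j, s)" and \<beta>: "\<beta> = (i', j', s')" and ne: "(s, i) \<noteq> (s', i')" "(s, j) \<noteq> (s', j')"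
  shows "node_ideal r (toggle D \<beta>)"
proof -
  have mem: "x \<in> toggle D \<beta> \<longleftrightarrow> x \<in> toggle (toggle D \<alpha>) \<beta>" if "x \<noteq> \<alpha>" for x
    using that ne \<alpha> \<beta> by (auto simp: in_toggle)
  have mem': "x \<in> toggle D \<beta> \<longleftrightarrow> x \<in> D" if "x \<noteq> \<beta>" for x
    using that by (auto simp: in_toggle)
  \<comment> \<open>A pair of nodes other than \<open>\<alpha>\<close>, \<open>\<beta>\<close>
    misses \<open>\<alpha>\<close>, and then the double toggle decides, or misses
    \<open>\<beta>\<close>, and then \<open>D\<close> decides.\<close>
  have cover: "x \<in> toggle D \<beta>"
    if "y \<in> toggle D \<beta>" "y \<in> D \<Longrightarrow> x \<in> D" "y \<in> toggle (toggle D \<alpha>) \<beta> \<Longrightarrow> x \<in> toggle (toggle D \<alpha>) \<beta>"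
      "\<not> (x = \<alpha> \<and> y = \<beta>)" "\<not> (x = \<beta> \<and> y = \<alpha>)" "x \<noteq> y" for x y
  proof -
    have "\<alpha> \<noteq> \<beta>" using ne \<alpha> \<beta> by auto
    then show ?thesis using that mem[of x] mem[of y] mem'[of x] mem'[of y] by metis
  qed
  show ?thesis
    unfolding node_ideal_def
  proof (intro conjI allI impI; (elim conjE)?)
    show "finite (toggle D \<beta>)" using node_ideal_finite[OF D(1)] by simp
  next
    fix a b c assume *: "(a, b, c) \<in> toggle D \<beta>"
    have "a \<ge> 1 \<and> b \<ge> 1 \<and> c \<in> {1..r}"
    proof (cases "(a, b, c) = \<beta>")
      case True
      then have "(a, b, c) \<noteq> \<alpha>" using ne \<alpha> \<beta> by auto
      then show ?thesis using * mem node_ideal_pos[OF D(3)] by blast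
    next
      case False
      then show ?thesis using * mem' node_ideal_pos[OF D(1)] by blast
    qed
    then show "1 \<le> a" "1 \<le> b" "c \<in> {1..r}" by auto
  next
    fix a b c assume *: "(Suc a, b, c) \<in> toggle D \<beta>" "1 \<le> a"
    show "(a, b, c) \<in> toggle D \<beta>"
      by (rule cover[OF *(1)]) (use ne \<alpha> \<beta> *(2) node_ideal_pred[OF D(1), of a b c] node_ideal_pred[OF D(3), of a b c] in auto)
  next
    fix a b c assume *: "(a, Suc b, c) \<in> toggle D \<beta>" "1 \<le> b"
    show "(a, b, c) \<in> toggle D \<beta>"
      by (rule cover[OF *(1)]) (use ne \<alpha> \<beta> *(2) node_ideal_pred[OF D(1), of a b c] node_ideal_pred[OF D(3), of a b c] in auto)
  qed
qed

text \<open>Both nodes can be toggled in the middle diagram, and in one row or column they are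
  comparable, hence neighbours. One is removable there and the other addable, so the two steps go in
  the same direction.\<close>

lemma toggle_no_square:
  assumes D: "node_ideal r D" "node_ideal r (toggle D (i, j, s))"
      "node_ideal r (toggle (toggle D (i, j, s)) (i', j', s))"
    and ne: "(i, j) \<noteq> (i', j')" and line: "i = i' \<or> j = j'"
  shows "\<bar>(int j' - int i') - (int j - int i)\<bar> = 1"
    "(i, j, s) \<in> D \<longleftrightarrow> (i', j', s) \<in> toggle D (i, j, s)"
proof -
  let ?D = "toggle D (i, j, s)"
  have D': "node_ideal r ?D" "node_ideal r (toggle ?D (i, j, s))" "node_ideal r (toggle ?D (i', j', s))"
    using D by simp_all
  have ne': "(i', j') \<noteq> (i, j)" using ne by auto
  have "(i \<le> i' \<and> j \<le> j') \<or> (i' \<le> i \<and> j' \<le> j)" using line by presburger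
  then consider "i \<le> i'" "j \<le> j'" | "i' \<le> i" "j' \<le> j" by blast
  then have "\<bar>(int j' - int i') - (int j - int i)\<bar> = 1 \<and> ((i, j, s) \<in> D \<longleftrightarrow> (i', j', s) \<in> ?D)"
  proof cases
    case 1
    note * = toggleable_comparable[OF D' 1 ne]
    have "(i, j, s) \<notin> D" using *(1) by (simp add: in_toggle)
    then show ?thesis using *(2,3) by auto
  next
    case 2
    note * = toggleable_comparable[OF D'(1,3,2) 2 ne']
    have "(i, j, s) \<in> D" using *(2) by (simp add: in_toggle)
    then show ?thesis using *(1,3) by auto
  qed
  then show "\<bar>(int j' - int i') - (int j - int i)\<bar> = 1"
    "(i, j, s) \<in> D \<longleftrightarrow> (i', j', s) \<in> ?D" by auto
qed

text \<open>Between toggling two different nodes of one diagonal, both upper neighbours of the lower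
  node would have to change, and a single step changes only one. Equal signs exclude that the outer
  steps use the same node, unless the middle step undoes the first.\<close>

lemma toggle_same_diagonal_twice:
  assumes D: "node_ideal r D" "node_ideal r (toggle D (i, j, s))"
      "node_ideal r (toggle (toggle D (i, j, s)) \<beta>)"
      "node_ideal r (toggle (toggle (toggle D (i, j, s)) \<beta>) (i', j', s))"
    and diag: "int j - int i = int j' - int i'"
    and sign: "(i, j, s) \<in> D \<longleftrightarrow> (i', j', s) \<in> toggle (toggle D (i, j, s)) \<beta>"
  shows "\<beta> = (i, j, s)"
proof (rule ccontr)
  assume ne: "\<beta> \<noteq> (i, j, s)"
  define D1 where "D1 = toggle D (i, j, s)"
  define D2 where "D2 = toggle D1 \<beta>"
  define D3 where "D3 = toggle D2 (i', j', s)"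
  note ideals = D[folded D1_def, folded D2_def, folded D3_def]
  have sg: "(i, j, s) \<in> D \<longleftrightarrow> (i', j', s) \<in> D2" using sign by (simp add: D1_def D2_def)
  have "(i', j') \<noteq> (i, j)" using sg ne by (auto simp: D1_def D2_def in_toggle)
  have pos: "i \<ge> 1 \<and> j \<ge> 1" "i' \<ge> 1 \<and> j' \<ge> 1"
    using node_ideal_pos[OF ideals(1), of i j s] node_ideal_pos[OF ideals(2), of i j s]
      node_ideal_pos[OF ideals(3), of i' j' s] node_ideal_pos[OF ideals(4), of i' j' s]
    by (auto simp: in_toggle D1_def D3_def)
  obtain m where m: "(i' = i + m \<and> j' = j + m) \<or> (i = i' + m \<and> j = j' + m)" "m \<ge> 1"
  proof (cases "i < i'")
    case True
    then show thesis using diag by (intro that[of "i' - i"]) auto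
  next
    case False
    then show thesis using diag \<open>(i', j') \<noteq> (i, j)\<close> by (intro that[of "i - i'"]) auto
  qed
  from m(1) show False
  proof (elim disjE conjE)
    assume e: "i' = i + m" "j' = j + m"
    \<comment> \<open>The upper neighbour of the lower node that the middle step leaves
      unchanged.\<close>
    obtain a b where ab: "(a, b, s) \<noteq> \<beta>" "(a = Suc i \<and> b = j) \<or> (a = i \<and> b = Suc j)"
    proof (cases "\<beta> = (Suc i, j, s)")
      case True
      then show thesis by (intro that[of i "Suc j"]) auto
    next
      case False
      then show thesis by (intro that[of "Suc i" j]) auto
    qed
    have "(a, b, s) \<in> D2"
      using node_ideal_down[OF ideals(3), of i' j' s a b] node_ideal_down[OF ideals(4), of i' j' s a b]
        ab e m pos
      by (cases "(i', j', s) \<in> D2") (auto simp: D3_def in_toggle)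
    then have "(a, b, s) \<in> D1" using ab by (simp add: D2_def in_toggle)
    then have "(i, j, s) \<in> D1" "(a, b, s) \<in> D"
      using node_ideal_down[OF ideals(2), of a b s i j] ab pos by (auto simp: D1_def in_toggle)
    then show False
      using node_ideal_down[OF ideals(1), of a b s i j] ab pos by (auto simp: D1_def in_toggle)
  next
    assume e: "i = i' + m" "j = j' + m"
    obtain a b where ab: "(a, b, s) \<noteq> \<beta>" "(a = Suc i' \<and> b = j') \<or> (a = i' \<and> b = Suc j')"
    proof (cases "\<beta> = (Suc i', j', s)")
      case True
      then show thesis by (intro that[of i' "Suc j'"]) auto
    next
      case False
      then show thesis by (intro that[of "Suc i'" j']) auto
    qed
    have "(a, b, s) \<in> D1"
      using node_ideal_down[OF ideals(1), of i j s a b] node_ideal_down[OF ideals(2), of i j s a b]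
        ab e m pos
      by (cases "(i, j, s) \<in> D") (auto simp: D1_def in_toggle)
    then have "(a, b, s) \<in> D2" using ab by (simp add: D2_def in_toggle)
    then have "(i', j', s) \<in> D2" "(a, b, s) \<in> D3"
      using node_ideal_down[OF ideals(3), of a b s i' j'] ab pos by (auto simp: D3_def in_toggle)
    then show False
      using node_ideal_down[OF ideals(4), of a b s i' j'] ab pos by (auto simp: D3_def in_toggle)
  qed
qed

section \<open>Dictionary between multipartitions and order ideals\<close>

lemma in_diagram: "(i, j, s) \<in> diagram \<mu> \<longleftrightarrow> 1 \<le> j \<and> j \<le> \<mu> s i"
  by (simp add: diagram_def)

lemma diagram_inj: "diagram \<mu> = diagram \<nu> \<Longrightarrow> \<mu> = \<nu>"
proof (intro ext)
  fix s i assume *: "diagram \<mu> = diagram \<nu>"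
  have "{1..\<mu> s i} = {j. (i, j, s) \<in> diagram \<mu>}" by (auto simp: in_diagram)
  also have "\<dots> = {1..\<nu> s i}" unfolding * by (auto simp: in_diagram)
  finally have "card {1..\<mu> s i} = card {1..\<nu> s i}" by (rule arg_cong)
  then show "\<mu> s i = \<nu> s i" by simp
qed

lemma diagram_eq_iff: "diagram \<mu> = diagram \<nu> \<longleftrightarrow> \<mu> = \<nu>"
  using diagram_inj by blast

lemma is_rpart_iff: "is_rpart r \<mu> \<longleftrightarrow> node_ideal r (diagram \<mu>)"
proof
  assume *: "is_rpart r \<mu>"
  then have z: "s \<notin> {1..r} \<or> i = 0 \<Longrightarrow> \<mu> s i = 0" for s i by (auto simp: is_rpart_def)
  have d: "s \<in> {1..r} \<Longrightarrow> i \<ge> 1 \<Longrightarrow> \<mu> s (Suc i) \<le> \<mu> s i" for s i using * by (auto simp: is_rpart_def)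
  show "node_ideal r (diagram \<mu>)"
    unfolding node_ideal_def in_diagram
  proof (intro conjI allI impI; (elim conjE)?)
    show "finite (diagram \<mu>)" using * by (simp add: is_rpart_def)
    fix i j s assume j: "1 \<le> j" "j \<le> \<mu> s i"
    show "1 \<le> i" using z[of s i] j by (cases i) auto
    show "s \<in> {1..r}" using z[of s i] j by (cases "s \<in> {1..r}") auto
  next
    fix i j s assume j: "1 \<le> j" "j \<le> \<mu> s (Suc i)" "1 \<le> i"
    then show "j \<le> \<mu> s i" using d[of s i] z[of s "Suc i"] by (cases "s \<in> {1..r}") auto
  qed auto
next
  assume *: "node_ideal r (diagram \<mu>)"
  show "is_rpart r \<mu>"
    unfolding is_rpart_def
  proof (intro conjI allI impI ballI)
    fix s i :: nat assume "s \<notin> {1..r} \<or> i = 0"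
    then have "(i, \<mu> s i, s) \<notin> diagram \<mu>" using node_ideal_pos[OF *] by fastforce
    then show "\<mu> s i = 0" by (simp add: in_diagram)
  next
    fix s i :: nat assume "1 \<le> i"
    then have "(i, \<mu> s (Suc i), s) \<in> diagram \<mu>" if "\<mu> s (Suc i) \<ge> 1"
      using node_ideal_pred(1)[OF *, of i] that by (auto simp: in_diagram)
    then show "\<mu> s (i + 1) \<le> \<mu> s i" by (cases "\<mu> s (Suc i)") (auto simp: in_diagram)
  next
    show "finite (diagram \<mu>)" by (rule node_ideal_finite[OF *])
  qed
qed

text \<open>Each row of an order ideal is an initial segment, so its cardinality can serve as the
  part.\<close>

lemma node_ideal_diagram:
  assumes "node_ideal r D"
  obtains \<mu> where "diagram \<mu> = D"
proof -
  define \<mu> where "\<mu> = (\<lambda>s i. card {j. (i, j, s) \<in> D})"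
  have "diagram \<mu> = D"
  proof (rule Set.set_eqI)
    fix x :: node
    obtain i j s where x: "x = (i, j, s)" by (cases x)
    have "finite {j. (i, j, s) \<in> D}"
    proof (rule finite_subset)
      show "{j. (i, j, s) \<in> D} \<subseteq> (\<lambda>(i, j, s). j) ` D" by force
      show "finite ((\<lambda>(i, j, s). j) ` D)" using node_ideal_finite[OF assms] by simp
    qed
    moreover have "{j. (i, j, s) \<in> D} \<subseteq> {1..}" using node_ideal_pos[OF assms] by auto
    moreover have "b \<in> {j. (i, j, s) \<in> D}" if "a \<in> {j. (i, j, s) \<in> D}" "1 \<le> b" "b \<le> a" for a b
      using node_ideal_down[OF assms, of i a s i b] node_ideal_pos[OF assms, of i a s] that by auto
    ultimately have eq: "S = {1..card S}" if "S = {j. (i, j, s) \<in> D}" for S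
    proof (cases "S = {}")
      case False
      assume S: "finite {j. (i, j, s) \<in> D}" "{j. (i, j, s) \<in> D} \<subseteq> {1..}"
        "\<And>a b. a \<in> {j. (i, j, s) \<in> D} \<Longrightarrow> 1 \<le> b \<Longrightarrow> b \<le> a \<Longrightarrow> b \<in> {j. (i, j, s) \<in> D}"
      have "S = {1..Max S}"
      proof
        show "S \<subseteq> {1..Max S}" using S(1,2) that by auto
        show "{1..Max S} \<subseteq> S" using S(1,3) that False Max_in[of S] by auto
      qed
      then show ?thesis by (metis card_atLeastAtMost diff_Suc_1)
    qed simp
    have "(i, j, s) \<in> D \<longleftrightarrow> j \<in> {j. (i, j, s) \<in> D}" by simp
    also have "\<dots> \<longleftrightarrow> j \<in> {1..\<mu> s i}" unfolding \<mu>_def using eq[OF refl] by simp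
    finally show "x \<in> diagram \<mu> \<longleftrightarrow> x \<in> D" by (simp add: x in_diagram)
  qed
  then show thesis by (rule that)
qed

lemma differ_by_iff: "differ_by \<alpha> \<mu> \<nu> \<longleftrightarrow> diagram \<nu> = toggle (diagram \<mu>) \<alpha>"
  unfolding differ_by_def adds_node_def toggle_def by auto

lemma differ_by_sym: "differ_by \<alpha> \<mu> \<nu> \<longleftrightarrow> differ_by \<alpha> \<nu> \<mu>"
  by (auto simp: differ_by_def)

lemma node_diff_eq: "differ_by \<alpha> \<mu> \<nu> \<Longrightarrow> node_diff \<mu> \<nu> = \<alpha>"
  unfolding node_diff_def differ_by_iff by (rule the_equality) (metis toggle_inj)+

lemma node_diff_commute: "node_diff \<mu> \<nu> = node_diff \<nu> \<mu>"
  unfolding node_diff_def using differ_by_sym by simp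

lemma adds_node_iff: "adds_node \<alpha> \<mu> \<nu> \<longleftrightarrow> differ_by \<alpha> \<mu> \<nu> \<and> \<alpha> \<notin> diagram \<mu>"
  unfolding differ_by_def adds_node_def by auto

lemma addable_iff: "\<alpha> \<in> addable r \<mu> \<longleftrightarrow> \<alpha> \<notin> diagram \<mu> \<and> node_ideal r (toggle (diagram \<mu>) \<alpha>)"
  unfolding addable_def mem_Collect_eq adds_node_iff differ_by_iff is_rpart_iff
  by (metis node_ideal_diagram)

lemma removable_iff: "\<alpha> \<in> removable r \<mu> \<longleftrightarrow> \<alpha> \<in> diagram \<mu> \<and> node_ideal r (toggle (diagram \<mu>) \<alpha>)"
proof -
  have "adds_node \<alpha> \<nu> \<mu> \<longleftrightarrow> diagram \<nu> = toggle (diagram \<mu>) \<alpha> \<and> \<alpha> \<in> diagram \<mu>" for \<nu>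
    unfolding adds_node_def toggle_def by auto
  then show ?thesis
    unfolding removable_def mem_Collect_eq is_rpart_iff by (metis node_ideal_diagram)
qed

lemma addable_removable_iff: "\<alpha> \<in> addable r \<mu> \<union> removable r \<mu> \<longleftrightarrow> node_ideal r (toggle (diagram \<mu>) \<alpha>)"
  by (auto simp: addable_iff removable_iff)

section \<open>Contents of addable and removable nodes\<close>

text \<open>One formula for the content of a node and for the content of a step; reversing a step
  inverts its label.\<close>

definition lab :: "'a::field \<Rightarrow> (nat \<Rightarrow> 'a) \<Rightarrow> node set \<Rightarrow> node \<Rightarrow> 'a"
  where "lab q u D \<alpha> = (if \<alpha> \<in> D then inverse (content q u \<alpha>) else content q u \<alpha>)"

lemma lab_toggle: "lab q u (toggle D \<alpha>) \<alpha> = inverse (lab q u D \<alpha>)"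
  by (simp add: lab_def in_toggle)

text \<open>The diagram contains the first \<open>i\<close> nodes of column 1 and the first
  \<open>j\<close> nodes of row 1 of the component.\<close>

lemma node_ideal_card_bounds:
  assumes D: "node_ideal r D" "(i, j, s) \<in> D"
  shows "i \<le> card D" "j \<le> card D"
proof -
  note pos = node_ideal_pos[OF D]
  have "card ((\<lambda>a. (a, 1::nat, s)) ` {1..i}) \<le> card D"
    by (rule card_mono[OF node_ideal_finite[OF D(1)]]) (use node_ideal_down[OF D] pos in auto)
  then show "i \<le> card D" by (subst (asm) card_image) (auto intro: inj_onI)
  have "card ((\<lambda>b. (1::nat, b, s)) ` {1..j}) \<le> card D"
    by (rule card_mono[OF node_ideal_finite[OF D(1)]]) (use node_ideal_down[OF D] pos in auto)
  then show "j \<le> card D" by (subst (asm) card_image) (auto intro: inj_onI)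
qed

lemma card_toggle_le: "finite D \<Longrightarrow> card (toggle D \<alpha>) \<le> Suc (card D)"
  by (auto simp: toggle_def card_insert_if intro: le_trans[OF card_Diff1_le])

locale bmw_params =
  fixes r n :: nat and q :: "'a::field" and u :: "nat \<Rightarrow> 'a"
  assumes q0: "q \<noteq> 0" and u0: "\<And>i. i \<in> {1..r} \<Longrightarrow> u i \<noteq> 0"
    and q_order: "\<And>m. m \<in> {1..2 * n} \<Longrightarrow> (q\<^sup>2) ^ m \<noteq> 1"
    and gen: "generic r n q u"
begin

text \<open>Satisfied by the nodes of diagrams of size at most \<open>n\<close>. Then
  \<open>j - i\<close> is at most \<open>n - 1\<close> in absolute value, so the difference or sum
  of two such numbers, even shifted by one, stays below the bound \<open>2 * n\<close> of
  genericity.\<close>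

definition small :: "node \<Rightarrow> bool"
  where "small \<alpha> \<longleftrightarrow> (case \<alpha> of (i, j, s) \<Rightarrow> i \<in> {1..n} \<and> j \<in> {1..n} \<and> s \<in> {1..r})"

lemma small_toggle:
  assumes "node_ideal r D" "node_ideal r (toggle D \<alpha>)" "card D \<le> n" "card (toggle D \<alpha>) \<le> n"
  shows "small \<alpha>"
proof (cases \<alpha>)
  case (fields i j s)
  then have "\<alpha> \<in> D \<or> \<alpha> \<in> toggle D \<alpha>" by (simp add: in_toggle)
  then show ?thesis
    using node_ideal_card_bounds[OF assms(1), of i j s] node_ideal_card_bounds[OF assms(2), of i j s]
      node_ideal_pos[OF assms(1), of i j s] node_ideal_pos[OF assms(2), of i j s] assms(3,4)
    unfolding small_def fields by fastforce
qed

lemma q_powi_even_eq_1: "q powi (2 * d) = 1 \<Longrightarrow> \<bar>d\<bar> \<le> 2 * int n \<Longrightarrow> d = 0"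
proof (rule ccontr)
  assume *: "q powi (2 * d) = 1" "\<bar>d\<bar> \<le> 2 * int n" "d \<noteq> 0"
  have "q powi (2 * \<bar>d\<bar>) = 1"
    using *(1) by (cases "d \<ge> 0") (auto simp: power_int_minus)
  then have "(q\<^sup>2) ^ nat \<bar>d\<bar> = 1"
    by (simp add: power_int_def nat_mult_distrib flip: power_mult)
  moreover have "nat \<bar>d\<bar> \<in> {1..2 * n}" using *(2,3) by auto
  ultimately show False using q_order by blast
qed

lemma generic_ne:
  assumes "s \<in> {1..r}" "t \<in> {1..r}" "s \<noteq> t" "\<bar>d\<bar> < 2 * int n"
  shows "u s * u t \<noteq> q powi (2 * d)" "u s * inverse (u t) \<noteq> q powi (2 * d)"
  using gen assms unfolding generic_def by force+

lemma generic_ne_power: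
  assumes "s \<in> {1..r}" "\<bar>d\<bar> < 2 * int n"
  shows "u s \<noteq> q powi d" "u s \<noteq> - (q powi d)"
  using gen assms unfolding generic_def by force+

lemma u_inj: "n \<ge> 1 \<Longrightarrow> inj_on u {1..r}"
proof (rule inj_onI, rule ccontr)
  fix s t assume n: "n \<ge> 1" and st: "s \<in> {1..r}" "t \<in> {1..r}" "u s = u t" "s \<noteq> t"
  then have "u s * inverse (u t) = q powi (2 * 0)" using u0 by simp
  then show False using generic_ne(2)[of s t 0] n st by auto
qed

lemma content_nz: "small \<alpha> \<Longrightarrow> content q u \<alpha> \<noteq> 0"
  using q0 u0 by (auto simp: small_def content_def)

text \<open>The shift \<open>m\<close> treats equality and the ratios \<open>q^2\<close>,
  \<open>q^(-2)\<close> together. Genericity excludes different components; within one component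
  only powers of \<open>q^2\<close> are compared.\<close>

lemma content_eq:
  assumes "small (i, j, s)" "small (i', j', t)" "\<bar>m\<bar> \<le> 1"
    and eq: "content q u (i, j, s) = q powi (2 * m) * content q u (i', j', t)"
  shows "s = t" "int j - int i = int j' - int i' + m"
proof -
  let ?d = "int j - int i" and ?e = "int j' - int i'"
  have st: "s \<in> {1..r}" "t \<in> {1..r}" and n: "\<bar>?d\<bar> \<le> int n - 1" "\<bar>?e\<bar> \<le> int n - 1"
    using assms(1,2) by (auto simp: small_def)
  have eq': "u s = u t * q powi (2 * (m + ?e - ?d))"
  proof -
    have "q powi (2 * (m + ?e - ?d)) = q powi (2 * m) * q powi (2 * ?e) / q powi (2 * ?d)"
      using q0 by (simp add: power_int_add power_int_diff distrib_left right_diff_distrib)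
    moreover have "u s * q powi (2 * ?d) = q powi (2 * m) * (u t * q powi (2 * ?e))"
      using eq by (simp add: content_def)
    moreover have "q powi (2 * ?d) \<noteq> 0" using q0 by simp
    moreover have "a = b * (M * B / A)" if "a * A = M * (b * B)" "A \<noteq> 0" for a b A B M :: 'a
      using that by (simp add: field_simps)
    ultimately show ?thesis by simp
  qed
  show "s = t"
  proof (rule ccontr)
    assume "s \<noteq> t"
    moreover have "u s * inverse (u t) = q powi (2 * (m + ?e - ?d))"
      using eq' u0[OF st(2)] by simp
    moreover have "\<bar>m + ?e - ?d\<bar> < 2 * int n" using n assms(3) by linarith
    ultimately show False using generic_ne(2) st by blast
  qed
  then have "q powi (2 * (m + ?e - ?d)) = 1" using eq' u0[OF st(2)] by simp
  moreover have "\<bar>m + ?e - ?d\<bar> \<le> 2 * int n" using n assms(3) by linarith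
  ultimately have "m + ?e - ?d = 0" by (rule q_powi_even_eq_1)
  then show "?d = ?e + m" by simp
qed

text \<open>Within one component the equation gives \<open>(u s)^2 = q powi (2 * d)\<close>, so
  \<open>u s\<close> is \<open>q powi d\<close> up to sign, which genericity forbids for such small
  \<open>d\<close>.\<close>

lemma content_mult_ne:
  assumes "small \<alpha>" "small \<beta>" "\<bar>m\<bar> \<le> 1"
  shows "content q u \<alpha> * content q u \<beta> \<noteq> q powi (2 * m)"
proof
  assume eq: "content q u \<alpha> * content q u \<beta> = q powi (2 * m)"
  obtain i j s i' j' t where \<alpha>\<beta>: "\<alpha> = (i, j, s)" "\<beta> = (i', j', t)" by (cases \<alpha>, cases \<beta>)
  let ?d = "int j - int i" and ?e = "int j' - int i'"
  have st: "s \<in> {1..r}" "t \<in> {1..r}" and n: "\<bar>?d\<bar> \<le> int n - 1" "\<bar>?e\<bar> \<le> int n - 1"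
    using assms(1,2) by (auto simp: small_def \<alpha>\<beta>)
  have eq': "u s * u t = q powi (2 * (m - ?e - ?d))"
  proof -
    have "q powi (2 * (m - ?e - ?d)) = q powi (2 * m) / q powi (2 * ?e) / q powi (2 * ?d)"
      using q0 by (simp add: power_int_diff right_diff_distrib)
    moreover have "(u s * q powi (2 * ?d)) * (u t * q powi (2 * ?e)) = q powi (2 * m)"
      using eq by (simp add: content_def \<alpha>\<beta>)
    moreover have "q powi (2 * ?d) \<noteq> 0" "q powi (2 * ?e) \<noteq> 0" using q0 by simp_all
    moreover have "a * b = M / B / A" if "(a * A) * (b * B) = M" "A \<noteq> 0" "B \<noteq> 0" for a b A B M :: 'a
      using that by (simp add: field_simps)
    ultimately show ?thesis by metis
  qed
  have b: "\<bar>m - ?e - ?d\<bar> < 2 * int n" using n assms(3) by linarith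
  show False
  proof (cases "s = t")
    case False
    then show False using generic_ne(1)[OF st] eq' b by blast
  next
    case True
    have "(q powi (m - ?e - ?d))\<^sup>2 = q powi (2 * (m - ?e - ?d))"
      by (metis mult.commute power_int_mult power_int_numeral)
    then have "(u s)\<^sup>2 = (q powi (m - ?e - ?d))\<^sup>2" using eq' True by (simp add: power2_eq_square)
    then have "u s = q powi (m - ?e - ?d) \<or> u s = - (q powi (m - ?e - ?d))"
      by (simp add: power2_eq_iff)
    then show False using generic_ne_power[OF st(1) b] by blast
  qed
qed

lemma lab_nz: "small \<alpha> \<Longrightarrow> lab q u D \<alpha> \<noteq> 0"
  by (simp add: lab_def content_nz)

text \<open>If exactly one of the labels were an inverse content, a product of two contents would be
  \<open>q powi (2 * m)\<close> or its inverse, against \<open>content_mult_ne\<close>.\<close>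

lemma lab_eq:
  assumes small: "small (i, j, s)" "small (i', j', t)" and m: "\<bar>m\<bar> \<le> 1"
    and eq: "lab q u D (i, j, s) = q powi (2 * m) * lab q u D' (i', j', t)"
  shows "(i, j, s) \<in> D \<longleftrightarrow> (i', j', t) \<in> D'" "s = t" "\<bar>(int j - int i) - (int j' - int i')\<bar> = \<bar>m\<bar>"
proof -
  let ?a = "content q u (i, j, s)" and ?b = "content q u (i', j', t)"
  have nz: "?a \<noteq> 0" "?b \<noteq> 0" "q powi (2 * m) \<noteq> 0" using small q0 by (auto simp: content_nz)
  show sign: "(i, j, s) \<in> D \<longleftrightarrow> (i', j', t) \<in> D'"
  proof (rule ccontr)
    assume "\<not> ?thesis"
    then have "?a * ?b = q powi (2 * m) \<or> inverse (?a * ?b) = q powi (2 * m)"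
      using eq nz by (auto simp: lab_def field_simps split: if_splits)
    then have "?a * ?b = q powi (2 * m) \<or> ?a * ?b = q powi (2 * (- m))"
      by (metis inverse_inverse_eq mult_minus_right power_int_minus)
    then show False using content_mult_ne[OF small, of m] content_mult_ne[OF small, of "- m"] m by force
  qed
  have "s = t \<and> \<bar>(int j - int i) - (int j' - int i')\<bar> = \<bar>m\<bar>"
  proof (cases "(i, j, s) \<in> D")
    case True
    then have "?b = q powi (2 * m) * ?a"
      using eq sign nz by (simp add: lab_def field_simps)
    then show ?thesis using content_eq[OF small(2,1) m] by auto
  next
    case False
    then have "?a = q powi (2 * m) * ?b" using eq sign by (simp add: lab_def)
    then show ?thesis using content_eq[OF small m] by auto
  qed
  then show "s = t" "\<bar>(int j - int i) - (int j' - int i')\<bar> = \<bar>m\<bar>" by auto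
qed

section \<open>Labels of the nodes that can be toggled in one diagram\<close>

context
  fixes D \<alpha> \<beta>
  assumes D: "node_ideal r D" "card D < n"
    and \<alpha>: "node_ideal r (toggle D \<alpha>)" and \<beta>: "node_ideal r (toggle D \<beta>)"
begin

lemma small_of_ideal: "small \<alpha>" "small \<beta>"
  using D(2) card_toggle_le[OF node_ideal_finite[OF D(1)], of \<alpha>]
    card_toggle_le[OF node_ideal_finite[OF D(1)], of \<beta>]
  by (auto intro!: small_toggle[OF D(1) \<alpha>] small_toggle[OF D(1) \<beta>])

lemma lab_inj: "lab q u D \<alpha> = lab q u D \<beta> \<Longrightarrow> \<alpha> = \<beta>"
proof -
  assume eq: "lab q u D \<alpha> = lab q u D \<beta>"
  obtain i j s i' j' t where \<alpha>\<beta>: "\<alpha> = (i, j, s)" "\<beta> = (i', j', t)" by (cases \<alpha>, cases \<beta>)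
  have "s = t" "int j - int i = int j' - int i'"
    using lab_eq(2,3)[of i j s i' j' t 0 D D] small_of_ideal eq by (simp_all add: \<alpha>\<beta>)
  then show ?thesis using toggleable_same_diagonal[OF D(1)] \<alpha> \<beta> by (simp add: \<alpha>\<beta>)
qed

text \<open>Such a ratio means adjacent diagonals and the same direction, but on adjacent diagonals
  one node is removable and the other addable.\<close>

lemma lab_adjacent: "\<bar>m\<bar> = 1 \<Longrightarrow> lab q u D \<alpha> \<noteq> q powi (2 * m) * lab q u D \<beta>"
proof
  assume m: "\<bar>m\<bar> = 1" and eq: "lab q u D \<alpha> = q powi (2 * m) * lab q u D \<beta>"
  obtain i j s i' j' t where \<alpha>\<beta>: "\<alpha> = (i, j, s)" "\<beta> = (i', j', t)" by (cases \<alpha>, cases \<beta>)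
  have *: "(i, j, s) \<in> D \<longleftrightarrow> (i', j', t) \<in> D" "s = t" "\<bar>(int j - int i) - (int j' - int i')\<bar> = 1"
    using lab_eq[of i j s i' j' t m D D] small_of_ideal eq m by (simp_all add: \<alpha>\<beta>)
  then show False
    using toggleable_adjacent_diagonals[OF D(1), of i j s i' j'] \<alpha> \<beta> unfolding \<alpha>\<beta> by blast
qed

text \<open>An inverse label is the label of the reversed step, and the two directions cannot have
  equal labels.\<close>

lemma lab_mult_ne_1: "lab q u D \<alpha> * lab q u D \<beta> \<noteq> 1"
proof
  assume "lab q u D \<alpha> * lab q u D \<beta> = 1"
  then have eq: "lab q u D \<alpha> = q powi (2 * 0) * lab q u (toggle D \<beta>) \<beta>"
    using lab_nz[OF small_of_ideal(2), of D] by (simp add: lab_toggle field_simps)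
  obtain i j s i' j' t where \<alpha>\<beta>: "\<alpha> = (i, j, s)" "\<beta> = (i', j', t)" by (cases \<alpha>, cases \<beta>)
  have *: "(i, j, s) \<in> D \<longleftrightarrow> (i', j', t) \<in> toggle D \<beta>" "s = t" "int j - int i = int j' - int i'"
    using lab_eq[OF _ _ _ eq[unfolded \<alpha>\<beta>]] small_of_ideal by (simp_all add: \<alpha>\<beta>)
  then have "\<alpha> = \<beta>" using toggleable_same_diagonal[OF D(1)] \<alpha> \<beta> by (simp add: \<alpha>\<beta>)
  then show False using *(1) \<alpha>\<beta> by (simp add: in_toggle)
qed

end

end

section \<open>Corners of a multipartition and the product of their labels\<close>

lemma addable_explicit:
  assumes "is_rpart r \<mu>"
  shows "(i, j, s) \<in> addable r \<mu> \<longleftrightarrow>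
    s \<in> {1..r} \<and> i \<ge> 1 \<and> j = Suc (\<mu> s i) \<and> (i = 1 \<or> \<mu> s i < \<mu> s (i - 1))" (is "?L \<longleftrightarrow> ?R")
proof -
  have D: "node_ideal r (diagram \<mu>)" using assms by (simp add: is_rpart_iff)
  show ?thesis
  proof
    assume ?L
    then have nin: "(i, j, s) \<notin> diagram \<mu>" and T: "node_ideal r (toggle (diagram \<mu>) (i, j, s))"
      by (auto simp: addable_iff)
    have pos: "i \<ge> 1 \<and> j \<ge> 1 \<and> s \<in> {1..r}"
      using node_ideal_pos[OF T, of i j s] nin by (simp add: in_toggle)
    have "j > \<mu> s i" using nin pos by (simp add: in_diagram)
    moreover have "j \<le> Suc (\<mu> s i)"
    proof (cases "j = 1")
      case False
      then have "(i, j - 1, s) \<in> toggle (diagram \<mu>) (i, j, s)"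
        using node_ideal_down[OF T, of i j s i "j - 1"] pos nin by (simp add: in_toggle)
      then show ?thesis using pos by (auto simp: in_toggle in_diagram split: if_splits)
    qed simp
    moreover have "i = 1 \<or> j \<le> \<mu> s (i - 1)"
    proof (cases "i = 1")
      case False
      then have "(i - 1, j, s) \<in> toggle (diagram \<mu>) (i, j, s)"
        using node_ideal_down[OF T, of i j s "i - 1" j] pos nin by (simp add: in_toggle)
      then show ?thesis using pos by (auto simp: in_toggle in_diagram split: if_splits)
    qed simp
    ultimately show ?R using pos by auto
  next
    assume R: ?R
    then have nin: "(i, j, s) \<notin> diagram \<mu>" by (simp add: in_diagram)
    then have t: "toggle (diagram \<mu>) (i, j, s) = insert (i, j, s) (diagram \<mu>)" by (simp add: toggle_def)
    have "node_ideal r (insert (i, j, s) (diagram \<mu>))"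
      unfolding node_ideal_def
    proof (intro conjI allI impI; (elim conjE)?)
      show "finite (insert (i, j, s) (diagram \<mu>))" using node_ideal_finite[OF D] by simp
    next
      fix a b c assume "(a, b, c) \<in> insert (i, j, s) (diagram \<mu>)"
      then show "a \<ge> 1" "b \<ge> 1" "c \<in> {1..r}" using R node_ideal_pos[OF D, of a b c] by auto
    next
      fix a b c assume "(Suc a, b, c) \<in> insert (i, j, s) (diagram \<mu>)" "a \<ge> 1"
      then show "(a, b, c) \<in> insert (i, j, s) (diagram \<mu>)"
        using R node_ideal_pred(1)[OF D, of a b c] by (auto simp: in_diagram)
    next
      fix a b c assume "(a, Suc b, c) \<in> insert (i, j, s) (diagram \<mu>)" "b \<ge> 1"
      then show "(a, b, c) \<in> insert (i, j, s) (diagram \<mu>)"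
        using R node_ideal_pred(2)[OF D, of a b c] by (auto simp: in_diagram)
    qed
    then show ?L using nin by (simp add: addable_iff t)
  qed
qed

lemma removable_explicit:
  assumes "is_rpart r \<mu>"
  shows "(i, j, s) \<in> removable r \<mu> \<longleftrightarrow>
    s \<in> {1..r} \<and> i \<ge> 1 \<and> j = \<mu> s i \<and> \<mu> s (Suc i) < \<mu> s i" (is "?L \<longleftrightarrow> ?R")
proof -
  have D: "node_ideal r (diagram \<mu>)" using assms by (simp add: is_rpart_iff)
  show ?thesis
  proof
    assume ?L
    then have inn: "(i, j, s) \<in> diagram \<mu>" and T: "node_ideal r (toggle (diagram \<mu>) (i, j, s))"
      by (auto simp: removable_iff)
    have pos: "i \<ge> 1 \<and> j \<ge> 1 \<and> s \<in> {1..r}"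
      using node_ideal_pos[OF D inn] by simp
    have "(i, Suc j, s) \<notin> diagram \<mu>"
      using node_ideal_pred(2)[OF T, of i j s] pos inn by (auto simp: in_toggle)
    moreover have "(Suc i, j, s) \<notin> diagram \<mu>"
      using node_ideal_pred(1)[OF T, of i j s] pos inn by (auto simp: in_toggle)
    ultimately show ?R using pos inn by (auto simp: in_diagram)
  next
    assume R: ?R
    then have inn: "(i, j, s) \<in> diagram \<mu>" by (auto simp: in_diagram)
    then have t: "toggle (diagram \<mu>) (i, j, s) = diagram \<mu> - {(i, j, s)}" by (simp add: toggle_def)
    have "node_ideal r (diagram \<mu> - {(i, j, s)})"
      unfolding node_ideal_def
    proof (intro conjI allI impI; (elim conjE)?)
      show "finite (diagram \<mu> - {(i, j, s)})" using node_ideal_finite[OF D] by simp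
    next
      fix a b c assume "(a, b, c) \<in> diagram \<mu> - {(i, j, s)}"
      then show "a \<ge> 1" "b \<ge> 1" "c \<in> {1..r}" using R node_ideal_pos[OF D, of a b c] by auto
    next
      fix a b c assume "(Suc a, b, c) \<in> diagram \<mu> - {(i, j, s)}" "a \<ge> 1"
      then show "(a, b, c) \<in> diagram \<mu> - {(i, j, s)}"
        using R node_ideal_pred(1)[OF D, of a b c] by (auto simp: in_diagram)
    next
      fix a b c assume "(a, Suc b, c) \<in> diagram \<mu> - {(i, j, s)}" "b \<ge> 1"
      then show "(a, b, c) \<in> diagram \<mu> - {(i, j, s)}"
        using R node_ideal_pred(2)[OF D, of a b c] by (auto simp: in_diagram)
    qed
    then show ?L using inn by (simp add: removable_iff t)
  qed
qed

context bmw_params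
begin

lemma powi_telescope:
  "(\<Prod>k = 1..L. q powi (2 * (int (a (Suc k)) - int (a k)))) = q powi (2 * (int (a (Suc L)) - int (a 1)))"
proof (induction L)
  case (Suc L)
  have "2 * (int (a (Suc L)) - int (a 1)) + 2 * (int (a (Suc (Suc L))) - int (a (Suc L))) =
    2 * (int (a (Suc (Suc L))) - int (a 1))" by simp
  then show ?case using Suc q0 by (simp del: One_nat_def flip: power_int_add)
qed (use q0 in simp)

text \<open>Row by row, the labels of the removable node of row \<open>k\<close> and of the addable node of row
  \<open>k + 1\<close> multiply to a power of \<open>q\<^sup>2\<close> which telescopes.\<close>

lemma addable_removable_labels:
  assumes "is_rpart r \<mu>"
  defines "N \<equiv> addable r \<mu> \<union> removable r \<mu>"
  shows "finite N" "(\<Prod>\<alpha>\<in>N. lab q u (diagram \<mu>) \<alpha>) = (\<Prod>i = 1..r. u i)" "even (card N) = even r"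
proof -
  have D: "node_ideal r (diagram \<mu>)" using assms by (simp add: is_rpart_iff)
  define L where "L = card (diagram \<mu>)"
  define S where "S = (\<lambda>s. {k. k \<ge> 1 \<and> \<mu> s (Suc k) < \<mu> s k})"
  \<comment> \<open>A row \<open>k\<close> strictly longer than the next one ends in a removable
    node, and row \<open>k + 1\<close> has an addable node. Together with the addable nodes
    \<open>h s\<close> of the first rows these are all corners, \<open>r + 2 * card I\<close> in
    number.\<close>
  define I where "I = Sigma {1..r} S"
  define h where "h = (\<lambda>s. (1::nat, Suc (\<mu> s 1), s))"
  define f where "f = (\<lambda>(s, k). (Suc k, Suc (\<mu> s (Suc k)), s))"
  define g where "g = (\<lambda>(s, k). (k, \<mu> s k, s :: nat))"
  have z: "\<mu> s i = 0" if "i > L" for s i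
    using node_ideal_card_bounds(1)[OF D, of i "\<mu> s i" s] that
    by (cases "\<mu> s i") (auto simp: L_def in_diagram)
  have SL: "S s \<subseteq> {1..L}" for s
    using z by (force simp: S_def not_less)
  then have finS: "finite (S s)" for s by (rule finite_subset) simp
  then have finI: "finite I" by (simp add: I_def)
  have inj: "inj_on h {1..r}" "inj_on f I" "inj_on g I"
    by (auto simp: inj_on_def h_def f_def g_def)
  have add: "addable r \<mu> = h ` {1..r} \<union> f ` I"
  proof (rule Set.set_eqI)
    fix x :: node
    obtain i j s where x: "x = (i, j, s)" by (cases x)
    show "x \<in> addable r \<mu> \<longleftrightarrow> x \<in> h ` {1..r} \<union> f ` I"
    proof
      assume "x \<in> addable r \<mu>"
      then have R: "s \<in> {1..r}" "i \<ge> 1" "j = Suc (\<mu> s i)" "i = 1 \<or> \<mu> s i < \<mu> s (i - 1)"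
        by (simp_all add: x addable_explicit[OF assms(1)])
      show "x \<in> h ` {1..r} \<union> f ` I"
      proof (cases "i = 1")
        case True
        then have "x = h s" using R by (simp add: x h_def)
        then show ?thesis using R by blast
      next
        case False
        then have "x = f (s, i - 1)" "(s, i - 1) \<in> I" using R by (auto simp: x f_def I_def S_def)
        then show ?thesis by blast
      qed
    next
      assume "x \<in> h ` {1..r} \<union> f ` I"
      then show "x \<in> addable r \<mu>"
        by (auto simp: h_def f_def I_def S_def addable_explicit[OF assms(1)])
    qed
  qed
  have rem: "removable r \<mu> = g ` I"
  proof (rule Set.set_eqI)
    fix x :: node
    obtain i j s where x: "x = (i, j, s)" by (cases x)
    show "x \<in> removable r \<mu> \<longleftrightarrow> x \<in> g ` I"
      unfolding x removable_explicit[OF assms(1)] by (force simp: g_def I_def S_def)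
  qed
  have disj1: "addable r \<mu> \<inter> removable r \<mu> = {}" by (auto simp: addable_iff removable_iff)
  have disj2: "h ` {1..r} \<inter> f ` I = {}" by (auto simp: h_def f_def I_def S_def)
  show "finite N" unfolding N_def add rem using finI by simp
  have "card N = card (h ` {1..r}) + card (f ` I) + card (g ` I)"
    unfolding N_def using finI disj1 disj2
    by (subst card_Un_disjoint) (auto simp: add rem card_Un_disjoint)
  then have "card N = r + 2 * card I"
    using inj by (simp add: card_image)
  then show "even (card N) = even r" by simp
  let ?c = "content q u"
  have "(\<Prod>\<alpha>\<in>N. lab q u (diagram \<mu>) \<alpha>) =
      (\<Prod>\<alpha>\<in>addable r \<mu>. lab q u (diagram \<mu>) \<alpha>) * (\<Prod>\<alpha>\<in>removable r \<mu>. lab q u (diagram \<mu>) \<alpha>)"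
    unfolding N_def using finI by (intro prod.union_disjoint disj1) (auto simp: add rem)
  also have "(\<Prod>\<alpha>\<in>addable r \<mu>. lab q u (diagram \<mu>) \<alpha>) = (\<Prod>\<alpha>\<in>addable r \<mu>. ?c \<alpha>)"
    by (rule prod.cong) (auto simp: addable_iff lab_def)
  also have "\<dots> = (\<Prod>s = 1..r. ?c (h s)) * (\<Prod>x\<in>I. ?c (f x))"
    unfolding add using finI inj by (subst prod.union_disjoint[OF _ _ disj2]) (auto simp: prod.reindex)
  also have "(\<Prod>\<alpha>\<in>removable r \<mu>. lab q u (diagram \<mu>) \<alpha>) = (\<Prod>\<alpha>\<in>removable r \<mu>. inverse (?c \<alpha>))"
    by (rule prod.cong) (auto simp: removable_iff lab_def)
  also have "\<dots> = (\<Prod>x\<in>I. inverse (?c (g x)))"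
    unfolding rem using inj by (simp add: prod.reindex)
  also have "(\<Prod>s = 1..r. ?c (h s)) * (\<Prod>x\<in>I. ?c (f x)) * (\<Prod>x\<in>I. inverse (?c (g x))) =
      (\<Prod>s = 1..r. ?c (h s)) * (\<Prod>x\<in>I. ?c (f x) * inverse (?c (g x)))"
    by (simp add: prod.distrib)
  also have "(\<Prod>x\<in>I. ?c (f x) * inverse (?c (g x))) =
      (\<Prod>(s, k)\<in>I. q powi (2 * (int (\<mu> s (Suc k)) - int (\<mu> s k))))"
  proof (rule prod.cong[OF refl])
    fix x assume "x \<in> I"
    then obtain s k where x: "x = (s, k)" "s \<in> {1..r}" by (auto simp: I_def)
    have "q powi (2 * (int (\<mu> s (Suc k)) - int (\<mu> s k))) =
        q powi (2 * (int (Suc (\<mu> s (Suc k))) - int (Suc k))) * inverse (q powi (2 * (int (\<mu> s k) - int k)))"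
      using q0 by (simp flip: power_int_add power_int_minus)
    then show "?c (f x) * inverse (?c (g x)) = (case x of (s, k) \<Rightarrow> q powi (2 * (int (\<mu> s (Suc k)) - int (\<mu> s k))))"
      using u0[OF x(2)] by (simp add: x(1) f_def g_def content_def)
  qed
  also have "\<dots> = (\<Prod>s = 1..r. \<Prod>k\<in>S s. q powi (2 * (int (\<mu> s (Suc k)) - int (\<mu> s k))))"
    unfolding I_def using finS by (subst prod.Sigma) auto
  also have "\<dots> = (\<Prod>s = 1..r. q powi (2 * (int (\<mu> s (Suc L)) - int (\<mu> s 1))))"
  proof (rule prod.cong[OF refl])
    fix s assume s: "s \<in> {1..r}"
    have "(\<Prod>k\<in>S s. q powi (2 * (int (\<mu> s (Suc k)) - int (\<mu> s k)))) =
        (\<Prod>k = 1..L. q powi (2 * (int (\<mu> s (Suc k)) - int (\<mu> s k))))"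
    proof (rule prod.mono_neutral_left)
      \<comment> \<open>A row as long as the next contributes \<open>q powi 0\<close>, so the
        product may run over all rows and telescopes.\<close>
      show "\<forall>k\<in>{1..L} - S s. q powi (2 * (int (\<mu> s (Suc k)) - int (\<mu> s k))) = 1"
      proof
        fix k assume "k \<in> {1..L} - S s"
        then have k: "1 \<le> k" "\<not> \<mu> s (Suc k) < \<mu> s k" by (auto simp: S_def)
        have "\<forall>s\<in>{1..r}. \<forall>i\<ge>1. \<mu> s (i + 1) \<le> \<mu> s i" using assms(1) unfolding is_rpart_def by blast
        then have "\<mu> s (k + 1) \<le> \<mu> s k" using s k(1) by blast
        then have "\<mu> s (Suc k) = \<mu> s k" using k(2) by simp
        then show "q powi (2 * (int (\<mu> s (Suc k)) - int (\<mu> s k))) = 1" by simp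
      qed
    qed (use SL in auto)
    then show "(\<Prod>k\<in>S s. q powi (2 * (int (\<mu> s (Suc k)) - int (\<mu> s k)))) =
        q powi (2 * (int (\<mu> s (Suc L)) - int (\<mu> s 1)))"
      by (simp only: powi_telescope)
  qed
  \<comment> \<open>Row \<open>L + 1\<close> is empty; what is left of the telescope is the inverse
    of the power of \<open>q\<close> in the content of \<open>h s\<close>.\<close>
  also have "(\<Prod>s = 1..r. ?c (h s)) * \<dots> = (\<Prod>i = 1..r. u i)"
    unfolding prod.distrib[symmetric]
  proof (rule prod.cong[OF refl])
    fix s
    have "q powi (2 * int (\<mu> s 1)) * q powi (- (2 * int (\<mu> s 1))) = 1"
      using q0 by (simp flip: power_int_add)
    then show "?c (h s) * q powi (2 * (int (\<mu> s (Suc L)) - int (\<mu> s 1))) = u s"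
      using z[of "Suc L" s] by (simp add: h_def content_def)
  qed
  finally show "(\<Prod>\<alpha>\<in>N. lab q u (diagram \<mu>) \<alpha>) = (\<Prod>i = 1..r. u i)" .
qed

end

section \<open>Updown tableaux\<close>

locale updown_tableaux = bmw_params r n q u for r n :: nat and q :: "'a::field" and u :: "nat \<Rightarrow> 'a" +
  fixes \<mu> :: mpart
begin

abbreviation TT :: "tab set" where "TT \<equiv> updown r n \<mu>"
abbreviation cc :: "tab \<Rightarrow> nat \<Rightarrow> 'a" where "cc s k \<equiv> cont_tab q u s k"
abbreviation stays :: "nat \<Rightarrow> tab \<Rightarrow> bool" where "stays k s \<equiv> s ! (k - 1) = s ! (k + 1)"

definition dg :: "tab \<Rightarrow> nat \<Rightarrow> node set" where "dg s k = diagram (s ! k)"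
definition nd :: "tab \<Rightarrow> nat \<Rightarrow> node" where "nd s k = node_diff (s ! k) (s ! (k - 1))"

lemma dg_eq_iff: "dg s j = dg t k \<longleftrightarrow> s ! j = t ! k"
  by (simp add: dg_def diagram_eq_iff)

lemma tab_length: "s \<in> TT \<Longrightarrow> length s = n + 1"
  by (simp add: updown_def)

lemma dg_ideal: "s \<in> TT \<Longrightarrow> k \<le> n \<Longrightarrow> node_ideal r (dg s k)"
  by (simp add: updown_def dg_def is_rpart_iff)

lemma dg_step:
  assumes "s \<in> TT" "1 \<le> k" "k \<le> n"
  shows "dg s k = toggle (dg s (k - 1)) (nd s k)"
proof -
  have "\<exists>\<alpha>. differ_by \<alpha> (s ! (k - 1)) (s ! k)"
    using assms by (simp add: updown_def del: split_paired_Ex)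
  then obtain \<alpha> where \<alpha>: "differ_by \<alpha> (s ! (k - 1)) (s ! k)" ..
  then have "nd s k = \<alpha>" unfolding nd_def using differ_by_sym node_diff_eq by blast
  then show ?thesis using \<alpha> by (simp add: dg_def differ_by_iff)
qed

lemma dg_step': "s \<in> TT \<Longrightarrow> 1 \<le> k \<Longrightarrow> k \<le> n \<Longrightarrow> dg s (k - 1) = toggle (dg s k) (nd s k)"
  by (simp add: dg_step)

lemma dg_0: "s \<in> TT \<Longrightarrow> dg s 0 = {}"
  by (auto simp: updown_def dg_def empty_mpart_def diagram_def)

lemma card_dg: "s \<in> TT \<Longrightarrow> k \<le> n \<Longrightarrow> card (dg s k) \<le> k"
proof (induction k)
  case 0
  then show ?case by (simp add: dg_0)
next
  case (Suc k)
  have "card (dg s (Suc k)) \<le> Suc (card (dg s k))"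
    using dg_step[of s "Suc k"] Suc.prems card_toggle_le[OF node_ideal_finite[OF dg_ideal[of s k]]] by auto
  then show ?case using Suc by auto
qed

lemma dg_pred:
  assumes "s \<in> TT" "1 \<le> k" "k \<le> n"
  shows "node_ideal r (dg s (k - 1))" "card (dg s (k - 1)) < n"
proof -
  have "k - 1 \<le> n" "k - 1 < n" using assms by auto
  then show "node_ideal r (dg s (k - 1))" "card (dg s (k - 1)) < n"
    using dg_ideal[OF assms(1)] card_dg[OF assms(1)] le_less_trans by blast+
qed

lemma cont_tab_eq_lab:
  assumes "s \<in> TT" "1 \<le> k" "k \<le> n"
  shows "cc s k = lab q u (dg s (k - 1)) (nd s k)"
proof -
  have "differ_by (nd s k) (s ! (k - 1)) (s ! k)"
    using dg_step[OF assms] by (simp add: differ_by_iff dg_def)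
  then show ?thesis
    by (simp add: cont_tab_def adds_node_iff lab_def dg_def nd_def Let_def)
qed

lemma inverse_cont_tab:
  assumes "s \<in> TT" "1 \<le> k" "k \<le> n"
  shows "inverse (cc s k) = lab q u (dg s k) (nd s k)"
  using cont_tab_eq_lab[OF assms] dg_step[OF assms] lab_toggle by metis

lemma nd_small: "s \<in> TT \<Longrightarrow> 1 \<le> k \<Longrightarrow> k \<le> n \<Longrightarrow> small (nd s k)"
  by (rule small_toggle[of "dg s (k - 1)"])
    (use dg_pred[of s k] dg_ideal[of s k] card_dg[of s k] dg_step[of s k] in auto)

lemma cc_nz: "s \<in> TT \<Longrightarrow> 1 \<le> k \<Longrightarrow> k \<le> n \<Longrightarrow> cc s k \<noteq> 0"
  by (simp add: cont_tab_eq_lab lab_nz nd_small)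

lemma cc_eq_imp:
  assumes "s \<in> TT" "t \<in> TT" "1 \<le> k" "k \<le> n" "s ! (k - 1) = t ! (k - 1)" "cc s k = cc t k"
  shows "s ! k = t ! k"
proof -
  have D: "dg t (k - 1) = dg s (k - 1)" using assms by (simp add: dg_eq_iff)
  have "nd s k = nd t k"
  proof (rule lab_inj[of "dg s (k - 1)"])
    show "node_ideal r (dg s (k - 1))" "card (dg s (k - 1)) < n"
      using assms dg_pred[of s k] by auto
    show "node_ideal r (toggle (dg s (k - 1)) (nd s k))"
      using dg_step[of s k] dg_ideal[of s k] assms by simp
    show "node_ideal r (toggle (dg s (k - 1)) (nd t k))"
      using dg_step[of t k] dg_ideal[of t k] assms D by simp
    show "lab q u (dg s (k - 1)) (nd s k) = lab q u (dg s (k - 1)) (nd t k)"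
      using assms cont_tab_eq_lab D by metis
  qed
  then show ?thesis using dg_step[of s k] dg_step[of t k] assms D by (metis dg_eq_iff)
qed

text \<open>Both tableaux leave the same vertex in step \<open>k\<close>, so the facts on the labels
  of one diagram apply.\<close>

lemma cc_mult_ne_1:
  assumes "s \<in> TT" "t \<in> TT" "1 \<le> k" "k \<le> n" "s ! (k - 1) = t ! (k - 1)"
  shows "cc s k * cc t k \<noteq> 1" and "\<bar>m\<bar> = 1 \<Longrightarrow> cc s k \<noteq> q powi (2 * m) * cc t k"
proof -
  have D: "dg t (k - 1) = dg s (k - 1)" using assms by (simp add: dg_eq_iff)
  have *: "node_ideal r (dg s (k - 1))" "card (dg s (k - 1)) < n"
      "node_ideal r (toggle (dg s (k - 1)) (nd s k))" "node_ideal r (toggle (dg s (k - 1)) (nd t k))"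
    using assms dg_pred[of s k] dg_step[of s k] dg_ideal[of s k]
      dg_step[of t k] dg_ideal[of t k] D by auto
  show "cc s k * cc t k \<noteq> 1"
    using lab_mult_ne_1[OF *] cont_tab_eq_lab assms D by metis
  show "\<bar>m\<bar> = 1 \<Longrightarrow> cc s k \<noteq> q powi (2 * m) * cc t k"
    using lab_adjacent[OF *] cont_tab_eq_lab assms D by metis
qed

text \<open>At the common vertex \<open>k\<close>, step \<open>k\<close> of \<open>s\<close> read
  backwards has label \<open>inverse (cc s k)\<close>, and step \<open>k + 1\<close> of
  \<open>t\<close> has label \<open>cc t (k + 1)\<close>. These are the facts on two labels of one
  diagram.\<close>

lemma mid_facts:
  assumes "s \<in> TT" "t \<in> TT" "1 \<le> k" "k < n" "s ! k = t ! k"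
  shows "cc s k * cc t (k + 1) = 1 \<Longrightarrow> s ! (k - 1) = t ! (k + 1)"
    and "cc t (k + 1) \<noteq> cc s k"
    and "\<bar>m\<bar> = 1 \<Longrightarrow> cc t (k + 1) * cc s k \<noteq> q powi (2 * m)"
proof -
  have D: "dg t k = dg s k" using assms by (simp add: dg_eq_iff)
  have step: "dg s (k - 1) = toggle (dg s k) (nd s k)" "dg t (k + 1) = toggle (dg s k) (nd t (k + 1))"
    using dg_step'[of s k] dg_step[of t "k + 1"] assms D by auto
  have *: "node_ideal r (dg s k)" "card (dg s k) < n"
      "node_ideal r (toggle (dg s k) (nd s k))" "node_ideal r (toggle (dg s k) (nd t (k + 1)))"
    using assms dg_ideal[of s k] card_dg[of s k] step dg_ideal[of s "k - 1"] dg_ideal[of t "k + 1"] by auto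
  have c: "inverse (cc s k) = lab q u (dg s k) (nd s k)" "cc t (k + 1) = lab q u (dg s k) (nd t (k + 1))"
    using inverse_cont_tab[of s k] cont_tab_eq_lab[of t "k + 1"] assms D by auto
  have nz: "cc s k \<noteq> 0" using cc_nz assms by auto
  show "s ! (k - 1) = t ! (k + 1)" if "cc s k * cc t (k + 1) = 1"
  proof -
    have "inverse (cc s k) = cc t (k + 1)" using that nz by (simp add: field_simps)
    then have "nd s k = nd t (k + 1)" using lab_inj[OF *] c by simp
    then show ?thesis using step by (metis dg_eq_iff)
  qed
  show "cc t (k + 1) \<noteq> cc s k"
    using lab_mult_ne_1[OF *] nz unfolding c[symmetric] by auto
  show "cc t (k + 1) * cc s k \<noteq> q powi (2 * m)" if "\<bar>m\<bar> = 1"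
    using lab_adjacent[OF *(1,2,4,3) that] nz unfolding c[symmetric] by (simp add: field_simps)
qed

text \<open>Undoing a step inverts its label, and at one vertex the label determines the
  node.\<close>

lemma stays_iff:
  assumes "s \<in> TT" "1 \<le> k" "k < n"
  shows "stays k s \<longleftrightarrow> cc s k * cc s (k + 1) = 1"
proof
  assume "stays k s"
  then have "dg s (k - 1) = dg s (k + 1)" by (simp add: dg_eq_iff)
  then have "nd s (k + 1) = nd s k"
    using dg_step'[of s k] dg_step[of s "k + 1"] assms by (auto dest: toggle_inj)
  then have "cc s (k + 1) = inverse (cc s k)"
    using inverse_cont_tab[of s k] cont_tab_eq_lab[of s "k + 1"] assms by simp
  then show "cc s k * cc s (k + 1) = 1" using cc_nz[of s k] assms by simp
qed (use mid_facts(1)[of s s k] assms in auto)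

text \<open>The joint eigenvalues of the \<open>X_i\<close> separate the basis vectors, because each
  label determines the next vertex.\<close>

lemma tab_eqI:
  assumes "s \<in> TT" "t \<in> TT" "\<And>k. 1 \<le> k \<Longrightarrow> k \<le> n \<Longrightarrow> cc s k = cc t k"
  shows "s = t"
proof (rule nth_equalityI)
  show "length s = length t" using assms tab_length by simp
  have "s ! k = t ! k" if "k \<le> n" for k
    using that
  proof (induction k)
    case 0
    then show ?case using assms by (simp add: updown_def)
  next
    case (Suc k)
    then show ?case using cc_eq_imp[of s t "Suc k"] assms by simp
  qed
  then show "s ! k = t ! k" if "k < length s" for k using that tab_length[OF assms(1)] by simp
qed

lemma ksim_sym: "ksim k s t \<Longrightarrow> ksim k t s"
  unfolding ksim_def by metis

lemma ksim_trans: "ksim k s t \<Longrightarrow> ksim k t t' \<Longrightarrow> ksim k s t'"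
  unfolding ksim_def by metis

lemma ksim_refl [simp]: "ksim k s s"
  by (simp add: ksim_def)

lemma ksim_nth: "ksim k s t \<Longrightarrow> s \<in> TT \<Longrightarrow> j \<le> n \<Longrightarrow> j \<noteq> k \<Longrightarrow> s ! j = t ! j"
  using tab_length by (auto simp: ksim_def)

lemma ksimI: "s \<in> TT \<Longrightarrow> t \<in> TT \<Longrightarrow> (\<And>j. j \<le> n \<Longrightarrow> j \<noteq> k \<Longrightarrow> s ! j = t ! j) \<Longrightarrow> ksim k s t"
  using tab_length by (auto simp: ksim_def)

lemma ksim_cc: "ksim k s t \<Longrightarrow> s \<in> TT \<Longrightarrow> 1 \<le> j \<Longrightarrow> j \<le> n \<Longrightarrow> j \<noteq> k \<Longrightarrow> j \<noteq> k + 1 \<Longrightarrow> cc s j = cc t j"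
  using ksim_nth[of k s t j] ksim_nth[of k s t "j - 1"] by (simp add: cont_tab_def)

lemma ksim_eqI:
  assumes "s \<in> TT" "t \<in> TT" "ksim k s t" "s ! k = t ! k"
  shows "s = t"
proof (rule nth_equalityI)
  show "length s = length t" using assms(3) by (simp add: ksim_def)
  show "s ! j = t ! j" if "j < length s" for j
    using assms(3,4) that unfolding ksim_def by (cases "j = k") blast+
qed

lemma ksim_stays: "ksim k s t \<Longrightarrow> s \<in> TT \<Longrightarrow> 1 \<le> k \<Longrightarrow> k < n \<Longrightarrow> stays k s \<longleftrightarrow> stays k t"
  using ksim_nth[of k s t "k - 1"] ksim_nth[of k s t "k + 1"] by auto

lemma update_tab:
  assumes s: "s \<in> TT" and k: "1 \<le> k" "k < n"
    and \<nu>: "node_ideal r (diagram \<nu>)" "diagram \<nu> = toggle (dg s (k - 1)) \<alpha>" "dg s (k + 1) = toggle (diagram \<nu>) \<beta>"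
  shows "s[k := \<nu>] \<in> TT" "ksim k s (s[k := \<nu>])" "s[k := \<nu>] ! k = \<nu>"
    "nd (s[k := \<nu>]) k = \<alpha>" "nd (s[k := \<nu>]) (k + 1) = \<beta>"
proof -
  let ?t = "s[k := \<nu>]"
  have len: "length s = n + 1" using tab_length[OF s] .
  have d: "differ_by \<alpha> (s ! (k - 1)) \<nu>" "differ_by \<beta> \<nu> (s ! (k + 1))"
    using \<nu> by (simp_all add: differ_by_iff dg_def)
  show "?t ! k = \<nu>" using len k by simp
  have t: "?t ! j = (if j = k then \<nu> else s ! j)" for j using len k by (auto simp: nth_list_update)
  show "?t \<in> TT"
    unfolding updown_def
  proof (intro CollectI conjI allI impI ballI)
    show "length ?t = n + 1" using len by simp
    show "is_rpart r (?t ! i)" if "i \<le> n" for i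
      using that s \<nu>(1) by (auto simp: t updown_def is_rpart_iff)
    show "?t ! 0 = empty_mpart" "?t ! n = \<mu>" using s k by (auto simp: t updown_def)
    show "\<exists>\<alpha>. differ_by \<alpha> (?t ! (i - 1)) (?t ! i)" if "i \<in> {1..n}" for i
    proof -
      consider "i = k" | "i = k + 1" | "i \<noteq> k" "i \<noteq> k + 1" by blast
      then show ?thesis
      proof cases
        case 1
        then have "?t ! (i - 1) = s ! (k - 1)" "?t ! i = \<nu>" using k by (auto simp: t)
        then show ?thesis using d(1) by metis
      next
        case 2
        then have "?t ! (i - 1) = \<nu>" "?t ! i = s ! (k + 1)" using k by (auto simp: t)
        then show ?thesis using d(2) by metis
      next
        case 3
        then have "?t ! (i - 1) = s ! (i - 1)" "?t ! i = s ! i" using that by (auto simp: t)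
        moreover have "\<exists>\<alpha>. differ_by \<alpha> (s ! (i - 1)) (s ! i)"
          using s that by (simp add: updown_def del: split_paired_Ex)
        ultimately show ?thesis by metis
      qed
    qed
  qed
  show "ksim k s ?t" by (simp add: ksim_def)
  show "nd ?t k = \<alpha>" "nd ?t (k + 1) = \<beta>"
  proof -
    have "node_diff \<nu> (s ! (k - 1)) = \<alpha>" "node_diff (s ! (k + 1)) \<nu> = \<beta>"
      using node_diff_eq[OF d(1)] node_diff_eq[OF d(2)] node_diff_commute by metis+
    then show "nd ?t k = \<alpha>" "nd ?t (k + 1) = \<beta>" using k by (auto simp: nd_def t)
  qed
qed

text \<open>Steps in one row or column use neighbouring nodes in the same direction. Together with
  \<open>b_zero\<close> this makes the root \<open>b\<close> vanish where the exchange is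
  undefined.\<close>

lemma not_swap:
  assumes s: "s \<in> TT" "1 \<le> k" "k < n" "\<not> stays k s" "\<not> swap_defined k s"
  shows "\<exists>m. \<bar>m\<bar> = 1 \<and> cc s (k + 1) = q powi (2 * m) * cc s k"
proof -
  obtain i j c i' j' c' where \<alpha>: "nd s k = (i, j, c)" and \<beta>: "nd s (k + 1) = (i', j', c')"
    by (cases "nd s k", cases "nd s (k + 1)")
  have line: "c = c'" "i = i' \<or> j = j'"
    using s(4,5) \<alpha> \<beta> by (auto simp: swap_defined_def nd_def)
  let ?D = "dg s (k - 1)"
  have D1: "dg s k = toggle ?D (i, j, c)" and D2: "dg s (k + 1) = toggle (toggle ?D (i, j, c)) (i', j', c)"
    using dg_step[of s k] dg_step[of s "k + 1"] s \<alpha> \<beta> line by auto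
  have ideals: "node_ideal r ?D" "node_ideal r (toggle ?D (i, j, c))"
      "node_ideal r (toggle (toggle ?D (i, j, c)) (i', j', c))"
    using dg_ideal[of s "k - 1"] dg_ideal[of s k] dg_ideal[of s "k + 1"] s D1 D2 by auto
  have ne: "(i, j) \<noteq> (i', j')"
  proof
    assume "(i, j) = (i', j')"
    then have "dg s (k + 1) = ?D" using D2 by simp
    then show False using s(4) by (simp add: dg_eq_iff)
  qed
  note * = toggle_no_square[OF ideals ne line(2)]
  define e where "e = (int j' - int i') - (int j - int i)"
  have c: "cc s k = lab q u ?D (i, j, c)" "cc s (k + 1) = lab q u (toggle ?D (i, j, c)) (i', j', c)"
    using cont_tab_eq_lab[of s k] cont_tab_eq_lab[of s "k + 1"] s \<alpha> \<beta> D1 line by auto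
  have e: "content q u (i', j', c) = q powi (2 * e) * content q u (i, j, c)"
  proof -
    have "2 * e + 2 * (int j - int i) = 2 * (int j' - int i')" by (simp add: e_def)
    then have "q powi (2 * e) * q powi (2 * (int j - int i)) = q powi (2 * (int j' - int i'))"
      using q0 by (simp flip: power_int_add)
    then show ?thesis by (simp add: content_def mult.left_commute)
  qed
  have "\<bar>e\<bar> = 1" using *(1) by (simp add: e_def)
  show ?thesis
  proof (cases "(i, j, c) \<in> ?D")
    case True
    then have "cc s (k + 1) = q powi (2 * (- e)) * cc s k"
      using c e *(2) by (simp add: lab_def power_int_minus)
    then show ?thesis using \<open>\<bar>e\<bar> = 1\<close> by (intro exI[of _ "- e"]) auto
  next
    case False
    then have "cc s (k + 1) = q powi (2 * e) * cc s k"
      using c e *(2) by (simp add: lab_def)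
    then show ?thesis using \<open>\<bar>e\<bar> = 1\<close> by blast
  qed
qed

text \<open>Toggling one of two different nodes does not affect whether the other belongs to the
  diagram, so the exchange permutes the two labels. It is an involution because contents separate
  tableaux.\<close>

lemma swap_facts:
  assumes s: "s \<in> TT" "1 \<le> k" "k < n" and sw: "swap_defined k s"
  shows "swap r k s \<in> TT" "ksim k s (swap r k s)" "cc (swap r k s) k = cc s (k + 1)"
    "cc (swap r k s) (k + 1) = cc s k" "swap_defined k (swap r k s)" "\<not> stays k s" "\<not> stays k (swap r k s)"
    "swap r k s \<noteq> s" "swap r k (swap r k s) = s"
proof -
  have gen: "swap r k s \<in> TT \<and> ksim k s (swap r k s) \<and> cc (swap r k s) k = cc s (k + 1) \<and>
    cc (swap r k s) (k + 1) = cc s k \<and> swap_defined k (swap r k s)"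
    if s: "s \<in> TT" and sw: "swap_defined k s" for s
  proof -
    obtain i j c i' j' c' where \<alpha>: "nd s k = (i, j, c)" and \<beta>: "nd s (k + 1) = (i', j', c')"
      by (cases "nd s k", cases "nd s (k + 1)")
    have ne: "(c, i) \<noteq> (c', i')" "(c, j) \<noteq> (c', j')" and nst: "\<not> stays k s"
      using sw \<alpha> \<beta> by (auto simp: swap_defined_def nd_def)
    then have ab: "nd s k \<noteq> nd s (k + 1)" using \<alpha> \<beta> by auto
    let ?D = "dg s (k - 1)"
    have D1: "dg s k = toggle ?D (nd s k)" and D2: "dg s (k + 1) = toggle (toggle ?D (nd s k)) (nd s (k + 1))"
      using dg_step[of s k] dg_step[of s "k + 1"] s \<open>1 \<le> k\<close> \<open>k < n\<close> by auto
    have ideals: "node_ideal r ?D" "node_ideal r (toggle ?D (nd s k))"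
        "node_ideal r (toggle (toggle ?D (nd s k)) (nd s (k + 1)))"
      using dg_ideal[of s "k - 1"] dg_ideal[of s k] dg_ideal[of s "k + 1"] s \<open>k < n\<close> D1 D2 by auto
    have id: "node_ideal r (toggle ?D (nd s (k + 1)))"
      by (rule toggle_square[OF ideals \<alpha> \<beta> ne])
    obtain \<nu> where \<nu>: "diagram \<nu> = toggle ?D (nd s (k + 1))" using node_ideal_diagram[OF id] .
    have D2': "dg s (k + 1) = toggle (diagram \<nu>) (nd s k)" unfolding \<nu> D2 by (rule toggle_commute)
    note up = update_tab[OF s \<open>1 \<le> k\<close> \<open>k < n\<close> id[folded \<nu>] \<nu> D2']
    have d1: "differ_by (nd s k) \<nu> (s ! (k + 1))" and d2: "differ_by (nd s (k + 1)) (s ! (k - 1)) \<nu>"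
      using D2' \<nu> by (simp_all add: differ_by_iff dg_def)
    have n1: "node_diff (s ! (k - 1)) (s ! k) = nd s k" "node_diff (s ! k) (s ! (k + 1)) = nd s (k + 1)"
      by (simp_all add: nd_def node_diff_commute)
    have "swap r k s = s[k := \<nu>]"
      unfolding swap_def n1
    proof (rule arg_cong[of _ _ "\<lambda>x. s[k := x]"], rule the_equality)
      show "is_rpart r \<nu> \<and> (\<exists>\<alpha>. differ_by \<alpha> \<nu> (s ! (k + 1))) \<and> (\<exists>\<alpha>. differ_by \<alpha> (s ! (k - 1)) \<nu>) \<and>
        node_diff \<nu> (s ! (k + 1)) = nd s k \<and> node_diff (s ! (k - 1)) \<nu> = nd s (k + 1)"
      proof (intro conjI)
        show "is_rpart r \<nu>" using id \<nu> by (simp add: is_rpart_iff)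
        show "\<exists>\<alpha>. differ_by \<alpha> \<nu> (s ! (k + 1))" "\<exists>\<alpha>. differ_by \<alpha> (s ! (k - 1)) \<nu>"
          using d1 d2 by blast+
        show "node_diff \<nu> (s ! (k + 1)) = nd s k" "node_diff (s ! (k - 1)) \<nu> = nd s (k + 1)"
          using d1 d2 node_diff_eq by blast+
      qed
    next
      \<comment> \<open>The prescribed difference with \<open>s ! (k - 1)\<close> already determines
        the vertex.\<close>
      fix x assume x: "is_rpart r x \<and> (\<exists>\<alpha>. differ_by \<alpha> x (s ! (k + 1))) \<and> (\<exists>\<alpha>. differ_by \<alpha> (s ! (k - 1)) x) \<and>
        node_diff x (s ! (k + 1)) = nd s k \<and> node_diff (s ! (k - 1)) x = nd s (k + 1)"
      then have "differ_by (nd s (k + 1)) (s ! (k - 1)) x" using node_diff_eq by metis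
      then show "x = \<nu>" using d2 diagram_inj by (simp add: differ_by_iff)
    qed
    then have sw_eq: "swap r k s = s[k := \<nu>]" .
    let ?t = "s[k := \<nu>]"
    have t: "?t \<in> TT" "ksim k s ?t" using up by auto
    have dgt: "dg ?t (k - 1) = ?D" "dg ?t k = toggle ?D (nd s (k + 1))" "?t ! (k - 1) = s ! (k - 1)" "?t ! (k + 1) = s ! (k + 1)"
      using ksim_nth[OF t(2) s, of "k - 1"] ksim_nth[OF t(2) s, of "k + 1"] up(3) \<nu> \<open>1 \<le> k\<close> \<open>k < n\<close> by (auto simp: dg_def)
    have "cc ?t k = lab q u ?D (nd s (k + 1))"
      using cont_tab_eq_lab[OF t(1), of k] up(4) dgt \<open>1 \<le> k\<close> \<open>k < n\<close> by simp
    also have "\<dots> = lab q u (dg s k) (nd s (k + 1))"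
      using ab by (simp add: D1 lab_def in_toggle)
    also have "\<dots> = cc s (k + 1)" using cont_tab_eq_lab[OF s, of "k + 1"] \<open>k < n\<close> by simp
    finally have c1: "cc ?t k = cc s (k + 1)" .
    have "cc ?t (k + 1) = lab q u (toggle ?D (nd s (k + 1))) (nd s k)"
      using cont_tab_eq_lab[OF t(1), of "k + 1"] up(5) dgt \<open>k < n\<close> by simp
    also have "\<dots> = lab q u ?D (nd s k)" using ab by (simp add: lab_def in_toggle)
    also have "\<dots> = cc s k" using cont_tab_eq_lab[OF s, of k] \<open>1 \<le> k\<close> \<open>k < n\<close> by simp
    finally have c2: "cc ?t (k + 1) = cc s k" .
    have "swap_defined k ?t"
      using up(4,5) dgt nst ne \<alpha> \<beta> by (auto simp: swap_defined_def nd_def)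
    then show ?thesis using t c1 c2 by (simp add: sw_eq)
  qed
  note S = gen[OF s(1) sw]
  show "swap r k s \<in> TT" "ksim k s (swap r k s)" "cc (swap r k s) k = cc s (k + 1)"
    "cc (swap r k s) (k + 1) = cc s k" "swap_defined k (swap r k s)" using S by auto
  show "\<not> stays k s" "\<not> stays k (swap r k s)" using sw S by (auto simp: swap_defined_def)
  show "swap r k s \<noteq> s" using S mid_facts(2)[of s s k] s by auto
  note S' = gen[of "swap r k s"]
  show "swap r k (swap r k s) = s"
  proof (rule tab_eqI)
    show "swap r k (swap r k s) \<in> TT" "s \<in> TT" using S S' s by auto
    fix j assume j: "1 \<le> j" "j \<le> n"
    show "cc (swap r k (swap r k s)) j = cc s j"
    proof (cases "j = k \<or> j = k + 1")
      case True
      then show ?thesis using S S' by auto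
    next
      case False
      then show ?thesis
        using ksim_cc[of k s "swap r k s" j] ksim_cc[of k "swap r k s" "swap r k (swap r k s)" j] S S' j s by auto
    qed
  qed
qed

text \<open>Equal contents two steps apart mean one diagonal and one direction, which is possible
  only if the step between undoes the first.\<close>

lemma cc_period:
  assumes s: "s \<in> TT" "1 \<le> k" "k + 2 \<le> n" and eq: "cc s k = cc s (k + 2)"
  shows "stays k s"
proof -
  obtain i j c i' j' c' where \<alpha>: "nd s k = (i, j, c)" and \<gamma>: "nd s (k + 2) = (i', j', c')"
    by (cases "nd s k", cases "nd s (k + 2)")
  let ?D = "dg s (k - 1)"
  have D1: "dg s k = toggle ?D (i, j, c)" and D2: "dg s (k + 1) = toggle (dg s k) (nd s (k + 1))"
    and D3: "dg s (k + 2) = toggle (dg s (k + 1)) (i', j', c')"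
    using dg_step[of s k] dg_step[of s "k + 1"] dg_step[of s "k + 2"] s \<alpha> \<gamma> by auto
  have "small (i, j, c)" "small (i', j', c')" using nd_small[of s k] nd_small[of s "k + 2"] s \<alpha> \<gamma> by auto
  moreover have "lab q u ?D (i, j, c) = q powi (2 * 0) * lab q u (dg s (k + 1)) (i', j', c')"
    using eq cont_tab_eq_lab[of s k] cont_tab_eq_lab[of s "k + 2"] s \<alpha> \<gamma> by simp
  ultimately have *: "(i, j, c) \<in> ?D \<longleftrightarrow> (i', j', c') \<in> dg s (k + 1)" "c = c'"
      "int j - int i = int j' - int i'"
    using lab_eq[of i j c i' j' c' 0] by simp_all
  have "nd s (k + 1) = (i, j, c)"
  proof (rule toggle_same_diagonal_twice[of r ?D])
    show "node_ideal r ?D" "node_ideal r (toggle ?D (i, j, c))"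
      "node_ideal r (toggle (toggle ?D (i, j, c)) (nd s (k + 1)))"
      "node_ideal r (toggle (toggle (toggle ?D (i, j, c)) (nd s (k + 1))) (i', j', c))"
      using dg_ideal[of s "k - 1"] dg_ideal[of s k] dg_ideal[of s "k + 1"] dg_ideal[of s "k + 2"]
        s D1 D2 D3 *(2) by auto
    show "int j - int i = int j' - int i'" by (rule *(3))
    show "(i, j, c) \<in> ?D \<longleftrightarrow> (i', j', c) \<in> toggle (toggle ?D (i, j, c)) (nd s (k + 1))"
      using * D1 D2 by simp
  qed
  then have "dg s (k + 1) = ?D" using D1 D2 by simp
  then show ?thesis by (simp add: dg_eq_iff)
qed

lemma finite_TT: "finite TT"
proof -
  let ?B = "{1..n} \<times> {1..n} \<times> {1..r}"
  let ?M = "{\<nu>. diagram \<nu> \<subseteq> ?B}"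
  have "finite (diagram ` ?M)" by (rule finite_subset[of _ "Pow ?B"]) auto
  then have "finite ?M" by (rule finite_imageD) (auto intro: inj_onI diagram_inj)
  then have "finite {xs. set xs \<subseteq> ?M \<and> length xs = n + 1}" by (rule finite_lists_length_eq)
  moreover have "TT \<subseteq> {xs. set xs \<subseteq> ?M \<and> length xs = n + 1}"
  proof
    fix s assume s: "s \<in> TT"
    have "diagram \<nu> \<subseteq> ?B" if "\<nu> \<in> set s" for \<nu>
    proof -
      obtain k where k: "\<nu> = s ! k" "k \<le> n"
        using \<open>\<nu> \<in> set s\<close> tab_length[OF s] by (metis Suc_eq_plus1 in_set_conv_nth less_Suc_eq_le)
      have D: "node_ideal r (dg s k)" "card (dg s k) \<le> n" using s k dg_ideal card_dg by fastforce+
      show ?thesis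
      proof
        fix x assume x: "x \<in> diagram \<nu>"
        obtain i j c where ijc: "x = (i, j, c)" by (cases x)
        then have "(i, j, c) \<in> dg s k" using x k by (simp add: dg_def)
        then show "x \<in> ?B" using node_ideal_card_bounds[OF D(1)] node_ideal_pos[OF D(1)] D(2) ijc by fastforce
      qed
    qed
    then show "s \<in> {xs. set xs \<subseteq> ?M \<and> length xs = n + 1}" using tab_length[OF s] by auto
  qed
  ultimately show ?thesis by (rule rev_finite_subset)
qed

text \<open>If the path returns, the vertex in between may be any neighbour of
  \<open>s ! (k - 1)\<close>. This turns sums over a block into sums over the poles of W_k.\<close>

lemma bij_labels:
  assumes s: "s \<in> TT" "1 \<le> k" "k < n" and st: "stays k s"
  shows "bij_betw (\<lambda>t. cc t k) {t \<in> TT. ksim k t s}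
    (lab q u (dg s (k - 1)) ` (addable r (s ! (k - 1)) \<union> removable r (s ! (k - 1))))"
proof (rule bij_betw_imageI)
  let ?D = "dg s (k - 1)" and ?N = "addable r (s ! (k - 1)) \<union> removable r (s ! (k - 1))"
  have prev: "t ! (k - 1) = s ! (k - 1)" if "ksim k t s" "t \<in> TT" for t
    using ksim_nth[OF that, of "k - 1"] s by simp
  show "inj_on (\<lambda>t. cc t k) {t \<in> TT. ksim k t s}"
  proof (rule inj_onI)
    fix t t' assume t: "t \<in> {t \<in> TT. ksim k t s}" "t' \<in> {t \<in> TT. ksim k t s}" and eq: "cc t k = cc t' k"
    then have "t ! (k - 1) = t' ! (k - 1)" using prev[of t] prev[of t'] by simp
    then have "t ! k = t' ! k" using cc_eq_imp[of t t' k] t eq s by simp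
    moreover have "ksim k t t'" using t ksim_sym ksim_trans by blast
    ultimately show "t = t'" using ksim_eqI t by blast
  qed
  show "(\<lambda>t. cc t k) ` {t \<in> TT. ksim k t s} = lab q u ?D ` ?N"
  proof (intro equalityI subsetI)
    fix c assume "c \<in> (\<lambda>t. cc t k) ` {t \<in> TT. ksim k t s}"
    then obtain t where t: "t \<in> TT" "ksim k t s" "c = cc t k" by auto
    have D: "dg t (k - 1) = ?D" using prev[of t] t by (simp add: dg_eq_iff)
    have "nd t k \<in> ?N"
      using dg_step[of t k] dg_ideal[of t k] t s D unfolding addable_removable_iff by (simp add: dg_def)
    then show "c \<in> lab q u ?D ` ?N" using cont_tab_eq_lab[of t k] t s D by auto
  next
    fix c assume "c \<in> lab q u ?D ` ?N"
    then obtain \<alpha> where \<alpha>: "\<alpha> \<in> ?N" "c = lab q u ?D \<alpha>" by auto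
    then have id: "node_ideal r (toggle ?D \<alpha>)" unfolding addable_removable_iff by (simp add: dg_def)
    obtain \<nu> where \<nu>: "diagram \<nu> = toggle ?D \<alpha>" using node_ideal_diagram[OF id] .
    have "dg s (k + 1) = toggle (diagram \<nu>) \<alpha>" using st \<nu> by (simp add: dg_def)
    note up = update_tab[OF s id[folded \<nu>] \<nu> this]
    have "cc (s[k := \<nu>]) k = c"
      using cont_tab_eq_lab[OF up(1), of k] up(4) ksim_nth[OF up(2) s(1), of "k - 1"] s \<alpha>
      by (simp add: dg_def)
    then show "c \<in> (\<lambda>t. cc t k) ` {t \<in> TT. ksim k t s}" using up ksim_sym by blast
  qed
qed

lemma replace_by_neighbour:
  assumes s: "s \<in> TT" "1 \<le> k" "k < n" and st: "stays k s"
    and \<nu>: "is_rpart r \<nu>" "\<exists>\<alpha>. differ_by \<alpha> (s ! (k + 1)) \<nu>"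
  obtains t where "t \<in> TT" "ksim k t s" "t ! k = \<nu>"
proof -
  obtain \<alpha> where \<alpha>: "diagram \<nu> = toggle (dg s (k + 1)) \<alpha>" using \<nu>(2) by (auto simp: differ_by_iff dg_def)
  have "diagram \<nu> = toggle (dg s (k - 1)) \<alpha>" "dg s (k + 1) = toggle (diagram \<nu>) \<alpha>"
    using \<alpha> st by (simp_all add: dg_def)
  note up = update_tab[OF s \<nu>(1)[unfolded is_rpart_iff] this]
  show thesis using that up ksim_sym by blast
qed

end

section \<open>Linear algebra on finitely supported functions\<close>

lemma lookup_smul [simp]: "Poly_Mapping.lookup (smul c v) s = c * Poly_Mapping.lookup v s"
  by (simp add: smul_def map.rep_eq when_def)

lemma smul_simps:
  "smul c (v + w) = smul c v + smul c w" "smul c (v - w) = smul c v - smul c w"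
  "smul c (- v) = - smul c v" "smul c 0 = 0"
  "smul (c + d) v = smul c v + smul d v" "smul (c - d) v = smul c v - smul d v"
  "smul c (smul d v) = smul (c * d) v" "smul 1 v = v" "smul 0 v = 0" "smul (- c) v = - smul c v"
  by (rule poly_mapping_eqI; simp add: algebra_simps lookup_add lookup_minus)+

lemma smul_sum: "smul c (\<Sum>x\<in>A. f x) = (\<Sum>x\<in>A. smul c (f x))"
  by (induction A rule: infinite_finite_induct) (simp_all add: smul_simps)

lemma lookup_bvec: "Poly_Mapping.lookup (bvec s) t = (if s = t then 1 else 0)"
  by (simp add: bvec_def lookup_single when_def)

lemma free_space_iff: "v \<in> free_space S \<longleftrightarrow> (\<forall>s. s \<notin> S \<longrightarrow> Poly_Mapping.lookup v s = 0)"
  by (auto simp: free_space_def in_keys_iff)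

lemma free_space_closed:
  "0 \<in> free_space S" "v \<in> free_space S \<Longrightarrow> w \<in> free_space S \<Longrightarrow> v + w \<in> free_space S"
  "v \<in> free_space S \<Longrightarrow> w \<in> free_space S \<Longrightarrow> v - w \<in> free_space S"
  "v \<in> free_space S \<Longrightarrow> smul c v \<in> free_space S"
  "s \<in> S \<Longrightarrow> bvec s \<in> free_space S"
  by (auto simp: free_space_iff lookup_add lookup_minus lookup_bvec)

lemma free_space_sum: "(\<And>x. x \<in> A \<Longrightarrow> f x \<in> free_space S) \<Longrightarrow> (\<Sum>x\<in>A. f x) \<in> free_space S"
  by (induction A rule: infinite_finite_induct) (auto intro: free_space_closed)

lemma poly_mapping_eq_sum_single:
  assumes "finite S" "Poly_Mapping.keys p \<subseteq> S"
  shows "p = (\<Sum>w\<in>S. Poly_Mapping.single w (Poly_Mapping.lookup p w))"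
proof (rule poly_mapping_eqI)
  fix x
  show "Poly_Mapping.lookup p x = Poly_Mapping.lookup (\<Sum>w\<in>S. Poly_Mapping.single w (Poly_Mapping.lookup p w)) x"
    using assms by (auto simp: lookup_sum lookup_single when_def in_keys_iff)
qed

lemma free_space_expand:
  assumes "finite S" "v \<in> free_space S"
  shows "v = (\<Sum>s\<in>S. smul (Poly_Mapping.lookup v s) (bvec s))"
proof (rule poly_mapping_eqI)
  fix x
  have "(\<Sum>s\<in>S. Poly_Mapping.lookup v s * Poly_Mapping.lookup (bvec s) x) =
      (\<Sum>s\<in>S. if s = x then Poly_Mapping.lookup v x else 0)"
    by (rule sum.cong) (auto simp: lookup_bvec)
  then show "Poly_Mapping.lookup v x = Poly_Mapping.lookup (\<Sum>s\<in>S. smul (Poly_Mapping.lookup v s) (bvec s)) x"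
    using assms by (auto simp: lookup_sum free_space_iff)
qed

definition linear_map :: "(('s \<Rightarrow>\<^sub>0 'a::field) \<Rightarrow> ('s \<Rightarrow>\<^sub>0 'a)) \<Rightarrow> bool"
  where "linear_map F \<longleftrightarrow> (\<forall>v w. F (v + w) = F v + F w) \<and> (\<forall>c v. F (smul c v) = smul c (F v))"

lemma linear_mapD:
  assumes "linear_map F"
  shows "F (v + w) = F v + F w" "F (smul c v) = smul c (F v)" "F 0 = 0" "F (- v) = - F v" "F (v - w) = F v - F w"
proof -
  show a: "F (v + w) = F v + F w" "F (smul c v) = smul c (F v)" for v w c
    using assms by (auto simp: linear_map_def)
  show "F 0 = 0" using a(2)[of 0 0] by (simp add: smul_simps)
  show m: "F (- v) = - F v" for v using a(2)[of "- 1" v] by (simp add: smul_simps)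
  show "F (v - w) = F v - F w" using a(1)[of v "- w"] m by simp
qed

lemma linear_map_sum: "linear_map F \<Longrightarrow> F (\<Sum>x\<in>A. f x) = (\<Sum>x\<in>A. F (f x))"
  by (induction A rule: infinite_finite_induct) (simp_all add: linear_mapD)

lemma linear_map_eq_on:
  assumes "linear_map F" "linear_map G" "finite S" "\<And>s. s \<in> S \<Longrightarrow> F (bvec s) = G (bvec s)" "v \<in> free_space S"
  shows "F v = G v"
  by (subst (1 2) free_space_expand[OF assms(3,5)])
    (simp add: linear_map_sum[OF assms(1)] linear_map_sum[OF assms(2)] linear_mapD[OF assms(1)]
      linear_mapD[OF assms(2)] assms(4))

section \<open>Modules from operators satisfying the relations\<close>

locale word_action =
  fixes F :: "bmw_gen \<Rightarrow> ('s \<Rightarrow>\<^sub>0 'a::field) \<Rightarrow> ('s \<Rightarrow>\<^sub>0 'a)"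
  assumes lin: "\<And>g. linear_map (F g)"
begin

definition wact :: "bmw_gen free_word \<Rightarrow> ('s \<Rightarrow>\<^sub>0 'a) \<Rightarrow> ('s \<Rightarrow>\<^sub>0 'a)"
  where "wact w v = foldr F (letters w) v"

definition act0 :: "'a bmw_free \<Rightarrow> ('s \<Rightarrow>\<^sub>0 'a) \<Rightarrow> ('s \<Rightarrow>\<^sub>0 'a)"
  where "act0 p v = (\<Sum>w\<in>Poly_Mapping.keys p. smul (Poly_Mapping.lookup p w) (wact w v))"

lemma linear_wact: "linear_map (wact w)"
proof -
  have "linear_map (foldr F gs)" for gs
    by (induction gs) (auto simp: linear_map_def linear_mapD[OF lin])
  then show ?thesis by (simp add: linear_map_def wact_def)
qed

lemma wact_add: "wact (x + y) v = wact x (wact y v)"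
  by (simp add: wact_def plus_free_word_def)

lemma wact_0: "wact 0 v = v"
  by (simp add: wact_def zero_free_word_def)

lemma act0_superset:
  assumes "finite S" "Poly_Mapping.keys p \<subseteq> S"
  shows "act0 p v = (\<Sum>w\<in>S. smul (Poly_Mapping.lookup p w) (wact w v))"
  unfolding act0_def using assms
  by (intro sum.mono_neutral_left) (auto simp: in_keys_iff smul_simps)

lemma linear_act0: "linear_map (act0 p)"
  by (simp add: linear_map_def act0_def linear_mapD[OF linear_wact] smul_simps sum.distrib smul_sum mult.commute)

lemma act0_add: "act0 (p + p') v = act0 p v + act0 p' v"
proof -
  let ?S = "Poly_Mapping.keys p \<union> Poly_Mapping.keys p'"
  have "Poly_Mapping.keys (p + p') \<subseteq> ?S" by (rule keys_add)
  then show ?thesis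
    by (subst (1 2 3) act0_superset[of ?S]) (auto simp: lookup_add smul_simps sum.distrib)
qed

lemma act0_0: "act0 0 v = 0"
  by (simp add: act0_def)

lemma act0_uminus: "act0 (- p) v = - act0 p v"
  using act0_add[of p "- p" v] by (simp add: act0_0 eq_neg_iff_add_eq_0 add.commute)

lemma act0_diff: "act0 (p - p') v = act0 p v - act0 p' v"
  using act0_add[of p "- p'" v] by (simp add: act0_uminus)

lemma act0_sum: "act0 (\<Sum>x\<in>A. f x) v = (\<Sum>x\<in>A. act0 (f x) v)"
  by (induction A rule: infinite_finite_induct) (simp_all add: act0_add act0_0)

lemma act0_single: "act0 (Poly_Mapping.single w c) v = smul c (wact w v)"
  by (subst act0_superset[of "{w}"]) (auto simp: in_keys_iff lookup_single when_def split: if_splits)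

lemma act0_mult: "act0 (p * p') v = act0 p (act0 p' v)"
proof -
  let ?K = "Poly_Mapping.keys p" and ?K' = "Poly_Mapping.keys p'"
  have "p * p' = (\<Sum>w\<in>?K. Poly_Mapping.single w (Poly_Mapping.lookup p w)) *
      (\<Sum>w\<in>?K'. Poly_Mapping.single w (Poly_Mapping.lookup p' w))"
    by (simp flip: poly_mapping_eq_sum_single)
  also have "\<dots> = (\<Sum>w\<in>?K. \<Sum>w'\<in>?K'. Poly_Mapping.single (w + w') (Poly_Mapping.lookup p w * Poly_Mapping.lookup p' w'))"
    by (simp add: sum_product mult_single)
  finally have "act0 (p * p') v =
      (\<Sum>w\<in>?K. \<Sum>w'\<in>?K'. smul (Poly_Mapping.lookup p w * Poly_Mapping.lookup p' w') (wact w (wact w' v)))"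
    by (simp add: act0_sum act0_single wact_add)
  then show ?thesis
    by (simp add: act0_def linear_map_sum[OF linear_wact] linear_mapD[OF linear_wact] smul_sum smul_simps)
qed

lemma act0_1: "act0 1 v = v"
  using act0_single[of 0 1 v] by (simp add: wact_0 smul_simps)

lemma act0_scal: "act0 (scal c) v = smul c v"
  by (simp add: scal_def act0_single wact_0)

lemma act0_gen: "act0 (gen g) v = F g v"
  by (simp add: gen_def act0_single wact_def smul_simps)

lemma act0_power: "act0 (p ^ k) v = (act0 p ^^ k) v"
  by (induction k) (simp_all add: act0_1 act0_mult)

lemmas act0_simps = act0_add act0_diff act0_mult act0_1 act0_0 act0_scal act0_gen

lemma act0_free_space:
  assumes "\<And>g v. g \<in> bmw_gens n \<Longrightarrow> v \<in> free_space S \<Longrightarrow> F g v \<in> free_space S"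
    and "p \<in> carrier (free_alg n)" and "v \<in> free_space S"
  shows "act0 p v \<in> free_space S"
  unfolding act0_def
proof (intro free_space_sum free_space_closed)
  fix w assume "w \<in> Poly_Mapping.keys p"
  then have "set (letters w) \<subseteq> bmw_gens n" using assms(2) by (auto simp: free_alg_def)
  moreover have "set gs \<subseteq> bmw_gens n \<Longrightarrow> foldr F gs v \<in> free_space S" for gs
    by (induction gs) (auto intro: assms(1,3))
  ultimately show "wact w v \<in> free_space S" by (simp add: wact_def)
qed

end

lemma carrier_free_alg: "p \<in> carrier (free_alg n) \<longleftrightarrow> (\<forall>w \<in> Poly_Mapping.keys p. set (letters w) \<subseteq> bmw_gens n)"
  by (simp add: free_alg_def)

lemma free_alg_closed:
  "0 \<in> carrier (free_alg n)" "1 \<in> carrier (free_alg n)" "scal c \<in> carrier (free_alg n)"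
  "g \<in> bmw_gens n \<Longrightarrow> gen g \<in> carrier (free_alg n)"
  "p \<in> carrier (free_alg n) \<Longrightarrow> p' \<in> carrier (free_alg n) \<Longrightarrow> p + p' \<in> carrier (free_alg n)"
  "p \<in> carrier (free_alg n) \<Longrightarrow> - p \<in> carrier (free_alg n)"
  "p \<in> carrier (free_alg n) \<Longrightarrow> p' \<in> carrier (free_alg n) \<Longrightarrow> p - p' \<in> carrier (free_alg n)"
  "p \<in> carrier (free_alg n) \<Longrightarrow> p' \<in> carrier (free_alg n) \<Longrightarrow> p * p' \<in> carrier (free_alg n)"
proof -
  show "0 \<in> carrier (free_alg n)" by (simp add: carrier_free_alg)
  show s: "scal c \<in> carrier (free_alg n)" for c
    by (auto simp: carrier_free_alg scal_def zero_free_word_def)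
  show "1 \<in> carrier (free_alg n)" using s[of 1] by (simp add: scal_def)
  show "g \<in> bmw_gens n \<Longrightarrow> gen g \<in> carrier (free_alg n)"
    by (auto simp: carrier_free_alg gen_def)
  show add: "p \<in> carrier (free_alg n) \<Longrightarrow> p' \<in> carrier (free_alg n) \<Longrightarrow> p + p' \<in> carrier (free_alg n)" for p p'
    unfolding carrier_free_alg using keys_add[of p p'] by blast
  show neg: "p \<in> carrier (free_alg n) \<Longrightarrow> - p \<in> carrier (free_alg n)" for p
    by (simp add: carrier_free_alg)
  show "p \<in> carrier (free_alg n) \<Longrightarrow> p' \<in> carrier (free_alg n) \<Longrightarrow> p - p' \<in> carrier (free_alg n)"
    using add[of p "- p'"] neg[of p'] by simp
  show "p \<in> carrier (free_alg n) \<Longrightarrow> p' \<in> carrier (free_alg n) \<Longrightarrow> p * p' \<in> carrier (free_alg n)"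
    unfolding carrier_free_alg using keys_mult[of p p'] by (fastforce simp: plus_free_word_def)
qed

lemma free_alg_ops [simp]:
  "x \<oplus>\<^bsub>free_alg n\<^esub> y = x + y" "x \<otimes>\<^bsub>free_alg n\<^esub> y = x * y" "\<zero>\<^bsub>free_alg n\<^esub> = 0" "\<one>\<^bsub>free_alg n\<^esub> = 1"
  by (simp_all add: free_alg_def)

lemma ring_free_alg: "ring (free_alg n)"
proof (rule ringI)
  show "abelian_group (free_alg n)"
  proof (rule abelian_groupI)
    fix x assume "x \<in> carrier (free_alg n)"
    then show "\<exists>y\<in>carrier (free_alg n). y \<oplus>\<^bsub>free_alg n\<^esub> x = \<zero>\<^bsub>free_alg n\<^esub>"
      by (intro bexI[of _ "- x"]) (simp_all add: free_alg_closed)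
  qed (simp_all add: free_alg_closed add_ac)
  show "monoid (free_alg n)"
    by (rule monoidI) (simp_all add: free_alg_closed mult.assoc)
qed (simp_all add: algebra_simps)

lemma free_alg_a_inv: "x \<in> carrier (free_alg n) \<Longrightarrow> \<ominus>\<^bsub>free_alg n\<^esub> x = - x"
  by (rule abelian_group.minus_equality[OF ring.is_abelian_group[OF ring_free_alg]])
    (simp_all add: free_alg_closed)

lemma free_alg_power: "p \<in> carrier (free_alg n) \<Longrightarrow> p ^ k \<in> carrier (free_alg n)"
  by (induction k) (simp_all add: free_alg_closed)

lemma gens_in_carrier:
  "i \<in> {1..<n} \<Longrightarrow> gT i \<in> carrier (free_alg n)" "i \<in> {1..<n} \<Longrightarrow> gE i \<in> carrier (free_alg n)"
  "i \<in> {1..n} \<Longrightarrow> gX i \<in> carrier (free_alg n)" "i \<in> {1..n} \<Longrightarrow> gXinv i \<in> carrier (free_alg n)"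
  by (auto intro!: free_alg_closed simp: bmw_gens_def)

lemma rels_in_carrier:
  assumes "(x, y) \<in> bmw_rels r n q u \<rho> \<omega>" "n \<ge> 1"
  shows "x \<in> carrier (free_alg n)" "y \<in> carrier (free_alg n)"
proof -
  have pl: "prod_list (map (\<lambda>l. gX 1 - scal (u l)) xs) \<in> carrier (free_alg n)" for xs :: "nat list"
    using assms(2) by (induction xs) (auto intro!: free_alg_closed gens_in_carrier)
  have "x \<in> carrier (free_alg n) \<and> y \<in> carrier (free_alg n)"
    using assms(1)
    by (cases rule: bmw_rels.cases)
      (auto intro!: free_alg_closed(1-3,5-) free_alg_power gens_in_carrier pl[unfolded One_nat_def] simp: gXpow_def power2_eq_square assms(2)[unfolded One_nat_def] simp del: upt_Suc)
  then show "x \<in> carrier (free_alg n)" "y \<in> carrier (free_alg n)" by auto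
qed

context word_action
begin

text \<open>The elements that act by zero form a two-sided ideal; closure under multiplication from
  the right uses that the generators preserve the space. It contains the differences of related
  elements, hence the ideal generated by them.\<close>

theorem module_of_relations:
  assumes n: "n \<ge> 1"
    and inv: "\<And>g v. g \<in> bmw_gens n \<Longrightarrow> v \<in> free_space S \<Longrightarrow> F g v \<in> free_space S"
    and rels: "\<And>x y v. (x, y) \<in> bmw_rels r n q u \<rho> \<omega> \<Longrightarrow> v \<in> free_space S \<Longrightarrow> act0 x v = act0 y v"
  shows "\<exists>act. left_module_on (cyc_bmw r n q u \<rho> \<omega>) (\<lambda>c. bmw_class r n q u \<rho> \<omega> (scal c)) (free_space S) smul act \<and>
    (\<forall>x \<in> carrier (free_alg n). \<forall>v \<in> free_space S. act (bmw_class r n q u \<rho> \<omega> x) v = act0 x v)"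
proof -
  let ?A = "free_alg n :: 'a bmw_free ring"
  define J where "J = {p \<in> carrier ?A. \<forall>v\<in>free_space S. act0 p v = 0}"
  define I where "I = bmw_ideal r n q u \<rho> \<omega>"
  let ?R = "{x - y | x y. (x, y) \<in> bmw_rels r n q u \<rho> \<omega>}"
  interpret A: ring ?A by (rule ring_free_alg)
  have R: "?R \<subseteq> carrier ?A" using rels_in_carrier n by (auto intro!: free_alg_closed(7))
  interpret I: ideal I ?A
    unfolding I_def bmw_ideal_def by (rule A.genideal_ideal[OF R])
  have afs: "act0 p v \<in> free_space S" if "p \<in> carrier ?A" "v \<in> free_space S" for p v
    by (rule act0_free_space[OF inv that])
  have "ideal J ?A"
  proof (rule idealI[OF ring_free_alg])
    show "subgroup J (add_monoid ?A)"
    proof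
      fix x assume x: "x \<in> J"
      then have "inv\<^bsub>add_monoid ?A\<^esub> x = - x"
        using free_alg_a_inv[of x n] by (simp add: a_inv_def J_def)
      then show "inv\<^bsub>add_monoid ?A\<^esub> x \<in> J" using x by (simp add: J_def free_alg_closed act0_uminus)
    qed (auto simp: J_def free_alg_closed act0_simps)
    fix a x assume a: "a \<in> J" "x \<in> carrier ?A"
    show "x \<otimes>\<^bsub>?A\<^esub> a \<in> J"
      using a by (simp add: J_def free_alg_closed act0_simps linear_mapD[OF linear_act0])
    show "a \<otimes>\<^bsub>?A\<^esub> x \<in> J"
      using a by (simp add: afs J_def free_alg_closed act0_simps)
  qed
  moreover have "?R \<subseteq> J" using R rels by (auto simp: J_def act0_diff)
  ultimately have IJ: "I \<subseteq> J" unfolding I_def bmw_ideal_def by (rule A.genideal_minimal)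
  \<comment> \<open>Any representative will do: two of them differ by an element of
    \<open>I\<close>, which acts by zero.\<close>
  define act where "act = (\<lambda>C v. act0 (SOME x. x \<in> C) v)"
  have cls: "bmw_class r n q u \<rho> \<omega> x = I +>\<^bsub>?A\<^esub> x" for x by (simp add: bmw_class_def I_def)
  have act: "act (I +>\<^bsub>?A\<^esub> x) v = act0 x v" if "x \<in> carrier ?A" "v \<in> free_space S" for x v
  proof -
    define y where "y = (SOME y. y \<in> I +>\<^bsub>?A\<^esub> x)"
    have "y \<in> I +>\<^bsub>?A\<^esub> x" unfolding y_def by (rule someI) (rule I.a_rcos_self[OF that(1)])
    then obtain z where z: "z \<in> I" "y = z + x" by (auto simp: a_r_coset_def r_coset_def)
    then have "act0 z v = 0" using IJ that(2) by (auto simp: J_def)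
    then show ?thesis by (simp add: act_def y_def[symmetric] z(2) act0_add)
  qed
  have car: "carrier (cyc_bmw r n q u \<rho> \<omega>) = (\<lambda>x. I +>\<^bsub>?A\<^esub> x) ` carrier ?A"
    unfolding cyc_bmw_def I_def[symmetric] FactRing_def A_RCOSETS_def' by auto
  have ops: "(I +>\<^bsub>?A\<^esub> x) \<oplus>\<^bsub>cyc_bmw r n q u \<rho> \<omega>\<^esub> (I +>\<^bsub>?A\<^esub> y) = I +>\<^bsub>?A\<^esub> (x + y)"
      "(I +>\<^bsub>?A\<^esub> x) \<otimes>\<^bsub>cyc_bmw r n q u \<rho> \<omega>\<^esub> (I +>\<^bsub>?A\<^esub> y) = I +>\<^bsub>?A\<^esub> (x * y)"
    if "x \<in> carrier ?A" "y \<in> carrier ?A" for x y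
    using I.rcoset_mult_add[OF that] I.a_rcos_sum[OF that]
    by (simp_all add: cyc_bmw_def I_def[symmetric] FactRing_def)
  have one: "\<one>\<^bsub>cyc_bmw r n q u \<rho> \<omega>\<^esub> = I +>\<^bsub>?A\<^esub> 1"
    by (simp add: cyc_bmw_def I_def[symmetric] FactRing_def)
  have "left_module_on (cyc_bmw r n q u \<rho> \<omega>) (\<lambda>c. bmw_class r n q u \<rho> \<omega> (scal c)) (free_space S) smul act"
    unfolding left_module_on_def car cls one
    by (auto simp: afs ops act free_alg_closed free_space_closed act0_simps linear_mapD[OF linear_act0])
  then show ?thesis using act by (auto simp: cls)
qed

end

section \<open>Matrices of a single block\<close>

text \<open>A single block of the action of \<open>E\<^sub>k\<close> and \<open>T\<^sub>k\<close>: here \<open>E = e e\<^sup>T\<close> has rank one and, for the diagonal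
  matrix \<open>D\<close> of contents, \<open>T\<close> is the solution of \<open>D T D - T = \<delta> (E - 1)\<close>. With \<open>T' = D T D\<close> the
  matrices \<open>T T' = (T D T) D\<close> and \<open>T' T = D (T D T)\<close> agree; so \<open>T D T\<close> is diagonal, and it is determined by
  its value on \<open>e\<close>.\<close>

locale rank_one_block =
  fixes B :: "'b set" and c e :: "'b \<Rightarrow> 'a::field" and \<delta> \<rho> :: 'a
  assumes fin: "finite B" and c_mult: "\<And>x y. x \<in> B \<Longrightarrow> y \<in> B \<Longrightarrow> c x * c y \<noteq> 1"
    and c_inj: "inj_on c B" and e_nz: "\<And>x. x \<in> B \<Longrightarrow> e x \<noteq> 0"
    and \<delta>: "\<delta> \<noteq> 0" and \<rho>: "\<rho> \<noteq> 0"
    and sum_e: "(\<Sum>y\<in>B. (e y)\<^sup>2) = 1 - inverse \<delta> * (\<rho> - inverse \<rho>)"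
    and sum_frac: "\<And>x. x \<in> B \<Longrightarrow>
      (\<Sum>y\<in>B. (e y)\<^sup>2 / (c x * c y - 1)) = 1 / ((c x)\<^sup>2 - 1) + inverse \<delta> * \<rho>"
begin

definition tt :: "'b \<Rightarrow> 'b \<Rightarrow> 'a"
  where "tt x y = \<delta> * ((e x * e y - (if x = y then 1 else 0)) / (c x * c y - 1))"

lemma tt_sym: "tt x y = tt y x"
  by (simp add: tt_def mult.commute eq_commute)

lemma tt_conj: "x \<in> B \<Longrightarrow> y \<in> B \<Longrightarrow>
    c x * tt x y * c y = tt x y + \<delta> * (e x * e y - (if x = y then 1 else 0))"
  using c_mult[of x y] unfolding tt_def by (simp add: field_simps)

text \<open>The identity matrix in \<open>E - 1\<close> contributes the summand
  \<open>1 / ((c x)^2 - 1)\<close> of \<open>sum_frac\<close> with the opposite sign, so only the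
  one with \<rho> survives.\<close>

lemma tt_e: "x \<in> B \<Longrightarrow> (\<Sum>y\<in>B. tt x y * e y) = \<rho> * e x"
proof -
  assume x: "x \<in> B"
  have "(\<Sum>y\<in>B. tt x y * e y) = (\<Sum>y\<in>B. \<delta> * e x * ((e y)\<^sup>2 / (c x * c y - 1)) -
      (if x = y then \<delta> * e x / ((c x)\<^sup>2 - 1) else 0))"
    by (rule sum.cong) (auto simp: tt_def power2_eq_square diff_divide_distrib left_diff_distrib right_diff_distrib)
  also have "\<dots> = \<delta> * e x * (\<Sum>y\<in>B. (e y)\<^sup>2 / (c x * c y - 1)) - \<delta> * e x / ((c x)\<^sup>2 - 1)"
    using x fin by (simp add: sum_subtractf sum_distrib_left)
  also have "\<dots> = \<rho> * e x"
    unfolding sum_frac[OF x] using \<delta> by (simp add: distrib_left)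
  finally show ?thesis .
qed

lemma sum_mult_delta:
  fixes f :: "'b \<Rightarrow> 'a"
  shows "z \<in> B \<Longrightarrow> (\<Sum>y\<in>B. f y * (if y = z then 1 else 0)) = f z"
proof -
  have "(\<Sum>y\<in>B. f y * (if y = z then 1 else 0)) = (\<Sum>y\<in>B. if y = z then f z else 0)"
    by (rule sum.cong) auto
  then show "z \<in> B \<Longrightarrow> (\<Sum>y\<in>B. f y * (if y = z then 1 else 0)) = f z" using fin by simp
qed

lemma tt_square:
  assumes x: "x \<in> B" and z: "z \<in> B"
  shows "(\<Sum>y\<in>B. tt x y * tt y z) = (if x = z then 1 else 0) + \<delta> * tt x z - \<delta> * \<rho> * (e x * e z)"
proof -
  \<comment> \<open>The matrix \<open>T D T\<close>; by \<open>tt_conj\<close>, its product with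
    \<open>D\<close> is \<open>T^2 - \<delta> T + \<delta> \<rho> E\<close>.\<close>
  define S where "S = (\<lambda>x z. \<Sum>y\<in>B. tt x y * c y * tt y z)"
  have L: "S x z * c z = (\<Sum>y\<in>B. tt x y * tt y z) - \<delta> * tt x z + \<delta> * \<rho> * (e x * e z)"
    if x: "x \<in> B" and z: "z \<in> B" for x z
  proof -
    have "S x z * c z = (\<Sum>y\<in>B. tt x y * (c y * tt y z * c z))"
      by (simp add: S_def sum_distrib_right mult.assoc)
    also have "\<dots> = (\<Sum>y\<in>B. tt x y * (tt y z + \<delta> * (e y * e z - (if y = z then 1 else 0))))"
      using z by (intro sum.cong) (simp_all only: tt_conj)
    also have "\<dots> = (\<Sum>y\<in>B. tt x y * tt y z + \<delta> * e z * (tt x y * e y) - \<delta> * (tt x y * (if y = z then 1 else 0)))"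
      by (rule sum.cong) (simp_all add: algebra_simps)
    also have "\<dots> = (\<Sum>y\<in>B. tt x y * tt y z) + \<delta> * e z * (\<rho> * e x) - \<delta> * tt x z"
      using sum_mult_delta[OF z, of "tt x"] tt_e[OF x]
      by (simp add: sum_subtractf sum.distrib flip: sum_distrib_left)
    finally show ?thesis by (simp add: algebra_simps)
  qed
  have S_sym: "S x z = S z x" for x z
    unfolding S_def by (rule sum.cong) (simp_all add: tt_sym[of x] tt_sym[of _ z] mult_ac)
  \<comment> \<open>That matrix is symmetric, so \<open>S\<close> commutes with \<open>D\<close>,
    whose entries are distinct.\<close>
  have comm: "S x z * c z = S x z * c x" if "x \<in> B" "z \<in> B" for x z
  proof -
    have "(\<Sum>y\<in>B. tt x y * tt y z) = (\<Sum>y\<in>B. tt z y * tt y x)"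
      by (rule sum.cong) (simp_all add: tt_sym[of x] tt_sym[of _ z] mult_ac)
    then have "S x z * c z = S z x * c x" using L[of x z] L[of z x] that tt_sym[of x z] by (simp add: mult.commute)
    then show ?thesis using S_sym by simp
  qed
  have S0: "S x z = 0" if "x \<in> B" "z \<in> B" "x \<noteq> z" for x z
  proof -
    have "S x z * (c z - c x) = 0" using comm[OF that(1,2)] by (simp add: algebra_simps)
    moreover have "c z \<noteq> c x" using c_inj that by (auto simp: inj_on_def)
    ultimately show ?thesis by simp
  qed
  have diag: "S x x * c x = 1" if x: "x \<in> B" for x
  proof -
    have "S x x * c x * e x = (\<Sum>z\<in>B. if z = x then S x x * c x * e x else 0)"
      using x fin by simp
    also have "\<dots> = (\<Sum>z\<in>B. S x z * c z * e z)"
      using x S0 by (intro sum.cong) auto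
    also have "\<dots> = (\<Sum>z\<in>B. (\<Sum>y\<in>B. tt x y * (tt y z * e z)) - \<delta> * (tt x z * e z) + \<delta> * \<rho> * e x * (e z)\<^sup>2)"
    proof (rule sum.cong[OF refl])
      fix z assume "z \<in> B"
      from L[OF x this] show "S x z * c z * e z =
          (\<Sum>y\<in>B. tt x y * (tt y z * e z)) - \<delta> * (tt x z * e z) + \<delta> * \<rho> * e x * (e z)\<^sup>2"
        by (simp only: left_diff_distrib distrib_right sum_distrib_right mult.assoc power2_eq_square)
    qed
    also have "\<dots> = (\<Sum>y\<in>B. tt x y * (\<Sum>z\<in>B. tt y z * e z)) - \<delta> * (\<rho> * e x) + \<delta> * \<rho> * e x * (\<Sum>z\<in>B. (e z)\<^sup>2)"
      using x by (simp add: sum_subtractf sum.distrib tt_e sum.swap[of _ B B] flip: sum_distrib_left)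
    also have "(\<Sum>y\<in>B. tt x y * (\<Sum>z\<in>B. tt y z * e z)) = (\<Sum>y\<in>B. \<rho> * (tt x y * e y))"
      by (rule sum.cong) (simp_all add: tt_e)
    also have "\<dots> = \<rho> * (\<rho> * e x)"
      using x by (simp add: tt_e flip: sum_distrib_left)
    \<comment> \<open>The sum in \<open>sum_e\<close> has the value that makes
      \<open>\<rho>^2 - \<delta> * \<rho> + \<delta> * \<rho> * sum\<close> equal to 1.\<close>
    also have "\<rho> * (\<rho> * e x) - \<delta> * (\<rho> * e x) + \<delta> * \<rho> * e x * (\<Sum>z\<in>B. (e z)\<^sup>2) = e x"
      unfolding sum_e using \<delta> \<rho> by (simp add: field_simps)
    finally show ?thesis using e_nz[OF x] by simp
  qed
  have "S x z * c z = (if x = z then 1 else 0)"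
    using S0[OF x z] diag[OF x] by auto
  then show ?thesis using L[OF x z] by (simp add: algebra_simps)
qed

end

locale seminormal = updown_tableaux r n q u \<mu>
  for r n :: nat and q :: "'a::field" and u :: "nat \<Rightarrow> 'a" and \<mu> :: mpart +
  fixes \<rho> :: 'a and \<omega> :: "int \<Rightarrow> 'a" and sE b :: "nat \<Rightarrow> tab \<Rightarrow> 'a"
  assumes r1: "r \<ge> 1" and n1: "n \<ge> 1" and \<rho>0: "\<rho> \<noteq> 0"
    and \<omega>0: "\<omega> 0 = 1 - inverse (dlt q) * (\<rho> - inverse \<rho>)"
    and adm: "u_admissible r q u \<rho> \<omega>"
    and roots: "root_conditions r n q u \<rho> \<mu> sE b"
begin

text \<open>The first two facts say which elements the chosen roots square to; the other six are the
  root conditions (a) to (f), in this order.\<close>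

lemmas root_list = roots[unfolded root_conditions_def Let_def]
lemmas root_E = root_list[THEN conjunct1, rule_format]
lemmas root_b = root_list[THEN conjunct2, THEN conjunct1, rule_format]
lemmas root_swap = root_list[THEN conjunct2, THEN conjunct2, THEN conjunct1, rule_format]
lemmas root_far = root_list[THEN conjunct2, THEN conjunct2, THEN conjunct2, THEN conjunct1, rule_format]
lemmas root_braid = root_list[THEN conjunct2, THEN conjunct2, THEN conjunct2, THEN conjunct2, THEN conjunct1, rule_format]
lemmas root_inverse = root_list[THEN conjunct2, THEN conjunct2, THEN conjunct2, THEN conjunct2, THEN conjunct2, THEN conjunct1, rule_format]
lemmas root_eq = root_list[THEN conjunct2, THEN conjunct2, THEN conjunct2, THEN conjunct2, THEN conjunct2, THEN conjunct2, THEN conjunct1, rule_format]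
lemmas root_hook = root_list[THEN conjunct2, THEN conjunct2, THEN conjunct2, THEN conjunct2, THEN conjunct2, THEN conjunct2, THEN conjunct2, rule_format]

abbreviation \<delta> where "\<delta> \<equiv> dlt q"
definition \<kappa> where "\<kappa> = inverse \<delta> * \<rho>"
definition PP where "PP = (\<Prod>i = 1..r. u i)"
definition labels :: "mpart \<Rightarrow> 'a set"
  where "labels \<nu> = lab q u (diagram \<nu>) ` (addable r \<nu> \<union> removable r \<nu>)"

lemma \<delta>_nz: "\<delta> \<noteq> 0"
proof
  assume "\<delta> = 0"
  then have "q * q = 1" using q0 by (metis eq_iff_diff_eq_0 right_inverse)
  moreover have "q\<^sup>2 \<noteq> 1" using q_order[of 1] n1 by simp
  ultimately show False by (simp add: power2_eq_square)
qed

lemma \<delta>_\<kappa>: "\<delta> * \<kappa> = \<rho>"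
  unfolding \<kappa>_def mult.assoc[symmetric] right_inverse[OF \<delta>_nz] by simp

lemma PP_nz: "PP \<noteq> 0"
  using u0 by (auto simp: PP_def)

text \<open>The bound on the size makes all corners \<open>small\<close>, so genericity applies. The
  last claim excludes the contents at which a residue could vanish.\<close>

lemma contents_set_labels:
  assumes "is_rpart r \<nu>" "card (diagram \<nu>) < n"
  shows "contents_set r PP (labels \<nu>)" "inj_on (lab q u (diagram \<nu>)) (addable r \<nu> \<union> removable r \<nu>)"
    "card (labels \<nu>) > 0" "\<And>c m. c \<in> labels \<nu> \<Longrightarrow> \<bar>m\<bar> \<le> 1 \<Longrightarrow> c\<^sup>2 \<noteq> q powi (2 * m)"
proof -
  let ?N = "addable r \<nu> \<union> removable r \<nu>" and ?l = "lab q u (diagram \<nu>)"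
  have D: "node_ideal r (diagram \<nu>)" using assms by (simp add: is_rpart_iff)
  note N = addable_removable_labels[OF assms(1)]
  show inj: "inj_on ?l ?N"
  proof (rule inj_onI)
    fix \<alpha> \<beta> assume "\<alpha> \<in> ?N" "\<beta> \<in> ?N" "?l \<alpha> = ?l \<beta>"
    then show "\<alpha> = \<beta>" using lab_inj[OF D assms(2)] unfolding addable_removable_iff by blast
  qed
  have small: "small \<alpha>" if "\<alpha> \<in> ?N" for \<alpha>
    using that small_of_ideal(1)[OF D assms(2), of \<alpha> \<alpha>] unfolding addable_removable_iff by blast
  show "contents_set r PP (labels \<nu>)"
  proof
    show "finite (labels \<nu>)" using N by (simp add: labels_def)
    show "0 \<notin> labels \<nu>"
      unfolding labels_def using lab_nz[OF small, of _ "diagram \<nu>"] by force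
    show "c * d \<noteq> 1" if cd: "c \<in> labels \<nu>" "d \<in> labels \<nu>" for c d
    proof -
      obtain \<alpha> \<beta> where "\<alpha> \<in> ?N" "\<beta> \<in> ?N" "c = ?l \<alpha>" "d = ?l \<beta>"
        using cd unfolding labels_def by blast
      then show ?thesis using lab_mult_ne_1[OF D assms(2)] unfolding addable_removable_iff by blast
    qed
    show "(\<Prod>c\<in>labels \<nu>. c) = PP"
      unfolding labels_def using N(2) by (simp add: prod.reindex[OF inj] PP_def)
    show "even (card (labels \<nu>)) = even r"
      unfolding labels_def using N(3) by (simp add: card_image[OF inj])
  qed
  \<comment> \<open>The node after the end of the first row of component 1 is always
    addable.\<close>
  have "(1, Suc (\<nu> 1 1), 1) \<in> ?N" using addable_explicit[OF assms(1)] r1 by auto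
  then have "?N \<noteq> {}" by blast
  then show "card (labels \<nu>) > 0" using N(1) by (simp add: labels_def card_gt_0_iff)
  fix c m assume c: "c \<in> labels \<nu>" and m: "\<bar>m :: int\<bar> \<le> 1"
  then obtain \<alpha> where \<alpha>: "\<alpha> \<in> ?N" "c = ?l \<alpha>" by (auto simp: labels_def)
  show "c\<^sup>2 \<noteq> q powi (2 * m)"
  proof
    assume *: "c\<^sup>2 = q powi (2 * m)"
    have "content q u \<alpha> * content q u \<alpha> = q powi (2 * m) \<or> inverse (content q u \<alpha> * content q u \<alpha>) = q powi (2 * m)"
      using * \<alpha>(2) by (auto simp: lab_def power2_eq_square split: if_splits)
    then have "content q u \<alpha> * content q u \<alpha> = q powi (2 * m) \<or> content q u \<alpha> * content q u \<alpha> = q powi (2 * (- m))"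
      by (metis inverse_inverse_eq mult_minus_right power_int_minus)
    then show False
      using content_mult_ne[OF small small, OF \<alpha>(1) \<alpha>(1), of m] content_mult_ne[OF small small, OF \<alpha>(1) \<alpha>(1), of "- m"] m
      by auto
  qed
qed

lemma prev_rpart:
  assumes "s \<in> TT" "1 \<le> k" "k \<le> n"
  shows "is_rpart r (s ! (k - 1))" "card (diagram (s ! (k - 1))) < n"
  using dg_pred[OF assms] by (simp_all add: dg_def is_rpart_iff)

lemma cc_in_labels:
  assumes "s \<in> TT" "1 \<le> k" "k \<le> n"
  shows "cc s k \<in> labels (s ! (k - 1))"
proof -
  have "nd s k \<in> addable r (s ! (k - 1)) \<union> removable r (s ! (k - 1))"
    using dg_step[OF assms] dg_ideal[OF assms(1,3)] unfolding addable_removable_iff by (simp add: dg_def)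
  then show ?thesis using cont_tab_eq_lab[OF assms] by (auto simp: labels_def dg_def)
qed

lemma E_diag_eq:
  assumes "s \<in> TT" "1 \<le> k" "k \<le> n"
  shows "E_diag r q u \<rho> k s = Eval r \<kappa> PP (labels (s ! (k - 1))) (cc s k)"
proof -
  let ?\<nu> = "s ! (k - 1)" and ?N = "addable r (s ! (k - 1)) \<union> removable r (s ! (k - 1))"
  let ?g = "cont_node r q u ?\<nu>"
  have g: "?g \<alpha> = lab q u (diagram ?\<nu>) \<alpha>" if "\<alpha> \<in> ?N" for \<alpha>
    using that by (auto simp: cont_node_def lab_def addable_iff removable_iff)
  note C = contents_set_labels[OF prev_rpart[OF assms]]
  interpret contents_set r \<kappa> PP "labels ?\<nu>" by (rule C(1))
  have nd: "nd s k \<in> ?N"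
    using dg_step[OF assms] dg_ideal[OF assms(1,3)] unfolding addable_removable_iff by (simp add: dg_def)
  have gnd: "?g (nd s k) = cc s k" using g[OF nd] cont_tab_eq_lab[OF assms] by (simp add: dg_def)
  have img: "?g ` ?N = labels ?\<nu>" unfolding labels_def using g by (rule image_cong[OF refl])
  have "inj_on ?g ?N" using C(2) g by (simp add: inj_on_def)
  moreover have "?g (nd s k) \<noteq> 0" "(?g (nd s k))\<^sup>2 \<noteq> 1"
    unfolding gnd using cc_in_labels[OF assms] nz mult_ne_1 by (auto simp: power2_eq_square)
  ultimately have "residue_at (?g (nd s k)) ((rf_y\<^sup>2 / (rf_y\<^sup>2 - 1) - rf_const \<kappa> +
      (rf_const \<kappa> * rf_const PP + rf_y * (if odd r then 1 else - rf_y) / (rf_y\<^sup>2 - 1)) * rf_const PP *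
      (\<Prod>\<beta>\<in>?N. (rf_y - rf_const (inverse (?g \<beta>))) / (rf_y - rf_const (?g \<beta>)))) / rf_y)
    = Eval r \<kappa> PP (?g ` ?N) (?g (nd s k))"
    using addable_removable_labels(1)[OF prev_rpart(1)[OF assms]] nd
    by (intro residue_at_Wfun)
  then show ?thesis
    unfolding E_diag_def Wfun_def Let_def gnd img \<kappa>_def PP_def .
qed

text \<open>In this form the values are the roots of \<open>x^2 = 1\<close> for odd \<open>r\<close>
  and of \<open>x^2 - \<delta> * x = 1\<close> for even \<open>r\<close>.\<close>

lemma admissible_\<rho>:
  "odd r \<Longrightarrow> \<rho> * PP = 1 \<or> \<rho> * PP = - 1"
  "even r \<Longrightarrow> \<rho> * PP = q \<or> \<rho> * PP = - inverse q"
proof -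
  have "(odd r \<longrightarrow> inverse \<rho> \<in> {PP, - PP}) \<and> (even r \<longrightarrow> inverse \<rho> \<in> {inverse q * PP, - (q * PP)})"
    using adm unfolding u_admissible_def Let_def PP_def by blast
  then have *: "odd r \<Longrightarrow> inverse \<rho> = PP \<or> inverse \<rho> = - PP"
      "even r \<Longrightarrow> inverse \<rho> = inverse q * PP \<or> inverse \<rho> = - (q * PP)" by auto
  have r: "\<rho> * inverse \<rho> = 1" using \<rho>0 by simp
  show "\<rho> * PP = 1 \<or> \<rho> * PP = - 1" if "odd r"
    using *(1)[OF that] r by (metis minus_minus mult_minus_right)
  show "\<rho> * PP = q \<or> \<rho> * PP = - inverse q" if "even r"
    using *(2)[OF that]
  proof
    assume h: "inverse \<rho> = inverse q * PP"
    have "\<rho> * PP = q * (\<rho> * (inverse q * PP))" using q0 by simp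
    then show ?thesis unfolding h[symmetric] using r by simp
  next
    assume h: "inverse \<rho> = - (q * PP)"
    have "\<rho> * PP = - inverse q * (\<rho> * - (q * PP))" using q0 by simp
    then show ?thesis unfolding h[symmetric] using r by simp
  qed
qed

text \<open>After multiplication by \<delta> and \<rho> this is the quadratic equation satisfied by
  \<open>\<rho> * PP\<close>.\<close>

lemma \<omega>0_eq: "1 - \<kappa> + \<kappa> * PP\<^sup>2 - (if even r then PP else 0) = \<omega> 0"
proof -
  have r: "\<rho> * inverse \<rho> = 1" using \<rho>0 by simp
  have "\<rho> * PP\<^sup>2 - (if even r then \<delta> * PP else 0) = inverse \<rho>"
  proof (cases "odd r")
    case True
    have "(\<rho> * PP) * (\<rho> * PP) = 1" using admissible_\<rho>(1)[OF True] by auto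
    then have "\<rho> * (\<rho> * PP\<^sup>2) = \<rho> * inverse \<rho>" using r by (simp add: power2_eq_square mult_ac)
    then have "\<rho> * PP\<^sup>2 = inverse \<rho>" using \<rho>0 mult_left_cancel by blast
    then show ?thesis using True by simp
  next
    case False
    then have "\<rho> * PP = q \<or> \<rho> * PP = - inverse q" using admissible_\<rho>(2) by simp
    then have "(\<rho> * PP) * (\<rho> * PP) - \<delta> * (\<rho> * PP) = 1"
    proof
      assume "\<rho> * PP = q"
      then show ?thesis using q0 by (simp add: left_diff_distrib)
    next
      assume "\<rho> * PP = - inverse q"
      then show ?thesis using q0 by (simp add: left_diff_distrib)
    qed
    then have "\<rho> * (\<rho> * PP\<^sup>2 - \<delta> * PP) = \<rho> * inverse \<rho>"
      using r by (simp add: power2_eq_square algebra_simps)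
    then have "\<rho> * PP\<^sup>2 - \<delta> * PP = inverse \<rho>" using \<rho>0 mult_left_cancel by blast
    then show ?thesis using False by simp
  qed
  then have "inverse \<delta> * (\<rho> * PP\<^sup>2 - (if even r then \<delta> * PP else 0)) = inverse \<delta> * inverse \<rho>" by simp
  moreover have "inverse \<delta> * \<delta> = 1" using \<delta>_nz by simp
  ultimately have "\<kappa> * PP\<^sup>2 - (if even r then PP else 0) = inverse \<delta> * inverse \<rho>"
    by (cases "even r") (simp_all add: \<kappa>_def right_diff_distrib mult.assoc[symmetric] del: left_inverse)
  then have "1 - \<kappa> + (\<kappa> * PP\<^sup>2 - (if even r then PP else 0)) = 1 - \<kappa> + inverse \<delta> * inverse \<rho>" by simp
  then show ?thesis unfolding \<omega>0 by (simp add: \<kappa>_def right_diff_distrib)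
qed

text \<open>The factors from the other nodes and \<open>c - inverse c\<close> are nonzero because no
  two labels have product 1. A zero of the remaining factor would force \<open>c^2\<close> to be
  \<open>q^2\<close> or its inverse.\<close>

lemma Eval_nz:
  assumes \<nu>: "is_rpart r \<nu>" "card (diagram \<nu>) < n" and c: "c \<in> labels \<nu>"
  shows "Eval r \<kappa> PP (labels \<nu>) c \<noteq> 0"
proof -
  note C = contents_set_labels[OF \<nu>]
  interpret contents_set r \<kappa> PP "labels \<nu>" by (rule C(1))
  have c0: "c \<noteq> 0" and c1: "c\<^sup>2 - 1 \<noteq> 0" using c nz sq_ne_1 by auto
  have cq: "c\<^sup>2 \<noteq> q\<^sup>2" "c\<^sup>2 \<noteq> inverse (q\<^sup>2)"
    using C(4)[OF c, of 1] C(4)[OF c, of "- 1"] by (simp_all add: power_int_minus)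
  have "c - inverse c \<noteq> 0"
  proof
    assume "c - inverse c = 0"
    then have "c * c = c * inverse c" by simp
    then show False using c0 c1 by (simp add: power2_eq_square)
  qed
  moreover have "(\<Prod>d\<in>labels \<nu> - {c}. (c - inverse d) / (c - d)) \<noteq> 0"
  proof -
    have "c \<noteq> inverse d" if "d \<in> labels \<nu>" for d
      using mult_ne_1[OF c that] nz that by (metis left_inverse)
    then show ?thesis using finC by auto
  qed
  moreover have "\<kappa> * PP + c * gam r c / (c\<^sup>2 - 1) \<noteq> 0"
  proof
    assume "\<kappa> * PP + c * gam r c / (c\<^sup>2 - 1) = 0"
    then have "\<delta> * (c\<^sup>2 - 1) * (\<kappa> * PP + c * gam r c / (c\<^sup>2 - 1)) = 0" by simp
    then have "(\<delta> * \<kappa>) * PP * (c\<^sup>2 - 1) + \<delta> * c * gam r c = 0" using c1 by (simp add: distrib_left mult_ac del: left_diff_distrib)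
    then have h: "(\<rho> * PP) * (c\<^sup>2 - 1) + \<delta> * c * gam r c = 0" unfolding \<delta>_\<kappa> .
    have qq: "q * inverse q = 1" using q0 by simp
    show False
    proof (cases "odd r")
      case True
      \<comment> \<open>For \<open>x = \<rho> * PP\<close> the numerator of the critical factor
        splits; its zeros \<open>- x * q\<close> and \<open>x * inverse q\<close> have the excluded
        squares.\<close>
      have fac: "(c + x * q) * (c - x * inverse q) = x * (x * (c\<^sup>2 - 1) + \<delta> * c)" if "x * x = 1" for x
      proof -
        have "(c + x * q) * (c - x * p) = c * c + x * ((q - p) * c) - (x * x) * (q * p)"
          "x * (x * (c\<^sup>2 - 1) + (q - p) * c) = (x * x) * (c\<^sup>2 - 1) + x * ((q - p) * c)" for p
          by (simp_all add: algebra_simps)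
        note * = this(1)[of "inverse q"] this(2)[of "inverse q"]
        show ?thesis unfolding * that qq by (simp add: power2_eq_square)
      qed
      have x: "(\<rho> * PP) * (\<rho> * PP) = 1" using admissible_\<rho>(1)[OF True] by auto
      have "(c + (\<rho> * PP) * q) * (c - (\<rho> * PP) * inverse q) = 0"
        unfolding fac[OF x] using h True by (simp add: gam_def)
      then have "c = - ((\<rho> * PP) * q) \<or> c = (\<rho> * PP) * inverse q"
        by (simp only: mult_eq_0_iff eq_neg_iff_add_eq_0 right_minus_eq)
      moreover have "(x * y) * (x * y) = y * y" if "x * x = 1" for x y :: 'a
        using that by (metis mult.assoc mult.commute mult_1)
      ultimately have "c\<^sup>2 = q\<^sup>2 \<or> c\<^sup>2 = (inverse q)\<^sup>2"
        unfolding power2_eq_square using x by (metis minus_mult_minus)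
      then show False using cq by (simp only: power_inverse) blast
    next
      case False
      then have "\<rho> * PP = q \<or> \<rho> * PP = - inverse q" using admissible_\<rho>(2) by simp
      then show False
      proof
        assume e: "\<rho> * PP = q"
        have "q * (c\<^sup>2 - 1) - \<delta> * c\<^sup>2 = 0" using h False unfolding e by (simp add: gam_def power2_eq_square mult.assoc)
        then have "inverse q * c\<^sup>2 = q" by (simp add: algebra_simps)
        then have "(q * inverse q) * c\<^sup>2 = q\<^sup>2" by (simp only: mult.assoc power2_eq_square)
        then show False using cq(1) unfolding qq by simp
      next
        assume e: "\<rho> * PP = - inverse q"
        have "- inverse q * (c\<^sup>2 - 1) - \<delta> * c\<^sup>2 = 0" using h False unfolding e by (simp add: gam_def power2_eq_square mult.assoc)
        then have "q * c\<^sup>2 = inverse q" by (simp add: algebra_simps)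
        then have "inverse q * (q * c\<^sup>2) = (inverse q)\<^sup>2" by (simp only: power2_eq_square)
        then have "(q * inverse q) * c\<^sup>2 = inverse (q\<^sup>2)" by (simp only: mult_ac power_inverse)
        then show False using cq(2) unfolding qq by simp
      qed
    qed
  qed
  ultimately show ?thesis using c0 PP_nz by (simp add: Eval_def)
qed

section \<open>Sums of residues over one block\<close>

context
  fixes s k assumes s: "s \<in> TT" "1 \<le> k" "k < n" and st: "stays k s"
begin

lemma sum_over_block: "(\<Sum>t | t \<in> TT \<and> ksim k t s. f (cc t k)) = (\<Sum>c\<in>labels (s ! (k - 1)). f c)"
  unfolding labels_def using sum.reindex_bij_betw[OF bij_labels[OF s st], of f] by (simp add: dg_def)

lemma block_prev: "t \<in> TT \<Longrightarrow> ksim k t s \<Longrightarrow> t ! (k - 1) = s ! (k - 1)"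
  using ksim_nth[of k t s "k - 1"] s by simp

lemma E_diag_block: "t \<in> TT \<Longrightarrow> ksim k t s \<Longrightarrow> E_diag r q u \<rho> k t = Eval r \<kappa> PP (labels (s ! (k - 1))) (cc t k)"
  using E_diag_eq[of t k] block_prev[of t] s by simp

lemma contents_set_block:
  "contents_set r PP (labels (s ! (k - 1)))" "card (labels (s ! (k - 1))) > 0"
  using contents_set_labels[OF prev_rpart[of s k]] s by auto

lemma sum_E_diag: "(\<Sum>t | t \<in> TT \<and> ksim k t s. E_diag r q u \<rho> k t) = \<omega> 0"
proof -
  interpret contents_set r \<kappa> PP "labels (s ! (k - 1))" by (rule contents_set_block)
  have "(\<Sum>t | t \<in> TT \<and> ksim k t s. E_diag r q u \<rho> k t) =
      (\<Sum>t | t \<in> TT \<and> ksim k t s. Eval r \<kappa> PP (labels (s ! (k - 1))) (cc t k))"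
    by (rule sum.cong) (auto simp: E_diag_block)
  then show ?thesis using sum_Eval[OF contents_set_block(2)] \<omega>0_eq by (simp add: sum_over_block)
qed

lemma sum_E_diag_frac:
  "(\<Sum>t | t \<in> TT \<and> ksim k t s. E_diag r q u \<rho> k t / (cc s k * cc t k - 1)) = 1 / ((cc s k)\<^sup>2 - 1) + \<kappa>"
proof -
  interpret contents_set r \<kappa> PP "labels (s ! (k - 1))" by (rule contents_set_block)
  have "(\<Sum>t | t \<in> TT \<and> ksim k t s. E_diag r q u \<rho> k t / (cc s k * cc t k - 1)) =
      (\<Sum>t | t \<in> TT \<and> ksim k t s. Eval r \<kappa> PP (labels (s ! (k - 1))) (cc t k) / (cc s k * cc t k - 1))"
    by (rule sum.cong) (auto simp: E_diag_block)
  also have "\<dots> = (\<Sum>c\<in>labels (s ! (k - 1)). Eval r \<kappa> PP (labels (s ! (k - 1))) c / (cc s k * c - 1))"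
    by (rule sum_over_block)
  also have "\<dots> = 1 / ((cc s k)\<^sup>2 - 1) + \<kappa>"
    by (rule sum_Eval_over_mult_minus_1[OF cc_in_labels]) (use s in auto)
  finally show ?thesis .
qed

lemma E_diag_nz: "E_diag r q u \<rho> k s \<noteq> 0"
  using E_diag_eq[of s k] Eval_nz[OF prev_rpart[of s k]] cc_in_labels[of s k] s by simp

lemma sE_square: "sE k s * sE k s = E_diag r q u \<rho> k s"
  using root_E[of s k] s st by (simp add: power2_eq_square)

end

end

section \<open>The operators\<close>

context seminormal
begin

text \<open>Row \<open>s\<close> of a matrix is the image of \<open>bvec s\<close>, so composition of operators reverses the matrix
  product.\<close>

definition mop :: "(tab \<Rightarrow> tab \<Rightarrow> 'a) \<Rightarrow> (tab \<Rightarrow>\<^sub>0 'a) \<Rightarrow> (tab \<Rightarrow>\<^sub>0 'a)"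
  where "mop M v = (\<Sum>s\<in>TT. \<Sum>t\<in>TT. smul (Poly_Mapping.lookup v s * M s t) (bvec t))"

definition mm :: "(tab \<Rightarrow> tab \<Rightarrow> 'a) \<Rightarrow> (tab \<Rightarrow> tab \<Rightarrow> 'a) \<Rightarrow> tab \<Rightarrow> tab \<Rightarrow> 'a"
  where "mm N M s t = (\<Sum>x\<in>TT. N s x * M x t)"

definition Id :: "tab \<Rightarrow> tab \<Rightarrow> 'a"
  where "Id s t = (if s = t then 1 else 0)"

abbreviation FS where "FS \<equiv> free_space TT :: (tab \<Rightarrow>\<^sub>0 'a) set"

lemma lookup_mop: "Poly_Mapping.lookup (mop M v) t = (if t \<in> TT then \<Sum>s\<in>TT. Poly_Mapping.lookup v s * M s t else 0)"
proof -
  have "(\<Sum>t'\<in>TT. (x t' :: 'a) * Poly_Mapping.lookup (bvec t') t) = (\<Sum>t'\<in>TT. if t' = t then x t else 0)" for x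
    by (rule sum.cong) (auto simp: lookup_bvec)
  then show ?thesis using finite_TT by (simp add: mop_def lookup_sum)
qed

lemma linear_mop: "linear_map (mop M)"
  unfolding linear_map_def
  by (auto intro!: poly_mapping_eqI simp: lookup_mop lookup_add distrib_right sum.distrib sum_distrib_left mult.assoc)

lemma mop_closed: "mop M v \<in> FS"
  by (simp add: free_space_iff lookup_mop)

lemma lookup_mop_bvec: "s \<in> TT \<Longrightarrow> t \<in> TT \<Longrightarrow> Poly_Mapping.lookup (mop M (bvec s)) t = M s t"
proof -
  assume s: "s \<in> TT" and t: "t \<in> TT"
  have "(\<Sum>x\<in>TT. Poly_Mapping.lookup (bvec s) x * M x t) = (\<Sum>x\<in>TT. if x = s then M s t else 0)"
    by (rule sum.cong) (auto simp: lookup_bvec)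
  then show ?thesis using s t finite_TT by (simp add: lookup_mop)
qed

lemma mop_mop: "mop M (mop N v) = mop (mm N M) v"
proof (rule poly_mapping_eqI)
  fix t
  have "(\<Sum>x\<in>TT. (\<Sum>s\<in>TT. Poly_Mapping.lookup v s * N s x) * M x t) =
      (\<Sum>s\<in>TT. Poly_Mapping.lookup v s * (\<Sum>x\<in>TT. N s x * M x t))"
    unfolding sum_distrib_left sum_distrib_right by (subst sum.swap) (simp add: mult.assoc)
  then show "Poly_Mapping.lookup (mop M (mop N v)) t = Poly_Mapping.lookup (mop (mm N M) v) t"
    by (simp add: lookup_mop mm_def)
qed

lemma mop_cong: "(\<And>s t. s \<in> TT \<Longrightarrow> t \<in> TT \<Longrightarrow> M s t = N s t) \<Longrightarrow> mop M v = mop N v"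
  by (auto intro!: poly_mapping_eqI sum.cong simp: lookup_mop)

lemma mop_Id: "v \<in> FS \<Longrightarrow> mop Id v = v"
proof (rule poly_mapping_eqI)
  fix t assume v: "v \<in> FS"
  have "(\<Sum>s\<in>TT. Poly_Mapping.lookup v s * Id s t) = (\<Sum>s\<in>TT. if s = t then Poly_Mapping.lookup v t else 0)"
    by (rule sum.cong) (auto simp: Id_def)
  then show "Poly_Mapping.lookup (mop Id v) t = Poly_Mapping.lookup v t"
    using v finite_TT by (auto simp: lookup_mop free_space_iff)
qed

lemma mop_add: "mop M v + mop N v = mop (\<lambda>s t. M s t + N s t) v"
  and mop_diff: "mop M v - mop N v = mop (\<lambda>s t. M s t - N s t) v"
  and smul_mop: "smul a (mop M v) = mop (\<lambda>s t. a * M s t) v"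
  by (auto intro!: poly_mapping_eqI simp: lookup_mop lookup_add lookup_minus algebra_simps
      sum.distrib sum_subtractf sum_distrib_left)

lemma mm_diag: "s \<in> TT \<Longrightarrow> t \<in> TT \<Longrightarrow> mm (\<lambda>s t. if s = t then d s else 0) M s t = d s * M s t"
  "s \<in> TT \<Longrightarrow> t \<in> TT \<Longrightarrow> mm M (\<lambda>s t. if s = t then d s else 0) s t = M s t * d t"
proof -
  assume s: "s \<in> TT" and t: "t \<in> TT"
  have "(\<Sum>x\<in>TT. (if s = x then d s else 0) * M x t) = (\<Sum>x\<in>TT. if x = s then d s * M s t else 0)"
    by (rule sum.cong) auto
  then show "mm (\<lambda>s t. if s = t then d s else 0) M s t = d s * M s t"
    using s finite_TT by (simp add: mm_def)
  have "(\<Sum>x\<in>TT. M s x * (if x = t then d x else 0)) = (\<Sum>x\<in>TT. if x = t then M s t * d t else 0)"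
    by (rule sum.cong) auto
  then show "mm M (\<lambda>s t. if s = t then d s else 0) s t = M s t * d t"
    using t finite_TT by (simp add: mm_def)
qed

text \<open>On the diagonal this is the square of the chosen root, which equals
  \<open>E_diag\<close>. So a block is literally the rank one matrix of the roots, without a
  separate diagonal case.\<close>

definition Em :: "nat \<Rightarrow> tab \<Rightarrow> tab \<Rightarrow> 'a"
  where "Em k s t = (if stays k s \<and> ksim k s t then sE k s * sE k t else 0)"

definition Tm :: "nat \<Rightarrow> tab \<Rightarrow> tab \<Rightarrow> 'a"
  where "Tm k s t = (if ksim k s t then
      (if stays k s then \<delta> * ((Em k s t - Id s t) / (cc s k * cc t k - 1))
       else if t = s then a_coef q u k s
       else if swap_defined k s \<and> t = swap r k s then b k s else 0)
    else 0)"

definition Xm :: "nat \<Rightarrow> tab \<Rightarrow> tab \<Rightarrow> 'a"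
  where "Xm i = (\<lambda>s t. if s = t then cc s i else 0)"

definition Xim :: "nat \<Rightarrow> tab \<Rightarrow> tab \<Rightarrow> 'a"
  where "Xim i = (\<lambda>s t. if s = t then inverse (cc s i) else 0)"

lemma Em_outside: "\<not> ksim k s t \<Longrightarrow> Em k s t = 0" "\<not> ksim k t s \<Longrightarrow> Em k s t = 0"
    "\<not> stays k s \<Longrightarrow> Em k s t = 0"
  using ksim_sym[of k s t] by (auto simp: Em_def)

lemma Tm_outside: "\<not> ksim k s t \<Longrightarrow> Tm k s t = 0" "\<not> ksim k t s \<Longrightarrow> Tm k s t = 0"
  using ksim_sym[of k s t] by (auto simp: Tm_def)

lemma Em_sym:
  assumes "s \<in> TT" "t \<in> TT" "1 \<le> k" "k < n"
  shows "Em k s t = Em k t s"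
proof (cases "ksim k s t")
  case True
  then have "ksim k t s" "stays k s \<longleftrightarrow> stays k t" using ksim_sym ksim_stays assms by blast+
  then show ?thesis using True unfolding Em_def by (simp only: mult.commute)
next
  case False
  then have "\<not> ksim k t s" using ksim_sym by blast
  then show ?thesis using False by (simp add: Em_outside)
qed

text \<open>For an exchange this is root condition (a), as the exchange is an involution. Symmetry
  lets relations be transposed later.\<close>

lemma Tm_sym: assumes "s \<in> TT" "t \<in> TT" "1 \<le> k" "k < n" shows "Tm k s t = Tm k t s"
proof (cases "ksim k s t")
  case False
  then show ?thesis using ksim_sym[of k t s] by (auto simp: Tm_def)
next
  case True
  then have k: "ksim k t s" "stays k s \<longleftrightarrow> stays k t" using ksim_sym ksim_stays assms by blast+
  show ?thesis
  proof (cases "stays k s")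
    case st: True
    have "Id s t = Id t s" by (auto simp: Id_def)
    then show ?thesis
      using True k st Em_sym[OF assms] by (simp add: Tm_def mult.commute)
  next
    case nst: False
    have iff: "swap_defined k s \<and> t = swap r k s \<longleftrightarrow> swap_defined k t \<and> s = swap r k t"
      using swap_facts(5,9)[of s k] swap_facts(5,9)[of t k] assms by metis
    have "b k s = b k t" if "swap_defined k s" "t = swap r k s"
      using root_swap[of s k] that nst assms by auto
    then show ?thesis using True k nst iff unfolding Tm_def by (cases "t = s") auto
  qed
qed

lemma sum_block:
  assumes "\<And>x. x \<in> TT \<Longrightarrow> \<not> ksim k x s \<Longrightarrow> f x = 0"
  shows "(\<Sum>x\<in>TT. f x) = (\<Sum>x | x \<in> TT \<and> ksim k x s. f x)"
  using finite_TT assms by (intro sum.mono_neutral_right) auto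

text \<open>All members of a block share the vertex \<open>k - 1\<close>, hence the same poles; the
  two sums required are \<open>sum_E_diag\<close> and \<open>sum_E_diag_frac\<close>.\<close>

lemma block:
  assumes s: "s \<in> TT" "1 \<le> k" "k < n" and st: "stays k s"
  shows "rank_one_block {t. t \<in> TT \<and> ksim k t s} (\<lambda>t. cc t k) (sE k) \<delta> \<rho>"
    "\<And>x y. x \<in> TT \<Longrightarrow> ksim k x s \<Longrightarrow> y \<in> TT \<Longrightarrow> ksim k y s \<Longrightarrow>
      Em k x y = sE k x * sE k y \<and>
      Tm k x y = rank_one_block.tt (\<lambda>t. cc t k) (sE k) \<delta> x y"
proof -
  let ?B = "{t. t \<in> TT \<and> ksim k t s}"
  have B: "t \<in> TT" "stays k t" "t ! (k - 1) = s ! (k - 1)" if "t \<in> ?B" for t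
    using that st s ksim_stays[of k t s] block_prev[OF s st] by auto
  have sq: "sE k t * sE k t = E_diag r q u \<rho> k t" if "t \<in> ?B" for t
    using sE_square[OF B(1)[OF that] s(2,3) B(2)[OF that]] .
  have E_same: "(\<Sum>y\<in>?B. E_diag r q u \<rho> k y / (cc x k * cc y k - 1)) = 1 / ((cc x k)\<^sup>2 - 1) + \<kappa>"
    if x: "x \<in> ?B" for x
  proof -
    have "?B = {t. t \<in> TT \<and> ksim k t x}" using x ksim_sym ksim_trans by blast
    then show ?thesis using sum_E_diag_frac[OF B(1)[OF x] s(2,3) B(2)[OF x]] by simp
  qed
  show block: "rank_one_block ?B (\<lambda>t. cc t k) (sE k) \<delta> \<rho>"
  proof
    show "finite ?B" using finite_TT by simp
    show "cc x k * cc y k \<noteq> 1" if "x \<in> ?B" "y \<in> ?B" for x y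
      using cc_mult_ne_1(1)[of x y k] B(1,3)[OF that(1)] B(1,3)[OF that(2)] s by simp
    show "inj_on (\<lambda>t. cc t k) ?B" using bij_labels[OF s st] by (rule bij_betw_imp_inj_on)
    show "sE k x \<noteq> 0" if "x \<in> ?B" for x
      using sq[OF that] E_diag_nz[OF B(1)[OF that] s(2,3) B(2)[OF that]] by auto
    show "\<delta> \<noteq> 0" "\<rho> \<noteq> 0" using \<delta>_nz \<rho>0 .
    have "(\<Sum>y\<in>?B. (sE k y)\<^sup>2) = (\<Sum>y\<in>?B. E_diag r q u \<rho> k y)"
      by (rule sum.cong) (simp_all only: power2_eq_square sq)
    then show "(\<Sum>y\<in>?B. (sE k y)\<^sup>2) = 1 - inverse \<delta> * (\<rho> - inverse \<rho>)"
      using sum_E_diag[OF s st] \<omega>0 by simp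
    fix x assume x: "x \<in> ?B"
    have "(\<Sum>y\<in>?B. (sE k y)\<^sup>2 / (cc x k * cc y k - 1)) = (\<Sum>y\<in>?B. E_diag r q u \<rho> k y / (cc x k * cc y k - 1))"
      by (rule sum.cong) (simp_all only: power2_eq_square sq)
    then show "(\<Sum>y\<in>?B. (sE k y)\<^sup>2 / (cc x k * cc y k - 1)) = 1 / ((cc x k)\<^sup>2 - 1) + inverse \<delta> * \<rho>"
      using E_same[OF x] by (simp add: \<kappa>_def)
  qed
  fix x y assume xy: "x \<in> TT" "ksim k x s" "y \<in> TT" "ksim k y s"
  have k: "ksim k x y" using xy ksim_sym ksim_trans by blast
  have stx: "stays k x" using B(2)[of x] xy by simp
  then have "Em k x y = sE k x * sE k y" using k by (simp add: Em_def)
  then show "Em k x y = sE k x * sE k y \<and> Tm k x y = rank_one_block.tt (\<lambda>t. cc t k) (sE k) \<delta> x y"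
    using k stx by (simp add: Tm_def rank_one_block.tt_def[OF block] Id_def)
qed

lemma mm_EE: assumes "s \<in> TT" "t \<in> TT" "1 \<le> k" "k < n"
  shows "mm (Em k) (Em k) s t = \<omega> 0 * Em k s t"
proof (cases "stays k s \<and> ksim k s t")
  case True
  then interpret rank_one_block "{t. t \<in> TT \<and> ksim k t s}" "\<lambda>t. cc t k" "sE k" \<delta> \<rho>
    using block(1) assms by blast
  have ts: "ksim k t s" using True ksim_sym by blast
  note E = block(2)[OF assms(1,3,4) conjunct1[OF True], THEN conjunct1]
  have "mm (Em k) (Em k) s t = (\<Sum>x | x \<in> TT \<and> ksim k x s. Em k s x * Em k x t)"
    unfolding mm_def by (intro sum_block) (auto simp: Em_outside)
  also have "\<dots> = (\<Sum>x | x \<in> TT \<and> ksim k x s. sE k s * sE k t * (sE k x)\<^sup>2)"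
    using assms ts by (intro sum.cong) (auto simp: E power2_eq_square)
  also have "\<dots> = sE k s * sE k t * \<omega> 0"
    using sum_e \<omega>0 by (simp add: flip: sum_distrib_left)
  finally show ?thesis using E[of s t] assms ts by simp
next
  case False
  have "Em k s x * Em k x t = 0" for x
    using False ksim_trans[of k s x t] by (auto simp: Em_def)
  then have "mm (Em k) (Em k) s t = 0" unfolding mm_def by (intro sum.neutral) blast
  moreover have "Em k s t = 0" using False by (auto simp: Em_def)
  ultimately show ?thesis by simp
qed

lemma mm_ET: assumes "s \<in> TT" "t \<in> TT" "1 \<le> k" "k < n"
  shows "mm (Tm k) (Em k) s t = \<rho> * Em k s t" "mm (Em k) (Tm k) s t = \<rho> * Em k s t"
proof -
  have TE: "mm (Tm k) (Em k) s t = \<rho> * Em k s t" if "s \<in> TT" "t \<in> TT" for s t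
  proof (cases "stays k s \<and> ksim k s t")
    case True
    then interpret rank_one_block "{t. t \<in> TT \<and> ksim k t s}" "\<lambda>t. cc t k" "sE k" \<delta> \<rho>
      using block(1) assms that by blast
    have ts: "ksim k t s" using True ksim_sym by blast
    note ET = block(2)[OF that(1) assms(3,4) conjunct1[OF True]]
    have "mm (Tm k) (Em k) s t = (\<Sum>x | x \<in> TT \<and> ksim k x s. Tm k s x * Em k x t)"
      unfolding mm_def by (intro sum_block) (auto simp: Tm_outside)
    also have "\<dots> = (\<Sum>x | x \<in> TT \<and> ksim k x s. sE k t * (tt s x * sE k x))"
      using that ts by (intro sum.cong) (auto simp: ET)
    also have "\<dots> = sE k t * (\<rho> * sE k s)"
      using tt_e[of s] that by (simp add: flip: sum_distrib_left)
    finally show ?thesis using ET[of s t] that ts by simp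
  next
    case False
    have "Tm k s x * Em k x t = 0" if x: "x \<in> TT" for x
    proof (rule ccontr)
      assume "\<not> ?thesis"
      then have "Tm k s x \<noteq> 0" "Em k x t \<noteq> 0" by auto
      then have "ksim k s x" "ksim k x t" "stays k x" using Tm_outside Em_outside by blast+
      then show False using False ksim_trans ksim_stays \<open>s \<in> TT\<close> assms(3,4) by blast
    qed
    then have "mm (Tm k) (Em k) s t = 0" unfolding mm_def by (intro sum.neutral) blast
    moreover have "Em k s t = 0" using False by (auto simp: Em_def)
    ultimately show ?thesis by simp
  qed
  then show "mm (Tm k) (Em k) s t = \<rho> * Em k s t" using assms by blast
  have "mm (Em k) (Tm k) s t = mm (Tm k) (Em k) t s"
    unfolding mm_def
  proof (rule sum.cong[OF refl])
    fix x assume "x \<in> TT"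
    then show "Em k s x * Tm k x t = Tm k t x * Em k x s"
      using Em_sym[of s x k] Tm_sym[of x t k] assms by (simp add: mult.commute)
  qed
  then show "mm (Em k) (Tm k) s t = \<rho> * Em k s t" using TE assms Em_sym[of s t] by simp
qed

text \<open>For the ratios \<open>q^2\<close> and \<open>q^(-2)\<close> the coefficient
  \<open>a\<close> is \<open>q\<close> and \<open>- inverse q\<close>, the two roots of
  \<open>1 - a^2 + \<delta> * a\<close>.\<close>

lemma b_zero:
  assumes s: "s \<in> TT" "1 \<le> k" "k < n" "\<not> stays k s" and m: "\<bar>m\<bar> = 1" "cc s (k + 1) = q powi (2 * m) * cc s k"
  shows "b k s = 0"
proof -
  have c: "cc s k \<noteq> 0" "cc s (k + 1) - cc s k \<noteq> 0" using cc_nz[of s k] mid_facts(2)[of s s k] s by auto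
  define a where "a = a_coef q u k s"
  have "a * (cc s (k + 1) - cc s k) = \<delta> * cc s (k + 1)" using c(2) by (simp add: a_def a_coef_def)
  then have "cc s k * (a * (q powi (2 * m) - 1)) = cc s k * (\<delta> * q powi (2 * m))"
    unfolding m(2) by (simp add: algebra_simps)
  then have a: "a * (q powi (2 * m) - 1) = \<delta> * q powi (2 * m)" using c(1) mult_left_cancel by blast
  have qq: "q * inverse q = 1" "q * q \<noteq> 1"
    using q0 q_order[of 1] n1 by (simp_all add: power2_eq_square)
  have "(a - q) * (a + inverse q) = 0"
  proof (cases "m = 1")
    case True
    then have "a * (q * q - 1) = (q - inverse q) * (q * q)" using a by (simp add: power2_eq_square)
    also have "\<dots> = q * (q * q) - (q * inverse q) * q" by (simp add: algebra_simps)
    also have "\<dots> = q * (q * q - 1)" unfolding qq(1) by (simp add: algebra_simps)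
    finally have "a = q" using qq(2) by (metis mult_right_cancel right_minus_eq)
    then show ?thesis by simp
  next
    case False
    then have "m = - 1" using m(1) by linarith
    then have "a * (inverse (q * q) - 1) = (q - inverse q) * inverse (q * q)"
      using a by (simp add: power2_eq_square power_int_minus)
    then have "(a * (inverse (q * q) - 1)) * (q * q) = ((q - inverse q) * inverse (q * q)) * (q * q)"
      by (rule arg_cong)
    moreover have "inverse (q * q) * (q * q) = 1" by (rule left_inverse) (use q0 in simp)
    moreover have "(a * (x - 1)) * y = a * (x * y - y)" "(z * x) * y = z * (x * y)" for x y z :: 'a
      by (simp_all add: algebra_simps)
    ultimately have "a * (1 - q * q) = q - inverse q" by (simp only: mult_1_right)
    also have "\<dots> = (q * inverse q) * q - inverse q" unfolding qq(1) by simp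
    also have "\<dots> = - inverse q * (1 - q * q)" by (simp add: algebra_simps)
    finally have "a = - inverse q" using qq(2) by (metis mult_right_cancel right_minus_eq)
    then show ?thesis by simp
  qed
  moreover have "1 - a\<^sup>2 + \<delta> * a = (1 - q * inverse q) - (a - q) * (a + inverse q)"
    by (simp add: power2_eq_square algebra_simps)
  ultimately have "1 - a\<^sup>2 + \<delta> * a = 0" unfolding qq(1) by simp
  then have "(b k s)\<^sup>2 = 0" using root_b[of s k] s by (simp add: a_def)
  then show ?thesis by simp
qed

lemma not_swap_b: "s \<in> TT \<Longrightarrow> 1 \<le> k \<Longrightarrow> k < n \<Longrightarrow> \<not> stays k s \<Longrightarrow> \<not> swap_defined k s \<Longrightarrow> b k s = 0"
  using not_swap[of s k] b_zero[of s k] by blast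

lemma mm_TT: assumes "s \<in> TT" "t \<in> TT" "1 \<le> k" "k < n"
  shows "mm (Tm k) (Tm k) s t = Id s t + \<delta> * Tm k s t - \<delta> * \<rho> * Em k s t"
proof (cases "ksim k s t")
  case False
  have "Tm k s x * Tm k x t = 0" for x
    using False ksim_trans[of k s x t] Tm_outside(1) mult_zero_left mult_zero_right by metis
  moreover have "s \<noteq> t" using False by auto
  moreover from calculation(1) have "mm (Tm k) (Tm k) s t = 0"
    unfolding mm_def by (intro sum.neutral) blast
  ultimately show ?thesis using False by (simp add: Tm_outside Em_outside Id_def)
next
  case True
  then have ts: "ksim k t s" by (rule ksim_sym)
  have sum: "mm (Tm k) (Tm k) s t = (\<Sum>x | x \<in> TT \<and> ksim k x s. Tm k s x * Tm k x t)"
    unfolding mm_def by (intro sum_block) (auto simp: Tm_outside)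
  show ?thesis
  proof (cases "stays k s")
    case st: True
    then interpret rank_one_block "{t. t \<in> TT \<and> ksim k t s}" "\<lambda>t. cc t k" "sE k" \<delta> \<rho>
      using block(1) assms by blast
    note ET = block(2)[OF assms(1,3,4) st]
    have "mm (Tm k) (Tm k) s t = (\<Sum>x | x \<in> TT \<and> ksim k x s. tt s x * tt x t)"
      unfolding sum using assms ts by (intro sum.cong) (auto simp: ET)
    then show ?thesis using tt_square[of s t] assms ts ET[of s t] by (simp add: Id_def)
  next
    case nst: False
    have nst': "\<not> stays k x" if "x \<in> TT" "ksim k x s" for x using ksim_stays[OF that(2,1)] assms nst by simp
    have E0: "Em k s t = 0" using nst by (simp add: Em_outside)
    define a where "a = a_coef q u k"
    have b2: "b k s * b k s = 1 - a s * a s + \<delta> * a s"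
      using root_b[of s k] assms nst by (simp add: power2_eq_square a_def)
    show ?thesis
    proof (cases "swap_defined k s")
      case sw: False
      \<comment> \<open>A block of size one: with \<open>b = 0\<close> its entry \<open>a\<close>
        satisfies the quadratic relation itself.\<close>
      have b0: "b k s = 0" using not_swap_b assms nst sw by blast
      have "a s * a s = 1 + \<delta> * a s - (1 - a s * a s + \<delta> * a s)" by (simp add: algebra_simps)
      then have aa: "a s * a s = 1 + \<delta> * a s" unfolding b2[symmetric] b0 by simp
      have "Tm k s x = (if x = s then a s else 0)" if "x \<in> TT" "ksim k x s" for x
        using ksim_sym[OF that(2)] nst sw by (auto simp: Tm_def a_def)
      then have "mm (Tm k) (Tm k) s t = (\<Sum>x | x \<in> TT \<and> ksim k x s. if x = s then a s * Tm k s t else 0)"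
        unfolding sum by (intro sum.cong) auto
      also have "\<dots> = a s * Tm k s t" using finite_TT assms by simp
      finally show ?thesis
        using aa True nst sw E0 by (auto simp: Tm_def Id_def a_def)
    next
      case sw: True
      define s' where "s' = swap r k s"
      note S = swap_facts[OF assms(1,3,4) sw, folded s'_def]
      have bs: "b k s' = b k s" using root_swap[of s k] assms nst sw unfolding s'_def by auto
      have nss': "\<not> stays k s'" by (rule S(7))
      have "Tm k s x = (if x = s then a s else 0) + (if x = s' then b k s else 0)" if "x \<in> TT" "ksim k x s" for x
        using ksim_sym[OF that(2)] nst sw S(8) by (auto simp: Tm_def s'_def a_def)
      then have "mm (Tm k) (Tm k) s t = (\<Sum>x | x \<in> TT \<and> ksim k x s.
          (if x = s then a s * Tm k s t else 0) + (if x = s' then b k s * Tm k s' t else 0))"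
        unfolding sum by (intro sum.cong) (auto simp: distrib_right)
      also have "\<dots> = a s * Tm k s t + b k s * Tm k s' t"
        using finite_TT assms S(1) ksim_sym[OF S(2)] by (simp add: sum.distrib)
      finally have eq: "mm (Tm k) (Tm k) s t = a s * Tm k s t + b k s * Tm k s' t" .
      have T1: "Tm k s t = (if t = s then a s else if t = s' then b k s else 0)"
        using True nst sw by (auto simp: Tm_def s'_def a_def)
      have T2: "Tm k s' t = (if t = s' then a s' else if t = s then b k s else 0)"
        using ksim_trans[OF ksim_sym[OF S(2)] True] nss' S(5,9) bs by (auto simp: Tm_def a_def)
      have c: "cc s (k + 1) - cc s k \<noteq> 0" using mid_facts(2)[of s s k] assms by simp
      have h1: "a s * (cc s (k + 1) - cc s k) = \<delta> * cc s (k + 1)"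
        using c by (simp add: a_def a_coef_def)
      have h2: "a s' * (cc s k - cc s (k + 1)) = \<delta> * cc s k"
        using c S(3,4) by (simp add: a_def a_coef_def)
      \<comment> \<open>The trace of the two by two block is \<delta>, which settles its
        off-diagonal entries; the diagonal ones are the defining equation of
        \<open>b\<close>.\<close>
      have "(a s + a s') * (cc s (k + 1) - cc s k) = a s * (cc s (k + 1) - cc s k) - a s' * (cc s k - cc s (k + 1))"
        by (simp add: algebra_simps)
      also have "\<dots> = \<delta> * (cc s (k + 1) - cc s k)" unfolding h1 h2 by (rule right_diff_distrib[symmetric])
      finally have "(a s + a s') * (cc s (k + 1) - cc s k) = \<delta> * (cc s (k + 1) - cc s k)" .
      then have aa: "a s + a s' = \<delta>" using c mult_right_cancel by blast
      have "a s * Tm k s t + b k s * Tm k s' t = Id s t + \<delta> * Tm k s t"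
      proof -
        consider "t = s" | "t = s'" "t \<noteq> s" | "t \<noteq> s" "t \<noteq> s'" by blast
        then show ?thesis
        proof cases
          case 1
          then show ?thesis unfolding T1 T2 using b2 S(8) by (simp add: Id_def)
        next
          case 2
          have "a s * b k s + b k s * a s' = \<delta> * b k s"
            unfolding aa[symmetric] by (simp add: algebra_simps)
          then show ?thesis unfolding T1 T2 using 2 by (simp add: Id_def)
        next
          case 3
          then show ?thesis unfolding T1 T2 by (simp add: Id_def)
        qed
      qed
      then show ?thesis using eq E0 by simp
    qed
  qed
qed

text \<open>In a staying block \<open>cc t (k + 1)\<close> is the inverse of \<open>cc t k\<close>,
  and the denominator of the coefficient of \<open>T\<close> clears. Otherwise the diagonal entry is
  the definition of \<open>a\<close>, and an exchange permutes the two contents.\<close>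

lemma Tm_X:
  assumes "s \<in> TT" "t \<in> TT" "1 \<le> k" "k < n"
  shows "Tm k s t * cc s k - Tm k s t * cc t (k + 1) = \<delta> * cc t (k + 1) * (Em k s t - Id s t)"
proof (cases "ksim k s t")
  case False
  moreover have "s \<noteq> t" using False by auto
  ultimately show ?thesis by (simp add: Tm_outside Em_outside Id_def)
next
  case True
  show ?thesis
  proof (cases "stays k s")
    case st: True
    then have stt: "stays k t" using True ksim_stays assms by blast
    have ct: "cc t k * cc t (k + 1) = 1" using stays_iff assms stt by simp
    have ne: "cc s k * cc t k - 1 \<noteq> 0"
      using cc_mult_ne_1(1)[of s t k] ksim_nth[OF True, of "k - 1"] assms by simp
    define x where "x = Em k s t - Id s t"
    have "Tm k s t * (cc s k * cc t k - 1) = \<delta> * x"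
      using True st ne by (simp add: Tm_def x_def)
    moreover have "T * (c * (d * d') - d') = (T * (c * d - 1)) * d'" for T c d d' :: 'a
      by (simp add: algebra_simps)
    ultimately have h: "Tm k s t * (cc s k * (cc t k * cc t (k + 1)) - cc t (k + 1)) = \<delta> * x * cc t (k + 1)"
      by (simp only:)
    have "T * c - T * d = D * d * x" if "T * (c * 1 - d) = D * x * d" for T c d D x :: 'a
      using that by (simp add: algebra_simps)
    from this[OF h[unfolded ct]] show ?thesis unfolding x_def .
  next
    case nst: False
    consider "t = s" | "t \<noteq> s" "swap_defined k s" "t = swap r k s" | "t \<noteq> s" "\<not> (swap_defined k s \<and> t = swap r k s)"
      by blast
    then show ?thesis
    proof cases
      case 1
      have "cc s (k + 1) - cc s k \<noteq> 0" using mid_facts(2)[of s s k] assms by simp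
      then have "a_coef q u k s * (cc s (k + 1) - cc s k) = \<delta> * cc s (k + 1)" by (simp add: a_coef_def)
      then show ?thesis using 1 True nst by (simp add: Tm_def Em_outside Id_def algebra_simps)
    next
      case 2
      then show ?thesis using True nst swap_facts(4)[of s k] assms by (simp add: Tm_def Em_outside Id_def)
    next
      case 3
      then show ?thesis using True nst by (auto simp: Tm_def Em_outside Id_def)
    qed
  qed
qed

lemma Tm_X':
  assumes "s \<in> TT" "t \<in> TT" "1 \<le> k" "k < n"
  shows "Tm k s t * cc t k - Tm k s t * cc s (k + 1) = \<delta> * (Em k s t - Id s t) * cc s (k + 1)"
proof -
  have "Id t s = Id s t" by (auto simp: Id_def)
  then show ?thesis using Tm_X[of t s k] Tm_sym[OF assms] Em_sym[OF assms] assms by (simp add: mult_ac)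
qed

lemma Tm_X_far:
  assumes "s \<in> TT" "t \<in> TT" "1 \<le> j" "j \<le> n" "j \<noteq> k" "j \<noteq> k + 1"
  shows "Tm k s t * cc s j = Tm k s t * cc t j"
  using ksim_cc[of k s t j] assms by (cases "ksim k s t") (auto simp: Tm_outside)

lemma Em_X:
  assumes "s \<in> TT" "t \<in> TT" "1 \<le> k" "k < n"
  shows "cc s k * cc s (k + 1) * Em k s t = Em k s t" "Em k s t * (cc t k * cc t (k + 1)) = Em k s t"
proof -
  have *: "cc s k * cc s (k + 1) * Em k s t = Em k s t" if "s \<in> TT" "t \<in> TT" for s t
    using stays_iff[of s k] that assms(3,4) by (cases "stays k s") (auto simp: Em_outside)
  then show "cc s k * cc s (k + 1) * Em k s t = Em k s t" using assms by blast
  show "Em k s t * (cc t k * cc t (k + 1)) = Em k s t"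
    using *[of t s] Em_sym[OF assms] assms by (simp add: mult_ac)
qed

section \<open>Locality of the coefficients and distant strands\<close>

lemma cc_local: "s ! (k - 1) = t ! (k - 1) \<Longrightarrow> s ! k = t ! k \<Longrightarrow> cc s k = cc t k"
  by (simp add: cont_tab_def)

lemma E_diag_local: "s ! (k - 1) = t ! (k - 1) \<Longrightarrow> s ! k = t ! k \<Longrightarrow> E_diag r q u \<rho> k s = E_diag r q u \<rho> k t"
  using cc_local[of s k t] by (simp add: E_diag_def Wfun_def)

lemma swap_local:
  assumes "s \<in> TT" "t \<in> TT" "1 \<le> k" "k < n"
    and eq: "s ! (k - 1) = t ! (k - 1)" "s ! k = t ! k" "s ! (k + 1) = t ! (k + 1)"
  shows "swap_defined k s = swap_defined k t" "swap r k s ! k = swap r k t ! k"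
proof -
  show "swap_defined k s = swap_defined k t" by (simp only: swap_defined_def eq)
  have "k < length s" "k < length t" using assms(1-4) tab_length by auto
  then show "swap r k s ! k = swap r k t ! k" by (simp only: swap_def nth_list_update_eq eq)
qed

text \<open>The residue depends only on the vertices \<open>k - 1\<close> and \<open>k\<close>, and
  by root condition (e) equal residues have equal chosen roots.\<close>

lemma sE_local:
  assumes "s \<in> TT" "t \<in> TT" "1 \<le> k" "k < n" "stays k s" "stays k t"
    and "s ! (k - 1) = t ! (k - 1)" "s ! k = t ! k"
  shows "sE k s = sE k t"
  using root_eq[of s t k] E_diag_local[of s k t] assms by simp

text \<open>A coefficient of \<open>T_l\<close> sees only the vertices \<open>l - 1\<close>,
  \<open>l\<close> and \<open>l + 1\<close>. For the roots \<open>b\<close>, which are arbitrary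
  choices, this is root condition (b).\<close>

lemma Tm_local:
  assumes TT: "s \<in> TT" "x \<in> TT" "y \<in> TT" "t \<in> TT" and l: "1 \<le> l" "l < n" and k: "1 \<le> k" "k < n"
    and far: "\<bar>int l - int k\<bar> > 1"
    and sim: "ksim l s x" "ksim l y t" "ksim k s y" and eq: "x ! l = t ! l"
  shows "Tm l s x = Tm l y t"
proof -
  have n: "l - 1 \<noteq> k" "l \<noteq> k" "l + 1 \<noteq> k" "l - 1 \<noteq> l" using far l by auto
  have sy: "s ! (l - 1) = y ! (l - 1)" "s ! l = y ! l" "s ! (l + 1) = y ! (l + 1)"
    using ksim_nth[OF sim(3) TT(1)] n l by auto
  have sx: "s ! (l - 1) = x ! (l - 1)" "s ! (l + 1) = x ! (l + 1)"
    using ksim_nth[OF sim(1) TT(1)] n l by auto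
  have yt: "y ! (l - 1) = t ! (l - 1)" "y ! (l + 1) = t ! (l + 1)"
    using ksim_nth[OF sim(2) TT(3)] n l by auto
  have ids: "s = x \<longleftrightarrow> y = t"
    using ksim_eqI[OF TT(1,2) sim(1)] ksim_eqI[OF TT(3,4) sim(2)] sy eq by auto
  have cs: "cc s l = cc y l" "cc x l = cc t l" "cc s (l + 1) = cc y (l + 1)"
    using cc_local[of s l y] cc_local[of x l t] cc_local[of s "l + 1" y] sy sx yt eq by auto
  show ?thesis
  proof (cases "stays l s")
    case True
    then have st: "stays l y" "stays l x" "stays l t" using sy sx yt by auto
    have "sE l s = sE l y" "sE l x = sE l t"
      using sE_local[of s y l] sE_local[of x t l] TT l True st sy sx yt eq by simp_all
    then show ?thesis using True st sim cs ids by (simp add: Tm_def Em_def Id_def)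
  next
    case False
    then have nst: "\<not> stays l y" using sy by auto
    have a: "a_coef q u l s = a_coef q u l y" using cs by (simp add: a_coef_def)
    have b: "b l s = b l y" using root_far[of s y l k] TT l k False sim(3) far by simp
    note sw = swap_local[OF TT(1,3) l sy]
    have "x = swap r l s \<longleftrightarrow> t = swap r l y" if sd: "swap_defined l s"
    proof -
      have sd': "swap_defined l y" using sd sw by simp
      note S = swap_facts[OF TT(1) l sd] and S' = swap_facts[OF TT(3) l sd']
      have "x = swap r l s \<longleftrightarrow> x ! l = swap r l s ! l"
        using ksim_eqI[OF TT(2) S(1) ksim_trans[OF ksim_sym[OF sim(1)] S(2)]] by auto
      also have "\<dots> \<longleftrightarrow> t ! l = swap r l y ! l" using eq sw(2) by simp
      also have "\<dots> \<longleftrightarrow> t = swap r l y"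
        using ksim_eqI[OF TT(4) S'(1) ksim_trans[OF ksim_sym[OF sim(2)] S'(2)]] by auto
      finally show ?thesis .
    qed
    moreover have "x = s \<longleftrightarrow> t = y" using ids by auto
    ultimately show ?thesis
      using False nst sim a b sw(1) unfolding Tm_def by (cases "swap_defined l s") simp_all
  qed
qed

lemma far_update:
  assumes TT: "s \<in> TT" "t \<in> TT" and l: "1 \<le> l" "l < n" and far: "\<bar>int l - int k\<bar> > 1"
    and agree: "\<And>j. j \<le> n \<Longrightarrow> j \<noteq> k \<Longrightarrow> j \<noteq> l \<Longrightarrow> s ! j = t ! j"
  obtains x where "x \<in> TT" "ksim l s x" "ksim k x t" "x ! l = t ! l"
proof -
  have n: "l - 1 \<noteq> k" "l \<noteq> k" "l + 1 \<noteq> k" "l - 1 \<noteq> l" using far l by auto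
  have eq: "dg s (l - 1) = dg t (l - 1)" "dg s (l + 1) = dg t (l + 1)"
    using agree[of "l - 1"] agree[of "l + 1"] n l by (auto simp: dg_def)
  have "node_ideal r (diagram (t ! l))" using dg_ideal[OF TT(2), of l] l by (simp add: dg_def)
  moreover have "diagram (t ! l) = toggle (dg s (l - 1)) (nd t l)"
    using dg_step[OF TT(2), of l] l eq by (simp add: dg_def)
  moreover have "dg s (l + 1) = toggle (diagram (t ! l)) (nd t (l + 1))"
    using dg_step[OF TT(2), of "l + 1"] l eq by (simp add: dg_def)
  ultimately have up: "s[l := t ! l] \<in> TT" "ksim l s (s[l := t ! l])" "s[l := t ! l] ! l = t ! l"
    using update_tab[OF TT(1) l] by blast+
  have "ksim k (s[l := t ! l]) t"
  proof (rule ksimI[OF up(1) TT(2)])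
    fix j assume j: "j \<le> n" "j \<noteq> k"
    show "s[l := t ! l] ! j = t ! j"
      using up(3) agree[OF j] by (cases "j = l") auto
  qed
  then show thesis using that up by blast
qed

lemma mm_unique:
  assumes "x \<in> TT" and "\<And>y. y \<in> TT \<Longrightarrow> N s y * M y t \<noteq> 0 \<Longrightarrow> y = x"
  shows "mm N M s t = N s x * M x t"
proof -
  have "mm N M s t = (\<Sum>y\<in>TT. if y = x then N s x * M x t else 0)"
    unfolding mm_def
  proof (rule sum.cong[OF refl])
    fix y assume "y \<in> TT"
    then show "N s y * M y t = (if y = x then N s x * M x t else 0)"
      using assms(2)[of y] by (cases "N s y * M y t = 0") auto
  qed
  then show ?thesis using assms(1) finite_TT by simp
qed

text \<open>In either order the end points determine the tableau in between, and locality matches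
  the two paths factor by factor.\<close>

lemma mm_TT_far:
  assumes TT: "s \<in> TT" "t \<in> TT" and l: "1 \<le> l" "l < n" and k: "1 \<le> k" "k < n"
    and far: "\<bar>int l - int k\<bar> > 1"
  shows "mm (Tm l) (Tm k) s t = mm (Tm k) (Tm l) s t"
proof (cases "\<forall>j\<le>n. j \<noteq> k \<and> j \<noteq> l \<longrightarrow> s ! j = t ! j")
  case False
  have z: "Tm i s y * Tm j y t = 0" if "y \<in> TT" "{i, j} = {k, l}" for i j y
  proof (rule ccontr)
    assume "Tm i s y * Tm j y t \<noteq> 0"
    then have "Tm i s y \<noteq> 0" "Tm j y t \<noteq> 0" by auto
    then have "ksim i s y" "ksim j y t" using Tm_outside by blast+
    have "s ! m = t ! m" if m: "m \<le> n" "m \<noteq> k" "m \<noteq> l" for m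
    proof -
      have "m \<noteq> i" "m \<noteq> j" using m \<open>{i, j} = {k, l}\<close> by blast+
      then show ?thesis
        using ksim_nth[OF \<open>ksim i s y\<close> TT(1) m(1)] ksim_nth[OF \<open>ksim j y t\<close> \<open>y \<in> TT\<close> m(1)] by simp
    qed
    then show False using False by blast
  qed
  have "mm (Tm l) (Tm k) s t = 0" "mm (Tm k) (Tm l) s t = 0"
    unfolding mm_def by (rule sum.neutral; use z in blast)+
  then show ?thesis by simp
next
  case True
  have lk: "l \<noteq> k" using far by auto
  obtain x where x: "x \<in> TT" "ksim l s x" "ksim k x t" "x ! l = t ! l"
    using far_update[OF TT l far] True by blast
  have far': "\<bar>int k - int l\<bar> > 1" using far by linarith
  obtain y where y: "y \<in> TT" "ksim k s y" "ksim l y t" "y ! k = t ! k"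
    using far_update[OF TT k far'] True by blast
  have "mm (Tm l) (Tm k) s t = Tm l s x * Tm k x t"
  proof (rule mm_unique[OF x(1)])
    fix z assume z: "z \<in> TT" "Tm l s z * Tm k z t \<noteq> 0"
    then have "Tm l s z \<noteq> 0" "Tm k z t \<noteq> 0" by auto
    then have zz: "ksim l s z" "ksim k z t" using Tm_outside by blast+
    have "z ! l = t ! l" using ksim_nth[OF zz(2) z(1), of l] lk l by simp
    then show "z = x" using ksim_eqI[OF z(1) x(1) ksim_trans[OF ksim_sym[OF zz(1)] x(2)]] x(4) by simp
  qed
  moreover have "mm (Tm k) (Tm l) s t = Tm k s y * Tm l y t"
  proof (rule mm_unique[OF y(1)])
    fix z assume z: "z \<in> TT" "Tm k s z * Tm l z t \<noteq> 0"
    then have "Tm k s z \<noteq> 0" "Tm l z t \<noteq> 0" by auto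
    then have zz: "ksim k s z" "ksim l z t" using Tm_outside by blast+
    have "z ! k = t ! k" using ksim_nth[OF zz(2) z(1), of k] lk k by simp
    then show "z = y" using ksim_eqI[OF z(1) y(1) ksim_trans[OF ksim_sym[OF zz(1)] y(2)]] y(4) by simp
  qed
  moreover have "Tm l s x = Tm l y t"
    by (rule Tm_local[OF TT(1) x(1) y(1) TT(2) l k far x(2) y(3) y(2) x(4)])
  moreover have "Tm k s y = Tm k x t"
    by (rule Tm_local[OF TT(1) y(1) x(1) TT(2) k l far' y(2) x(3) x(2) y(4)])
  ultimately show ?thesis by simp
qed

section \<open>The vectors that span the images of the \<open>E_k\<close>\<close>

definition xi :: "nat \<Rightarrow> tab \<Rightarrow> (tab \<Rightarrow>\<^sub>0 'a)"
  where "xi k w = (\<Sum>x | x \<in> TT \<and> ksim k x w. smul (sE k x) (bvec x))"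

lemma xi_ksim: "ksim k w s \<Longrightarrow> xi k w = xi k s"
proof -
  assume "ksim k w s"
  then have "{x. x \<in> TT \<and> ksim k x w} = {x. x \<in> TT \<and> ksim k x s}"
    using ksim_sym ksim_trans by blast
  then show ?thesis by (simp add: xi_def)
qed

lemma lookup_xi: "t \<in> TT \<Longrightarrow> Poly_Mapping.lookup (xi k w) t = (if ksim k t w then sE k t else 0)"
proof -
  assume t: "t \<in> TT"
  have "Poly_Mapping.lookup (xi k w) t = (\<Sum>x | x \<in> TT \<and> ksim k x w. if x = t then sE k t else 0)"
    unfolding xi_def lookup_sum by (rule sum.cong) (auto simp: lookup_bvec)
  then show ?thesis using t finite_TT by simp
qed

lemma xi_closed: "xi k w \<in> FS"
  unfolding xi_def by (intro free_space_sum free_space_closed) auto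

lemma FS_eqI: "v \<in> FS \<Longrightarrow> w \<in> FS \<Longrightarrow> (\<And>t. t \<in> TT \<Longrightarrow> Poly_Mapping.lookup v t = Poly_Mapping.lookup w t) \<Longrightarrow> v = w"
  by (rule poly_mapping_eqI) (metis free_space_iff)

lemma mop_xi: "mop M (xi k w) = (\<Sum>x | x \<in> TT \<and> ksim k x w. smul (sE k x) (mop M (bvec x)))"
  by (simp add: xi_def linear_map_sum[OF linear_mop] linear_mapD[OF linear_mop])

lemma lookup_mop_xi: "t \<in> TT \<Longrightarrow>
    Poly_Mapping.lookup (mop M (xi k w)) t = (\<Sum>x | x \<in> TT \<and> ksim k x w. sE k x * M x t)"
  by (simp add: mop_xi lookup_sum lookup_mop_bvec)

lemma E_bvec:
  assumes "s \<in> TT"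
  shows "mop (Em k) (bvec s) = (if stays k s then smul (sE k s) (xi k s) else 0)"
proof (rule FS_eqI)
  show "mop (Em k) (bvec s) \<in> FS" by (rule mop_closed)
  show "(if stays k s then smul (sE k s) (xi k s) else 0) \<in> FS"
    by (simp add: free_space_closed xi_closed)
  fix t assume "t \<in> TT"
  moreover have "ksim k t s \<longleftrightarrow> ksim k s t" using ksim_sym by blast
  ultimately show "Poly_Mapping.lookup (mop (Em k) (bvec s)) t =
      Poly_Mapping.lookup (if stays k s then smul (sE k s) (xi k s) else 0) t"
    using assms by (cases "ksim k s t") (auto simp: lookup_mop_bvec lookup_xi Em_def)
qed

text \<open>In the \<open>l\<close>-block of \<open>w\<close> only \<open>w\<close> stays at
  \<open>k\<close>, and its coefficient is \<open>sE l w * sE k w = 1\<close> by root condition (d).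
  The form of the hypothesis on \<open>{k, l}\<close> covers both orders of neighbouring
  strands.\<close>

lemma E_xi:
  assumes w: "w \<in> TT" "stays k w" "stays l w" and kl: "{k, l} = {m, m + 1}" "1 \<le> m" "m + 1 < n"
  shows "mop (Em k) (xi l w) = xi k w"
proof -
  have only: "x = w" if x: "x \<in> TT" "ksim l x w" "stays k x" for x
  proof -
    have "x ! l = w ! l"
    proof (cases "k = m")
      case True
      then have l: "l = m + 1" using kl(1) by (auto simp: doubleton_eq_iff)
      have "x ! (m - 1) = w ! (m - 1)" using ksim_nth[OF x(2,1), of "m - 1"] l kl by simp
      then show ?thesis using x(3) w(2) True l by simp
    next
      case False
      then have l: "k = m + 1" "l = m" using kl(1) by (auto simp: doubleton_eq_iff)
      have "x ! (m + 2) = w ! (m + 2)" using ksim_nth[OF x(2,1), of "m + 2"] l kl by simp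
      then show ?thesis using x(3) w(2) l by simp
    qed
    then show "x = w" by (rule ksim_eqI[OF x(1) w(1) x(2)])
  qed
  have "mop (Em k) (xi l w) = (\<Sum>x | x \<in> TT \<and> ksim l x w. if x = w then smul (sE l w) (mop (Em k) (bvec w)) else 0)"
    unfolding mop_xi
  proof (rule sum.cong[OF refl])
    fix x assume x: "x \<in> {x. x \<in> TT \<and> ksim l x w}"
    show "smul (sE l x) (mop (Em k) (bvec x)) = (if x = w then smul (sE l w) (mop (Em k) (bvec w)) else 0)"
      using only[of x] x by (cases "stays k x") (auto simp: E_bvec smul_simps)
  qed
  also have "\<dots> = smul (sE l w) (mop (Em k) (bvec w))"
    using finite_TT w by simp
  also have "\<dots> = smul (sE l w * sE k w) (xi k w)"
    using w by (simp add: E_bvec smul_simps)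
  also have "sE l w * sE k w = 1"
  proof -
    have "stays m w" "stays (m + 1) w" using w kl(1) by (auto simp: doubleton_eq_iff)
    then have "sE m w * sE (m + 1) w = 1" using root_inverse[of w m] w(1) kl(2,3) by simp
    then show ?thesis using kl(1) by (auto simp: doubleton_eq_iff mult.commute)
  qed
  finally show ?thesis by (simp add: smul_simps)
qed

text \<open>The vertex \<open>k\<close> is replaced by \<open>s ! (k + 2)\<close> or
  \<open>s ! (k - 2)\<close>, depending on the side of \<open>l\<close>; the path then goes back and
  forth at both positions.\<close>

lemma exists_double:
  assumes s: "s \<in> TT" and kl: "{k, l} = {m, m + 1}" "1 \<le> m" "m + 1 < n" and st: "stays k s"
  obtains w where "w \<in> TT" "ksim k w s" "stays k w" "stays l w"
proof (cases "k = m")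
  case True
  then have l: "l = m + 1" using kl(1) by (auto simp: doubleton_eq_iff)
  have "\<exists>\<alpha>. differ_by \<alpha> (s ! (k + 1)) (s ! (k + 2))" "is_rpart r (s ! (k + 2))"
    using dg_step[OF s, of "k + 2"] dg_ideal[OF s, of "k + 2"] True kl
    by (auto simp: differ_by_iff dg_def is_rpart_iff simp del: split_paired_Ex)
  then obtain w where w: "w \<in> TT" "ksim k w s" "w ! k = s ! (k + 2)"
    using replace_by_neighbour[of s k "s ! (k + 2)"] s st True kl by auto
  have "w ! (k + 2) = s ! (k + 2)" using ksim_nth[OF w(2,1), of "k + 2"] True kl by simp
  then have "stays l w" using w(3) True l by simp
  moreover have "stays k w" using ksim_stays[OF w(2,1)] True kl st by simp
  ultimately show thesis using that w by blast
next
  case False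
  then have l: "k = m + 1" "l = m" using kl(1) by (auto simp: doubleton_eq_iff)
  have "\<exists>\<alpha>. differ_by \<alpha> (s ! (k + 1)) (s ! (m - 1))" "is_rpart r (s ! (m - 1))"
    using dg_step'[OF s, of m] dg_ideal[OF s, of "m - 1"] st l kl
    by (auto simp: differ_by_iff dg_def is_rpart_iff simp del: split_paired_Ex)
  then obtain w where w: "w \<in> TT" "ksim k w s" "w ! k = s ! (m - 1)"
    using replace_by_neighbour[of s k "s ! (m - 1)"] s st l kl by auto
  have "w ! (m - 1) = s ! (m - 1)" using ksim_nth[OF w(2,1), of "m - 1"] l kl by simp
  then have "stays l w" using w(3) l by simp
  moreover have "stays k w" using ksim_stays[OF w(2,1)] l kl st by simp
  ultimately show thesis using that w by blast
qed

text \<open>\<open>T_l\<close> does not move the vertex \<open>k\<close>, so only the block member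
  with the right vertex there can reach \<open>t\<close>.\<close>

lemma sum_Tm_single:
  assumes t: "t \<in> TT" and kl: "k \<noteq> l" "k \<le> n" and x: "x \<in> TT" "ksim k x w" "x ! k = t ! k"
  shows "(\<Sum>y | y \<in> TT \<and> ksim k y w. sE k y * Tm l y t) = sE k x * Tm l x t"
proof -
  have "(\<Sum>y | y \<in> TT \<and> ksim k y w. sE k y * Tm l y t) =
      (\<Sum>y | y \<in> TT \<and> ksim k y w. if y = x then sE k x * Tm l x t else 0)"
  proof (rule sum.cong[OF refl])
    fix y assume "y \<in> {y. y \<in> TT \<and> ksim k y w}"
    then have y: "y \<in> TT" "ksim k y w" by auto
    have "y = x" if "Tm l y t \<noteq> 0"
    proof (rule ksim_eqI[OF y(1) x(1)])
      show "ksim k y x" using y x ksim_sym ksim_trans by blast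
      have "ksim l y t" using that Tm_outside by blast
      then show "y ! k = x ! k" using ksim_nth[of l y t k] y kl x(3) by simp
    qed
    then show "sE k y * Tm l y t = (if y = x then sE k x * Tm l x t else 0)" by auto
  qed
  then show ?thesis using x finite_TT by simp
qed

lemma sum_Tm_zero:
  assumes "\<And>x. x \<in> TT \<Longrightarrow> ksim k x w \<Longrightarrow> Tm l x t = 0"
  shows "(\<Sum>y | y \<in> TT \<and> ksim k y w. sE k y * Tm l y t) = 0"
  using assms by (intro sum.neutral) auto

end

section \<open>Three adjacent strands\<close>

text \<open>Three strands. With \<open>U = T\<^sub>1\<^sup>-\<^sup>1 = T\<^sub>1 - \<delta> + \<delta> E\<^sub>1\<close> one has \<open>T\<^sub>2 E\<^sub>1 = U E\<^sub>2 E\<^sub>1\<close> and \<open>E\<^sub>1 T\<^sub>2 = E\<^sub>1 E\<^sub>2 U\<close>;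
  these turn the error terms in \<open>\<Phi> X\<^sub>1 = X\<^sub>3 \<Phi>\<close> into \<open>(U + \<delta> - \<delta> E\<^sub>1) E\<^sub>2 U = T\<^sub>1 E\<^sub>2 U\<close>.\<close>

locale bmw_triple =
  fixes V :: "('s \<Rightarrow>\<^sub>0 'a::field) set"
    and T1 T2 E1 E2 X1 X2 X3 :: "('s \<Rightarrow>\<^sub>0 'a) \<Rightarrow> ('s \<Rightarrow>\<^sub>0 'a)" and \<delta> \<rho> :: 'a
  assumes lin: "linear_map T1" "linear_map T2" "linear_map E1" "linear_map E2" "linear_map X3"
    and closed: "\<And>v. v \<in> V \<Longrightarrow> T1 v \<in> V" "\<And>v. v \<in> V \<Longrightarrow> T2 v \<in> V" "\<And>v. v \<in> V \<Longrightarrow> E1 v \<in> V"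
      "\<And>v. v \<in> V \<Longrightarrow> E2 v \<in> V" "\<And>v. v \<in> V \<Longrightarrow> X1 v \<in> V" "\<And>v. v \<in> V \<Longrightarrow> X2 v \<in> V" "\<And>v. v \<in> V \<Longrightarrow> X3 v \<in> V"
      "\<And>v w. v \<in> V \<Longrightarrow> w \<in> V \<Longrightarrow> v + w \<in> V" "\<And>v w. v \<in> V \<Longrightarrow> w \<in> V \<Longrightarrow> v - w \<in> V"
      "\<And>c v. v \<in> V \<Longrightarrow> smul c v \<in> V"
    and sq: "\<And>v. v \<in> V \<Longrightarrow> T1 (T1 v) = v + smul \<delta> (T1 v) - smul (\<delta> * \<rho>) (E1 v)"
      "\<And>v. v \<in> V \<Longrightarrow> T2 (T2 v) = v + smul \<delta> (T2 v) - smul (\<delta> * \<rho>) (E2 v)"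
    and TE: "\<And>v. v \<in> V \<Longrightarrow> T1 (E1 v) = smul \<rho> (E1 v)" "\<And>v. v \<in> V \<Longrightarrow> E1 (T1 v) = smul \<rho> (E1 v)"
      "\<And>v. v \<in> V \<Longrightarrow> E2 (T2 v) = smul \<rho> (E2 v)"
    and h: "\<And>v. v \<in> V \<Longrightarrow> T1 (T2 (E1 v)) = E2 (E1 v)" "\<And>v. v \<in> V \<Longrightarrow> E1 (T2 (T1 v)) = E1 (E2 v)"
      "\<And>v. v \<in> V \<Longrightarrow> E2 (T1 (T2 v)) = E2 (E1 v)"
    and EEE: "\<And>v. v \<in> V \<Longrightarrow> E2 (E1 (E2 v)) = E2 v"
    and TX: "\<And>v. v \<in> V \<Longrightarrow> T1 (X1 v) = X2 (T1 v) + smul \<delta> (X2 (E1 v)) - smul \<delta> (X2 v)"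
      "\<And>v. v \<in> V \<Longrightarrow> T2 (X2 v) = X3 (T2 v) + smul \<delta> (X3 (E2 v)) - smul \<delta> (X3 v)"
      "\<And>v. v \<in> V \<Longrightarrow> T1 (X3 v) = X3 (T1 v)" "\<And>v. v \<in> V \<Longrightarrow> T2 (X1 v) = X1 (T2 v)"
begin

lemmas lins = linear_mapD[OF lin(1)] linear_mapD[OF lin(2)] linear_mapD[OF lin(3)] linear_mapD[OF lin(4)]
  linear_mapD[OF lin(5)]

definition U where "U v = T1 v - smul \<delta> v + smul \<delta> (E1 v)"

lemma U_closed: "v \<in> V \<Longrightarrow> U v \<in> V"
  by (simp add: U_def closed)

lemma T1_U: "v \<in> V \<Longrightarrow> T1 (U v) = v"
  by (simp add: U_def lins sq TE smul_simps)

lemma U_T1: "v \<in> V \<Longrightarrow> U (T1 v) = v"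
  by (simp add: U_def closed sq TE smul_simps)

definition Phi where "Phi v = T1 (T2 (T1 v)) - T2 (T1 (T2 v))"

text \<open>Both halves give \<open>\<rho> E1 E2\<close>: the left one by
  \<open>E1 T1 = \<rho> E1\<close> and then \<open>E1 T2 T1 = E1 E2\<close>, the right one in the
  opposite order with \<open>E2 T2 = \<rho> E2\<close>.\<close>

lemma E1_Phi: "v \<in> V \<Longrightarrow> E1 (Phi v) = 0"
proof -
  assume v: "v \<in> V"
  have "E1 (T1 (T2 (T1 v))) = smul \<rho> (E1 (E2 v))" using v by (simp add: TE closed h)
  moreover have "E1 (T2 (T1 (T2 v))) = smul \<rho> (E1 (E2 v))" using v by (simp add: TE closed h lins)
  ultimately show ?thesis by (simp add: Phi_def lins)
qed

lemma E2_Phi: "v \<in> V \<Longrightarrow> E2 (Phi v) = 0"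
proof -
  assume v: "v \<in> V"
  have "E2 (T1 (T2 (T1 v))) = smul \<rho> (E2 (E1 v))" using v by (simp add: TE closed h lins)
  moreover have "E2 (T2 (T1 (T2 v))) = smul \<rho> (E2 (E1 v))" using v by (simp add: TE closed h)
  ultimately show ?thesis by (simp add: Phi_def lins)
qed

lemma error_terms:
  assumes v: "v \<in> V"
  shows "T1 (E2 (T1 v)) + smul \<delta> (T1 (E2 (E1 v))) - smul \<delta> (T1 (E2 v)) =
    T2 (E1 (T2 v)) + smul \<delta> (E2 (E1 (T2 v))) - smul \<delta> (E1 (T2 v))"
proof -
  have T2E1: "T2 (E1 w) = U (E2 (E1 w))" if w: "w \<in> V" for w
    using U_T1[of "T2 (E1 w)"] w by (simp add: closed h)
  have E1T2: "E1 (T2 v) = E1 (E2 (U v))"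
    using h(2)[OF U_closed[OF v]] v by (simp add: T1_U)
  have E2E1T2: "E2 (E1 (T2 v)) = E2 (U v)"
    unfolding E1T2 using v by (simp add: EEE U_closed)
  have "T2 (E1 (T2 v)) + smul \<delta> (E2 (E1 (T2 v))) - smul \<delta> (E1 (T2 v)) =
      U (E2 (U v)) + smul \<delta> (E2 (U v)) - smul \<delta> (E1 (E2 (U v)))"
    using T2E1[of "T2 v"] v by (simp add: closed U_closed EEE E2E1T2 E1T2)
  also have "\<dots> = T1 (E2 (U v))" by (simp add: U_def)
  also have "\<dots> = T1 (E2 (T1 v)) + smul \<delta> (T1 (E2 (E1 v))) - smul \<delta> (T1 (E2 v))"
    by (simp add: U_def lins)
  finally show ?thesis by simp
qed

lemma Phi_X: assumes v: "v \<in> V" shows "Phi (X1 v) = X3 (Phi v)"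
proof -
  have T1X: "T2 (T1 (X1 w)) = X3 (T2 (T1 w) + smul \<delta> (E2 (T1 w)) - smul \<delta> (T1 w)
      + smul \<delta> (T2 (E1 w) + smul \<delta> (E2 (E1 w)) - smul \<delta> (E1 w))
      - smul \<delta> (T2 w + smul \<delta> (E2 w) - smul \<delta> w))" if w: "w \<in> V" for w
    using w by (simp add: TX closed lins smul_simps)
  \<comment> \<open>The corrections collected when \<open>X1\<close> moves to the left through the
    two products and becomes \<open>X3\<close>.\<close>
  define Z where "Z = smul \<delta> (T1 (E2 (T1 v)) - T1 (T1 v) + T1 (T2 (E1 v)) + smul \<delta> (T1 (E2 (E1 v)))
    - smul \<delta> (T1 (E1 v)) - T1 (T2 v) - smul \<delta> (T1 (E2 v)) + smul \<delta> (T1 v))"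
  define Z' where "Z' = smul \<delta> (E2 (T1 (T2 v)) - T1 (T2 v) + T2 (E1 (T2 v)) + smul \<delta> (E2 (E1 (T2 v)))
    - smul \<delta> (E1 (T2 v)) - T2 (T2 v) - smul \<delta> (E2 (T2 v)) + smul \<delta> (T2 v))"
  have L: "T1 (T2 (T1 (X1 v))) = X3 (T1 (T2 (T1 v)) + Z)"
    using v by (simp add: T1X TX closed lins smul_simps Z_def)
  have R: "T2 (T1 (T2 (X1 v))) = X3 (T2 (T1 (T2 v)) + Z')"
    using v by (simp add: T1X TX closed lins smul_simps Z'_def)
  have "Z = smul \<delta> (T1 (E2 (T1 v)) + smul \<delta> (T1 (E2 (E1 v))) - smul \<delta> (T1 (E2 v)) + E2 (E1 v) - T1 (T2 v) - v)"
    using v by (simp add: Z_def sq TE h closed smul_simps)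
  also have "\<dots> = smul \<delta> (T2 (E1 (T2 v)) + smul \<delta> (E2 (E1 (T2 v))) - smul \<delta> (E1 (T2 v)) + E2 (E1 v) - T1 (T2 v) - v)"
    unfolding error_terms[OF v] ..
  also have "\<dots> = Z'"
    using v by (simp add: Z'_def sq TE h closed smul_simps)
  finally show ?thesis by (simp add: Phi_def L R lins)
qed

end

context seminormal
begin

section \<open>The relations so far as identities of operators\<close>

lemma op_EE: "mop (Em k) (mop (Em k) v) = smul (\<omega> 0) (mop (Em k) v)" if "1 \<le> k" "k < n"
  unfolding mop_mop smul_mop by (rule mop_cong) (use mm_EE that in auto)

lemma op_TE:
  assumes "1 \<le> k" "k < n"
  shows "mop (Tm k) (mop (Em k) v) = smul \<rho> (mop (Em k) v)" "mop (Em k) (mop (Tm k) v) = smul \<rho> (mop (Em k) v)"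
  unfolding mop_mop smul_mop by (rule mop_cong; use mm_ET assms in auto)+

lemma op_TT:
  assumes "1 \<le> k" "k < n" "v \<in> FS"
  shows "mop (Tm k) (mop (Tm k) v) = v + smul \<delta> (mop (Tm k) v) - smul (\<delta> * \<rho>) (mop (Em k) v)"
proof -
  have "mop (Tm k) (mop (Tm k) v) = mop (\<lambda>s t. (Id s t + \<delta> * Tm k s t) - (\<delta> * \<rho>) * Em k s t) v"
    unfolding mop_mop by (rule mop_cong) (use mm_TT assms in auto)
  also have "\<dots> = mop Id v + smul \<delta> (mop (Tm k) v) - smul (\<delta> * \<rho>) (mop (Em k) v)"
    by (simp only: mop_add mop_diff smul_mop)
  finally show ?thesis using mop_Id[OF assms(3)] by simp
qed

lemma op_TT_far:
  assumes "1 \<le> k" "k < n" "1 \<le> l" "l < n" "\<bar>int l - int k\<bar> > 1"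
  shows "mop (Tm k) (mop (Tm l) v) = mop (Tm l) (mop (Tm k) v)"
  unfolding mop_mop by (rule mop_cong) (use mm_TT_far assms in auto)

lemma op_TX:
  assumes "1 \<le> k" "k < n"
  shows "mop (Tm k) (mop (Xm k) v) - mop (Xm (k + 1)) (mop (Tm k) v) =
      smul \<delta> (mop (Xm (k + 1)) (mop (Em k) v)) - smul \<delta> (mop (Xm (k + 1)) (mop Id v))"
    "mop (Xm k) (mop (Tm k) v) - mop (Tm k) (mop (Xm (k + 1)) v) =
      smul \<delta> (mop (Em k) (mop (Xm (k + 1)) v)) - smul \<delta> (mop Id (mop (Xm (k + 1)) v))"
proof -
  show "mop (Tm k) (mop (Xm k) v) - mop (Xm (k + 1)) (mop (Tm k) v) =
      smul \<delta> (mop (Xm (k + 1)) (mop (Em k) v)) - smul \<delta> (mop (Xm (k + 1)) (mop Id v))"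
    unfolding mop_mop smul_mop mop_diff
  proof (rule mop_cong)
    fix s t assume st: "s \<in> TT" "t \<in> TT"
    have gen: "a * T - T * d = D * (E * d) - D * (I * d)" if "T * a - T * d = D * d * (E - I)"
      for a T d D E I :: 'a using that by (simp add: algebra_simps)
    show "mm (Xm k) (Tm k) s t - mm (Tm k) (Xm (k + 1)) s t =
        \<delta> * mm (Em k) (Xm (k + 1)) s t - \<delta> * mm Id (Xm (k + 1)) s t"
      unfolding Xm_def mm_diag[OF st] by (rule gen[OF Tm_X[OF st assms]])
  qed
  show "mop (Xm k) (mop (Tm k) v) - mop (Tm k) (mop (Xm (k + 1)) v) =
      smul \<delta> (mop (Em k) (mop (Xm (k + 1)) v)) - smul \<delta> (mop Id (mop (Xm (k + 1)) v))"
    unfolding mop_mop smul_mop mop_diff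
  proof (rule mop_cong)
    fix s t assume st: "s \<in> TT" "t \<in> TT"
    have gen: "T * a - d * T = D * (d * E) - D * (d * I)" if "T * a - T * d = D * (E - I) * d"
      for a T d D E I :: 'a using that by (simp add: algebra_simps)
    show "mm (Tm k) (Xm k) s t - mm (Xm (k + 1)) (Tm k) s t =
        \<delta> * mm (Xm (k + 1)) (Em k) s t - \<delta> * mm (Xm (k + 1)) Id s t"
      unfolding Xm_def mm_diag[OF st] by (rule gen[OF Tm_X'[OF st assms]])
  qed
qed

lemma op_TX_far:
  assumes "1 \<le> j" "j \<le> n" "j \<noteq> k" "j \<noteq> k + 1"
  shows "mop (Tm k) (mop (Xm j) v) = mop (Xm j) (mop (Tm k) v)"
  unfolding mop_mop
proof (rule mop_cong)
  fix s t assume st: "s \<in> TT" "t \<in> TT"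
  show "mm (Xm j) (Tm k) s t = mm (Tm k) (Xm j) s t"
    unfolding Xm_def mm_diag[OF st] using Tm_X_far[OF st assms] by (simp only: mult.commute)
qed

text \<open>The entry at \<open>w\<close> of the hook identity: \<open>e\<close> and
  \<open>g\<close> are the mutually inverse roots of \<open>w\<close> at \<open>k\<close> and
  \<open>k + 1\<close>, and \<open>c\<close> and \<open>d\<close> the mutually inverse
  contents.\<close>

lemma algebra_hook_diag:
  fixes e g c d D :: 'a
  assumes "e * g = 1" "c * d = 1" "c * c - 1 \<noteq> 0" "d * d - 1 \<noteq> 0"
  shows "e * (D * ((g * g - 1) / (d * d - 1))) = g * (D * ((e * e - 1) / (c * c - 1))) + D * e - D * g"
proof -
  have eg: "e * (g * g - 1) = g - e" "g * (e * e - 1) = e - g"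
    using assms(1) by (simp_all add: right_diff_distrib mult.assoc[symmetric] mult.commute[of g e])
  have cd: "(d * d - 1) * (c * c) = 1 - c * c"
  proof -
    have "(d * d - 1) * (c * c) = (c * d) * (c * d) - c * c" by (simp add: algebra_simps)
    then show ?thesis using assms(2) by simp
  qed
  have c0: "c * c \<noteq> 0" using assms(2) by auto
  have "e * (D * ((g * g - 1) / (d * d - 1))) = D * ((e * (g * g - 1)) / (d * d - 1))" by simp
  also have "\<dots> = D * (((g - e) * (c * c)) / ((d * d - 1) * (c * c)))" unfolding eg using c0 by simp
  also have "\<dots> = D * (((g - e) * (c * c)) / (1 - c * c))" unfolding cd ..
  also have "((g - e) * (c * c)) / (1 - c * c) = (e - g) / (c * c - 1) + (e - g)"
    using assms(3) by (simp add: divide_simps) (simp add: algebra_simps)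
  finally have "e * (D * ((g * g - 1) / (d * d - 1))) = D * ((g * (e * e - 1)) / (c * c - 1)) + D * (e - g)"
    unfolding eg by (simp add: distrib_left)
  then show ?thesis by (simp add: right_diff_distrib)
qed

lemma two_sided_inverse: "(a :: 'a) * c = 1 \<Longrightarrow> c * d = 1 \<Longrightarrow> d = a"
  by (metis mult.assoc mult_1 mult_1_right)

text \<open>As triples of contents at \<open>k\<close>, \<open>k + 1\<close>, \<open>k + 2\<close>:
  \<open>w\<close> is (c, 1/c, c), \<open>x\<close> is (d, 1/d, c), \<open>t\<close> is (d, c, 1/d)
  and \<open>y\<close> is (c, d, 1/d). The exchange from \<open>t\<close> to \<open>y\<close> exists
  because \<open>c\<close> and \<open>d\<close> are labels at one vertex.\<close>

lemma hook_swap_1: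
  assumes w: "w \<in> TT" "1 \<le> k" "k + 1 < n" "stays k w" "stays (k + 1) w"
    and x: "x \<in> TT" "ksim k x w" "swap_defined (k + 1) x"
  defines "t \<equiv> swap r (k + 1) x"
  obtains y where "y \<in> TT" "ksim (k + 1) y w" "swap_defined k y" "t = swap r k y"
proof -
  note S = swap_facts[OF x(1) _ _ x(3), folded t_def]
  have t: "t \<in> TT" "ksim (k + 1) x t" "cc t (k + 1) = cc x (k + 2)" using S(1-3) w by auto
  have xw: "x ! (k - 1) = w ! (k - 1)" using ksim_nth[OF x(2,1), of "k - 1"] w by simp
  have ck: "cc t k = cc x k" using ksim_cc[OF t(2) x(1), of k] w by simp
  have c0: "cc x (k + 2) = cc w k"
  proof -
    have "cc x (k + 2) = cc w (k + 2)" using ksim_cc[OF x(2,1), of "k + 2"] w by simp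
    moreover have 1: "cc w k * cc w (k + 1) = 1" "cc w (k + 1) * cc w (k + 2) = 1"
      using stays_iff[of w k] stays_iff[of w "k + 1"] w by auto
    moreover have "cc w (k + 2) = cc w k" by (rule two_sided_inverse[OF 1])
    ultimately show ?thesis by simp
  qed
  have nst: "\<not> stays k t"
    using stays_iff[OF t(1), of k] cc_mult_ne_1(1)[OF x(1) w(1), of k] xw w t(3) ck c0 by simp
  have sd: "swap_defined k t"
  proof (rule ccontr)
    assume "\<not> swap_defined k t"
    then obtain m where m: "\<bar>m\<bar> = 1" "cc t (k + 1) = q powi (2 * m) * cc t k"
      using not_swap[OF t(1) _ _ nst] w by auto
    then show False using cc_mult_ne_1(2)[OF w(1) x(1), of k m] xw w t(3) ck c0 by simp
  qed
  define y where "y = swap r k t"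
  note Y = swap_facts[OF t(1) _ _ sd, folded y_def]
  have y: "y \<in> TT" "ksim k t y" "cc y k = cc w k" "swap_defined k y" "swap r k y = t"
    using Y(1-3,5,9) w t(3) c0 by auto
  have agree: "y ! j = w ! j" if "j \<le> n" "j \<noteq> k" "j \<noteq> k + 1" for j
    using ksim_nth[OF y(2) t(1), of j] ksim_nth[OF t(2) x(1), of j] ksim_nth[OF x(2,1), of j] that by simp
  have "y ! k = w ! k" using cc_eq_imp[OF y(1) w(1), of k] agree[of "k - 1"] y(3) w by simp
  then have "ksim (k + 1) y w" using agree by (intro ksimI[OF y(1) w(1)]) metis
  then show thesis using that y by simp
qed

text \<open>The converse, with the same triples. The exchange from \<open>t\<close> to
  \<open>x\<close> exists because the consecutive contents \<open>d\<close> and \<open>c\<close> of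
  \<open>t\<close> are different and their product is not \<open>q^2\<close> or
  \<open>q^(-2)\<close>.\<close>

lemma hook_swap_2:
  assumes w: "w \<in> TT" "1 \<le> k" "k + 1 < n" "stays k w" "stays (k + 1) w"
    and y: "y \<in> TT" "ksim (k + 1) y w" "swap_defined k y"
  defines "t \<equiv> swap r k y"
  obtains x where "x \<in> TT" "ksim k x w" "swap_defined (k + 1) x" "t = swap r (k + 1) x"
proof -
  note S = swap_facts[OF y(1) _ _ y(3), folded t_def]
  have t: "t \<in> TT" "ksim k y t" "cc t k = cc y (k + 1)" "cc t (k + 1) = cc y k" using S(1-4) w by auto
  have "stays (k + 1) y" using ksim_stays[OF y(2,1)] w by simp
  then have yy: "cc y (k + 1) * cc y (k + 2) = 1" using stays_iff[OF y(1), of "k + 1"] w by simp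
  have c2: "cc t (k + 2) = cc y (k + 2)" using ksim_cc[OF t(2) y(1), of "k + 2"] w by simp
  have ne: "cc y (k + 1) \<noteq> cc y k" using mid_facts(2)[OF y(1) y(1), of k] w by simp
  have y0: "cc y (k + 1) \<noteq> 0" using yy by auto
  have inv: "cc y (k + 2) = inverse (cc y (k + 1))" using yy y0 by (metis inverse_unique)
  have nst: "\<not> stays (k + 1) t"
  proof
    assume "stays (k + 1) t"
    then have "cc y k * inverse (cc y (k + 1)) = 1"
      using stays_iff[OF t(1), of "k + 1"] w t(4) c2 inv by simp
    then have "cc y k = cc y (k + 1)" using y0 by (simp add: field_simps)
    then show False using ne by simp
  qed
  have sd: "swap_defined (k + 1) t"
  proof (rule ccontr)
    assume "\<not> swap_defined (k + 1) t"
    then obtain m where m: "\<bar>m\<bar> = 1" "cc t (k + 2) = q powi (2 * m) * cc t (k + 1)"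
      using not_swap[OF t(1) _ _ nst] w by auto
    then have "cc y (k + 1) * (q powi (2 * m) * cc y k) = 1" using c2 inv t(4) y0 by simp
    then have "q powi (2 * m) * (cc y k * cc y (k + 1)) = 1" by (simp only: mult_ac)
    then have "cc y k * cc y (k + 1) = q powi (2 * (- m))"
      using q0 by (simp add: power_int_minus field_simps)
    moreover have "\<bar>- m\<bar> = 1" using m(1) by simp
    ultimately show False using mid_facts(3)[OF t(1) t(1), of k "- m"] w t(3,4) by simp
  qed
  define x where "x = swap r (k + 1) t"
  note X = swap_facts[OF t(1) _ _ sd, folded x_def]
  have x: "x \<in> TT" "ksim (k + 1) t x" "cc x (k + 1) = inverse (cc y (k + 1))" "swap_defined (k + 1) x" "swap r (k + 1) x = t"
    using X(1-3,5,9) w c2 inv by auto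
  have "cc x k = cc y (k + 1)" using ksim_cc[OF x(2) t(1), of k] w t(3) by simp
  then have stx: "stays k x" using stays_iff[OF x(1), of k] w x(3) y0 by simp
  have agree: "x ! j = w ! j" if "j \<le> n" "j \<noteq> k" "j \<noteq> k + 1" for j
    using ksim_nth[OF x(2) t(1), of j] ksim_nth[OF t(2) y(1), of j] ksim_nth[OF y(2,1), of j] that by simp
  have "x ! (k + 1) = w ! (k + 1)" using stx w(4) agree[of "k - 1"] w by simp
  then have "ksim k x w" using agree by (intro ksimI[OF x(1) w(1)]) metis
  then show thesis using that x by simp
qed

lemma Tm_swap: "s \<in> TT \<Longrightarrow> 1 \<le> k \<Longrightarrow> k < n \<Longrightarrow> swap_defined k s \<Longrightarrow> Tm k s (swap r k s) = b k s"
  using swap_facts(2,6,8)[of s k] by (simp add: Tm_def)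

lemma Tm_nonstays:
  assumes "\<not> stays k s" "Tm k s t \<noteq> 0" "s \<noteq> t"
  shows "swap_defined k s" "t = swap r k s" "Tm k s t = b k s"
  using assms by (auto simp: Tm_def split: if_splits)

text \<open>Checked at each entry \<open>t\<close>. In the two blocks of \<open>w\<close> it is a
  scalar identity that uses \<open>sE k w * sE (k + 1) w = 1\<close>; elsewhere either both sides
  are a single exchange or both vanish.\<close>

lemma hook:
  assumes w: "w \<in> TT" "1 \<le> k" "k + 1 < n" "stays k w" "stays (k + 1) w"
  shows "mop (Tm (k + 1)) (xi k w) = mop (Tm k) (xi (k + 1) w) + smul \<delta> (xi k w) - smul \<delta> (xi (k + 1) w)"
proof (rule FS_eqI)
  let ?l = "k + 1"
  show "mop (Tm ?l) (xi k w) \<in> FS" by (rule mop_closed)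
  show "mop (Tm k) (xi ?l w) + smul \<delta> (xi k w) - smul \<delta> (xi ?l w) \<in> FS"
    by (intro free_space_closed mop_closed xi_closed)
  fix t assume t: "t \<in> TT"
  define L where "L = (\<Sum>x | x \<in> TT \<and> ksim k x w. sE k x * Tm ?l x t)"
  define R where "R = (\<Sum>y | y \<in> TT \<and> ksim ?l y w. sE ?l y * Tm k y t)"
  note Lsingle = sum_Tm_single[OF t, of k ?l, folded L_def]
  have ee: "sE k w * sE ?l w = 1" using root_inverse[of w k] w by simp
  have cw: "cc w k * cc w ?l = 1" "cc w ?l * cc w (k + 2) = 1"
    using stays_iff[of w k] stays_iff[of w ?l] w by auto
  have c0: "cc w (k + 2) = cc w k" by (rule two_sided_inverse[OF cw])
  have nz: "cc w k * cc w k - 1 \<noteq> 0" "cc w ?l * cc w ?l - 1 \<noteq> 0"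
    using cc_mult_ne_1(1)[of w w k] cc_mult_ne_1(1)[of w w ?l] w by auto
  have "L = R + \<delta> * (if ksim k t w then sE k t else 0) - \<delta> * (if ksim ?l t w then sE ?l t else 0)"
  proof -
    consider "t = w" | "ksim k t w" "t \<noteq> w" | "ksim ?l t w" "t \<noteq> w" | "\<not> ksim k t w" "\<not> ksim ?l t w" by blast
    then show ?thesis
    proof cases
      case 1
      have "L = sE k w * Tm ?l w w" "R = sE ?l w * Tm k w w"
        unfolding L_def R_def 1 by (rule sum_Tm_single; use w in simp)+
      moreover have "Tm ?l w w = \<delta> * ((sE ?l w * sE ?l w - 1) / (cc w ?l * cc w ?l - 1))"
        "Tm k w w = \<delta> * ((sE k w * sE k w - 1) / (cc w k * cc w k - 1))"
        using w by (simp_all add: Tm_def Em_def Id_def)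
      ultimately show ?thesis
        using algebra_hook_diag[OF ee cw(1) nz, of \<delta>] 1 by simp
    next
      case 2
      have nk: "\<not> ksim ?l t w"
        using ksim_nth[of ?l t w k] ksim_eqI[OF t w(1) 2(1)] t 2(2) w(3) by auto
      have stt: "stays k t" using ksim_stays[OF 2(1) t] w by simp
      have tw: "t ! (k - 1) = w ! (k - 1)" "t ! (k + 1) = w ! (k + 1)" "t ! (k + 2) = w ! (k + 2)"
        using ksim_nth[OF 2(1) t] w by auto
      have nst: "\<not> stays ?l t"
        using ksim_eqI[OF t w(1) 2(1)] 2(2) w(5) tw by auto
      \<comment> \<open>\<open>T_(k+1)\<close> cannot move the vertex \<open>k\<close>, so on the
        left \<open>t\<close> is reached only from itself; on the right it is reached only from
        \<open>w\<close>.\<close>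
      have "L = sE k t * Tm ?l t t"
        unfolding L_def by (rule sum_Tm_single) (use t w 2 in simp_all)
      also have "Tm ?l t t = \<delta> * cc t (k + 2) / (cc t (k + 2) - cc t ?l)"
        using nst by (simp add: Tm_def a_coef_def)
      also have "cc t (k + 2) = cc w k" using ksim_cc[OF 2(1) t, of "k + 2"] w c0 by simp
      finally have L: "L = sE k t * (\<delta> * cc w k / (cc w k - cc t ?l))" .
      have "R = sE ?l w * Tm k w t"
        unfolding R_def by (rule sum_Tm_single) (use t w tw in simp_all)
      also have "Tm k w t = \<delta> * (sE k w * sE k t / (cc w k * cc t k - 1))"
        using w 2 ksim_sym[OF 2(1)] by (simp add: Tm_def Em_def Id_def)
      finally have "R = (sE k w * sE ?l w) * (\<delta> * (sE k t / (cc w k * cc t k - 1)))" by (simp add: mult_ac)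
      then have R: "R = \<delta> * (sE k t / (cc w k * cc t k - 1))" using ee by simp
      have ct: "cc t k * cc t ?l = 1" using stays_iff[OF t, of k] w stt by simp
      have ne: "cc w k * cc t k - 1 \<noteq> 0" using cc_mult_ne_1(1)[OF w(1) t, of k] w tw by simp
      have "x * (D * c / (c - d')) = D * (x / (c * d - 1)) + D * x"
        if "d * d' = 1" "c * d - 1 \<noteq> 0" for x D c d d' :: 'a
      proof -
        have d: "d \<noteq> 0" using that by auto
        have "(c - d') * d = c * d - d * d'" by (simp add: algebra_simps)
        then have "c * d - 1 = (c - d') * d" using that(1) by simp
        then have "c / (c - d') = (c * d) / (c * d - 1)" using d by simp
        also have "\<dots> = 1 / (c * d - 1) + 1" using that(2) by (simp add: field_simps)
        finally have "x * D * (c / (c - d')) = x * D * (1 / (c * d - 1) + 1)" by simp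
        then show ?thesis by (simp add: distrib_left mult_ac)
      qed
      from this[OF ct ne] show ?thesis using 2 nk by (simp add: L R)
    next
      case 3
      have nk: "\<not> ksim k t w"
        using ksim_nth[of k t w ?l] ksim_eqI[OF t w(1) 3(1)] t 3(2) w(3) by auto
      have stt: "stays ?l t" using ksim_stays[OF 3(1) t] w by simp
      have tw: "t ! (k - 1) = w ! (k - 1)" "t ! k = w ! k" "t ! (k + 2) = w ! (k + 2)"
        using ksim_nth[OF 3(1) t] w by auto
      have nst: "\<not> stays k t"
        using ksim_eqI[OF t w(1) 3(1)] 3(2) w(4) tw by auto
      have "R = sE ?l t * Tm k t t"
        unfolding R_def by (rule sum_Tm_single) (use t w 3 in simp_all)
      also have "Tm k t t = \<delta> * cc t ?l / (cc t ?l - cc t k)"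
        using nst by (simp add: Tm_def a_coef_def)
      also have "cc t k = cc w k" using cc_local[OF tw(1,2)] .
      finally have R: "R = sE ?l t * (\<delta> * cc t ?l / (cc t ?l - cc w k))" .
      have "L = sE k w * Tm ?l w t"
        unfolding L_def by (rule sum_Tm_single) (use t w tw in simp_all)
      also have "Tm ?l w t = \<delta> * (sE ?l w * sE ?l t / (cc w ?l * cc t ?l - 1))"
        using w 3 ksim_sym[OF 3(1)] by (simp add: Tm_def Em_def Id_def)
      finally have "L = (sE k w * sE ?l w) * (\<delta> * (sE ?l t / (cc w ?l * cc t ?l - 1)))" by (simp add: mult_ac)
      then have L: "L = \<delta> * (sE ?l t / (cc w ?l * cc t ?l - 1))" using ee by simp
      have ne: "cc w ?l * cc t ?l - 1 \<noteq> 0" using cc_mult_ne_1(1)[OF w(1) t, of ?l] w tw by simp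
      have "D * (x / (c' * d - 1)) = x * (D * d / (d - c)) - D * x"
        if "c * c' = 1" "c' * d - 1 \<noteq> 0" for x D c c' d :: 'a
      proof -
        have c: "c \<noteq> 0" using that by auto
        have "(c' * d - 1) * c = (c * c') * d - c" "(c' * d) * c = (c * c') * d" by (simp_all add: algebra_simps)
        then have "d = (c' * d) * c" "d - c = (c' * d - 1) * c" using that(1) by simp_all
        then have "d / (d - c) = ((c' * d) * c) / ((c' * d - 1) * c)" by (rule arg_cong2[where f = "(/)"])
        also have "\<dots> = (c' * d) / (c' * d - 1)" using c by simp
        also have "\<dots> = 1 / (c' * d - 1) + 1" using that(2) by (simp add: field_simps)
        finally have "x * D * (d / (d - c)) = x * D * (1 / (c' * d - 1) + 1)" by simp
        then show ?thesis by (simp add: distrib_left mult_ac)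
      qed
      from this[OF cw(1) ne] show ?thesis using 3 nk by (simp add: L R)
    next
      case 4
      \<comment> \<open>Each side is one root \<open>b\<close> times one root \<open>sE\<close>, and
        root condition (f) equates the products.\<close>
      have LR: "L = R" if x: "x \<in> TT" "ksim k x w" "swap_defined ?l x" "t = swap r ?l x"
        and y: "y \<in> TT" "ksim ?l y w" "swap_defined k y" "t = swap r k y" for x y
      proof -
        have xt: "ksim ?l x t" and yt: "ksim k y t"
          using swap_facts(2)[OF x(1) _ _ x(3)] swap_facts(2)[OF y(1) _ _ y(3)] x(4) y(4) w by auto
        have "L = sE k x * Tm ?l x t"
          unfolding L_def by (rule sum_Tm_single) (use t w x ksim_nth[OF xt x(1), of k] in simp_all)
        moreover have "Tm ?l x t = b ?l x" using Tm_swap[OF x(1) _ _ x(3)] x(4) w by simp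
        moreover have "R = sE ?l y * Tm k y t"
          unfolding R_def by (rule sum_Tm_single) (use t w y ksim_nth[OF yt y(1), of ?l] in simp_all)
        moreover have "Tm k y t = b k y" using Tm_swap[OF y(1) _ _ y(3)] y(4) w by simp
        moreover have "b k y * sE ?l y = b ?l x * sE k x"
          using root_hook[of w y x k] w x y by simp
        ultimately show ?thesis by (simp add: mult.commute)
      qed
      have "L = R"
      proof (cases "\<exists>x\<in>TT. ksim k x w \<and> swap_defined ?l x \<and> t = swap r ?l x")
        case True
        then obtain x where x: "x \<in> TT" "ksim k x w" "swap_defined ?l x" "t = swap r ?l x" by blast
        obtain y where "y \<in> TT" "ksim ?l y w" "swap_defined k y" "t = swap r k y"
          using hook_swap_1[OF w x(1-3)] x(4) by metis
        then show ?thesis using LR x by blast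
      next
        case noX: False
        then have noY: "\<not> (\<exists>y\<in>TT. ksim ?l y w \<and> swap_defined k y \<and> t = swap r k y)"
          using hook_swap_2[OF w] by metis
        \<comment> \<open>A member of the \<open>k\<close>-block other than \<open>w\<close> does
          not stay at \<open>k + 1\<close>, so it could reach \<open>t\<close> only by an
          exchange.\<close>
        have "L = 0" unfolding L_def
        proof (rule sum_Tm_zero, rule ccontr)
          fix x assume x: "x \<in> TT" "ksim k x w" and nz: "Tm ?l x t \<noteq> 0"
          have "ksim ?l x t" using nz Tm_outside by blast
          then have "x \<noteq> w" "x \<noteq> t" using 4 x(2) ksim_sym by blast+
          moreover have "\<not> stays ?l x"
          proof
            assume "stays ?l x"
            moreover have "x ! (k + 2) = w ! (k + 2)" using ksim_nth[OF x(2,1), of "k + 2"] w by simp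
            ultimately have "x ! k = w ! k" using w(5) by simp
            then show False using ksim_eqI[OF x(1) w(1) x(2)] \<open>x \<noteq> w\<close> by simp
          qed
          ultimately show False using Tm_nonstays[OF _ nz] noX x by blast
        qed
        moreover have "R = 0" unfolding R_def
        proof (rule sum_Tm_zero, rule ccontr)
          fix y assume y: "y \<in> TT" "ksim ?l y w" and nz: "Tm k y t \<noteq> 0"
          have "ksim k y t" using nz Tm_outside by blast
          then have "y \<noteq> w" "y \<noteq> t" using 4 y(2) ksim_sym by blast+
          moreover have "\<not> stays k y"
          proof
            assume "stays k y"
            moreover have "y ! (k - 1) = w ! (k - 1)" using ksim_nth[OF y(2,1), of "k - 1"] w by simp
            ultimately have "y ! ?l = w ! ?l" using w(4) by simp
            then show False using ksim_eqI[OF y(1) w(1) y(2)] \<open>y \<noteq> w\<close> by simp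
          qed
          ultimately show False using Tm_nonstays[OF _ nz] noY y by blast
        qed
        ultimately show ?thesis by simp
      qed
      then show ?thesis using 4 by simp
    qed
  qed
  then show "Poly_Mapping.lookup (mop (Tm ?l) (xi k w)) t =
      Poly_Mapping.lookup (mop (Tm k) (xi ?l w) + smul \<delta> (xi k w) - smul \<delta> (xi ?l w)) t"
    using t by (simp add: lookup_add lookup_minus lookup_mop_xi lookup_xi L_def R_def)
qed

lemma sE_nz: "s \<in> TT \<Longrightarrow> 1 \<le> k \<Longrightarrow> k < n \<Longrightarrow> stays k s \<Longrightarrow> sE k s \<noteq> 0"
  using E_diag_nz[of s k] sE_square[of s k] by auto

lemma smul_cancel: "(a :: 'a) \<noteq> 0 \<Longrightarrow> smul a v = smul a w \<Longrightarrow> v = w"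
proof -
  assume a: "a \<noteq> 0" and "smul a v = smul a w"
  then have "smul (inverse a) (smul a v) = smul (inverse a) (smul a w)" by simp
  then show "v = w" using a by (simp add: smul_simps)
qed

lemma T_xi:
  assumes "w \<in> TT" "1 \<le> k" "k < n" "stays k w"
  shows "mop (Tm k) (xi k w) = smul \<rho> (xi k w)"
proof (rule smul_cancel[OF sE_nz[OF assms]])
  have "smul (sE k w) (mop (Tm k) (xi k w)) = mop (Tm k) (mop (Em k) (bvec w))"
    using assms by (simp add: E_bvec linear_mapD[OF linear_mop])
  also have "\<dots> = smul \<rho> (mop (Em k) (bvec w))" using assms by (simp add: op_TE)
  also have "\<dots> = smul (sE k w) (smul \<rho> (xi k w))"
    using assms by (simp add: E_bvec smul_simps mult.commute)
  finally show "smul (sE k w) (mop (Tm k) (xi k w)) = smul (sE k w) (smul \<rho> (xi k w))" .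
qed

text \<open>The hook identity is equivalent to the one with the two strands interchanged.\<close>

lemma hook_any:
  assumes w: "w \<in> TT" "stays k w" "stays l w" and kl: "{k, l} = {m, m + 1}" "1 \<le> m" "m + 1 < n"
  shows "mop (Tm l) (xi k w) = mop (Tm k) (xi l w) + smul \<delta> (xi k w) - smul \<delta> (xi l w)"
proof -
  consider "k = m" "l = m + 1" | "k = m + 1" "l = m" using kl(1) by (auto simp: doubleton_eq_iff)
  then show ?thesis
  proof cases
    case 1
    then show ?thesis using hook[of w m] w kl by simp
  next
    case 2
    have "A = B + x - y" if "B = A + y - x" for A B x y :: "tab \<Rightarrow>\<^sub>0 'a" using that by simp
    from this[OF hook[OF w(1) kl(2,3)]] show ?thesis using w 2 by simp
  qed
qed

lemma FS_op_eqI: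
  assumes "linear_map F" "linear_map G" "\<And>s. s \<in> TT \<Longrightarrow> F (bvec s) = G (bvec s)" "v \<in> FS"
  shows "F v = G v"
  using linear_map_eq_on[OF assms(1,2) finite_TT] assms(3,4) by blast

text \<open>By \<open>exists_double\<close> the image of a basis vector is a multiple of some
  \<open>xi k w\<close> with \<open>w\<close> staying at both positions. Applying \<open>T_k\<close>
  to the hook identity, the quadratic relation and \<open>E_xi\<close> cancel everything but
  \<open>xi l w\<close>.\<close>

lemma op_hook:
  assumes kl: "{k, l} = {m, m + 1}" "1 \<le> m" "m + 1 < n" and v: "v \<in> FS"
  shows "mop (Tm k) (mop (Tm l) (mop (Em k) v)) = mop (Em l) (mop (Em k) v)"
    "mop (Em k) (mop (Em l) (mop (Em k) v)) = mop (Em k) v"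
proof -
  have k: "1 \<le> k" "k < n" and l: "1 \<le> l" "l < n" and lk: "{l, k} = {m, m + 1}"
    using kl by (auto simp: doubleton_eq_iff)
  have basis: "mop (Tm k) (mop (Tm l) (mop (Em k) (bvec s))) = mop (Em l) (mop (Em k) (bvec s)) \<and>
      mop (Em k) (mop (Em l) (mop (Em k) (bvec s))) = mop (Em k) (bvec s)" if s: "s \<in> TT" for s
  proof (cases "stays k s")
    case False
    then show ?thesis using s by (simp add: E_bvec linear_mapD[OF linear_mop])
  next
    case True
    obtain w where w: "w \<in> TT" "ksim k w s" "stays k w" "stays l w"
      using exists_double[OF s kl True] .
    note lm = linear_mapD[OF linear_mop]
    have "mop (Tm k) (mop (Tm l) (xi k w)) =
        mop (Tm k) (mop (Tm k) (xi l w)) + smul \<delta> (mop (Tm k) (xi k w)) - smul \<delta> (mop (Tm k) (xi l w))"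
      by (simp only: hook_any[OF w(1,3,4) kl] lm)
    also have "\<dots> = xi l w"
      using T_xi[OF w(1) k w(3)] op_TT[OF k xi_closed, of l w] E_xi[OF w(1,3,4) kl]
      by (simp add: smul_simps)
    finally have T: "mop (Tm k) (mop (Tm l) (xi k w)) = xi l w" .
    have E: "mop (Em l) (xi k w) = xi l w" "mop (Em k) (xi l w) = xi k w"
      using E_xi[OF w(1,4,3) lk kl(2,3)] E_xi[OF w(1,3,4) kl] by auto
    have "mop (Em k) (bvec s) = smul (sE k s) (xi k w)"
      using s True xi_ksim[OF w(2)] by (simp add: E_bvec)
    then show ?thesis using T E by (simp add: lm)
  qed
  show "mop (Tm k) (mop (Tm l) (mop (Em k) v)) = mop (Em l) (mop (Em k) v)"
    unfolding mop_mop
    by (rule FS_op_eqI[OF linear_mop linear_mop _ v]) (use basis in \<open>simp only: mop_mop\<close>)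
  show "mop (Em k) (mop (Em l) (mop (Em k) v)) = mop (Em k) v"
    unfolding mop_mop
    by (rule FS_op_eqI[OF linear_mop linear_mop _ v]) (use basis in \<open>simp only: mop_mop\<close>)
qed

lemma mm_transpose:
  assumes "\<And>x. x \<in> TT \<Longrightarrow> N s x = N' x s" "\<And>x. x \<in> TT \<Longrightarrow> M x t = M' t x"
  shows "mm N M s t = mm M' N' t s"
  unfolding mm_def by (rule sum.cong) (use assms in \<open>auto simp: mult.commute\<close>)

lemma mop_eqD: "mop M (bvec s) = mop N (bvec s) \<Longrightarrow> s \<in> TT \<Longrightarrow> t \<in> TT \<Longrightarrow> M s t = N s t"
  using lookup_mop_bvec by metis

text \<open>Transposing symmetric matrices reverses products and turns \<open>A B C = D C\<close>
  into \<open>C B A = C D\<close>.\<close>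

lemma mop_transpose_hook:
  assumes sym: "\<And>s t. s \<in> TT \<Longrightarrow> t \<in> TT \<Longrightarrow> A s t = A t s" "\<And>s t. s \<in> TT \<Longrightarrow> t \<in> TT \<Longrightarrow> B s t = B t s"
    "\<And>s t. s \<in> TT \<Longrightarrow> t \<in> TT \<Longrightarrow> C s t = C t s" "\<And>s t. s \<in> TT \<Longrightarrow> t \<in> TT \<Longrightarrow> D s t = D t s"
    and eq: "\<And>v. v \<in> FS \<Longrightarrow> mop A (mop B (mop C v)) = mop D (mop C v)"
  shows "mop C (mop B (mop A v)) = mop C (mop D v)"
  unfolding mop_mop
proof (rule mop_cong)
  fix s t assume st: "s \<in> TT" "t \<in> TT"
  have "mm (mm A B) C s t = mm C (mm B A) t s"
    by (intro mm_transpose) (use st sym in auto)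
  also have "\<dots> = mm (mm C B) A t s"
    using mop_eqD[of "mm C (mm B A)" t "mm (mm C B) A" s] st by (simp flip: mop_mop)
  also have "\<dots> = mm C D t s"
  proof (rule mop_eqD)
    show "mop (mm (mm C B) A) (bvec t) = mop (mm C D) (bvec t)"
      using eq[OF free_space_closed(5)[OF st(2)]] by (simp only: mop_mop)
  qed (use st in auto)
  also have "\<dots> = mm D C s t" by (intro mm_transpose) (use st sym in auto)
  finally show "mm (mm A B) C s t = mm D C s t" .
qed

lemma op_hook':
  assumes kl: "{k, l} = {m, m + 1}" "1 \<le> m" "m + 1 < n"
  shows "mop (Em k) (mop (Tm l) (mop (Tm k) v)) = mop (Em k) (mop (Em l) v)"
proof (rule mop_transpose_hook)
  have k: "1 \<le> k" "k < n" and l: "1 \<le> l" "l < n"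
    using kl by (auto simp: doubleton_eq_iff)
  show "Tm k s t = Tm k t s" "Tm l s t = Tm l t s" "Em k s t = Em k t s" "Em l s t = Em l t s"
    if "s \<in> TT" "t \<in> TT" for s t
    using Tm_sym[OF that] Em_sym[OF that] k l by auto
qed (use op_hook(1)[OF kl] in blast)

lemma lookup_diag:
  assumes "t \<in> TT"
  shows "Poly_Mapping.lookup (mop (\<lambda>s t. if s = t then d s else 0) v) t = d t * Poly_Mapping.lookup v t"
proof -
  have "(\<Sum>s\<in>TT. Poly_Mapping.lookup v s * (if s = t then d s else 0)) =
      (\<Sum>s\<in>TT. if s = t then d t * Poly_Mapping.lookup v t else 0)"
    by (rule sum.cong) auto
  then show ?thesis using assms finite_TT by (simp add: lookup_mop)
qed

lemma lookup_X: "t \<in> TT \<Longrightarrow> Poly_Mapping.lookup (mop (Xm i) v) t = cc t i * Poly_Mapping.lookup v t"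
  "t \<in> TT \<Longrightarrow> Poly_Mapping.lookup (mop (Xim i) v) t = inverse (cc t i) * Poly_Mapping.lookup v t"
  by (simp_all only: lookup_diag Xm_def Xim_def)

lemma X_bvec: "s \<in> TT \<Longrightarrow> mop (Xm j) (bvec s) = smul (cc s j) (bvec s)"
proof (rule FS_eqI)
  assume s: "s \<in> TT"
  show "mop (Xm j) (bvec s) \<in> FS" "smul (cc s j) (bvec s) \<in> FS"
    using s by (auto intro!: free_space_closed mop_closed)
  fix t assume "t \<in> TT"
  then show "Poly_Mapping.lookup (mop (Xm j) (bvec s)) t = Poly_Mapping.lookup (smul (cc s j) (bvec s)) t"
    using s by (simp add: lookup_mop_bvec Xm_def lookup_smul lookup_bvec)
qed

lemma triple:
  assumes k: "1 \<le> k" "k + 1 < n"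
  shows "bmw_triple FS (mop (Tm k)) (mop (Tm (k + 1))) (mop (Em k)) (mop (Em (k + 1)))
    (mop (Xm k)) (mop (Xm (k + 1))) (mop (Xm (k + 2))) \<delta> \<rho>"
proof -
  have kl: "{k, k + 1} = {k, k + 1}" "{k + 1, k} = {k, k + 1}" by auto
  have k': "k < n" "1 \<le> k + 1" "k + 2 \<le> n" using k by auto
  have alg: "A = B + x - y" if "A - B = x - y" for A B x y :: "tab \<Rightarrow>\<^sub>0 'a"
    using that by (simp add: algebra_simps)
  have FS: "mop M v \<in> FS" for M v by (rule mop_closed)
  show ?thesis
  \<comment> \<open>The first fifteen goals are linearity and closure; the numbered cases are the
    relations in the order of the locale.\<close>
  proof (unfold_locales, goal_cases)
    case (16 v) then show ?case using op_TT[OF k(1) k'(1)] by blast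
  next
    case (17 v) then show ?case using op_TT[OF k'(2) k(2)] by blast
  next
    case (18 v) show ?case by (rule op_TE(1)[OF k(1) k'(1)])
  next
    case (19 v) show ?case by (rule op_TE(2)[OF k(1) k'(1)])
  next
    case (20 v) show ?case by (rule op_TE(2)[OF k'(2) k(2)])
  next
    case (21 v) then show ?case by (rule op_hook(1)[OF kl(1) k])
  next
    case (22 v) show ?case by (rule op_hook'[OF kl(1) k])
  next
    case (23 v) show ?case by (rule op_hook'[OF kl(2) k])
  next
    case (24 v) then show ?case by (rule op_hook(2)[OF kl(2) k])
  next
    case (25 v)
    then show ?case using alg[OF op_TX(1)[OF k(1) k'(1), of v]] by (simp add: mop_Id)
  next
    case (26 v)
    then show ?case using alg[OF op_TX(1)[OF k'(2) k(2), of v]] by (simp add: mop_Id)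
  next
    case (27 v)
    then show ?case using op_TX_far[of "k + 2" k v] k by simp
  next
    case (28 v)
    then show ?case using op_TX_far[of k "k + 1" v] k by simp
  qed (auto intro: linear_mop FS free_space_closed)
qed

end

section \<open>The braid relation\<close>

context seminormal
begin

text \<open>The product is 1 throughout a staying block, and an exchange permutes its
  factors.\<close>

lemma Tm_prod:
  assumes "s \<in> TT" "t \<in> TT" "1 \<le> k" "k < n" "Tm k s t \<noteq> 0"
  shows "cc s k * cc s (k + 1) = cc t k * cc t (k + 1)"
proof -
  have st: "ksim k s t" using assms(5) Tm_outside(1) by blast
  show ?thesis
  proof (cases "stays k s")
    case True
    then have "stays k t" using ksim_stays[OF st] assms by simp
    then show ?thesis using True stays_iff[of s k] stays_iff[of t k] assms by simp
  next
    case False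
    show ?thesis
    proof (cases "s = t")
      case False
      note sw = Tm_nonstays[OF \<open>\<not> stays k s\<close> assms(5) False]
      then show ?thesis using swap_facts(3,4)[OF assms(1,3,4) sw(1)] by (simp add: mult.commute)
    qed simp
  qed
qed

text \<open>From a tableau that does not stay, \<open>T_i\<close> leads only to itself and to its
  exchange. The hypothesis \<open>far\<close> excludes every path whose first or last step is
  stationary, so one path is left.\<close>

lemma path_value:
  assumes TT: "s \<in> TT" "t \<in> TT" and i: "1 \<le> i" "i < n" and j: "1 \<le> j" "j < n"
    and nst: "\<not> stays i s" "\<not> stays i t"
    and far: "\<And>x y. x \<in> TT \<Longrightarrow> y \<in> TT \<Longrightarrow> ksim j x y \<Longrightarrow>
      x = s \<or> swap_defined i s \<and> x = swap r i s \<Longrightarrow> y = t \<or> swap_defined i t \<and> y = swap r i t \<Longrightarrow>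
      x \<noteq> s \<and> y \<noteq> t"
  shows "mm (mm (Tm i) (Tm j)) (Tm i) s t = (if swap_defined i s \<and> swap_defined i t
      then b i s * Tm j (swap r i s) (swap r i t) * b i t else 0)"
proof -
  have nz: "swap_defined i s \<and> x = swap r i s \<and> Tm i s x = b i s \<and>
      swap_defined i t \<and> y = swap r i t \<and> Tm i y t = b i t"
    if xy: "x \<in> TT" "y \<in> TT" and ne: "Tm i s x * Tm j x y * Tm i y t \<noteq> 0" for x y
  proof -
    have ne': "Tm i s x \<noteq> 0" "Tm j x y \<noteq> 0" "Tm i y t \<noteq> 0" using ne by auto
    have e: "Tm i y t = Tm i t y" by (rule Tm_sym[OF xy(2) TT(2) i])
    then have ne3: "Tm i t y \<noteq> 0" using ne' by simp
    have "ksim j x y" using ne'(2) Tm_outside(1) by blast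
    moreover have "x = s \<or> swap_defined i s \<and> x = swap r i s" using Tm_nonstays[OF nst(1) ne'(1)] by metis
    moreover have "y = t \<or> swap_defined i t \<and> y = swap r i t" using Tm_nonstays[OF nst(2) ne3] by metis
    ultimately have d: "s \<noteq> x" "t \<noteq> y" using far[OF xy] by auto
    show ?thesis using Tm_nonstays[OF nst(1) ne'(1) d(1)] Tm_nonstays[OF nst(2) ne3 d(2)] e by simp
  qed
  have sum: "mm (mm (Tm i) (Tm j)) (Tm i) s t = (\<Sum>y\<in>TT. \<Sum>x\<in>TT. Tm i s x * Tm j x y * Tm i y t)"
    by (simp add: mm_def sum_distrib_right)
  show ?thesis
  proof (cases "swap_defined i s \<and> swap_defined i t")
    case False
    then have "(\<Sum>y\<in>TT. \<Sum>x\<in>TT. Tm i s x * Tm j x y * Tm i y t) = 0"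
      using nz by (intro sum.neutral ballI) blast
    then show ?thesis using False by (simp only: sum if_False)
  next
    case True
    let ?x = "swap r i s" and ?y = "swap r i t"
    have S: "?x \<in> TT" "?y \<in> TT" "Tm i s ?x = b i s" "Tm i ?y t = b i t"
      using swap_facts(1)[OF TT(1) i] swap_facts(1)[OF TT(2) i] True
        Tm_swap[OF TT(1) i] Tm_swap[OF TT(2) i] Tm_sym[of ?y t i] TT i by auto
    have "(\<Sum>y\<in>TT. \<Sum>x\<in>TT. Tm i s x * Tm j x y * Tm i y t) =
        (\<Sum>y\<in>TT. \<Sum>x\<in>TT. if x = ?x then if y = ?y then Tm i s ?x * Tm j ?x ?y * Tm i ?y t else 0 else 0)"
    proof (intro sum.cong refl)
      fix y x assume xy: "y \<in> TT" "x \<in> TT"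
      show "Tm i s x * Tm j x y * Tm i y t =
          (if x = ?x then if y = ?y then Tm i s ?x * Tm j ?x ?y * Tm i ?y t else 0 else 0)"
        using nz[OF xy(2,1)] by (cases "Tm i s x * Tm j x y * Tm i y t = 0") auto
    qed
    also have "\<dots> = Tm i s ?x * Tm j ?x ?y * Tm i ?y t"
      using S finite_TT by simp
    finally show ?thesis using S True sum by simp
  qed
qed

text \<open>An undefined exchange has content ratio \<open>q^2\<close> or \<open>q^(-2)\<close>; the
  reversed pair has the inverse ratio, where \<open>b_zero\<close> applies too.\<close>

lemma b_zero_reversed:
  assumes "x \<in> TT" "y \<in> TT" "1 \<le> i" "i < n" "1 \<le> j" "j < n" "\<not> stays i x" "\<not> stays j y"
    and "\<not> swap_defined i x" "cc y j = cc x (i + 1)" "cc y (j + 1) = cc x i"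
  shows "b j y = 0"
proof -
  obtain m where m: "\<bar>m\<bar> = 1" "cc x (i + 1) = q powi (2 * m) * cc x i"
    using not_swap[of x i] assms by auto
  have "q powi (2 * - m) * q powi (2 * m) = 1" using q0 by (simp add: power_int_minus)
  then have "cc y (j + 1) = q powi (2 * - m) * cc y j" using m(2) assms(10,11) by (simp add: mult.assoc[symmetric])
  moreover have "\<bar>- m\<bar> = 1" using m(1) by simp
  ultimately show ?thesis using b_zero[of y j "- m"] assms by blast
qed

text \<open>If \<open>s\<close> and \<open>t\<close> have the contents \<open>(c\<^sub>1, c\<^sub>2, c\<^sub>3)\<close> and \<open>(c\<^sub>3, c\<^sub>2, c\<^sub>1)\<close> in the positions
  \<open>k, k + 1, k + 2\<close>, each side of the braid relation has at most one path from \<open>s\<close> to \<open>t\<close>.\<close>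

lemma braid_reversed:
  assumes TT: "s \<in> TT" "t \<in> TT" and k: "1 \<le> k" "k + 1 < n"
    and agree: "\<And>m. m \<le> n \<Longrightarrow> m \<noteq> k \<Longrightarrow> m \<noteq> k + 1 \<Longrightarrow> s ! m = t ! m"
    and c: "cc t k = cc s (k + 2)" "cc t (k + 1) = cc s (k + 1)" "cc t (k + 2) = cc s k"
    and nst: "\<not> stays k s" "\<not> stays k t" "\<not> stays (k + 1) s" "\<not> stays (k + 1) t"
  shows "mm (mm (Tm k) (Tm (k + 1))) (Tm k) s t = mm (mm (Tm (k + 1)) (Tm k)) (Tm (k + 1)) s t"
proof -
  let ?l = "k + 1"
  have kk: "k < n" "1 \<le> ?l" "?l < n" "k + 2 \<le> n" "?l + 1 = k + 2" using k by auto
  have ct: "cc t ?l = cc s ?l" "cc t (?l + 1) = cc s k" using c by auto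
  \<comment> \<open>The three contents are distinct: the outer two by \<open>cc_period\<close>,
    neighbours by \<open>mid_facts\<close>.\<close>
  have ne: "cc s k \<noteq> cc s (k + 2)" "cc s ?l \<noteq> cc s k" "cc s (k + 2) \<noteq> cc s ?l"
    using cc_period[OF TT(1) k(1) kk(4)] nst mid_facts(2)[OF TT(1) TT(1) k(1) kk(1)]
      mid_facts(2)[OF TT(1) TT(1) kk(2,3)] by auto
  have prev: "s ! (k - 1) = t ! (k - 1)" using agree[of "k - 1"] k by simp
  \<comment> \<open>\<open>s\<close> and \<open>t\<close> leave the common vertex
    \<open>k - 1\<close> with the labels \<open>c_1\<close> and \<open>c_3\<close>.\<close>
  have n13: "cc s k * cc s (k + 2) \<noteq> 1" "\<And>m. \<bar>m\<bar> = 1 \<Longrightarrow> cc s (k + 2) \<noteq> q powi (2 * m) * cc s k"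
    using cc_mult_ne_1(1)[OF TT k(1) _ prev] cc_mult_ne_1(2)[OF TT(2,1) k(1) _ prev[symmetric]] kk c by auto
  have far_cc: "cc s j = cc t j" if "1 \<le> j" "j \<le> n" "j \<noteq> k" "j \<noteq> ?l" "j \<noteq> k + 2" for j
    using that agree[of j] agree[of "j - 1"] by (intro cc_local) auto
  note Sks = swap_facts[OF TT(1) k(1) kk(1)] and Skt = swap_facts[OF TT(2) k(1) kk(1)]
    and Sls = swap_facts[OF TT(1) kk(2,3)] and Slt = swap_facts[OF TT(2) kk(2,3)]
  have L: "mm (mm (Tm k) (Tm ?l)) (Tm k) s t = (if swap_defined k s \<and> swap_defined k t
      then b k s * Tm ?l (swap r k s) (swap r k t) * b k t else 0)"
  proof (rule path_value[OF TT k(1) kk(1-3) nst(1,2)])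
    fix x y assume xy: "x \<in> TT" "y \<in> TT" "ksim ?l x y"
      and x: "x = s \<or> swap_defined k s \<and> x = swap r k s" and y: "y = t \<or> swap_defined k t \<and> y = swap r k t"
    \<comment> \<open>\<open>T_(k+1)\<close> keeps the content at \<open>k\<close>. It is
      \<open>c_1\<close> or \<open>c_2\<close> for \<open>x\<close> and \<open>c_3\<close> or
      \<open>c_2\<close> for \<open>y\<close>, so it must be \<open>c_2\<close>, and both outer
      steps are exchanges.\<close>
    have "cc x k = cc y k" using ksim_nth[OF xy(3,1)] kk by (intro cc_local) auto
    moreover have "x = s \<or> cc x k = cc s ?l" using x Sks(3) by blast
    moreover have "y = t \<or> cc y k = cc s ?l" using y Skt(3) ct by metis
    ultimately show "x \<noteq> s \<and> y \<noteq> t" using ne c by metis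
  qed
  have R: "mm (mm (Tm ?l) (Tm k)) (Tm ?l) s t = (if swap_defined ?l s \<and> swap_defined ?l t
      then b ?l s * Tm k (swap r ?l s) (swap r ?l t) * b ?l t else 0)"
  proof (rule path_value[OF TT kk(2,3) k(1) kk(1) nst(3,4)])
    fix x y assume xy: "x \<in> TT" "y \<in> TT" "ksim k x y"
      and x: "x = s \<or> swap_defined ?l s \<and> x = swap r ?l s" and y: "y = t \<or> swap_defined ?l t \<and> y = swap r ?l t"
    have "cc x (k + 2) = cc y (k + 2)" using ksim_nth[OF xy(3,1)] kk by (intro cc_local) auto
    moreover have "x = s \<or> cc x (k + 2) = cc s ?l" using x Sls(4) kk(5) by metis
    moreover have "y = t \<or> cc y (k + 2) = cc s ?l" using y Slt(4) ct kk(5) by metis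
    ultimately show "x \<noteq> s \<and> y \<noteq> t" using ne c by metis
  qed
  show ?thesis
  proof (cases "swap_defined k s \<and> swap_defined k t \<and> swap_defined ?l s \<and> swap_defined ?l t")
    case False
    \<comment> \<open>An exchange that is undefined on one side kills a root on the other side, so
      both sides vanish.\<close>
    have "\<not> swap_defined k s \<Longrightarrow> b ?l t = 0" "\<not> swap_defined ?l t \<Longrightarrow> b k s = 0"
      "\<not> swap_defined k t \<Longrightarrow> b ?l s = 0" "\<not> swap_defined ?l s \<Longrightarrow> b k t = 0"
      using b_zero_reversed[OF TT k(1) kk(1-3) nst(1,4)] b_zero_reversed[OF TT(2,1) kk(2,3) k(1) kk(1) nst(4,1)]
        b_zero_reversed[OF TT(2,1) k(1) kk(1-3) nst(2,3)] b_zero_reversed[OF TT kk(2,3) k(1) kk(1) nst(3,2)]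
        c ct kk(5) by metis+
    then show ?thesis using False unfolding L R by auto
  next
    case True
    then have sd: "swap_defined k s" "swap_defined k t" "swap_defined ?l s" "swap_defined ?l t" by auto
    \<comment> \<open>In contents: \<open>x\<close> is (c_2, c_1, c_3), \<open>y\<close> is (c_2,
      c_3, c_1), \<open>v\<close> is (c_1, c_3, c_2) and \<open>w\<close> is (c_3, c_1,
      c_2).\<close>
    define x y v w where "x = swap r k s" and "y = swap r k t" and "v = swap r ?l s" and "w = swap r ?l t"
    note X = Sks[OF sd(1), folded x_def] and Y = Skt[OF sd(2), folded y_def]
      and V = Sls[OF sd(3), folded v_def] and W = Slt[OF sd(4), folded w_def]
    have x3: "cc x (k + 2) = cc s (k + 2)" and y3: "cc y (k + 2) = cc s k"
      and v1: "cc v k = cc s k" and w1: "cc w k = cc s (k + 2)"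
      using ksim_cc[OF X(2) TT(1), of "k + 2"] ksim_cc[OF Y(2) TT(2), of "k + 2"]
        ksim_cc[OF V(2) TT(1), of k] ksim_cc[OF W(2) TT(2), of k] kk k c by auto
    have nx: "\<not> stays ?l x" and nv: "\<not> stays k v"
      using stays_iff[OF X(1) kk(2,3)] stays_iff[OF V(1) k(1) kk(1)] n13(1) X(4) V(3) x3 v1 kk(5) by auto
    have sx: "swap_defined ?l x"
    proof (rule ccontr)
      assume "\<not> swap_defined ?l x"
      then show False using not_swap[OF X(1) kk(2,3) nx] n13(2) X(4) x3 kk(5) by metis
    qed
    have sv: "swap_defined k v"
    proof (rule ccontr)
      assume "\<not> swap_defined k v"
      then show False using not_swap[OF V(1) k(1) kk(1) nv] n13(2) V(3) v1 kk(5) by metis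
    qed
    note XL = swap_facts[OF X(1) kk(2,3) sx] and VK = swap_facts[OF V(1) k(1) kk(1) sv]
    have yx: "y = swap r ?l x"
    proof (rule tab_eqI[OF Y(1) XL(1)])
      fix j assume j: "1 \<le> j" "j \<le> n"
      consider "j = k" | "j = ?l" | "j = k + 2" | "j \<noteq> k" "j \<noteq> ?l" "j \<noteq> k + 2" by blast
      then show "cc y j = cc (swap r ?l x) j"
      proof cases
        case 1
        then show ?thesis using ksim_cc[OF XL(2) X(1), of k] X(3) Y(3) ct k by simp
      next
        case 2
        then show ?thesis using XL(3) x3 Y(4) c kk(5) by simp
      next
        case 3
        then show ?thesis using XL(4) X(4) y3 kk(5) by simp
      next
        case 4
        then show ?thesis using far_cc[OF j] ksim_cc[OF XL(2) X(1) j] ksim_cc[OF X(2) TT(1) j] ksim_cc[OF Y(2) TT(2) j] by simp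
      qed
    qed
    have wv: "w = swap r k v"
    proof (rule tab_eqI[OF W(1) VK(1)])
      fix j assume j: "1 \<le> j" "j \<le> n"
      consider "j = k" | "j = ?l" | "j = k + 2" | "j \<noteq> k" "j \<noteq> ?l" "j \<noteq> k + 2" by blast
      then show "cc w j = cc (swap r k v) j"
      proof cases
        case 1
        then show ?thesis using VK(3) V(3) w1 kk(5) by simp
      next
        case 2
        then show ?thesis using VK(4) v1 W(3) ct by simp
      next
        case 3
        then show ?thesis using ksim_cc[OF VK(2) V(1), of "k + 2"] V(4) W(4) ct kk by simp
      next
        case 4
        then show ?thesis using far_cc[OF j] ksim_cc[OF VK(2) V(1) j] ksim_cc[OF V(2) TT(1) j] ksim_cc[OF W(2) TT(2) j] by simp
      qed
    qed
    \<comment> \<open>Root condition (c), applied at \<open>s\<close>, \<open>x\<close> and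
      \<open>v\<close>, matches the three roots on the two sides.\<close>
    have "b k v = b ?l x"
      using root_braid[of s k] TT k nst sd nx nv unfolding x_def v_def by blast
    moreover have "b k t = b ?l s"
    proof -
      have "b k (swap r ?l x) = b ?l (swap r k x)"
        using root_braid[of x k] X(1,5,7,9) k nx sx nst(3) Y(7) yx by metis
      moreover have "b k y = b k t" unfolding y_def using root_swap[of t k] TT k kk nst sd by simp
      ultimately show ?thesis using yx X(9) by simp
    qed
    moreover have "b k s = b ?l t"
    proof -
      have "b k (swap r ?l v) = b ?l (swap r k v)"
        using root_braid[of v k] V(1,5,7,9) k nv sv nst(1) W(7) wv by metis
      moreover have "b ?l w = b ?l t" unfolding w_def using root_swap[of t ?l] TT k kk nst sd by simp
      ultimately show ?thesis using wv V(9) by simp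
    qed
    moreover have "Tm ?l x y = b ?l x" "Tm k v w = b k v"
      using Tm_swap[OF X(1) kk(2,3) sx] Tm_swap[OF V(1) k(1) kk(1) sv] yx wv by auto
    ultimately show ?thesis using L R sd by (simp add: x_def y_def v_def w_def mult.commute)
  qed
qed

lemma mm_assoc: "mm (mm A B) C s t = mm A (mm B C) s t"
  unfolding mm_def sum_distrib_left sum_distrib_right by (subst sum.swap) (simp add: mult.assoc)

lemma mm_nz: "mm N M s t \<noteq> 0 \<Longrightarrow> \<exists>x\<in>TT. N s x \<noteq> 0 \<and> M x t \<noteq> 0"
  unfolding mm_def by (rule ccontr) (auto intro: sum.neutral)

text \<open>The matrix of \<Phi>. Both products are palindromes, so the reversed order of
  composition in \<open>mop\<close> makes no difference.\<close>

definition braid_diff :: "nat \<Rightarrow> tab \<Rightarrow> tab \<Rightarrow> 'a"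
  where "braid_diff k s t = mm (mm (Tm k) (Tm (k + 1))) (Tm k) s t - mm (mm (Tm (k + 1)) (Tm k)) (Tm (k + 1)) s t"

lemma braid_diff_sym:
  assumes "s \<in> TT" "t \<in> TT" "1 \<le> k" "k + 1 < n"
  shows "braid_diff k s t = braid_diff k t s"
proof -
  have "mm (mm (Tm i) (Tm j)) (Tm i) s t = mm (mm (Tm i) (Tm j)) (Tm i) t s"
    if "1 \<le> i" "i < n" "1 \<le> j" "j < n" for i j
  proof -
    have "mm (mm (Tm i) (Tm j)) (Tm i) s t = mm (Tm i) (mm (Tm j) (Tm i)) t s"
      using that assms Tm_sym by (intro mm_transpose) auto
    then show ?thesis by (simp add: mm_assoc)
  qed
  then show ?thesis using assms by (simp add: braid_diff_def)
qed

lemma Tm_step: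
  assumes "s \<in> TT" "t \<in> TT" "1 \<le> k" "k + 1 < n" "i = k \<or> i = k + 1" "Tm i s t \<noteq> 0"
  shows "cc s k * cc s (k + 1) * cc s (k + 2) = cc t k * cc t (k + 1) * cc t (k + 2)"
    "m \<le> n \<Longrightarrow> m \<noteq> k \<Longrightarrow> m \<noteq> k + 1 \<Longrightarrow> s ! m = t ! m"
proof -
  have st: "ksim i s t" using assms(6) Tm_outside(1) by blast
  show "m \<le> n \<Longrightarrow> m \<noteq> k \<Longrightarrow> m \<noteq> k + 1 \<Longrightarrow> s ! m = t ! m"
    using ksim_nth[OF st assms(1)] assms(5) by auto
  have p: "cc s i * cc s (i + 1) = cc t i * cc t (i + 1)" using Tm_prod[of s t i] assms by auto
  from assms(5) show "cc s k * cc s (k + 1) * cc s (k + 2) = cc t k * cc t (k + 1) * cc t (k + 2)"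
  proof
    assume "i = k"
    then show ?thesis using p ksim_cc[OF st assms(1), of "k + 2"] assms(3,4) by simp
  next
    assume i: "i = k + 1"
    then have "cc s k = cc t k" using ksim_cc[OF st assms(1), of k] assms(3,4) by simp
    then show ?thesis using p i by (simp add: mult.assoc)
  qed
qed

text \<open>Each factor preserves these quantities, hence so does every path.\<close>

lemma braid_diff_support:
  assumes "s \<in> TT" "t \<in> TT" "1 \<le> k" "k + 1 < n" "braid_diff k s t \<noteq> 0"
  shows "cc s k * cc s (k + 1) * cc s (k + 2) = cc t k * cc t (k + 1) * cc t (k + 2)"
    "m \<le> n \<Longrightarrow> m \<noteq> k \<Longrightarrow> m \<noteq> k + 1 \<Longrightarrow> s ! m = t ! m"
proof -
  obtain i j where ij: "i = k \<or> i = k + 1" "j = k \<or> j = k + 1" "mm (mm (Tm i) (Tm j)) (Tm i) s t \<noteq> 0"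
  proof -
    have "mm (mm (Tm k) (Tm (k + 1))) (Tm k) s t \<noteq> 0 \<or> mm (mm (Tm (k + 1)) (Tm k)) (Tm (k + 1)) s t \<noteq> 0"
      using assms(5) unfolding braid_diff_def by auto
    then show thesis using that[of k "k + 1"] that[of "k + 1" k] by blast
  qed
  obtain y where y: "y \<in> TT" "mm (Tm i) (Tm j) s y \<noteq> 0" "Tm i y t \<noteq> 0" using mm_nz[OF ij(3)] by blast
  obtain x where x: "x \<in> TT" "Tm i s x \<noteq> 0" "Tm j x y \<noteq> 0" using mm_nz[OF y(2)] by blast
  note a = Tm_step[OF assms(1) x(1) assms(3,4) ij(1) x(2)] and b = Tm_step[OF x(1) y(1) assms(3,4) ij(2) x(3)]
    and c = Tm_step[OF y(1) assms(2-4) ij(1) y(3)]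
  show "cc s k * cc s (k + 1) * cc s (k + 2) = cc t k * cc t (k + 1) * cc t (k + 2)" using a(1) b(1) c(1) by simp
  show "s ! m = t ! m" if "m \<le> n" "m \<noteq> k" "m \<noteq> k + 1" using a(2)[OF that] b(2)[OF that] c(2)[OF that] by simp
qed

lemma braid_diff_zero:
  assumes TT: "s \<in> TT" "t \<in> TT" and k: "1 \<le> k" "k + 1 < n"
  shows "braid_diff k s t = 0"
proof (rule ccontr)
  assume nz: "braid_diff k s t \<noteq> 0"
  have kk: "k < n" "1 \<le> k + 1" "k + 2 \<le> n" using k by auto
  let ?Phi = "bmw_triple.Phi (mop (Tm k)) (mop (Tm (k + 1)))"
  note tr = triple[OF k]
  have Phi: "?Phi v = mop (braid_diff k) v" for v
    unfolding bmw_triple.Phi_def[OF tr] mop_mop mop_diff by (rule mop_cong) (simp add: braid_diff_def)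
  have c13: "cc s k = cc t (k + 2)" if st: "s \<in> TT" "t \<in> TT" and nz: "braid_diff k s t \<noteq> 0" for s t
  proof -
    have bs: "bvec s \<in> FS" by (rule free_space_closed(5)[OF st(1)])
    have "smul (cc s k) (mop (braid_diff k) (bvec s)) = mop (Xm (k + 2)) (mop (braid_diff k) (bvec s))"
      using bmw_triple.Phi_X[OF tr bs] st unfolding Phi by (simp add: X_bvec linear_mapD[OF linear_mop])
    then have "cc s k * braid_diff k s t = cc t (k + 2) * braid_diff k s t"
      using st lookup_X(1)[of t "k + 2" "mop (braid_diff k) (bvec s)"] by (metis lookup_mop_bvec lookup_smul)
    then show ?thesis using nz by simp
  qed
  \<comment> \<open>The other end comes from \<open>c13\<close> for the transposed entry, the middle
    from the conserved product of the three contents.\<close>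
  have contents: "cc t k = cc s (k + 2)" "cc t (k + 1) = cc s (k + 1)" "cc t (k + 2) = cc s k"
    if st: "s \<in> TT" "t \<in> TT" and nz: "braid_diff k s t \<noteq> 0" for s t
  proof -
    show 3: "cc t (k + 2) = cc s k" using c13[OF that] by simp
    show 1: "cc t k = cc s (k + 2)" using c13[of t s] that braid_diff_sym[OF st k] by simp
    have "cc s k \<noteq> 0" "cc s (k + 2) \<noteq> 0" using cc_nz[OF st(1)] k by auto
    then show "cc t (k + 1) = cc s (k + 1)"
      using braid_diff_support(1)[OF st k nz] unfolding 1 3 by simp
  qed
  have unique: "t' = t" if st: "s \<in> TT" "t \<in> TT" "t' \<in> TT"
    and nz: "braid_diff k s t \<noteq> 0" "braid_diff k s t' \<noteq> 0" for s t t'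
  proof (rule tab_eqI[OF st(3,2)])
    fix j assume j: "1 \<le> j" "j \<le> n"
    consider "j = k" | "j = k + 1" | "j = k + 2" | "j \<noteq> k" "j \<noteq> k + 1" "j \<noteq> k + 2" by blast
    then show "cc t' j = cc t j"
    proof cases
      case 4
      note a = braid_diff_support(2)[OF st(1,2) k nz(1)] and b = braid_diff_support(2)[OF st(1,3) k nz(2)]
      show ?thesis using a[of j] a[of "j - 1"] b[of j] b[of "j - 1"] j 4 by (intro cc_local) auto
    qed (use contents[OF st(1,2) nz(1)] contents[OF st(1,3) nz(2)] in simp_all)
  qed
  \<comment> \<open>As \<open>t\<close> is the only nonzero entry in row \<open>s\<close>, the
    relation \<open>E_i \<Phi> = 0\<close> reads
    \<open>braid_diff k s t * Em i t t = 0\<close>.\<close>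
  have nst: "\<not> stays i t" if i: "i = k \<or> i = k + 1" and st: "s \<in> TT" "t \<in> TT" and nz: "braid_diff k s t \<noteq> 0"
    for i s t
  proof
    assume stay: "stays i t"
    have bs: "bvec s \<in> FS" by (rule free_space_closed(5)[OF st(1)])
    have "mop (Em i) (mop (braid_diff k) (bvec s)) = 0"
      using i bmw_triple.E1_Phi[OF tr bs] bmw_triple.E2_Phi[OF tr bs] unfolding Phi by auto
    then have "mm (braid_diff k) (Em i) s t = 0"
      unfolding mop_mop using lookup_mop_bvec[OF st] by (metis lookup_zero)
    moreover have "mm (braid_diff k) (Em i) s t = braid_diff k s t * Em i t t"
      by (rule mm_unique[OF st(2)]) (use unique[OF st] nz in auto)
    moreover have "Em i t t \<noteq> 0" using stay sE_nz[OF st(2), of i] i k by (auto simp: Em_def)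
    ultimately show False using nz by simp
  qed
  have nz': "braid_diff k t s \<noteq> 0" using nz braid_diff_sym[OF TT k] by simp
  have "mm (mm (Tm k) (Tm (k + 1))) (Tm k) s t = mm (mm (Tm (k + 1)) (Tm k)) (Tm (k + 1)) s t"
    by (rule braid_reversed[OF TT k braid_diff_support(2)[OF TT k nz] contents[OF TT nz]
        nst[OF _ TT(2,1) nz'] nst[OF _ TT nz] nst[OF _ TT(2,1) nz'] nst[OF _ TT nz]]) auto
  then show False using nz by (simp add: braid_diff_def)
qed

lemma op_braid:
  assumes "1 \<le> k" "k + 1 < n"
  shows "mop (Tm k) (mop (Tm (k + 1)) (mop (Tm k) v)) = mop (Tm (k + 1)) (mop (Tm k) (mop (Tm (k + 1)) v))"
  unfolding mop_mop
proof (rule mop_cong)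
  fix s t assume "s \<in> TT" "t \<in> TT"
  then show "mm (mm (Tm k) (Tm (k + 1))) (Tm k) s t = mm (mm (Tm (k + 1)) (Tm k)) (Tm (k + 1)) s t"
    using braid_diff_zero[OF _ _ assms] by (simp add: braid_diff_def)
qed

end

section \<open>The parameters as moments\<close>

context seminormal
begin

lemma empty_mpart_facts: "diagram empty_mpart = {}" "is_rpart r empty_mpart"
proof -
  show D: "diagram empty_mpart = {}" by (auto simp: diagram_def empty_mpart_def)
  show "is_rpart r empty_mpart" by (simp add: is_rpart_def D) (simp add: empty_mpart_def)
qed

lemma contents_set_empty: "contents_set r PP (labels empty_mpart)" "card (labels empty_mpart) > 0"
  using contents_set_labels[of empty_mpart] n1 empty_mpart_facts by auto

lemma labels_empty: "labels empty_mpart = u ` {1..r}"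
proof -
  note D = empty_mpart_facts(1) and e = empty_mpart_facts(2)
  have "addable r empty_mpart = (\<lambda>s. (1, 1, s)) ` {1..r}"
  proof (rule Set.set_eqI)
    fix \<alpha> :: node
    obtain i j s where "\<alpha> = (i, j, s)" by (cases \<alpha>)
    then show "\<alpha> \<in> addable r empty_mpart \<longleftrightarrow> \<alpha> \<in> (\<lambda>s. (1, 1, s)) ` {1..r}"
      using addable_explicit[OF e, of i j s] by (auto simp: empty_mpart_def)
  qed
  moreover have "removable r empty_mpart = {}"
  proof (rule Set.set_eqI)
    fix \<alpha> :: node
    obtain i j s where "\<alpha> = (i, j, s)" by (cases \<alpha>)
    then show "\<alpha> \<in> removable r empty_mpart \<longleftrightarrow> \<alpha> \<in> {}"
      using removable_explicit[OF e, of i j s] by (auto simp: empty_mpart_def)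
  qed
  ultimately show ?thesis by (simp add: labels_def D lab_def content_def image_image)
qed

lemma start: "s \<in> TT \<Longrightarrow> s ! 0 = empty_mpart"
  by (simp add: updown_def)

lemma prod_labels_empty: "(\<Prod>c\<in>labels empty_mpart. g c) = (\<Prod>i = 1..r. g (u i))"
  unfolding labels_empty by (subst prod.reindex[OF u_inj[OF n1]]) simp

lemma sum_int_atLeastAtMost: "(\<Sum>k = 0..int m. f k) = (\<Sum>k = 0..m. f (int k))"
  by (rule sum.reindex_bij_witness[of _ int nat]) auto

lemma Qser_nat: "Qser r u (int a) = fps_nth (\<Prod>i = 1..r. (fps_X - fps_const (u i)) / (fps_const (u i) * fps_X - 1)) a"
    "Qser' r u (int a) = fps_nth (\<Prod>i = 1..r. (fps_const (u i) * fps_X - 1) / (fps_X - fps_const (u i))) a"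
  by (simp_all add: Qser_def Qser'_def)

lemma even_ones_convolution:
  assumes "\<And>a. fps_nth Q a = Z (int a)"
  shows "fps_nth (even_ones * Q) m = (\<Sum>k = 0..int m. ev k * Z (int m - k))"
proof -
  have "fps_nth (even_ones * Q) m = (\<Sum>k = 0..m. ev (int k) * Z (int m - int k))"
    unfolding fps_mult_nth
    by (rule sum.cong) (auto simp: even_ones_def ev_def assms of_nat_diff)
  then show ?thesis by (simp only: sum_int_atLeastAtMost)
qed

text \<open>For the empty multipartition the contents are the \<open>u i\<close>, and the right-hand
  side of \<open>moments_nonneg\<close> is the generating function that admissibility
  prescribes.\<close>

lemma \<omega>_nonneg: "\<omega> (int a) = (\<Sum>c\<in>labels empty_mpart. Eval r \<kappa> PP (labels empty_mpart) c * c ^ a)"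
proof -
  let ?C = "labels empty_mpart"
  define Q where "Q = (\<Prod>i = 1..r. (fps_X - fps_const (u i)) / (fps_const (u i) * fps_X - 1))"
  have Q: "fps_nth Q a = Qser r u (int a)" for a by (simp add: Q_def Qser_nat)
  note C = contents_set_empty
  have "Abs_fps (\<lambda>a. \<Sum>c\<in>?C. Eval r \<kappa> PP ?C c * c ^ a) =
      even_ones - fps_const \<kappa> + (fps_const (\<kappa> * PP) + (if odd r then fps_X else - 1) * even_ones) * Q"
    using contents_set.moments_nonneg[OF C, of \<kappa>] by (simp only: prod_labels_empty Q_def)
  from arg_cong[OF this, of "\<lambda>f. fps_nth f a"] have "(\<Sum>c\<in>?C. Eval r \<kappa> PP ?C c * c ^ a) =
      fps_nth (even_ones - fps_const \<kappa> + (fps_const (\<kappa> * PP) + (if odd r then fps_X else - 1) * even_ones) * Q) a"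
    by (simp only: fps_nth_Abs_fps)
  also have "\<dots> = ev (int a) - (if a = 0 then \<kappa> else 0) + \<kappa> * PP * Qser r u (int a) +
      (if odd r then fps_nth (fps_X * (even_ones * Q)) a else - fps_nth (even_ones * Q) a)"
    by (simp add: distrib_right mult.assoc Q even_ones_def ev_def)
  \<comment> \<open>For \<open>a = 0\<close> the integer range is empty, in agreement with the zero
    constant term.\<close>
  also have "fps_nth (fps_X * (even_ones * Q)) a = (\<Sum>k = 0..int a - 1. ev k * Qser r u (int a - 1 - k))"
    by (cases a) (simp_all add: even_ones_convolution[OF Q])
  also have "fps_nth (even_ones * Q) a = (\<Sum>k = 0..int a. ev k * Qser r u (int a - k))"
    by (rule even_ones_convolution[OF Q])
  also have "ev (int a) - (if a = 0 then \<kappa> else 0) + \<kappa> * PP * Qser r u (int a) +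
      (if odd r then \<Sum>k = 0..int a - 1. ev k * Qser r u (int a - 1 - k) else - (\<Sum>k = 0..int a. ev k * Qser r u (int a - k))) = \<omega> (int a)"
  proof -
    have "\<omega> (int a) = (if odd r
         then adm_A r q u \<rho> (int a) + (\<Sum>k = 0..int a - 1. ev k * Qser r u (int a - 1 - k))
                - inverse (dlt q) * \<rho> * (if int a = 0 then 1 else 0)
         else adm_A r q u \<rho> (int a) - (\<Sum>k = 0..int a. ev k * Qser r u (int a - k))
                - inverse (dlt q) * \<rho> * (if int a = 0 then 1 else 0))"
      using adm unfolding u_admissible_def Let_def by simp
    then show ?thesis unfolding adm_A_def \<kappa>_def[symmetric] PP_def[symmetric] by simp
  qed
  finally show ?thesis by simp
qed

lemma \<omega>_neg: "a > 0 \<Longrightarrow> \<omega> (- int a) = (\<Sum>c\<in>labels empty_mpart. Eval r \<kappa> PP (labels empty_mpart) c * inverse c ^ a)"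
proof -
  assume a: "a > 0"
  let ?C = "labels empty_mpart"
  define Q where "Q = (\<Prod>i = 1..r. (fps_const (u i) * fps_X - 1) / (fps_X - fps_const (u i)))"
  have Q: "fps_nth Q a = Qser' r u (int a)" for a by (simp add: Q_def Qser_nat)
  note C = contents_set_empty
  have "Abs_fps (\<lambda>a. if a = 0 then 0 else \<Sum>c\<in>?C. Eval r \<kappa> PP ?C c * inverse c ^ a) =
      fps_X\<^sup>2 * even_ones + fps_const \<kappa> - (fps_const (\<kappa> * PP) - (if odd r then fps_X else - fps_X\<^sup>2) * even_ones) * Q"
    using contents_set.moments_neg[OF C, of \<kappa>] by (simp only: prod_labels_empty Q_def)
  from arg_cong[OF this, of "\<lambda>f. fps_nth f a"] have "(if a = 0 then 0 else \<Sum>c\<in>?C. Eval r \<kappa> PP ?C c * inverse c ^ a) =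
      fps_nth (fps_X\<^sup>2 * even_ones + fps_const \<kappa> - (fps_const (\<kappa> * PP) - (if odd r then fps_X else - fps_X\<^sup>2) * even_ones) * Q) a"
    by (simp only: fps_nth_Abs_fps)
  then have "(\<Sum>c\<in>?C. Eval r \<kappa> PP ?C c * inverse c ^ a) =
      fps_nth (fps_X\<^sup>2 * even_ones) a - \<kappa> * PP * Qser' r u (int a) +
      (if odd r then fps_nth (fps_X * (even_ones * Q)) a else - fps_nth (fps_X\<^sup>2 * (even_ones * Q)) a)"
    using a by (simp add: left_diff_distrib distrib_right mult.assoc Q)
  \<comment> \<open>The two sides differ at \<open>a = 0\<close>, where \<open>ev\<close> is 1;
    hence the restriction to positive \<open>a\<close>.\<close>
  also have "fps_nth (fps_X\<^sup>2 * even_ones) a = ev (int a)"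
    using a by (auto simp: fps_X_power_mult_nth even_ones_def ev_def)
  also have "fps_nth (fps_X * (even_ones * Q)) a = (\<Sum>k = 0..int a - 1. ev k * Qser' r u (int a - 1 - k))"
    using a by (cases a) (simp_all add: even_ones_convolution[OF Q])
  also have "fps_nth (fps_X\<^sup>2 * (even_ones * Q)) a = (\<Sum>k = 0..int a - 2. ev k * Qser' r u (int a - 2 - k))"
  proof (cases "a < 2")
    \<comment> \<open>Here \<open>a = 1\<close>, and the range ends at -1.\<close>
    case True
    then show ?thesis by (simp add: fps_X_power_mult_nth)
  next
    case False
    then have "int (a - 2) = int a - 2" by simp
    then show ?thesis using False even_ones_convolution[OF Q, of "a - 2"] by (simp add: fps_X_power_mult_nth)
  qed
  also have "ev (int a) - \<kappa> * PP * Qser' r u (int a) +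
      (if odd r then \<Sum>k = 0..int a - 1. ev k * Qser' r u (int a - 1 - k)
       else - (\<Sum>k = 0..int a - 2. ev k * Qser' r u (int a - 2 - k))) = \<omega> (- int a)"
  proof -
    have "\<omega> (- int a) = (if odd r
         then adm_B r q u \<rho> (int a) + (\<Sum>k = 0..int a - 1. ev k * Qser' r u (int a - 1 - k))
         else adm_B r q u \<rho> (int a) - (\<Sum>k = 0..int a - 2. ev k * Qser' r u (int a - 2 - k)))"
      using adm a unfolding u_admissible_def Let_def by simp
    then show ?thesis unfolding adm_B_def \<kappa>_def[symmetric] PP_def[symmetric] by simp
  qed
  finally show ?thesis by simp
qed

text \<open>Every tableau starts at the empty multipartition, so for \<open>k = 1\<close> the poles
  are those of W_1 whatever the shape.\<close>

lemma moments:
  assumes "s \<in> TT" "1 < n" "stays 1 s"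
  shows "(\<Sum>t | t \<in> TT \<and> ksim 1 t s. E_diag r q u \<rho> 1 t * cc t 1 ^ a) = \<omega> (int a)"
    "a > 0 \<Longrightarrow> (\<Sum>t | t \<in> TT \<and> ksim 1 t s. E_diag r q u \<rho> 1 t * inverse (cc t 1) ^ a) = \<omega> (- int a)"
proof -
  have 0: "labels (s ! (1 - 1)) = labels empty_mpart" using start[OF assms(1)] by simp
  have *: "(\<Sum>t | t \<in> TT \<and> ksim 1 t s. E_diag r q u \<rho> 1 t * g (cc t 1)) =
      (\<Sum>c\<in>labels empty_mpart. Eval r \<kappa> PP (labels empty_mpart) c * g c)" for g
  proof -
    have "(\<Sum>t | t \<in> TT \<and> ksim 1 t s. E_diag r q u \<rho> 1 t * g (cc t 1)) =
        (\<Sum>t | t \<in> TT \<and> ksim 1 t s. Eval r \<kappa> PP (labels empty_mpart) (cc t 1) * g (cc t 1))"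
      using E_diag_block[OF assms(1) _ assms(2,3)] unfolding 0 by (intro sum.cong) auto
    also have "\<dots> = (\<Sum>c\<in>labels empty_mpart. Eval r \<kappa> PP (labels empty_mpart) c * g c)"
      using sum_over_block[OF assms(1) _ assms(2,3), of "\<lambda>c. Eval r \<kappa> PP (labels empty_mpart) c * g c"] unfolding 0 by simp
    finally show ?thesis .
  qed
  show "(\<Sum>t | t \<in> TT \<and> ksim 1 t s. E_diag r q u \<rho> 1 t * cc t 1 ^ a) = \<omega> (int a)"
    unfolding \<omega>_nonneg by (rule *)
  show "(\<Sum>t | t \<in> TT \<and> ksim 1 t s. E_diag r q u \<rho> 1 t * inverse (cc t 1) ^ a) = \<omega> (- int a)" if "a > 0"
    unfolding \<omega>_neg[OF that] by (rule *)
qed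

lemma cc_1: "s \<in> TT \<Longrightarrow> cc s 1 \<in> u ` {1..r}"
  using cc_in_labels[of s 1] n1 start[of s] by (simp add: labels_empty)

end

section \<open>The module\<close>

context seminormal
begin

definition gen_op :: "bmw_gen \<Rightarrow> (tab \<Rightarrow>\<^sub>0 'a) \<Rightarrow> (tab \<Rightarrow>\<^sub>0 'a)"
  where "gen_op g = (case g of GenT k \<Rightarrow> mop (Tm k) | GenE k \<Rightarrow> mop (Em k) | GenX i \<Rightarrow> mop (Xm i)
    | GenXinv i \<Rightarrow> mop (Xim i))"

lemma gen_op_simps [simp]:
  "gen_op (GenT k) = mop (Tm k)" "gen_op (GenE k) = mop (Em k)" "gen_op (GenX k) = mop (Xm k)"
  "gen_op (GenXinv k) = mop (Xim k)"
  by (simp_all add: gen_op_def)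

lemma word_action_gen_op: "word_action gen_op"
  by unfold_locales (auto simp: gen_op_def linear_mop split: bmw_gen.split)

lemma op_X_Xinv:
  assumes "1 \<le> i" "i \<le> n" "v \<in> FS"
  shows "mop (Xm i) (mop (Xim i) v) = v" "mop (Xim i) (mop (Xm i) v) = v"
  using cc_nz assms by (auto intro!: FS_eqI mop_closed simp: lookup_X)

lemma op_XX: "mop (Xm i) (mop (Xm j) v) = mop (Xm j) (mop (Xm i) v)"
  by (rule FS_eqI) (simp_all add: mop_closed lookup_X)

lemma mop_diag_power:
  assumes "v \<in> FS"
  shows "(mop (\<lambda>s t. if s = t then d s else 0) ^^ m) v = mop (\<lambda>s t. if s = t then d s ^ m else 0) v"
proof (induction m)
  case 0
  show ?case using assms by (intro FS_eqI) (simp_all only: funpow_0 mop_closed lookup_diag power_0 mult_1)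
next
  case (Suc m)
  show ?case unfolding funpow.simps comp_apply Suc by (rule FS_eqI) (simp_all only: mop_closed lookup_diag power_Suc mult.assoc)
qed

text \<open>For \<open>E = e e^T\<close> and diagonal \<open>D\<close> one has
  \<open>E D E = (e^T D e) E\<close>, and the scalar is a sum of residues weighted by
  \<open>d\<close>.\<close>

lemma op_E_diag_E:
  assumes k: "1 \<le> k" "k < n"
    and c: "\<And>s. s \<in> TT \<Longrightarrow> stays k s \<Longrightarrow> (\<Sum>x | x \<in> TT \<and> ksim k x s. E_diag r q u \<rho> k x * d x) = c"
  shows "mop (Em k) (mop (\<lambda>s t. if s = t then d s else 0) (mop (Em k) v)) = smul c (mop (Em k) v)"
  unfolding mop_mop smul_mop
proof (rule mop_cong)
  let ?D = "\<lambda>s t. if s = t then d s else 0"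
  fix s t assume st: "s \<in> TT" "t \<in> TT"
  have sum: "mm (mm (Em k) ?D) (Em k) s t = (\<Sum>x\<in>TT. Em k s x * d x * Em k x t)"
    unfolding mm_def[of "mm (Em k) ?D"] by (rule sum.cong) (simp_all add: mm_diag(2)[OF st(1)])
  show "mm (mm (Em k) ?D) (Em k) s t = c * Em k s t"
  proof (cases "stays k s \<and> ksim k s t")
    case False
    have "Em k s x * d x * Em k x t = 0" for x
    proof (rule ccontr)
      assume "Em k s x * d x * Em k x t \<noteq> 0"
      then have "Em k s x \<noteq> 0" "Em k x t \<noteq> 0" by auto
      then have "stays k s" "ksim k s x" "ksim k x t" using Em_outside by blast+
      then show False using False ksim_trans by blast
    qed
    moreover have "Em k s t = 0" using False Em_outside by blast
    ultimately show ?thesis unfolding sum by (simp only: sum.neutral_const mult_zero_right)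
  next
    case True
    have "(\<Sum>x\<in>TT. Em k s x * d x * Em k x t) = (\<Sum>x | x \<in> TT \<and> ksim k x s. Em k s x * d x * Em k x t)"
      by (rule sum_block) (simp add: Em_outside)
    also have "\<dots> = (\<Sum>x | x \<in> TT \<and> ksim k x s. Em k s t * (E_diag r q u \<rho> k x * d x))"
    proof (rule sum.cong[OF refl])
      fix x assume "x \<in> {x. x \<in> TT \<and> ksim k x s}"
      then have x: "x \<in> TT" "ksim k x s" by auto
      have xs: "ksim k s x" "ksim k x t" using ksim_sym[OF x(2)] ksim_trans[OF x(2)] True by auto
      have "stays k x" using ksim_stays[OF x(2,1) k] True by simp
      then have "Em k s x * d x * Em k x t = Em k s t * ((sE k x * sE k x) * d x)"
        using True xs by (simp add: Em_def mult_ac)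
      also have "sE k x * sE k x = E_diag r q u \<rho> k x" using sE_square[OF x(1) k \<open>stays k x\<close>] .
      finally show "Em k s x * d x * Em k x t = Em k s t * (E_diag r q u \<rho> k x * d x)" .
    qed
    also have "\<dots> = c * Em k s t" using c[OF st(1)] True by (simp add: mult.commute flip: sum_distrib_left)
    finally show ?thesis unfolding sum .
  qed
qed

lemma op_EXX:
  assumes "1 \<le> k" "k < n"
  shows "mop (Em k) (mop (Xm k) (mop (Xm (k + 1)) v)) = mop (Em k) v"
    "mop (Xm k) (mop (Xm (k + 1)) (mop (Em k) v)) = mop (Em k) v"
proof -
  show "mop (Em k) (mop (Xm k) (mop (Xm (k + 1)) v)) = mop (Em k) v"
    unfolding mop_mop
  proof (rule mop_cong)
    fix s t assume st: "s \<in> TT" "t \<in> TT"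
    show "mm (mm (Xm (k + 1)) (Xm k)) (Em k) s t = Em k s t"
      unfolding mm_assoc unfolding Xm_def mm_diag[OF st] using Em_X(1)[OF st assms] by (simp add: mult_ac)
  qed
  show "mop (Xm k) (mop (Xm (k + 1)) (mop (Em k) v)) = mop (Em k) v"
    unfolding mop_mop
  proof (rule mop_cong)
    fix s t assume st: "s \<in> TT" "t \<in> TT"
    show "mm (mm (Em k) (Xm (k + 1))) (Xm k) s t = Em k s t"
      unfolding Xm_def mm_diag[OF st] using Em_X(2)[OF st assms] by (simp add: mult_ac)
  qed
qed

interpretation W: word_action gen_op
  by (rule word_action_gen_op)

lemma op_moment:
  assumes "1 < n"
  shows "W.act0 (gE 1 * gXpow 1 a * gE 1) v = W.act0 (scal (\<omega> a) * gE 1) v"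
proof -
  let ?w = "mop (Em 1) v"
  have X: "W.act0 (gX 1) = mop (Xm 1)" "W.act0 (gXinv 1) = mop (Xim 1)"
    by (auto simp: W.act0_gen)
  have "mop (Em 1) (W.act0 (gXpow 1 a) ?w) = smul (\<omega> a) ?w"
  proof (cases "0 \<le> a")
    case True
    have "W.act0 (gXpow 1 a) ?w = (mop (Xm 1) ^^ nat a) ?w"
      using True by (simp only: gXpow_def W.act0_power X if_True)
    also have "\<dots> = mop (\<lambda>s t. if s = t then cc s 1 ^ nat a else 0) ?w"
      unfolding Xm_def by (rule mop_diag_power[OF mop_closed])
    finally show ?thesis
      using op_E_diag_E[of 1 "\<lambda>s. cc s 1 ^ nat a" "\<omega> a" v] moments(1)[of _ "nat a"] assms True by simp
  next
    case False
    have "W.act0 (gXpow 1 a) ?w = (mop (Xim 1) ^^ nat (- a)) ?w"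
      using False by (simp only: gXpow_def W.act0_power X if_False)
    also have "\<dots> = mop (\<lambda>s t. if s = t then inverse (cc s 1) ^ nat (- a) else 0) ?w"
      unfolding Xim_def by (rule mop_diag_power[OF mop_closed])
    finally show ?thesis
      using op_E_diag_E[of 1 "\<lambda>s. inverse (cc s 1) ^ nat (- a)" "\<omega> a" v] moments(2)[of _ "nat (- a)"] assms False by simp
  qed
  then show ?thesis by (simp add: W.act0_simps)
qed

text \<open>The first step adds a node to the empty multipartition, so its content is some
  \<open>u l\<close> and that factor vanishes on the basis vector.\<close>

lemma op_cyclotomic:
  assumes "v \<in> FS"
  shows "W.act0 (prod_list (map (\<lambda>l. gX 1 - scal (u l)) [1..<Suc r])) v = 0"
proof -
  have *: "W.act0 (prod_list (map (\<lambda>l. gX 1 - scal (u l)) xs)) v \<in> FS \<and>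
      (\<forall>t\<in>TT. Poly_Mapping.lookup (W.act0 (prod_list (map (\<lambda>l. gX 1 - scal (u l)) xs)) v) t =
        prod_list (map (\<lambda>l. cc t 1 - u l) xs) * Poly_Mapping.lookup v t)" for xs :: "nat list"
  proof (induction xs)
    case Nil
    then show ?case using assms by (simp add: W.act0_simps)
  next
    case (Cons l xs)
    then show ?case
      by (auto intro!: free_space_closed mop_closed simp: W.act0_simps lookup_minus lookup_X algebra_simps)
  qed
  show ?thesis
  proof (rule FS_eqI)
    fix t assume t: "t \<in> TT"
    obtain l where l: "l \<in> {1..r}" "cc t 1 = u l" using cc_1[OF t] by blast
    have "cc t 1 - u l \<in> set (map (\<lambda>l. cc t 1 - u l) [1..<Suc r])"
      unfolding set_map using l(1) by (intro imageI) auto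
    then have "0 \<in> set (map (\<lambda>l. cc t 1 - u l) [1..<Suc r])" unfolding l(2) diff_self .
    then have "prod_list (map (\<lambda>l. cc t 1 - u l) [1..<Suc r]) = 0" by (simp only: prod_list_zero_iff)
    then show "Poly_Mapping.lookup (W.act0 (prod_list (map (\<lambda>l. gX 1 - scal (u l)) [1..<Suc r])) v) t =
        Poly_Mapping.lookup 0 t"
      using * t by (metis lookup_zero mult_zero_left)
  qed (use * free_space_closed(1) in blast)+
qed

lemma relations:
  assumes "(x, y) \<in> bmw_rels r n q u \<rho> \<omega>" and v: "v \<in> FS"
  shows "W.act0 x v = W.act0 y v"
  using assms(1)
proof (cases rule: bmw_rels.cases)
  case (a1 i)
  then show ?thesis using op_X_Xinv[of i v] v by (simp add: W.act0_simps)
next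
  case (a2 i)
  then show ?thesis using op_X_Xinv[of i v] v by (simp add: W.act0_simps)
next
  case (b i)
  then show ?thesis using op_TT[of i v] v by (simp add: W.act0_simps power2_eq_square)
next
  case (c1 i j)
  then show ?thesis using op_TT_far[of i j v] by (simp add: W.act0_simps)
next
  case (c2 i)
  then show ?thesis using op_braid[of i v] by (simp add: W.act0_simps)
next
  case (c3 i j)
  then show ?thesis using op_TX_far[of j i v] by (simp add: W.act0_simps)
next
  case (d i)
  then show ?thesis using op_EE[of i v] by (simp add: W.act0_simps power2_eq_square)
next
  case (e i j)
  then show ?thesis using op_XX[of i j v] by (simp add: W.act0_simps)
next
  case (f1 i)
  then show ?thesis using op_TX(1)[of i v] v by (simp add: W.act0_simps mop_Id linear_mapD[OF linear_mop] smul_simps(2))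
next
  case (f2 i)
  then show ?thesis using op_TX(2)[of i v] by (simp add: W.act0_simps mop_Id mop_closed smul_simps(2))
next
  case (g a)
  then show ?thesis using op_moment by simp
next
  case (h1 i)
  then show ?thesis using op_TE(2)[of i v] by (simp add: W.act0_simps)
next
  case (h2 i)
  then show ?thesis using op_TE(1)[of i v] by (simp add: W.act0_simps)
next
  case (h3 i)
  then show ?thesis using op_hook'[of "i + 1" i i v] by (simp add: W.act0_simps insert_commute)
next
  case (h4 i)
  then show ?thesis using op_hook(1)[of i "i + 1" i v] v by (simp add: W.act0_simps)
next
  case (i1 i)
  then show ?thesis using op_hook(2)[of "i + 1" i i v] v by (simp add: W.act0_simps insert_commute)
next
  case (i2 i)
  then show ?thesis using op_hook(2)[of i "i + 1" i v] v by (simp add: W.act0_simps)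
next
  case (j1 i)
  then show ?thesis using op_EXX(1)[of i v] by (simp add: W.act0_simps)
next
  case (j2 i)
  then show ?thesis using op_EXX(2)[of i v] by (simp add: W.act0_simps)
next
  case k
  then show ?thesis using op_cyclotomic[OF v] by (simp only: W.act0_0)
qed

section \<open>Comparison of the matrices with the coefficients in the theorem\<close>

lemma lookup_block_sum:
  assumes "t \<in> TT"
  shows "Poly_Mapping.lookup (\<Sum>x | x \<in> TT \<and> ksim k x s. smul (f x) (bvec x)) t = (if ksim k t s then f t else 0)"
proof -
  have "Poly_Mapping.lookup (\<Sum>x | x \<in> TT \<and> ksim k x s. smul (f x) (bvec x)) t =
      (\<Sum>x | x \<in> TT \<and> ksim k x s. if x = t then f t else 0)"
    unfolding lookup_sum by (rule sum.cong) (auto simp: lookup_bvec)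
  then show ?thesis using assms finite_TT by simp
qed

lemma E_coef_eq:
  assumes "s \<in> TT" "1 \<le> k" "k < n" "stays k s" "ksim k t s"
  shows "E_coef r q u \<rho> sE k s t = Em k s t"
  using sE_square[OF assms(1-4)] assms ksim_sym[OF assms(5)] by (auto simp: E_coef_def Em_def)

lemma Em_action:
  assumes s: "s \<in> TT" "1 \<le> k" "k < n"
  shows "mop (Em k) (bvec s) = (if stays k s
    then \<Sum>t | t \<in> TT \<and> ksim k t s. smul (E_coef r q u \<rho> sE k s t) (bvec t) else 0)" (is "_ = ?R")
proof (rule FS_eqI[OF mop_closed])
  show "?R \<in> FS" by (auto intro!: free_space_sum free_space_closed)
  fix t assume t: "t \<in> TT"
  show "Poly_Mapping.lookup (mop (Em k) (bvec s)) t = Poly_Mapping.lookup ?R t"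
  proof (cases "stays k s")
    case True
    have "(if ksim k t s then E_coef r q u \<rho> sE k s t else 0) = Em k s t"
      using E_coef_eq[OF s True] Em_outside(2) by auto
    then show ?thesis unfolding if_P[OF True] lookup_block_sum[OF t] lookup_mop_bvec[OF s(1) t] by (rule sym)
  next
    case False
    then show ?thesis using s t Em_outside(3)[OF False] by (simp add: lookup_mop_bvec)
  qed
qed

lemma Tm_action:
  assumes s: "s \<in> TT" "1 \<le> k" "k < n"
  shows "mop (Tm k) (bvec s) = (if stays k s
    then \<Sum>t | t \<in> TT \<and> ksim k t s. smul (T_coef r q u \<rho> sE k s t) (bvec t)
    else smul (a_coef q u k s) (bvec s) + smul (b k s) (if swap_defined k s then bvec (swap r k s) else 0))"
    (is "_ = ?R")
proof (rule FS_eqI[OF mop_closed])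
  show "?R \<in> FS" using s swap_facts(1)[OF s] by (auto intro!: free_space_sum free_space_closed)
  fix t assume t: "t \<in> TT"
  show "Poly_Mapping.lookup (mop (Tm k) (bvec s)) t = Poly_Mapping.lookup ?R t"
  proof (cases "stays k s")
    case True
    have "(if ksim k t s then T_coef r q u \<rho> sE k s t else 0) = Tm k s t"
    proof (cases "ksim k t s")
      case ts: True
      then show ?thesis using E_coef_eq[OF s True ts] True ksim_sym[OF ts] by (simp add: T_coef_def Tm_def Id_def)
    qed (simp add: Tm_outside(2))
    then show ?thesis unfolding if_P[OF True] lookup_block_sum[OF t] lookup_mop_bvec[OF s(1) t] by (rule sym)
  next
    case False
    have "Tm k s t = a_coef q u k s * (if s = t then 1 else 0) +
        b k s * (if swap_defined k s then if swap r k s = t then 1 else 0 else 0)"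
      using False swap_facts(2,8)[OF s] by (auto simp: Tm_def)
    then show ?thesis
      using False s t by (simp add: lookup_mop_bvec lookup_add lookup_bvec)
  qed
qed

lemma bmw_module:
  "\<exists>act :: 'a bmw_free set \<Rightarrow> (tab \<Rightarrow>\<^sub>0 'a) \<Rightarrow> (tab \<Rightarrow>\<^sub>0 'a).
    left_module_on (cyc_bmw r n q u \<rho> \<omega>) (\<lambda>c. bmw_class r n q u \<rho> \<omega> (scal c)) FS smul act \<and>
    (\<forall>g \<in> bmw_gens n. \<forall>v \<in> FS. act (bmw_class r n q u \<rho> \<omega> (gen g)) v = gen_op g v)"
proof -
  have inv: "gen_op g v \<in> FS" for g v by (cases g) (auto intro: mop_closed)
  show ?thesis
    using W.module_of_relations[of n TT r q u \<rho> \<omega>, OF n1 inv relations] free_alg_closed(4) W.act0_gen by metis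
qed

end

theorem theorem4p19:
  fixes r n f :: nat
    and q \<rho> :: "'a::field"
    and u :: "nat \<Rightarrow> 'a"
    and \<omega> :: "int \<Rightarrow> 'a"
    and \<mu> :: mpart
    and sE b :: "nat \<Rightarrow> tab \<Rightarrow> 'a"
  assumes "r \<ge> 1" and "n \<ge> 1"
    and "q \<noteq> 0" and "\<forall>i \<in> {1..r}. u i \<noteq> 0" and "\<rho> \<noteq> 0"
    and "\<omega> 0 = 1 - inverse (dlt q) * (\<rho> - inverse \<rho>)"
    and "\<forall>m \<in> {1..2 * n}. (q^2) ^ m \<noteq> 1"
    and "generic r n q u"
    and "u_admissible r q u \<rho> \<omega>"
    and "f \<le> n div 2"
    and "\<mu> \<in> rparts r (n - 2 * f)"
    and "root_conditions r n q u \<rho> \<mu> sE b"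
  shows "\<exists>act :: 'a bmw_free set \<Rightarrow> (tab \<Rightarrow>\<^sub>0 'a) \<Rightarrow> (tab \<Rightarrow>\<^sub>0 'a).
    left_module_on (cyc_bmw r n q u \<rho> \<omega>) (\<lambda>c. bmw_class r n q u \<rho> \<omega> (scal c))
      (free_space (updown r n \<mu>)) smul act \<and>
    (\<forall>s \<in> updown r n \<mu>. \<forall>k \<in> {1..<n}.
      act (bmw_class r n q u \<rho> \<omega> (gT k)) (bvec s) =
        (if s ! (k - 1) = s ! (k + 1)
         then \<Sum>t | t \<in> updown r n \<mu> \<and> ksim k t s. smul (T_coef r q u \<rho> sE k s t) (bvec t)
         else smul (a_coef q u k s) (bvec s) +
              smul (b k s) (if swap_defined k s then bvec (swap r k s) else 0))) \<and>
    (\<forall>s \<in> updown r n \<mu>. \<forall>k \<in> {1..<n}.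
      act (bmw_class r n q u \<rho> \<omega> (gE k)) (bvec s) =
        (if s ! (k - 1) = s ! (k + 1)
         then \<Sum>t | t \<in> updown r n \<mu> \<and> ksim k t s. smul (E_coef r q u \<rho> sE k s t) (bvec t)
         else 0)) \<and>
    (\<forall>s \<in> updown r n \<mu>. \<forall>i \<in> {1..n}.
      act (bmw_class r n q u \<rho> \<omega> (gX i)) (bvec s) = smul (cont_tab q u s i) (bvec s))"
proof -
  interpret seminormal r n q u \<mu> \<rho> \<omega> sE b
    by unfold_locales (use assms in auto)
  obtain act :: "'a bmw_free set \<Rightarrow> (tab \<Rightarrow>\<^sub>0 'a) \<Rightarrow> (tab \<Rightarrow>\<^sub>0 'a)"
    where mod: "left_module_on (cyc_bmw r n q u \<rho> \<omega>) (\<lambda>c. bmw_class r n q u \<rho> \<omega> (scal c)) FS smul act"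
      and act: "\<And>g v. g \<in> bmw_gens n \<Longrightarrow> v \<in> FS \<Longrightarrow> act (bmw_class r n q u \<rho> \<omega> (gen g)) v = gen_op g v"
    using bmw_module by blast
  have gens: "GenT k \<in> bmw_gens n" "GenE k \<in> bmw_gens n" if "k \<in> {1..<n}" for k
    using that by (auto simp: bmw_gens_def)
  have gensX: "GenX i \<in> bmw_gens n" if "i \<in> {1..n}" for i
    using that by (auto simp: bmw_gens_def)
  have T: "act (bmw_class r n q u \<rho> \<omega> (gT k)) (bvec s) = mop (Tm k) (bvec s)"
    and E: "act (bmw_class r n q u \<rho> \<omega> (gE k)) (bvec s) = mop (Em k) (bvec s)"
    if "s \<in> TT" "k \<in> {1..<n}" for s k
    using act[OF gens(1)[OF that(2)]] act[OF gens(2)[OF that(2)]] free_space_closed(5)[OF that(1)] by simp_all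
  have X: "act (bmw_class r n q u \<rho> \<omega> (gX i)) (bvec s) = mop (Xm i) (bvec s)"
    if "s \<in> TT" "i \<in> {1..n}" for s i
    using act[OF gensX[OF that(2)]] free_space_closed(5)[OF that(1)] by simp
  show ?thesis
  proof (intro exI[of _ act] conjI ballI)
    fix s k assume sk: "s \<in> TT" "k \<in> {1..<n}"
    then have k: "1 \<le> k" "k < n" by auto
    note T[OF sk, unfolded Tm_action[OF sk(1) k]] E[OF sk, unfolded Em_action[OF sk(1) k]]
    then show "act (bmw_class r n q u \<rho> \<omega> (gT k)) (bvec s) = (if s ! (k - 1) = s ! (k + 1)
         then \<Sum>t | t \<in> TT \<and> ksim k t s. smul (T_coef r q u \<rho> sE k s t) (bvec t)
         else smul (a_coef q u k s) (bvec s) + smul (b k s) (if swap_defined k s then bvec (swap r k s) else 0))"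
      "act (bmw_class r n q u \<rho> \<omega> (gE k)) (bvec s) = (if s ! (k - 1) = s ! (k + 1)
         then \<Sum>t | t \<in> TT \<and> ksim k t s. smul (E_coef r q u \<rho> sE k s t) (bvec t) else 0)"
      by blast+
  next
    fix s i assume "s \<in> TT" "i \<in> {1..n}"
    then show "act (bmw_class r n q u \<rho> \<omega> (gX i)) (bvec s) = smul (cc s i) (bvec s)"
      using X X_bvec by simp
  qed (rule mod)
qed

end
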